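(* The BV-Laplacian $\Delta_{\mathrm{BV}}\colon\overline{H}^n(\pi_{\mathrm{BV}})\to\overline{H}^n(\pi_{\mathrm{BV}})$ extends to a linear operator $\Delta_{\mathrm{BV}}$ on the space $\overline{\mathfrak{M}}^n(\pi_{\mathrm{BV}})$ such that $$\Delta_{\mathrm{BV}}(F\cdot G)(s)=(\Delta_{\mathrm{BV}}F)(s)\cdot G(s)+(-)^{\mathrm{gh}(F)}[\![F,G]\!](s)+(-)^{\mathrm{gh}(F)}F(s)\cdot(\Delta_{\mathrm{BV}}G)(s)$$ for any $F,G\in\overline{\mathfrak{M}}^n(\pi_{\mathrm{BV}})$ and all $s\in\Gamma(\pi_{\mathrm{BV}})$.
   Context: Setting. $\Bbbk$ is $\mathbb{R}$ or $\mathbb{C}$. $M$ is a smooth real oriented $n$-dimensional manifold with coordinates $x^i$. $\boldsymbol{\pi}$ is a vector bundle of finite rank $N$ over $M$ with (purely even) fibre coordinates $q^1,\dots,q^N$ of ghost parity $\mathrm{gh}(q^\alpha)=0$; $\Pi\widehat{\boldsymbol{\pi}}$ is the parity-reversed dual bundle with fibre coordinates $q^\dagger_1,\dots,q^\dagger_N$ of ghost parity $\mathrm{gh}(q^\dagger_\alpha)=1\in\mathbb{Z}_2$. The BV-bundle $\pi_{\mathrm{BV}}$ is the bundle over $M$ with total space $J^\infty(\boldsymbol{\pi})\times_M J^\infty(\Pi\widehat{\boldsymbol{\pi}})$ and coordinates $q^\alpha_\sigma$, $q^\dagger_{\alpha,\sigma}$ ($\sigma$ a multi-index, $q^\alpha_\varnothing=q^\alpha$,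 $q^\dagger_{\alpha,\varnothing}=q^\dagger_\alpha$). Densities $f(x,[q],[q^\dagger])$ are smooth functions on it depending on derivatives of arbitrarily high but finite order; total derivatives are $D_i=\partial_{x^i}+q^\alpha_{\sigma+1_i}\partial/\partial q^\alpha_\sigma+q^\dagger_{\alpha,\sigma+1_i}\partial/\partial q^\dagger_{\alpha,\sigma}$. $\overline{H}^n(\pi_{\mathrm{BV}})$ is the space of top-degree horizontal forms $f\,\mathrm{d}^nx$ modulo the image of the horizontal differential, with classes written $F=\int f\,\mathrm{d}^nx$ and called integral functionals. All sections are such that integration by parts produces no boundary terms. A class $F$ acts on sections by $F(s)=\int_M j^\infty(s)^*f\,\mathrm{d}^nx$, where $s\in\Gamma(\pi_{\mathrm{BV}})$ is understood as a section of $\boldsymbol{\pi}\times_M\Pi\widehat{\boldsymbol{\pi}}$ with infinite jet $j^\infty(s)$. $\mathrm{gh}(F)\in\mathbb{Z}_2$ is the ghost parity of a homogeneous functional, and formulas with signs are for homogeneous arguments. Summation over repeated indices is understood. Variational derivatives. For $u=q^\alpha$ or $q^\dagger_\alpha$, $\overleftarrow{\delta f}/\delta u=\sum_\sigma(-1)^{|\sigma|}D_\sigma(\partial f/\partial u_\sigma)$ with partial derivatives acting from the left (variations are transported to the left), and $\overrightarrow{\delta f}/\delta u$ is the same expression with partial derivatives acting from the right (variations are transported to the right). BV-Laplacian on integral functionals. For $\mathcal{H}=\int h\,\mathrm{d}^nx$, $\Delta_{\mathrm{BV}}(\mathcal{H})=\int\frac{\overleftarrow{\delta}}{\delta q^\alpha}\Bigl(\frac{\overleftarrow{\delta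 h}}{\delta q^\dagger_\alpha}\Bigr)\mathrm{d}^nx$. Local functionals. $\overline{\mathfrak{M}}^n(\pi_{\mathrm{BV}})=\bigoplus_{i\geq1}\bigotimes_{\Bbbk}^i\overline{H}^n(\pi_{\mathrm{BV}})$ is the space of finite sums of products of finitely many integral functionals, viewed as maps on $\Gamma(\pi_{\mathrm{BV}})$, with pointwise product $(F\cdot G)(s)=F(s)\cdot G(s)$, graded-commutative: $F\cdot G=(-)^{\mathrm{gh}(F)\mathrm{gh}(G)}G\cdot F$. Schouten bracket. On integral functionals $F=\int f\,\mathrm{d}^nx$, $G=\int g\,\mathrm{d}^nx$ it is $[\![F,G]\!]=\int\Bigl(\frac{\overrightarrow{\delta f}}{\delta q^\alpha}\cdot\frac{\overleftarrow{\delta g}}{\delta q^\dagger_\alpha}-\frac{\overrightarrow{\delta f}}{\delta q^\dagger_\alpha}\cdot\frac{\overleftarrow{\delta g}}{\delta q^\alpha}\Bigr)\mathrm{d}^nx$. It is extended to $\overline{\mathfrak{M}}^n(\pi_{\mathrm{BV}})$ as the $\Bbbk$-bilinear bracket with $[\![F,G]\!]=-(-)^{(\mathrm{gh}(F)-1)(\mathrm{gh}(G)-1)}[\![G,F]\!]$ and $[\![F,G\cdot H]\!]=[\![F,G]\!]\cdot H+(-)^{(\mathrm{gh}(F)-1)\mathrm{gh}(G)}G\cdot[\![F,H]\!]$.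
   Formalization: The coordinate formulas for the BV-Laplacian and the Schouten bracket are not invariant under general coordinate changes, so they are assumed to send densities to densities; sections are those on which all integrals converge and exact terms integrate to zero (none if M is noncompact). *)

theory Defs
  imports "HOL-Analysis.Analysis" "HOL-Library.Poly_Mapping"
begin

section \<open>Grassmann algebras\<close>

text \<open>
  An element of the Grassmann algebra on odd generators \<open>\<theta>\<^sub>v\<close>, with \<open>v\<close> from a countable type, is its
  family of coefficients at the monomials \<open>\<theta>\<^sub>S\<close>, where \<open>S\<close> is a finite set of generators and
  the factors of \<open>\<theta>\<^sub>S\<close> stand in increasing order with respect to the numbering \<^const>\<open>to_nat\<close>.
\<close>

type_synonym ('v, 'k) grass = "'v set \<Rightarrow> 'k"

definition gsign :: "'v::countable set \<Rightarrow> 'v set \<Rightarrow> 'k::comm_ring_1" where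
  "gsign A B = (-1) ^ card {(a, b). a \<in> A \<and> b \<in> B \<and> to_nat b < to_nat a}"

definition gmul :: "('v::countable, 'k::comm_ring_1) grass \<Rightarrow> ('v, 'k) grass \<Rightarrow> ('v, 'k) grass" where
  "gmul f g = (\<lambda>S. \<Sum>A\<in>Pow S. gsign A (S - A) * f A * g (S - A))"

definition gone :: "('v, 'k::comm_ring_1) grass" where
  "gone = (\<lambda>S. if S = {} then 1 else 0)"

definition gvar :: "'v \<Rightarrow> ('v, 'k::comm_ring_1) grass" where
  "gvar v = (\<lambda>S. if S = {v} then 1 else 0)"

definition gprod :: "('v::countable, 'k::comm_ring_1) grass list \<Rightarrow> ('v, 'k) grass" where
  "gprod ys = foldr gmul ys gone"

text \<open>The partial derivatives \<open>\<partial>/\<partial>\<theta>\<^sub>v\<close> acting from the left and from the right.\<close>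

definition gderivL :: "'v::countable \<Rightarrow> ('v, 'k::comm_ring_1) grass \<Rightarrow> ('v, 'k) grass" where
  "gderivL v f = (\<lambda>S. if v \<in> S then 0
      else (-1) ^ card {w \<in> S. to_nat w < to_nat v} * f (insert v S))"

definition gderivR :: "'v::countable \<Rightarrow> ('v, 'k::comm_ring_1) grass \<Rightarrow> ('v, 'k) grass" where
  "gderivR v f = (\<lambda>S. if v \<in> S then 0
      else (-1) ^ card {w \<in> S. to_nat v < to_nat w} * f (insert v S))"

text \<open>Substitution of odd elements \<open>y v\<close> of another Grassmann algebra for the generators.\<close>

definition geval ::
  "('v::countable, 'k::comm_ring_1) grass \<Rightarrow> ('v \<Rightarrow> ('w::countable, 'k) grass) \<Rightarrow> ('w, 'k) grass" where
  "geval f y = (\<lambda>T. Sum_any (\<lambda>S. f S * gprod (map y (sorted_key_list_of_set to_nat S)) T))"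


section \<open>Smooth functions of the base coordinates\<close>

definition coord_list :: "'n::finite list" where
  "coord_list = sorted_key_list_of_set to_nat UNIV"

definition pd :: "'n::finite \<Rightarrow> (real^'n \<Rightarrow> 'b::real_normed_vector) \<Rightarrow> real^'n \<Rightarrow> 'b" where
  "pd i h x = vector_derivative (\<lambda>t. h (x + t *\<^sub>R axis i 1)) (at 0)"

definition pd_multi :: "('n::finite \<Rightarrow> nat) \<Rightarrow> (real^'n \<Rightarrow> 'b::real_normed_vector) \<Rightarrow> real^'n \<Rightarrow> 'b" where
  "pd_multi \<sigma> = foldr (\<lambda>i. pd i ^^ \<sigma> i) coord_list"

definition smooth_fun :: "(real^'n::finite) set \<Rightarrow> (real^'n \<Rightarrow> 'b::real_normed_vector) \<Rightarrow> bool" where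
  "smooth_fun \<Omega> h \<longleftrightarrow> (\<forall>is. continuous_on \<Omega> (foldr pd is h) \<and>
     (\<forall>x\<in>\<Omega>. \<forall>i. (\<lambda>t. foldr pd is h (x + t *\<^sub>R axis i 1)) differentiable at 0))"


section \<open>The base manifold and the bundles\<close>

text \<open>
  The carrier of the manifold is the whole type \<open>'m\<close>. A chart with index \<open>i\<close> has domain
  \<open>cdom B i\<close> and coordinate map \<open>coord B i\<close>. The bundle \<open>\<pi>\<close> with fibre \<open>'k\<^sup>N\<close>, where \<open>N\<close> is the
  cardinality of \<open>'a\<close>, is trivialised over each chart and is described by its transition matrices:
  \<open>q\<^sub>i = fib B i j q\<^sub>j\<close>. The dual fibre coordinates then satisfy
  \<open>q\<dagger>\<^sub>i = (fib B j i)\<^sup>T q\<dagger>\<^sub>j\<close>.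
\<close>

record ('i, 'm, 'n::finite, 'a::finite, 'k) bv_bundle =
  charts :: "'i set"
  cdom :: "'i \<Rightarrow> 'm set"
  coord :: "'i \<Rightarrow> 'm \<Rightarrow> real^'n"
  fib :: "'i \<Rightarrow> 'i \<Rightarrow> 'm \<Rightarrow> 'k^'a^'a"

definition cinv :: "('i, 'm, 'n::finite, 'a::finite, 'k) bv_bundle \<Rightarrow> 'i \<Rightarrow> real^'n \<Rightarrow> 'm" where
  "cinv B i = inv_into (cdom B i) (coord B i)"

definition cimg :: "('i, 'm, 'n::finite, 'a::finite, 'k) bv_bundle \<Rightarrow> 'i \<Rightarrow> (real^'n) set" where
  "cimg B i = coord B i ` cdom B i"

text \<open>Row \<open>l\<close>, column \<open>k\<close>: the derivative of the \<open>l\<close>-th coordinate of chart \<open>j\<close> with respect to the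
  \<open>k\<close>-th coordinate of chart \<open>i\<close>.\<close>

definition jacobian :: "('i, 'm, 'n::finite, 'a::finite, 'k) bv_bundle \<Rightarrow> 'i \<Rightarrow> 'i \<Rightarrow> 'm \<Rightarrow> real^'n^'n" where
  "jacobian B i j p = (\<chi> l k. pd k (\<lambda>x. coord B j (cinv B i x) $ l) (coord B i p))"

definition oriented_vector_bundle ::
  "('i, 'm::{t2_space,second_countable_topology}, 'n::finite, 'a::finite,
    'k::{real_normed_field,euclidean_space}) bv_bundle \<Rightarrow> bool" where
  "oriented_vector_bundle B \<longleftrightarrow>
     (\<Union>i\<in>charts B. cdom B i) = UNIV \<and>
     (\<forall>i\<in>charts B. open (cdom B i) \<and> open (cimg B i) \<and>
        homeomorphism (cdom B i) (cimg B i) (coord B i) (cinv B i)) \<and>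
     (\<forall>i\<in>charts B. \<forall>j\<in>charts B.
        smooth_fun (coord B i ` (cdom B i \<inter> cdom B j)) (\<lambda>x. coord B j (cinv B i x)) \<and>
        (\<forall>p\<in>cdom B i \<inter> cdom B j. det (jacobian B i j p) > 0) \<and>
        (\<forall>\<alpha> \<beta>. smooth_fun (coord B i ` (cdom B i \<inter> cdom B j)) (\<lambda>x. fib B i j (cinv B i x) $ \<alpha> $ \<beta>))) \<and>
     (\<forall>i\<in>charts B. \<forall>p\<in>cdom B i. fib B i i p = mat 1) \<and>
     (\<forall>i\<in>charts B. \<forall>j\<in>charts B. \<forall>k\<in>charts B. \<forall>p\<in>cdom B i \<inter> cdom B j \<inter> cdom B k.
        fib B i j p ** fib B j k p = fib B i k p)"


section \<open>Local densities on the infinite jet space\<close>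

text \<open>
  A pair \<open>(\<alpha>, \<sigma>)\<close> of a fibre index and a multi-index names the even jet coordinate \<open>q\<^sup>\<alpha>\<^sub>\<sigma>\<close> as well as
  the odd one \<open>q\<dagger>\<^sub>\<alpha>\<^sub>,\<^sub>\<sigma>\<close>. A local function sends the base coordinates \<open>x\<close> and the values \<open>u\<close> of all
  even jet coordinates to an element of the Grassmann algebra on the odd jet coordinates.
\<close>

type_synonym ('n, 'a) jvar = "'a \<times> ('n \<Rightarrow> nat)"

type_synonym ('n, 'a, 'k) jfun =
  "real^'n \<Rightarrow> (('n, 'a) jvar \<Rightarrow> 'k) \<Rightarrow> (('n, 'a) jvar, 'k) grass"

type_synonym ('i, 'n, 'a, 'k) dens = "'i \<Rightarrow> ('n, 'a, 'k) jfun"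

definition jshift :: "'n \<Rightarrow> ('n, 'a) jvar \<Rightarrow> ('n, 'a) jvar" where
  "jshift i v = (fst v, (snd v)(i := Suc (snd v i)))"

definition morder :: "('n::finite \<Rightarrow> nat) \<Rightarrow> nat" where
  "morder \<sigma> = sum \<sigma> UNIV"

definition dx ::
  "'n \<Rightarrow> ('n::finite, 'a, 'k::{real_normed_field,euclidean_space}) jfun \<Rightarrow> ('n, 'a, 'k) jfun" where
  "dx i f x u S = pd i (\<lambda>y. f y u S) x"

definition dq ::
  "('n, 'a) jvar \<Rightarrow> ('n::finite, 'a, 'k::{real_normed_field,euclidean_space}) jfun \<Rightarrow> ('n, 'a, 'k) jfun" where
  "dq v f x u S = deriv (\<lambda>z. f x (u(v := z)) S) (u v)"

definition dthL ::
  "('n, 'a) jvar \<Rightarrow> ('n::finite, 'a::finite, 'k::{real_normed_field,euclidean_space}) jfun \<Rightarrow> ('n, 'a, 'k) jfun" where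
  "dthL v f x u = gderivL v (f x u)"

definition dthR ::
  "('n, 'a) jvar \<Rightarrow> ('n::finite, 'a::finite, 'k::{real_normed_field,euclidean_space}) jfun \<Rightarrow> ('n, 'a, 'k) jfun" where
  "dthR v f x u = gderivR v (f x u)"

definition jpartial ::
  "'n + ('n, 'a) jvar \<Rightarrow> ('n::finite, 'a, 'k::{real_normed_field,euclidean_space}) jfun \<Rightarrow> ('n, 'a, 'k) jfun" where
  "jpartial w = case_sum dx dq w"

text \<open>
  Smoothness: all iterated partial derivatives in the \<open>x\<^sup>i\<close> and the \<open>q\<^sup>\<alpha>\<^sub>\<sigma>\<close> exist and are continuous,
  where derivatives in \<open>q\<^sup>\<alpha>\<^sub>\<sigma>\<close> are taken over the ground field. For functions of finite order,
  continuity for the product topology on the jet fibre is the usual continuity.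
\<close>

definition smooth_jfun ::
  "(real^'n) set \<Rightarrow> ('n::finite, 'a, 'k::{real_normed_field,euclidean_space}) jfun \<Rightarrow> bool" where
  "smooth_jfun \<Omega> f \<longleftrightarrow> (\<forall>ws S.
     continuous_on (\<Omega> \<times> UNIV) (\<lambda>(x, u). foldr jpartial ws f x u S) \<and>
     (\<forall>x\<in>\<Omega>. \<forall>u.
        (\<forall>i. (\<lambda>t. foldr jpartial ws f (x + t *\<^sub>R axis i 1) u S) differentiable at 0) \<and>
        (\<forall>v. (\<lambda>z. foldr jpartial ws f x (u(v := z)) S) field_differentiable at (u v))))"

definition jorder_le ::
  "nat \<Rightarrow> (real^'n) set \<Rightarrow> ('n::finite, 'a, 'k::{real_normed_field,euclidean_space}) jfun \<Rightarrow> bool" where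
  "jorder_le m \<Omega> f \<longleftrightarrow> (\<forall>x\<in>\<Omega>.
     (\<forall>u u'. (\<forall>v. morder (snd v) \<le> m \<longrightarrow> u v = u' v) \<longrightarrow> f x u = f x u') \<and>
     (\<forall>u S. f x u S \<noteq> 0 \<longrightarrow> S \<subseteq> {v. morder (snd v) \<le> m}))"

text \<open>The sums over jet coordinates and multi-indices below have only finitely many nonzero terms
  at each argument, provided that the function is of finite order near \<open>x\<close>.\<close>

definition total_deriv ::
  "'n \<Rightarrow> ('n::finite, 'a::finite, 'k::{real_normed_field,euclidean_space}) jfun \<Rightarrow> ('n, 'a, 'k) jfun" where
  "total_deriv i f x u S = dx i f x u S
     + Sum_any (\<lambda>v. u (jshift i v) * dq v f x u S)
     + Sum_any (\<lambda>v. gmul (gvar (jshift i v)) (dthL v f x u) S)"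

definition total_deriv_multi ::
  "('n \<Rightarrow> nat) \<Rightarrow> ('n::finite, 'a::finite, 'k::{real_normed_field,euclidean_space}) jfun \<Rightarrow> ('n, 'a, 'k) jfun" where
  "total_deriv_multi \<sigma> = foldr (\<lambda>i. total_deriv i ^^ \<sigma> i) coord_list"

text \<open>The coordinates \<open>q\<^sup>\<alpha>\<close> are even, so the left and right variational derivatives with respect to
  them coincide.\<close>

definition var_q ::
  "'a \<Rightarrow> ('n::finite, 'a::finite, 'k::{real_normed_field,euclidean_space}) jfun \<Rightarrow> ('n, 'a, 'k) jfun" where
  "var_q \<alpha> f x u S = Sum_any (\<lambda>\<sigma>. (-1) ^ morder \<sigma> * total_deriv_multi \<sigma> (dq (\<alpha>, \<sigma>) f) x u S)"

definition var_thL ::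
  "'a \<Rightarrow> ('n::finite, 'a::finite, 'k::{real_normed_field,euclidean_space}) jfun \<Rightarrow> ('n, 'a, 'k) jfun" where
  "var_thL \<alpha> f x u S = Sum_any (\<lambda>\<sigma>. (-1) ^ morder \<sigma> * total_deriv_multi \<sigma> (dthL (\<alpha>, \<sigma>) f) x u S)"

definition var_thR ::
  "'a \<Rightarrow> ('n::finite, 'a::finite, 'k::{real_normed_field,euclidean_space}) jfun \<Rightarrow> ('n, 'a, 'k) jfun" where
  "var_thR \<alpha> f x u S = Sum_any (\<lambda>\<sigma>. (-1) ^ morder \<sigma> * total_deriv_multi \<sigma> (dthR (\<alpha>, \<sigma>) f) x u S)"

text \<open>
  The two coordinate expressions below are evaluated chart by chart. They are compatible with
  coordinate changes of unit Jacobian and locally constant transition matrices, but not with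
  arbitrary ones: the Laplacian depends on the fibre frame, and the bracket pairs two densities.
\<close>

definition laplacian_dens ::
  "('i, 'n::finite, 'a::finite, 'k::{real_normed_field,euclidean_space}) dens \<Rightarrow> ('i, 'n, 'a, 'k) dens" where
  "laplacian_dens h i x u S = (\<Sum>\<alpha>\<in>UNIV. var_q \<alpha> (var_thL \<alpha> (h i)) x u S)"

definition bracket_dens ::
  "('i, 'n::finite, 'a::finite, 'k::{real_normed_field,euclidean_space}) dens
    \<Rightarrow> ('i, 'n, 'a, 'k) dens \<Rightarrow> ('i, 'n, 'a, 'k) dens" where
  "bracket_dens f g i x u S = (\<Sum>\<alpha>\<in>UNIV.
     gmul (var_q \<alpha> (f i) x u) (var_thL \<alpha> (g i) x u) S -
     gmul (var_thR \<alpha> (f i) x u) (var_q \<alpha> (g i) x u) S)"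


section \<open>Sections\<close>

text \<open>
  A section is given in chart coordinates. Its \<open>\<pi>\<close>-component has values in the ground field.
  Its component in the parity-reversed dual has values in the odd part of the Grassmann algebra
  on countably many auxiliary generators, so that the values of odd functionals anticommute.
\<close>

type_synonym ('i, 'n, 'a, 'k) bv_section =
  "('i \<Rightarrow> real^'n \<Rightarrow> 'a \<Rightarrow> 'k) \<times> ('i \<Rightarrow> real^'n \<Rightarrow> 'a \<Rightarrow> (nat, 'k) grass)"

definition local_section ::
  "('i, 'm, 'n::finite, 'a::finite, 'k::{real_normed_field,euclidean_space}) bv_bundle
    \<Rightarrow> 'm set \<Rightarrow> ('i, 'n, 'a, 'k) bv_section \<Rightarrow> bool" where
  "local_section B W s \<longleftrightarrow>
     (\<forall>i\<in>charts B. \<forall>\<alpha>.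
        smooth_fun (coord B i ` (W \<inter> cdom B i)) (\<lambda>x. fst s i x \<alpha>) \<and>
        (\<forall>T. smooth_fun (coord B i ` (W \<inter> cdom B i)) (\<lambda>x. snd s i x \<alpha> T)) \<and>
        (\<forall>x\<in>coord B i ` (W \<inter> cdom B i). \<forall>T. snd s i x \<alpha> T \<noteq> 0 \<longrightarrow> finite T \<and> odd (card T))) \<and>
     (\<forall>i\<in>charts B. \<forall>j\<in>charts B. \<forall>p\<in>W \<inter> cdom B i \<inter> cdom B j. \<forall>\<alpha>.
        fst s i (coord B i p) \<alpha> = (\<Sum>\<beta>\<in>UNIV. fib B i j p $ \<alpha> $ \<beta> * fst s j (coord B j p) \<beta>) \<and>
        (\<forall>T. snd s i (coord B i p) \<alpha> T
           = (\<Sum>\<beta>\<in>UNIV. fib B j i p $ \<beta> $ \<alpha> * snd s j (coord B j p) \<beta> T)))"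

definition jet_pullback ::
  "('n::finite, 'a::finite, 'k::{real_normed_field,euclidean_space}) jfun
    \<Rightarrow> ('i, 'n, 'a, 'k) bv_section \<Rightarrow> 'i \<Rightarrow> real^'n \<Rightarrow> (nat, 'k) grass" where
  "jet_pullback f s i x = geval
     (f x (\<lambda>(\<alpha>, \<sigma>). pd_multi \<sigma> (\<lambda>y. fst s i y \<alpha>) x))
     (\<lambda>(\<alpha>, \<sigma>) T. pd_multi \<sigma> (\<lambda>y. snd s i y \<alpha> T) x)"


section \<open>Horizontal cohomology\<close>

text \<open>
  A horizontal top-degree form is a family \<open>f\<^sub>i d\<^sup>nx\<^sub>i\<close>, and a horizontal form of degree \<open>n - 1\<close> is a family
  \<open>\<eta>\<^sub>i\<^sup>k \<iota>(\<partial>/\<partial>x\<^sub>i\<^sup>k) d\<^sup>nx\<^sub>i\<close> whose horizontal differential is \<open>D\<^sub>k \<eta>\<^sub>i\<^sup>k d\<^sup>nx\<^sub>i\<close>. The coefficients change between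
  charts in such a way that the pull-backs along all local sections are differential forms on the base.
\<close>

definition densities ::
  "('i, 'm::topological_space, 'n::finite, 'a::finite, 'k::{real_normed_field,euclidean_space}) bv_bundle
    \<Rightarrow> ('i, 'n, 'a, 'k) dens set" where
  "densities B = {f.
     (\<exists>m. \<forall>i\<in>charts B. jorder_le m (cimg B i) (f i)) \<and>
     (\<forall>i\<in>charts B. smooth_jfun (cimg B i) (f i)) \<and>
     (\<forall>W s. open W \<and> local_section B W s \<longrightarrow>
       (\<forall>i\<in>charts B. \<forall>j\<in>charts B. \<forall>p\<in>W \<inter> cdom B i \<inter> cdom B j. \<forall>T.
          jet_pullback (f i) s i (coord B i p) T =
          of_real (det (jacobian B i j p)) * jet_pullback (f j) s j (coord B j p) T))}"

definition currents ::
  "('i, 'm::topological_space, 'n::finite, 'a::finite, 'k::{real_normed_field,euclidean_space}) bv_bundle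
    \<Rightarrow> ('n \<Rightarrow> ('i, 'n, 'a, 'k) dens) set" where
  "currents B = {\<eta>.
     (\<exists>m. \<forall>i\<in>charts B. \<forall>k. jorder_le m (cimg B i) (\<eta> k i)) \<and>
     (\<forall>i\<in>charts B. \<forall>k. smooth_jfun (cimg B i) (\<eta> k i)) \<and>
     (\<forall>W s. open W \<and> local_section B W s \<longrightarrow>
       (\<forall>i\<in>charts B. \<forall>j\<in>charts B. \<forall>p\<in>W \<inter> cdom B i \<inter> cdom B j. \<forall>T l.
          (\<Sum>k\<in>UNIV. of_real (jacobian B i j p $ l $ k) * jet_pullback (\<eta> k i) s i (coord B i p) T) =
          of_real (det (jacobian B i j p)) * jet_pullback (\<eta> l j) s j (coord B j p) T))}"

definition exact_densities ::
  "('i, 'm::topological_space, 'n::finite, 'a::finite, 'k::{real_normed_field,euclidean_space}) bv_bundle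
    \<Rightarrow> ('i, 'n, 'a, 'k) dens set" where
  "exact_densities B = {f \<in> densities B. \<exists>\<eta>\<in>currents B. \<forall>i\<in>charts B. \<forall>x\<in>cimg B i. \<forall>u S.
     f i x u S = (\<Sum>k\<in>UNIV. total_deriv k (\<eta> k i) x u S)}"

type_synonym ('i, 'n, 'a, 'k) ifun = "('i, 'n, 'a, 'k) dens set"

definition hclass ::
  "('i, 'm::topological_space, 'n::finite, 'a::finite, 'k::{real_normed_field,euclidean_space}) bv_bundle
    \<Rightarrow> ('i, 'n, 'a, 'k) dens \<Rightarrow> ('i, 'n, 'a, 'k) ifun" where
  "hclass B f = {g \<in> densities B. (\<lambda>i x u S. g i x u S - f i x u S) \<in> exact_densities B}"

definition integral_functionals ::
  "('i, 'm::topological_space, 'n::finite, 'a::finite, 'k::{real_normed_field,euclidean_space}) bv_bundle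
    \<Rightarrow> ('i, 'n, 'a, 'k) ifun set" where
  "integral_functionals B = hclass B ` densities B"

text \<open>Operations on quotients are written, here and below, as unions over representatives; these are
  unions of equal sets as soon as the operation respects the equivalence.\<close>

definition hadd ::
  "('i, 'm::topological_space, 'n::finite, 'a::finite, 'k::{real_normed_field,euclidean_space}) bv_bundle
    \<Rightarrow> ('i, 'n, 'a, 'k) ifun \<Rightarrow> ('i, 'n, 'a, 'k) ifun \<Rightarrow> ('i, 'n, 'a, 'k) ifun" where
  "hadd B F G = (\<Union>f\<in>F. \<Union>g\<in>G. hclass B (\<lambda>i x u S. f i x u S + g i x u S))"

definition hscale ::
  "('i, 'm::topological_space, 'n::finite, 'a::finite, 'k::{real_normed_field,euclidean_space}) bv_bundle
    \<Rightarrow> 'k \<Rightarrow> ('i, 'n, 'a, 'k) ifun \<Rightarrow> ('i, 'n, 'a, 'k) ifun" where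
  "hscale B c F = (\<Union>f\<in>F. hclass B (\<lambda>i x u S. c * f i x u S))"

definition hlaplacian ::
  "('i, 'm::topological_space, 'n::finite, 'a::finite, 'k::{real_normed_field,euclidean_space}) bv_bundle
    \<Rightarrow> ('i, 'n, 'a, 'k) ifun \<Rightarrow> ('i, 'n, 'a, 'k) ifun" where
  "hlaplacian B F = (\<Union>f\<in>F. hclass B (laplacian_dens f))"

definition hbracket ::
  "('i, 'm::topological_space, 'n::finite, 'a::finite, 'k::{real_normed_field,euclidean_space}) bv_bundle
    \<Rightarrow> ('i, 'n, 'a, 'k) ifun \<Rightarrow> ('i, 'n, 'a, 'k) ifun \<Rightarrow> ('i, 'n, 'a, 'k) ifun" where
  "hbracket B F G = (\<Union>f\<in>F. \<Union>g\<in>G. hclass B (bracket_dens f g))"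

text \<open>Ghost parities are represented by natural numbers, of which only the residue modulo \<open>2\<close> matters;
  in particular \<open>p + 1\<close> stands for \<open>p - 1\<close>.\<close>

definition hparity ::
  "('i, 'm::topological_space, 'n::finite, 'a::finite, 'k::{real_normed_field,euclidean_space}) bv_bundle
    \<Rightarrow> nat \<Rightarrow> ('i, 'n, 'a, 'k) ifun \<Rightarrow> bool" where
  "hparity B p F \<longleftrightarrow> F \<in> integral_functionals B \<and>
     (\<exists>f\<in>F. \<forall>i\<in>charts B. \<forall>x\<in>cimg B i. \<forall>u S. f i x u S \<noteq> 0 \<longrightarrow> even (card S + p))"


section \<open>Local functionals\<close>

text \<open>
  Finite linear combinations of nonempty words in integral functionals, modulo multilinearity and
  graded commutativity: the direct sum of the tensor powers of positive degree, with the
  graded-commutative product.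
\<close>

type_synonym ('i, 'n, 'a, 'k) tens = "('i, 'n, 'a, 'k) ifun list \<Rightarrow>\<^sub>0 'k"

type_synonym ('i, 'n, 'a, 'k) lfun = "('i, 'n, 'a, 'k) tens set"

definition tscale :: "'k::comm_ring_1 \<Rightarrow> ('w \<Rightarrow>\<^sub>0 'k) \<Rightarrow> ('w \<Rightarrow>\<^sub>0 'k)" where
  "tscale c x = Poly_Mapping.map ((*) c) x"

definition tmul :: "('h list \<Rightarrow>\<^sub>0 'k::comm_ring_1) \<Rightarrow> ('h list \<Rightarrow>\<^sub>0 'k) \<Rightarrow> ('h list \<Rightarrow>\<^sub>0 'k)" where
  "tmul x y = (\<Sum>v\<in>Poly_Mapping.keys x. \<Sum>w\<in>Poly_Mapping.keys y.
     Poly_Mapping.single (v @ w) (Poly_Mapping.lookup x v * Poly_Mapping.lookup y w))"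

definition tensors ::
  "('i, 'm::topological_space, 'n::finite, 'a::finite, 'k::{real_normed_field,euclidean_space}) bv_bundle
    \<Rightarrow> ('i, 'n, 'a, 'k) tens set" where
  "tensors B = {x. \<forall>w\<in>Poly_Mapping.keys x. w \<noteq> [] \<and> set w \<subseteq> integral_functionals B}"

definition tensor_relations ::
  "('i, 'm::topological_space, 'n::finite, 'a::finite, 'k::{real_normed_field,euclidean_space}) bv_bundle
    \<Rightarrow> ('i, 'n, 'a, 'k) tens set" where
  "tensor_relations B =
     {Poly_Mapping.single (v @ [hadd B F G] @ w) 1
        - Poly_Mapping.single (v @ [F] @ w) 1 - Poly_Mapping.single (v @ [G] @ w) 1 | v w F G.
        set v \<union> set w \<union> {F, G} \<subseteq> integral_functionals B} \<union>
     {Poly_Mapping.single (v @ [hscale B c F] @ w) 1 - Poly_Mapping.single (v @ [F] @ w) c | v w c F.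
        set v \<union> set w \<union> {F} \<subseteq> integral_functionals B} \<union>
     {Poly_Mapping.single (v @ [F, G] @ w) 1 - Poly_Mapping.single (v @ [G, F] @ w) ((-1) ^ (p * q))
        | v w F G p q.
        set v \<union> set w \<subseteq> integral_functionals B \<and> hparity B p F \<and> hparity B q G}"

definition lclass ::
  "('i, 'm::topological_space, 'n::finite, 'a::finite, 'k::{real_normed_field,euclidean_space}) bv_bundle
    \<Rightarrow> ('i, 'n, 'a, 'k) tens \<Rightarrow> ('i, 'n, 'a, 'k) lfun" where
  "lclass B x = {y \<in> tensors B. y - x \<in> module.span tscale (tensor_relations B)}"

definition local_functionals ::
  "('i, 'm::topological_space, 'n::finite, 'a::finite, 'k::{real_normed_field,euclidean_space}) bv_bundle
    \<Rightarrow> ('i, 'n, 'a, 'k) lfun set" where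
  "local_functionals B = lclass B ` tensors B"

definition lincl ::
  "('i, 'm::topological_space, 'n::finite, 'a::finite, 'k::{real_normed_field,euclidean_space}) bv_bundle
    \<Rightarrow> ('i, 'n, 'a, 'k) ifun \<Rightarrow> ('i, 'n, 'a, 'k) lfun" where
  "lincl B F = lclass B (Poly_Mapping.single [F] 1)"

definition ladd ::
  "('i, 'm::topological_space, 'n::finite, 'a::finite, 'k::{real_normed_field,euclidean_space}) bv_bundle
    \<Rightarrow> ('i, 'n, 'a, 'k) lfun \<Rightarrow> ('i, 'n, 'a, 'k) lfun \<Rightarrow> ('i, 'n, 'a, 'k) lfun" where
  "ladd B F G = (\<Union>x\<in>F. \<Union>y\<in>G. lclass B (x + y))"

definition lscale ::
  "('i, 'm::topological_space, 'n::finite, 'a::finite, 'k::{real_normed_field,euclidean_space}) bv_bundle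
    \<Rightarrow> 'k \<Rightarrow> ('i, 'n, 'a, 'k) lfun \<Rightarrow> ('i, 'n, 'a, 'k) lfun" where
  "lscale B c F = (\<Union>x\<in>F. lclass B (tscale c x))"

definition lmul ::
  "('i, 'm::topological_space, 'n::finite, 'a::finite, 'k::{real_normed_field,euclidean_space}) bv_bundle
    \<Rightarrow> ('i, 'n, 'a, 'k) lfun \<Rightarrow> ('i, 'n, 'a, 'k) lfun \<Rightarrow> ('i, 'n, 'a, 'k) lfun" where
  "lmul B F G = (\<Union>x\<in>F. \<Union>y\<in>G. lclass B (tmul x y))"

definition lparity ::
  "('i, 'm::topological_space, 'n::finite, 'a::finite, 'k::{real_normed_field,euclidean_space}) bv_bundle
    \<Rightarrow> nat \<Rightarrow> ('i, 'n, 'a, 'k) lfun \<Rightarrow> bool" where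
  "lparity B p F \<longleftrightarrow> F \<in> local_functionals B \<and>
     (\<exists>x\<in>F. \<forall>w\<in>Poly_Mapping.keys x. \<exists>ps. list_all2 (hparity B) ps w \<and> even (sum_list ps + p))"

definition llinear ::
  "('i, 'm::topological_space, 'n::finite, 'a::finite, 'k::{real_normed_field,euclidean_space}) bv_bundle
    \<Rightarrow> (('i, 'n, 'a, 'k) lfun \<Rightarrow> ('i, 'n, 'a, 'k) lfun) \<Rightarrow> bool" where
  "llinear B L \<longleftrightarrow>
     (\<forall>F\<in>local_functionals B. L F \<in> local_functionals B \<and> (\<forall>c. L (lscale B c F) = lscale B c (L F))) \<and>
     (\<forall>F\<in>local_functionals B. \<forall>G\<in>local_functionals B. L (ladd B F G) = ladd B (L F) (L G))"

definition schouten_bracket ::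
  "('i, 'm::topological_space, 'n::finite, 'a::finite, 'k::{real_normed_field,euclidean_space}) bv_bundle
    \<Rightarrow> (('i, 'n, 'a, 'k) lfun \<Rightarrow> ('i, 'n, 'a, 'k) lfun \<Rightarrow> ('i, 'n, 'a, 'k) lfun) \<Rightarrow> bool" where
  "schouten_bracket B br \<longleftrightarrow>
     (\<forall>F\<in>local_functionals B. llinear B (br F) \<and> llinear B (\<lambda>G. br G F)) \<and>
     (\<forall>F\<in>integral_functionals B. \<forall>G\<in>integral_functionals B.
        br (lincl B F) (lincl B G) = lincl B (hbracket B F G)) \<and>
     (\<forall>p q F G. lparity B p F \<and> lparity B q G \<longrightarrow>
        br F G = lscale B (- ((-1) ^ ((p + 1) * (q + 1)))) (br G F)) \<and>
     (\<forall>p q r F G H. lparity B p F \<and> lparity B q G \<and> lparity B r H \<longrightarrow>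
        br F (lmul B G H) =
          ladd B (lmul B (br F G) H) (lscale B ((-1) ^ ((p + 1) * q)) (lmul B G (br F H))))"


section \<open>Values on sections\<close>

text \<open>
  The integral of a differential form of top degree is computed by cutting the manifold into
  countably many disjoint Borel pieces, each inside one chart. The choice of the pieces is fixed
  once and for all; the value does not depend on it.
\<close>

definition borel_pieces :: "('i, 'm::topological_space, 'n::finite, 'a::finite, 'k) bv_bundle \<Rightarrow> nat \<Rightarrow> 'i \<times> 'm set" where
  "borel_pieces B = (SOME P. (\<forall>r. fst (P r) \<in> charts B \<and> snd (P r) \<in> sets borel \<and>
       snd (P r) \<subseteq> cdom B (fst (P r))) \<and>
     disjoint_family (\<lambda>r. snd (P r)) \<and> (\<Union>r. snd (P r)) = UNIV)"

definition piece_img :: "('i, 'm::topological_space, 'n::finite, 'a::finite, 'k) bv_bundle \<Rightarrow> nat \<Rightarrow> (real^'n) set" where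
  "piece_img B r = coord B (fst (borel_pieces B r)) ` snd (borel_pieces B r)"

definition form_integrable ::
  "('i, 'm::topological_space, 'n::finite, 'a::finite, 'k::{real_normed_field,euclidean_space}) bv_bundle
    \<Rightarrow> ('i \<Rightarrow> real^'n \<Rightarrow> 'k) \<Rightarrow> bool" where
  "form_integrable B \<omega> \<longleftrightarrow>
     (\<forall>r. set_integrable lborel (piece_img B r) (\<omega> (fst (borel_pieces B r)))) \<and>
     summable (\<lambda>r. LINT x:piece_img B r|lborel. norm (\<omega> (fst (borel_pieces B r)) x))"

definition form_integral ::
  "('i, 'm::topological_space, 'n::finite, 'a::finite, 'k::{real_normed_field,euclidean_space}) bv_bundle
    \<Rightarrow> ('i \<Rightarrow> real^'n \<Rightarrow> 'k) \<Rightarrow> 'k" where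
  "form_integral B \<omega> = suminf (\<lambda>r. LINT x:piece_img B r|lborel. \<omega> (fst (borel_pieces B r)) x)"

definition dens_integral ::
  "('i, 'm::topological_space, 'n::finite, 'a::finite, 'k::{real_normed_field,euclidean_space}) bv_bundle
    \<Rightarrow> ('i, 'n, 'a, 'k) dens \<Rightarrow> ('i, 'n, 'a, 'k) bv_section \<Rightarrow> (nat, 'k) grass" where
  "dens_integral B f s = (\<lambda>T. form_integral B (\<lambda>i x. jet_pullback (f i) s i x T))"

text \<open>Global sections on which all integrals converge and integration by parts produces no boundary
  terms. When the manifold is compact, every smooth section qualifies.\<close>

definition bv_sections ::
  "('i, 'm::topological_space, 'n::finite, 'a::finite, 'k::{real_normed_field,euclidean_space}) bv_bundle
    \<Rightarrow> ('i, 'n, 'a, 'k) bv_section set" where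
  "bv_sections B = {s. local_section B UNIV s \<and>
     (\<forall>f\<in>densities B. \<forall>T. form_integrable B (\<lambda>i x. jet_pullback (f i) s i x T)) \<and>
     (\<forall>f\<in>exact_densities B. \<forall>T. dens_integral B f s T = 0)}"

definition hvalue ::
  "('i, 'm::topological_space, 'n::finite, 'a::finite, 'k::{real_normed_field,euclidean_space}) bv_bundle
    \<Rightarrow> ('i, 'n, 'a, 'k) ifun \<Rightarrow> ('i, 'n, 'a, 'k) bv_section \<Rightarrow> (nat, 'k) grass" where
  "hvalue B F s = dens_integral B (SOME f. f \<in> F) s"

definition lvalue ::
  "('i, 'm::topological_space, 'n::finite, 'a::finite, 'k::{real_normed_field,euclidean_space}) bv_bundle
    \<Rightarrow> ('i, 'n, 'a, 'k) lfun \<Rightarrow> ('i, 'n, 'a, 'k) bv_section \<Rightarrow> (nat, 'k) grass" where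
  "lvalue B F s = (\<lambda>T. let x = (SOME x. x \<in> F) in
     \<Sum>w\<in>Poly_Mapping.keys x. Poly_Mapping.lookup x w * gprod (map (\<lambda>H. hvalue B H s) w) T)"

end

theory Submission
  imports Defs
begin

text \<open>
  On words of integral functionals the operator is defined by the recursion
  \<open>\<Delta>(F \<cdot> w) = \<Delta>F \<cdot> w + \<lbrakk>\<sigma>F, w\<rbrakk> + \<sigma>F \<cdot> \<Delta>w\<close>, where \<open>\<sigma>\<close> is the parity involution. Written with \<open>\<sigma>\<close>
  instead of the sign \<open>(-)\<^bsup>gh(F)\<^esup>\<close>, the right-hand side is linear in \<open>F\<close>, so only graded
  commutativity has to be checked; it follows from the Leibniz rule and the skew-symmetry of the
  bracket, because \<open>\<Delta>\<close> changes the parity of an integral functional. The product formula is then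
  an induction on the first word, which uses the Leibniz rule of the bracket in its left argument.

  For \<open>\<Delta>\<close> and the bracket to act on classes at all, variational derivatives must annihilate total
  derivatives. This comes from \<open>[\<partial>/\<partial>q\<^sub>\<sigma>, D\<^sub>i] = \<partial>/\<partial>q\<^sub>\<sigma>\<^sub>-\<^sub>1\<^sub>i\<close> and its odd analogue: with
  \<open>[D\<^sub>i, D\<^sub>j] = 0\<close> the sum over \<open>\<sigma>\<close> telescopes.
\<close>

section \<open>The Grassmann algebra\<close>

text \<open>The sign rules of the bracket are given only for homogeneous arguments, and no axiom
  says that the bracket of homogeneous functionals is homogeneous. Splitting each letter of a word
  into its even and its odd half reduces everything to homogeneous words. The parity of a bracket is
  traced back, through the Leibniz rule, to the bracket of integral functionals, where it is read
  off from the densities; only then can the Leibniz rule be moved to the left argument. Local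
  functionals are classes of combinations of nonempty words, so identities hold only modulo the
  relations. The calculations take place on representatives, with the empty word added as a unit;
  there the recursion has a base case. The Laplacian and the bracket of densities are coordinate
  expressions, so it is a hypothesis that they yield densities. Granted that, more than invariance
  of classes holds: equivalent densities have equal variational derivatives, hence literally equal
  Laplacians and brackets in every chart.\<close>

definition gfin :: "('v, 'k::zero) grass \<Rightarrow> bool" where
  "gfin f \<longleftrightarrow> (\<forall>S. f S \<noteq> 0 \<longrightarrow> finite S)"

definition gpar :: "nat \<Rightarrow> ('v, 'k::zero) grass \<Rightarrow> bool" where
  "gpar p f \<longleftrightarrow> (\<forall>S. f S \<noteq> 0 \<longrightarrow> finite S \<and> even (card S + p))"

text \<open>Multiplies the part of degree \<open>k\<close> by \<open>(-1) ^ k\<close>. Sign rules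
  that depend on the parity of a factor become linear identities in this way, valid for
  inhomogeneous elements too.\<close>

definition geps :: "('v, 'k::comm_ring_1) grass \<Rightarrow> ('v, 'k) grass" where
  "geps f S = (-1) ^ card S * f S"

lemma gpar_gfin: "gpar p f \<Longrightarrow> gfin f"
  by (auto simp: gpar_def gfin_def)

lemma minus_one_power_sq [simp]:
  "(-1) ^ a * (-1) ^ a = (1 :: 'k::comm_ring_1)" "(-1) ^ a * ((-1) ^ a * x) = (x :: 'k)"
  by (simp_all flip: power_add mult.assoc)

text \<open>The exponent in \<open>gsign A B\<close> counts inversions, that is pairs
  \<open>(a, b)\<close> with \<open>b\<close> before \<open>a\<close>. A disjoint union in either
  slot splits this set of pairs in two, so the exponents add.\<close>

lemma gsign_Un_left:
  assumes "finite A" "finite A'" "finite B" "A \<inter> A' = {}"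
  shows "gsign (A \<union> A') B = gsign A B * gsign A' B"
proof -
  have "{(a, b). a \<in> A \<union> A' \<and> b \<in> B \<and> to_nat b < to_nat a} =
      {(a, b). a \<in> A \<and> b \<in> B \<and> to_nat b < to_nat a} \<union> {(a, b). a \<in> A' \<and> b \<in> B \<and> to_nat b < to_nat a}"
    by auto
  moreover have disj: "{(a, b). a \<in> A \<and> b \<in> B \<and> to_nat b < to_nat a} \<inter>
      {(a, b). a \<in> A' \<and> b \<in> B \<and> to_nat b < to_nat a} = {}"
    using assms(4) by auto
  moreover have "finite {(a, b). a \<in> A \<and> b \<in> B \<and> to_nat b < to_nat a}"
    by (rule finite_subset[of _ "A \<times> B"]) (use assms in auto)
  moreover have "finite {(a, b). a \<in> A' \<and> b \<in> B \<and> to_nat b < to_nat a}"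
    by (rule finite_subset[of _ "A' \<times> B"]) (use assms in auto)
  ultimately show ?thesis
    using assms(4) unfolding gsign_def power_add[symmetric]
    by (simp only: card_Un_disjoint)
qed

lemma gsign_Un_right:
  assumes "finite A" "finite B" "finite B'" "B \<inter> B' = {}"
  shows "gsign A (B \<union> B') = gsign A B * gsign A B'"
proof -
  have "{(a, b). a \<in> A \<and> b \<in> B \<union> B' \<and> to_nat b < to_nat a} =
      {(a, b). a \<in> A \<and> b \<in> B \<and> to_nat b < to_nat a} \<union> {(a, b). a \<in> A \<and> b \<in> B' \<and> to_nat b < to_nat a}"
    by auto
  moreover have disj: "{(a, b). a \<in> A \<and> b \<in> B \<and> to_nat b < to_nat a} \<inter>
      {(a, b). a \<in> A \<and> b \<in> B' \<and> to_nat b < to_nat a} = {}"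
    using assms(4) by auto
  moreover have "finite {(a, b). a \<in> A \<and> b \<in> B \<and> to_nat b < to_nat a}"
    by (rule finite_subset[of _ "A \<times> B"]) (use assms in auto)
  moreover have "finite {(a, b). a \<in> A \<and> b \<in> B' \<and> to_nat b < to_nat a}"
    by (rule finite_subset[of _ "A \<times> B'"]) (use assms in auto)
  ultimately show ?thesis
    using assms(4) unfolding gsign_def power_add[symmetric]
    by (simp only: card_Un_disjoint)
qed

text \<open>Every pair from two disjoint sets is an inversion in exactly one of the two directions,
  because distinct generators have distinct numbers. The two inversion counts therefore add up to
  \<open>card A * card B\<close>.\<close>

lemma gsign_swap:
  assumes "finite A" "finite B" "A \<inter> B = {}"
  shows "gsign A B = (-1) ^ (card A * card B) * (gsign B A :: 'b::comm_ring_1)"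
proof -
  let ?X = "{(a, b). a \<in> A \<and> b \<in> B \<and> to_nat b < to_nat a}"
  let ?Y = "{(b, a). b \<in> B \<and> a \<in> A \<and> to_nat a < to_nat b}"
  have AB: "A \<times> B = ?X \<union> prod.swap ` ?Y"
    using assms(3) by (auto simp: image_iff nat_neq_iff)
  have "finite ?X"
    by (rule finite_subset[of _ "A \<times> B"]) (use assms in auto)
  moreover have "finite ?Y"
    by (rule finite_subset[of _ "B \<times> A"]) (use assms in auto)
  ultimately have "card (A \<times> B) = card ?X + card (prod.swap ` ?Y)"
    unfolding AB by (intro card_Un_disjoint) auto
  then have "card A * card B = card ?X + card (prod.swap ` ?Y)"
    by (simp only: card_cartesian_product)
  also have "card (prod.swap ` ?Y) = card ?Y"
    by (rule card_image) (auto intro: inj_onI)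
  finally have "(-1) ^ (card A * card B) = (-1) ^ card ?X * ((-1) ^ card ?Y :: 'b)"
    unfolding power_add[symmetric] by (rule arg_cong)
  then show ?thesis
    unfolding gsign_def by (simp only: mult.assoc minus_one_power_sq mult_1_right)
qed

lemma gsign_empty [simp]: "gsign {} B = 1" "gsign A {} = 1"
  by (simp_all add: gsign_def)

text \<open>Elements are families over all sets of generators, but at an infinite \<open>S\<close>
  the sum over \<open>Pow S\<close> has infinitely many indices and is zero by convention.
  Coefficients at infinite sets are lost in products, which is why the unit law below asks for
  \<open>gfin\<close>.\<close>

lemma gmul_infinite: "infinite S \<Longrightarrow> gmul f g S = 0"
  by (simp add: gmul_def)

lemma gfin_gmul: "gfin (gmul f g)"
  using gmul_infinite by (auto simp: gfin_def)

text \<open>Both sides sum over the divisions of \<open>S\<close> into three ordered blocks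
  \<open>A\<close>, \<open>P - A\<close> and \<open>S - P\<close>. In either bracketing the sign is
  the product of the three pairwise signs of the blocks.\<close>

lemma gmul_assoc: "gmul (gmul f g) h = gmul f (gmul g h)"
proof
  fix S :: "'a set"
  show "gmul (gmul f g) h S = gmul f (gmul g h) S"
  proof (cases "finite S")
    case False
    then show ?thesis by (simp add: gmul_infinite)
  next
    case True
    let ?L = "\<lambda>(P, A). gsign P (S - P) * (gsign A (P - A) * f A * g (P - A)) * h (S - P)"
    let ?R = "\<lambda>(A, Q). gsign A (S - A) * f A * (gsign Q (S - A - Q) * g Q * h (S - A - Q))"
    have fin: "finite (Pow S)" "\<forall>A\<in>Pow S. finite (Pow A)" "\<forall>A\<in>Pow S. finite (Pow (S - A))"
      using True by (auto intro: finite_subset)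
    have "gmul (gmul f g) h S = sum ?L (SIGMA P:Pow S. Pow P)"
      unfolding gmul_def sum_distrib_left sum_distrib_right
      by (rule sum.Sigma) (use fin in auto)
    also have "\<dots> = sum ?R (SIGMA A:Pow S. Pow (S - A))"
    \<comment> \<open>The left side chooses the union \<open>P\<close> of the first two blocks and
      then \<open>A\<close> inside it; the right side chooses \<open>A\<close> and then the middle
      block \<open>Q\<close> from the rest.\<close>
    proof (rule sum.reindex_bij_witness[where i = "\<lambda>(A, Q). (A \<union> Q, A)" and j = "\<lambda>(P, A). (A, P - A)"])
      fix a assume a: "a \<in> (SIGMA P:Pow S. Pow P)"
      obtain P A where a_eq: "a = (P, A)" by force
      have PA: "P \<subseteq> S" "A \<subseteq> P" using a a_eq by auto
      have fin: "finite P" "finite A" "finite (P - A)" "finite (S - P)"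
        using True PA by (auto intro: finite_subset)
      have eq: "S - A - (P - A) = S - P" "S - A = (P - A) \<union> (S - P)" using PA by auto
      have "gsign P (S - P) = gsign A (S - P) * (gsign (P - A) (S - P) :: 'b)"
        using gsign_Un_left[of A "P - A" "S - P"] fin PA by (simp add: Un_absorb1 subset_Un_eq)
      moreover have "gsign A (S - A) = gsign A (P - A) * (gsign A (S - P) :: 'b)"
        unfolding eq(2) by (rule gsign_Un_right) (use fin PA in auto)
      ultimately show "?R (case a of (P, A) \<Rightarrow> (A, P - A)) = ?L a"
        unfolding a_eq by (simp add: eq(1) mult_ac)
    qed auto
    also have "\<dots> = gmul f (gmul g h) S"
      unfolding gmul_def sum_distrib_left
      by (rule sum.Sigma[symmetric]) (use fin in auto)
    finally show ?thesis .
  qed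
qed

lemma gmul_add_left: "gmul (\<lambda>S. f S + g S) h = (\<lambda>S. gmul f h S + gmul g h S)"
  by (simp add: gmul_def algebra_simps sum.distrib)

lemma gmul_add_right: "gmul h (\<lambda>S. f S + g S) = (\<lambda>S. gmul h f S + gmul h g S)"
  by (simp add: gmul_def algebra_simps sum.distrib)

lemma gmul_scale_left: "gmul (\<lambda>S. c * f S) h = (\<lambda>S. c * gmul f h S)"
  by (simp add: gmul_def sum_distrib_left mult_ac)

lemma gmul_scale_right: "gmul h (\<lambda>S. c * f S) = (\<lambda>S. c * gmul h f S)"
  by (simp add: gmul_def sum_distrib_left mult_ac)

lemma gmul_zero [simp]: "gmul (\<lambda>S. 0) h = (\<lambda>S. 0)" "gmul h (\<lambda>S. 0) = (\<lambda>S. 0)"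
  by (simp_all add: gmul_def)

lemma gmul_gone_left:
  assumes "gfin f" shows "gmul gone f = f"
proof
  fix S show "gmul gone f S = f S"
  proof (cases "finite S")
    case True
    have "gmul gone f S = (\<Sum>A\<in>Pow S. if A = {} then f S else 0)"
      unfolding gmul_def by (rule sum.cong) (auto simp: gone_def)
    with True show ?thesis by simp
  next
    case False
    with assms show ?thesis by (auto simp: gmul_infinite gfin_def)
  qed
qed

text \<open>Exchanging \<open>A\<close> with its complement matches the terms. The sign that appears
  depends only on the product of the two cardinalities modulo 2, which homogeneity fixes to that of
  \<open>p * q\<close>.\<close>

lemma gmul_commute:
  assumes "gpar p f" "gpar q g"
  shows "gmul f g = (\<lambda>S. (-1) ^ (p * q) * gmul g f S)"
proof
  fix S
  have "gmul f g S = (\<Sum>A\<in>Pow S. (-1) ^ (p * q) * (gsign A (S - A) * g A * f (S - A)))"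
    unfolding gmul_def
  proof (rule sum.reindex_bij_witness[where i = "\<lambda>A. S - A" and j = "\<lambda>A. S - A"])
    fix A assume A: "A \<in> Pow S"
    then have S: "S - (S - A) = A" by auto
    show "(-1) ^ (p * q) * (gsign (S - A) (S - (S - A)) * g (S - A) * f (S - (S - A))) =
        gsign A (S - A) * f A * g (S - A)"
    proof (cases "f A = 0 \<or> g (S - A) = 0")
      case False
      then have *: "finite A" "finite (S - A)" "even (card A + p)" "even (card (S - A) + q)"
        using assms by (auto simp: gpar_def)
      then have "even (card A * card (S - A)) = even (p * q)" by auto
      then have "(-1) ^ (card A * card (S - A)) = ((-1) ^ (p * q) :: 'b)"
        by (cases "even (p * q)") simp_all
      then have "gsign A (S - A) = (-1) ^ (p * q) * (gsign (S - A) A :: 'b)"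
        using gsign_swap[OF *(1,2) Diff_disjoint, where 'b = 'b] by (simp only:)
      then show ?thesis unfolding S by (simp only: mult_ac)
    qed (auto simp: S)
  qed auto
  then show "gmul f g S = (-1) ^ (p * q) * gmul g f S"
    by (simp add: gmul_def sum_distrib_left)
qed

lemma gpar_gmul:
  assumes "gpar p f" "gpar q g" shows "gpar (p + q) (gmul f g)"
  unfolding gpar_def
proof (intro allI impI)
  fix S assume nz: "gmul f g S \<noteq> 0"
  then have fin: "finite S" using gmul_infinite by blast
  from nz obtain A where A: "A \<in> Pow S" "f A \<noteq> 0" "g (S - A) \<noteq> 0"
    unfolding gmul_def by (metis (no_types, lifting) mult_eq_0_iff mult_zero_left mult_zero_right sum.neutral)
  have "card S = card A + card (S - A)"
    using A(1) fin by (metis PowD card_Diff_subset card_mono finite_subset le_add_diff_inverse)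
  with fin A(2,3) assms show "finite S \<and> even (card S + (p + q))" by (auto simp: gpar_def)
qed

lemma gpar_gone: "gpar 0 gone"
  by (simp add: gpar_def gone_def)

lemma gprod_simps [simp]: "gprod [] = gone" "gprod (y # ys) = gmul y (gprod ys)"
  by (simp_all add: gprod_def)

lemma gfin_gprod: "gfin (gprod ys)"
  by (cases ys) (use gpar_gone gpar_gfin gfin_gmul in auto)

lemma gprod_append: "gprod (xs @ ys) = gmul (gprod xs) (gprod ys)"
  by (induction xs) (simp_all add: gmul_gone_left gfin_gprod gmul_assoc)

lemma gpar_gprod:
  assumes "\<And>y. y \<in> set ys \<Longrightarrow> gpar 1 y"
  shows "gpar (length ys) (gprod ys)"
  using assms
proof (induction ys)
  case (Cons y ys)
  then show ?case using gpar_gmul[of 1 y "length ys" "gprod ys"] by simp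
qed (simp add: gpar_gone)

lemma geps_gmul: "geps (gmul f g) = gmul (geps f) (geps g)"
proof
  fix S show "geps (gmul f g) S = gmul (geps f) (geps g) S"
  proof (cases "finite S")
    case True
    have "(-1) ^ card S = (-1) ^ card A * ((-1) ^ card (S - A) :: 'b)" if "A \<subseteq> S" for A
      using that True
      by (metis card_Diff_subset card_mono finite_subset le_add_diff_inverse power_add)
    then show ?thesis unfolding geps_def gmul_def sum_distrib_left
      by (intro sum.cong) (auto simp: mult_ac)
  qed (simp add: geps_def gmul_infinite)
qed

text \<open>Left multiplication by \<open>\<theta>\<^sub>w\<close>, also on families with infinite support.\<close>

definition gnu :: "'v::countable \<Rightarrow> 'v set \<Rightarrow> 'k::comm_ring_1" where
  "gnu v S = (-1) ^ card {w \<in> S. to_nat w < to_nat v}"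

definition gext :: "'v::countable \<Rightarrow> ('v, 'k::comm_ring_1) grass \<Rightarrow> ('v, 'k) grass" where
  "gext w g S = (if w \<in> S then gnu w S * g (S - {w}) else 0)"

lemma gderivL_gnu: "gderivL v f S = (if v \<in> S then 0 else gnu v S * f (insert v S))"
  by (simp add: gderivL_def gnu_def)

text \<open>The generators are numbered by natural numbers, so only finitely many precede a given
  one. The signs \<open>gnu\<close> are therefore meaningful on infinite sets as well, and the
  anticommutation rules below hold for arbitrary families.\<close>

lemma finite_below: "finite {w \<in> S. to_nat (w::'v::countable) < n}"
  by (rule finite_subset[OF _ finite_vimageI[of "{..<n}" to_nat]]) auto

lemma gnu_insert:
  assumes "w \<notin> S"
  shows "gnu v (insert w S) = (if to_nat w < to_nat v then - gnu v S else gnu v S)"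
proof -
  have "{x \<in> insert w S. to_nat x < to_nat v} =
     (if to_nat w < to_nat v then insert w {x \<in> S. to_nat x < to_nat v} else {x \<in> S. to_nat x < to_nat v})"
    by auto
  then show ?thesis using assms finite_below[of S "to_nat v"]
    by (auto simp: gnu_def)
qed

lemma gnu_sq [simp]: "gnu v S * gnu v S = 1" "gnu v S * (gnu v S * x) = x"
proof -
  show "gnu v S * gnu v S = 1"
    unfolding gnu_def by (simp flip: power_add)
  then show "gnu v S * (gnu v S * x) = x" by (metis mult.assoc mult_1)
qed

lemma gnu_insert_self [simp]: "gnu v (insert v S) = gnu v S"
proof -
  have "{w \<in> insert v S. to_nat w < to_nat v} = {w \<in> S. to_nat w < to_nat v}" by auto
  then show ?thesis by (simp add: gnu_def)
qed

lemma to_nat_cases: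
  assumes "v \<noteq> w" shows "to_nat v < to_nat w \<and> \<not> to_nat w < to_nat v \<or> to_nat w < to_nat v \<and> \<not> to_nat v < to_nat w"
  using assms by (metis linorder_neqE_nat not_less_iff_gr_or_eq to_nat_split)

text \<open>In one order the sign of \<open>w\<close> is computed in the presence of
  \<open>v\<close>, in the other that of \<open>v\<close> in the presence of \<open>w\<close>. Since
  one of the two generators precedes the other, exactly one of these signs changes.\<close>

lemma gderivL_anticomm: "gderivL v (gderivL w f) S = - gderivL w (gderivL v f) S"
proof (cases "v = w")
  case False
  then show ?thesis using to_nat_cases[OF False]
    by (auto simp: gderivL_gnu gnu_insert insert_commute mult_ac)
qed (simp add: gderivL_gnu)

lemma gext_anticomm: "gext v (gext w f) S = - gext w (gext v f) S"
proof (cases "v = w")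
  case False
  show ?thesis
  proof (cases "v \<in> S \<and> w \<in> S")
    case True
    define R where "R = S - {v, w}"
    have S: "S = insert v (insert w R)" "v \<notin> R" "w \<notin> R" using True by (auto simp: R_def)
    have *: "S - {v} = insert w R" "S - {w} = insert v R" "insert w R - {w} = R" "insert v R - {v} = R"
      using S False by auto
    show ?thesis using to_nat_cases[OF False] False S(2,3)
      by (auto simp: gext_def * S(1) gnu_insert insert_commute insert_Diff_if mult_ac)
  qed (use False in \<open>auto simp: gext_def\<close>)
qed (simp add: gext_def)

text \<open>The canonical anticommutation relation between an odd derivative and an odd
  multiplication. Its Kronecker term is the source of the extra summand when an odd derivative
  passes a total derivative.\<close>

lemma gderivL_gext:
  "gderivL v (gext w f) S = (if v = w then f S else 0) - gext w (gderivL v f) S"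
proof (cases "v = w")
  case True
  show ?thesis
  proof (cases "w \<in> S")
    case w: True
    then have "gnu w S = (gnu w (S - {w}) :: 'a)"
      using gnu_insert_self[of w "S - {w}"] by (simp add: insert_absorb)
    with w True show ?thesis by (simp add: gderivL_gnu gext_def insert_absorb)
  qed (use True in \<open>simp add: gderivL_gnu gext_def\<close>)
next
  case False
  show ?thesis
  proof (cases "w \<in> S \<and> v \<notin> S")
    case True
    define R where "R = S - {w}"
    have S: "S = insert w R" "v \<notin> R" "w \<notin> R" using True by (auto simp: R_def)
    have *: "insert v (insert w R) - {w} = insert v R" using False S by auto
    show ?thesis using to_nat_cases[OF False] False S(2,3)
      by (auto simp: gderivL_gnu gext_def * S(1) gnu_insert insert_commute insert_Diff_if mult_ac)
  qed (use False in \<open>auto simp: gext_def gderivL_gnu\<close>)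
qed

text \<open>Total derivatives are defined with \<open>gmul\<close> and \<open>gvar\<close>. On
  families supported on finite sets that product may be replaced by \<open>gext\<close>, whose
  commutation rules are explicit.\<close>

lemma gmul_gvar:
  assumes "gfin g" shows "gmul (gvar w) g = gext w g"
proof
  fix S show "gmul (gvar w) g S = gext w g S"
  proof (cases "finite S")
    case True
    have "{(a, b). a \<in> {w} \<and> b \<in> S - {w} \<and> to_nat b < to_nat a} = Pair w ` {x \<in> S. to_nat x < to_nat w}"
      by auto
    then have gs: "gsign {w} (S - {w}) = (gnu w S :: 'b)"
      by (simp add: gsign_def gnu_def card_image inj_on_def)
    have "gmul (gvar w) g S = (\<Sum>A\<in>Pow S. if A = {w} then gsign {w} (S - {w}) * g (S - {w}) else 0)"
      unfolding gmul_def by (rule sum.cong) (auto simp: gvar_def)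
    with True show ?thesis by (auto simp: gs gext_def)
  next
    case False
    with assms have "g (S - {w}) = 0" by (auto simp: gfin_def)
    with False show ?thesis by (simp add: gmul_infinite gext_def)
  qed
qed

text \<open>On the left, \<open>v\<close> is taken out past the generators before it, on the right
  past those after it. Together these are all of \<open>S\<close>, so the two signs differ by
  \<open>(-1) ^ card S\<close>. Right derivatives are thereby reduced to left ones.\<close>

lemma gderivR_geps:
  assumes "gfin f" shows "gderivR v f = geps (gderivL v f)"
proof
  fix S show "gderivR v f S = geps (gderivL v f) S"
  proof (cases "finite S \<and> v \<notin> S")
    case True
    let ?a = "{w \<in> S. to_nat w < to_nat v}" and ?b = "{w \<in> S. to_nat v < to_nat w}"
    have S: "S = ?a \<union> ?b" using True
      by (auto simp: nat_neq_iff) (metis linorder_neqE_nat to_nat_split)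
    have "card (?a \<union> ?b) = card ?a + card ?b"
      by (rule card_Un_disjoint) (use True in auto)
    then have "(-1) ^ card S = (-1) ^ card ?a * ((-1) ^ card ?b :: 'b)"
      unfolding power_add[symmetric] S[symmetric] by (rule arg_cong)
    then have "geps (gderivL v f) S = (-1) ^ card ?b * ((-1) ^ card ?a * ((-1) ^ card ?a * f (insert v S)))"
      using True unfolding geps_def gderivL_def by (simp only: if_False mult_ac simp_thms)
    also have "\<dots> = gderivR v f S"
      using True by (simp add: gderivR_def)
    finally show ?thesis by simp
  next
    case False
    with assms have "v \<notin> S \<Longrightarrow> f (insert v S) = 0" by (auto simp: gfin_def)
    with False show ?thesis by (auto simp: gderivR_def gderivL_def geps_def)
  qed
qed

lemma geps_gderivL:
  assumes "gfin f" shows "gderivL v (geps f) = (\<lambda>S. - geps (gderivL v f) S)"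
proof
  fix S
  have "infinite S \<Longrightarrow> f (insert v S) = 0" using assms by (auto simp: gfin_def)
  then show "gderivL v (geps f) S = - geps (gderivL v f) S"
    by (cases "finite S") (auto simp: gderivL_def geps_def mult_ac)
qed

lemma geps_gext:
  assumes "gfin f" shows "gext v (geps f) = (\<lambda>S. - geps (gext v f) S)"
proof
  fix S
  have "finite S \<Longrightarrow> v \<in> S \<Longrightarrow> card S = Suc (card (S - {v}))"
    by (rule card.remove)
  moreover have "infinite S \<Longrightarrow> f (S - {v}) = 0" using assms by (auto simp: gfin_def)
  ultimately show "gext v (geps f) S = - geps (gext v f) S"
    by (cases "finite S") (auto simp: gext_def geps_def mult_ac simp del: card_Diff_insert card_Diff_singleton)
qed

section \<open>Smooth functions on the jet space\<close>

lemma MVT_unit_square: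
  fixes f :: "real \<Rightarrow> real \<Rightarrow> real"
  assumes h: "0 < h" "h < e"
    and fa: "\<And>s t. \<bar>s\<bar> < e \<Longrightarrow> \<bar>t\<bar> < e \<Longrightarrow> ((\<lambda>s. f s t) has_real_derivative fa s t) (at s)"
    and fab: "\<And>s t. \<bar>s\<bar> < e \<Longrightarrow> \<bar>t\<bar> < e \<Longrightarrow> ((\<lambda>t. fa s t) has_real_derivative fab s t) (at t)"
  shows "\<exists>s t. 0 < s \<and> s < h \<and> 0 < t \<and> t < h \<and> f h h - f h 0 - f 0 h + f 0 0 = h * h * fab s t"
proof -
  have "\<exists>z. 0 < z \<and> z < h \<and> (f h h - f h 0) - (f 0 h - f 0 0) = (h - 0) * (fa z h - fa z 0)"
    by (rule MVT2) (use h in \<open>auto intro!: DERIV_diff fa\<close>)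
  then obtain s where s: "0 < s" "s < h" "(f h h - f h 0) - (f 0 h - f 0 0) = h * (fa s h - fa s 0)"
    by auto
  have "\<exists>z. 0 < z \<and> z < h \<and> fa s h - fa s 0 = (h - 0) * fab s z"
    by (rule MVT2) (use h s in \<open>auto intro!: fab\<close>)
  then obtain t where "0 < t" "t < h" "fa s h - fa s 0 = h * fab s t" by auto
  with s show ?thesis by (intro exI[of _ s] exI[of _ t]) (simp add: algebra_simps)
qed

text \<open>The second difference of \<open>f\<close> over a small square is symmetric in the two
  variables. The mean value theorem, applied in either order, writes it as \<open>h * h\<close>
  times one of the mixed derivatives at some point of the square; continuity at the origin then
  forces the two values to agree.\<close>

lemma mixed_derivatives_eq_real:
  fixes f :: "real \<Rightarrow> real \<Rightarrow> real"
  assumes e: "0 < e"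
    and fa: "\<And>s t. \<bar>s\<bar> < e \<Longrightarrow> \<bar>t\<bar> < e \<Longrightarrow> ((\<lambda>s. f s t) has_real_derivative fa s t) (at s)"
    and fab: "\<And>s t. \<bar>s\<bar> < e \<Longrightarrow> \<bar>t\<bar> < e \<Longrightarrow> ((\<lambda>t. fa s t) has_real_derivative fab s t) (at t)"
    and fb: "\<And>s t. \<bar>s\<bar> < e \<Longrightarrow> \<bar>t\<bar> < e \<Longrightarrow> ((\<lambda>t. f s t) has_real_derivative fb s t) (at t)"
    and fba: "\<And>s t. \<bar>s\<bar> < e \<Longrightarrow> \<bar>t\<bar> < e \<Longrightarrow> ((\<lambda>s. fb s t) has_real_derivative fba s t) (at s)"
    and cont: "isCont (\<lambda>(s, t). fab s t) (0, 0)" "isCont (\<lambda>(s, t). fba s t) (0, 0)"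
  shows "fab 0 0 = fba 0 0"
proof (rule ccontr)
  assume ne: "fab 0 0 \<noteq> fba 0 0"
  \<comment> \<open>Half the gap: a common value of the two derivatives cannot lie within
    \<open>d\<close> of both limits.\<close>
  define d where "d = \<bar>fab 0 0 - fba 0 0\<bar> / 2"
  have d: "0 < d" using ne by (simp add: d_def)
  obtain r1 where r1: "0 < r1" "\<And>p. dist p (0, 0) < r1 \<Longrightarrow> dist ((\<lambda>(s, t). fab s t) p) (fab 0 0) < d"
    using cont(1) d unfolding continuous_at_eps_delta by force
  obtain r2 where r2: "0 < r2" "\<And>p. dist p (0, 0) < r2 \<Longrightarrow> dist ((\<lambda>(s, t). fba s t) p) (fba 0 0) < d"
    using cont(2) d unfolding continuous_at_eps_delta by force
  \<comment> \<open>The division by 2 pays for estimating the distance from the origin by the sum of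
    the two coordinates, each of which is below \<open>h\<close>.\<close>
  define h where "h = min e (min r1 r2) / 2"
  have h: "0 < h" "h < e" "2 * h \<le> r1" "2 * h \<le> r2" using e r1 r2 by (auto simp: h_def)
  obtain s t where st: "0 < s" "s < h" "0 < t" "t < h" "f h h - f h 0 - f 0 h + f 0 0 = h * h * fab s t"
    using MVT_unit_square[of h e f fa fab] h fa fab by blast
  obtain s' t' where st': "0 < s'" "s' < h" "0 < t'" "t' < h"
      "f h h - f 0 h - f h 0 + f 0 0 = h * h * fba t' s'"
    using MVT_unit_square[of h e "\<lambda>t s. f s t" "\<lambda>t s. fb s t" "\<lambda>t s. fba s t"] h fb fba by blast
  have "h * h * fab s t = h * h * fba t' s'" using st(5) st'(5) by linarith
  then have eq: "fab s t = fba t' s'" using h by simp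
  have small: "dist (a, b) (0, 0) < r" if "0 < a" "a < h" "0 < b" "b < h" "2 * h \<le> r" for a b r :: real
  proof -
    have "dist (a, b) (0, 0) \<le> \<bar>a\<bar> + \<bar>b\<bar>"
      using norm_Pair_le[of a b] by (simp add: dist_norm zero_prod_def[symmetric])
    with that show ?thesis by simp
  qed
  have "dist (fab s t) (fab 0 0) < d" using r1(2)[OF small[of s t r1]] st h by simp
  moreover have "dist (fba t' s') (fba 0 0) < d" using r2(2)[OF small[of t' s' r2]] st' h by simp
  ultimately have "\<bar>fab 0 0 - fba 0 0\<bar> < 2 * d" unfolding eq dist_real_def by linarith
  then show False by (simp add: d_def)
qed

text \<open>The mean value theorem concerns real-valued functions, so the claim is checked on each
  coordinate with respect to \<open>Basis\<close>.\<close>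

lemma mixed_derivatives_eq:
  fixes f :: "real \<Rightarrow> real \<Rightarrow> 'k::euclidean_space"
  assumes e: "0 < e"
    and fa: "\<And>s t. \<bar>s\<bar> < e \<Longrightarrow> \<bar>t\<bar> < e \<Longrightarrow> ((\<lambda>s. f s t) has_vector_derivative fa s t) (at s)"
    and fab: "\<And>s t. \<bar>s\<bar> < e \<Longrightarrow> \<bar>t\<bar> < e \<Longrightarrow> ((\<lambda>t. fa s t) has_vector_derivative fab s t) (at t)"
    and fb: "\<And>s t. \<bar>s\<bar> < e \<Longrightarrow> \<bar>t\<bar> < e \<Longrightarrow> ((\<lambda>t. f s t) has_vector_derivative fb s t) (at t)"
    and fba: "\<And>s t. \<bar>s\<bar> < e \<Longrightarrow> \<bar>t\<bar> < e \<Longrightarrow> ((\<lambda>s. fb s t) has_vector_derivative fba s t) (at s)"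
    and cont: "isCont (\<lambda>(s, t). fab s t) (0, 0)" "isCont (\<lambda>(s, t). fba s t) (0, 0)"
  shows "fab 0 0 = fba 0 0"
proof (rule euclidean_eqI)
  fix b :: 'k assume "b \<in> Basis"
  have inner: "((\<lambda>s. g s \<bullet> b) has_real_derivative (g' \<bullet> b)) (at x)"
    if "(g has_vector_derivative g') (at x)" for g g' x
    using bounded_linear.has_vector_derivative[OF bounded_linear_inner_left that]
    by (simp add: has_real_derivative_iff_has_vector_derivative)
  have cont': "isCont (\<lambda>(s, t). g s t \<bullet> b) (0, 0)" if "isCont (\<lambda>(s, t). g s t) (0, 0)"
    for g :: "real \<Rightarrow> real \<Rightarrow> 'k"
    using isCont_o2[OF that, of "\<lambda>y. y \<bullet> b"] by (simp add: case_prod_unfold)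
  show "fab 0 0 \<bullet> b = fba 0 0 \<bullet> b"
    by (rule mixed_derivatives_eq_real[where f = "\<lambda>s t. f s t \<bullet> b" and fa = "\<lambda>s t. fa s t \<bullet> b"
          and fb = "\<lambda>s t. fb s t \<bullet> b", OF e])
       (use fa fab fb fba cont in \<open>auto intro!: inner cont'\<close>)
qed

text \<open>A relational form of the partial derivative: real in the direction of a base coordinate,
  over the ground field in the direction of a fibre coordinate. It asserts existence together with
  the value, so that the rules of calculus can be stated without separate differentiability
  hypotheses.\<close>

definition jhd where
  "jhd w f x u S d = (case w of
     Inl i \<Rightarrow> ((\<lambda>t. f (x + t *\<^sub>R axis i 1) u S) has_vector_derivative d) (at 0)
   | Inr v \<Rightarrow> ((\<lambda>z. f x (u(v := z)) S) has_field_derivative d) (at (u v)))"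

lemma jhd_unique:
  fixes f :: "('n::finite, 'a, 'k::{real_normed_field,euclidean_space}) jfun"
  assumes "jhd w f x u S d" shows "jpartial w f x u S = d"
  using assms by (cases w)
    (auto simp: jhd_def jpartial_def dx_def pd_def dq_def intro: vector_derivative_at DERIV_imp_deriv)

lemma jhd_add:
  "jhd w f x u S d \<Longrightarrow> jhd w g x u S d' \<Longrightarrow> jhd w (\<lambda>x u S. f x u S + g x u S) x u S (d + d')"
  by (cases w) (auto simp: jhd_def intro: has_vector_derivative_add DERIV_add)

lemma jhd_zero: "jhd w (\<lambda>x u S. 0) x u S 0"
  by (cases w) (auto simp: jhd_def)

text \<open>Multiplication by an odd coordinate, odd derivatives, the parity involution and scaling
  all act on a family of Grassmann coefficients by constants \<open>c S\<close> and a reindexing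
  \<open>r\<close>. One rule for this shape covers them all.\<close>

lemma jhd_lin:
  fixes f :: "('n::finite, 'a, 'k::{real_normed_field,euclidean_space}) jfun"
  shows "jhd w f x u (r S) d \<Longrightarrow> jhd w (\<lambda>x u S. c S * f x u (r S)) x u S (c S * d)"
  by (cases w) (auto simp: jhd_def intro: has_vector_derivative_mult_right DERIV_cmult)

definition jmulq where "jmulq v f x u S = u v * f x u S"

lemma jhd_jmulq:
  fixes f :: "('n::finite, 'a, 'k::{real_normed_field,euclidean_space}) jfun"
  assumes "jhd w f x u S d"
  shows "jhd w (jmulq v f) x u S (u v * d + (if w = Inr v then f x u S else 0))"
proof (cases w)
  case (Inl i)
  with assms show ?thesis by (auto simp: jhd_def jmulq_def intro: has_vector_derivative_mult_right)
next
  case (Inr v')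
  show ?thesis
  proof (cases "v' = v")
    case True
    have "((\<lambda>z. z * f x (u(v := z)) S) has_field_derivative u v * d + 1 * f x (u(v := u v)) S) (at (u v))"
      using assms Inr True by (auto simp: jhd_def intro!: derivative_eq_intros)
    with Inr True show ?thesis by (simp add: jhd_def jmulq_def)
  next
    case False
    with assms Inr show ?thesis by (auto simp: jhd_def jmulq_def intro: DERIV_cmult)
  qed
qed

text \<open>A local function is total in \<open>x\<close>, but only its values on a chart image have
  a meaning. Identities between operators are therefore asserted on a set \<Omega> only.\<close>

definition eqon :: "'x set \<Rightarrow> ('x \<Rightarrow> 'y) \<Rightarrow> ('x \<Rightarrow> 'y) \<Rightarrow> bool" where
  "eqon \<Omega> f g \<longleftrightarrow> (\<forall>x\<in>\<Omega>. f x = g x)"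

lemma eqon_refl [simp]: "eqon \<Omega> f f" by (simp add: eqon_def)
lemma eqon_sym: "eqon \<Omega> f g \<Longrightarrow> eqon \<Omega> g f" by (simp add: eqon_def)
lemma eqon_trans [trans]: "eqon \<Omega> f g \<Longrightarrow> eqon \<Omega> g h \<Longrightarrow> eqon \<Omega> f h" by (simp add: eqon_def)

lemma eventually_axis:
  fixes x :: "real^'n"
  assumes "open \<Omega>" "x \<in> \<Omega>"
  shows "eventually (\<lambda>t. x + t *\<^sub>R axis i 1 \<in> \<Omega>) (nhds (0::real))"
proof -
  have "open ((\<lambda>t::real. x + t *\<^sub>R axis i 1) -` \<Omega>)"
    by (rule open_vimage[OF assms(1)]) (intro continuous_intros)
  with assms(2) show ?thesis
    unfolding eventually_nhds by (intro exI[of _ "(\<lambda>t::real. x + t *\<^sub>R axis i 1) -` \<Omega>"]) auto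
qed

lemma jhd_cong:
  fixes f :: "('n::finite, 'a, 'k::{real_normed_field,euclidean_space}) jfun"
  assumes "open \<Omega>" "x \<in> \<Omega>" "eqon \<Omega> f g"
  shows "jhd w f x u S d \<longleftrightarrow> jhd w g x u S d"
proof (cases w)
  case (Inl i)
  have "eventually (\<lambda>t. f (x + t *\<^sub>R axis i 1) u S = g (x + t *\<^sub>R axis i 1) u S) (nhds 0)"
    by (rule eventually_mono[OF eventually_axis[OF assms(1,2), of i]]) (use assms(3) in \<open>auto simp: eqon_def\<close>)
  with Inl assms show ?thesis
    by (auto simp: jhd_def eqon_def intro!: has_vector_derivative_cong_ev)
qed (use assms in \<open>simp add: jhd_def eqon_def\<close>)

lemma jpartial_cong:
  fixes f :: "('n::finite, 'a, 'k::{real_normed_field,euclidean_space}) jfun"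
  assumes "open \<Omega>" "eqon \<Omega> f g"
  shows "eqon \<Omega> (jpartial w f) (jpartial w g)"
  unfolding eqon_def
proof (intro ballI ext)
  fix x u S assume x: "x \<in> \<Omega>"
  show "jpartial w f x u S = jpartial w g x u S"
  proof (cases w)
    case (Inl i)
    have "eventually (\<lambda>t. t \<in> UNIV \<longrightarrow> f (x + t *\<^sub>R axis i 1) u S = g (x + t *\<^sub>R axis i 1) u S) (nhds 0)"
      by (rule eventually_mono[OF eventually_axis[OF assms(1) x, of i]]) (use assms(2) in \<open>auto simp: eqon_def\<close>)
    then show ?thesis
      using Inl by (auto simp: jpartial_def dx_def pd_def intro!: vector_derivative_cong_eq)
  qed (use assms x in \<open>simp add: jpartial_def dq_def eqon_def\<close>)
qed

section \<open>Smooth local functions and their closure properties\<close>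

lemma smooth_jhd:
  fixes f :: "('n::finite, 'a, 'k::{real_normed_field,euclidean_space}) jfun"
  assumes "smooth_jfun \<Omega> f" "x \<in> \<Omega>"
  shows "jhd w f x u S (jpartial w f x u S)"
proof (cases w)
  case (Inl i)
  have "(\<lambda>t. foldr jpartial [] f (x + t *\<^sub>R axis i 1) u S) differentiable at 0"
    using assms unfolding smooth_jfun_def by blast
  then show ?thesis using Inl
    by (simp add: jhd_def jpartial_def dx_def pd_def vector_derivative_works)
next
  case (Inr v)
  have "(\<lambda>z. foldr jpartial [] f x (u(v := z)) S) field_differentiable at (u v)"
    using assms unfolding smooth_jfun_def by blast
  then show ?thesis using Inr
    by (simp add: jhd_def jpartial_def dq_def DERIV_deriv_iff_field_differentiable)
qed

lemma smooth_continuous: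
  assumes "smooth_jfun \<Omega> f"
  shows "continuous_on (\<Omega> \<times> UNIV) (\<lambda>(x, u). f x u S)"
proof -
  have "continuous_on (\<Omega> \<times> UNIV) (\<lambda>(x, u). foldr jpartial [] f x u S)"
    using assms unfolding smooth_jfun_def by blast
  then show ?thesis by simp
qed

lemma smooth_jpartial:
  assumes "smooth_jfun \<Omega> f" shows "smooth_jfun \<Omega> (jpartial w f)"
  unfolding smooth_jfun_def
proof (intro allI)
  fix ws S
  have "foldr jpartial ws (jpartial w f) = foldr jpartial (ws @ [w]) f" by simp
  then show "continuous_on (\<Omega> \<times> UNIV) (\<lambda>(x, u). foldr jpartial ws (jpartial w f) x u S) \<and>
     (\<forall>x\<in>\<Omega>. \<forall>u.
        (\<forall>i. (\<lambda>t. foldr jpartial ws (jpartial w f) (x + t *\<^sub>R axis i 1) u S) differentiable at 0) \<and>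
        (\<forall>v. (\<lambda>z. foldr jpartial ws (jpartial w f) x (u(v := z)) S) field_differentiable at (u v)))"
    using assms unfolding smooth_jfun_def by metis
qed

text \<open>Smoothness quantifies over all iterated partial derivatives. It suffices to exhibit a
  class of continuous functions closed under partial differentiation on \<Omega>: every iterated
  derivative then agrees on \<Omega> with a member of the class, whatever its explicit
  formula.\<close>

lemma smooth_jfun_coinduct:
  fixes f :: "('n::finite, 'a, 'k::{real_normed_field,euclidean_space}) jfun"
  assumes op: "open \<Omega>" and f: "P f"
    and cont: "\<And>g S. P g \<Longrightarrow> continuous_on (\<Omega> \<times> UNIV) (\<lambda>(x, u). g x u S)"
    and step: "\<And>g w. P g \<Longrightarrow> \<exists>h. P h \<and> (\<forall>x\<in>\<Omega>. \<forall>u S. jhd w g x u S (h x u S))"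
  shows "smooth_jfun \<Omega> f"
proof -
  have *: "\<exists>h. P h \<and> eqon \<Omega> (foldr jpartial ws f) h" for ws
  proof (induction ws)
    case Nil
    then show ?case using f by auto
  next
    case (Cons w ws)
    then obtain h where h: "P h" "eqon \<Omega> (foldr jpartial ws f) h" by blast
    obtain h' where h': "P h'" "\<forall>x\<in>\<Omega>. \<forall>u S. jhd w h x u S (h' x u S)" using step[OF h(1)] by blast
    have "eqon \<Omega> (jpartial w h) h'"
      using h'(2) by (auto simp: eqon_def fun_eq_iff intro: jhd_unique)
    with jpartial_cong[OF op h(2)] h'(1) show ?case by (auto intro: eqon_trans)
  qed
  show ?thesis
    unfolding smooth_jfun_def
  proof (intro allI conjI ballI)
    fix ws S
    obtain h where h: "P h" "eqon \<Omega> (foldr jpartial ws f) h" using * by blast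
    show "continuous_on (\<Omega> \<times> UNIV) (\<lambda>(x, u). foldr jpartial ws f x u S)"
      using cont[OF h(1), of S] h(2) by (elim continuous_on_eq) (auto simp: eqon_def)
    fix x u assume x: "x \<in> \<Omega>"
    have jhd: "\<exists>d. jhd w (foldr jpartial ws f) x u S d" for w
      using step[OF h(1), of w] x jhd_cong[OF op x h(2)] by metis
    show "(\<lambda>t. foldr jpartial ws f (x + t *\<^sub>R axis i 1) u S) differentiable at 0" for i
      using jhd[of "Inl i"] by (auto simp: jhd_def intro: differentiableI_vector)
    show "(\<lambda>z. foldr jpartial ws f x (u(v := z)) S) field_differentiable at (u v)" for v
      using jhd[of "Inr v"] by (auto simp: jhd_def field_differentiable_def)
  qed
qed

lemma smooth_cong:
  assumes "open \<Omega>" "eqon \<Omega> f g" "smooth_jfun \<Omega> f"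
  shows "smooth_jfun \<Omega> g"
proof (rule smooth_jfun_coinduct[where P = "\<lambda>g. \<exists>f. eqon \<Omega> f g \<and> smooth_jfun \<Omega> f", OF assms(1)])
  fix g S assume "\<exists>f. eqon \<Omega> f g \<and> smooth_jfun \<Omega> f"
  then obtain f where f: "eqon \<Omega> f g" "smooth_jfun \<Omega> f" by blast
  show "continuous_on (\<Omega> \<times> UNIV) (\<lambda>(x, u). g x u S)"
    using smooth_continuous[OF f(2), of S] f(1) by (elim continuous_on_eq) (auto simp: eqon_def)
  show "\<exists>h. (\<exists>f. eqon \<Omega> f h \<and> smooth_jfun \<Omega> f) \<and> (\<forall>x\<in>\<Omega>. \<forall>u S. jhd w g x u S (h x u S))" for w
    using smooth_jhd[OF f(2)] smooth_jpartial[OF f(2)] jhd_cong[OF assms(1) _ f(1)] eqon_refl by blast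
qed (use assms in auto)

lemma smooth_add:
  fixes f :: "('n::finite, 'a, 'k::{real_normed_field,euclidean_space}) jfun"
  assumes "open \<Omega>" "smooth_jfun \<Omega> f" "smooth_jfun \<Omega> g"
  shows "smooth_jfun \<Omega> (\<lambda>x u S. f x u S + g x u S)"
proof (rule smooth_jfun_coinduct[where P = "\<lambda>h. \<exists>f g. h = (\<lambda>x u S. f x u S + g x u S) \<and>
    smooth_jfun \<Omega> f \<and> smooth_jfun \<Omega> g", OF assms(1)])
  fix h :: "('n::finite, 'a, 'k::{real_normed_field,euclidean_space}) jfun"
  fix S w assume "\<exists>f g. h = (\<lambda>x u S. f x u S + g x u S) \<and> smooth_jfun \<Omega> f \<and> smooth_jfun \<Omega> g"
  then obtain f g where h: "h = (\<lambda>x u S. f x u S + g x u S)" and fg: "smooth_jfun \<Omega> f" "smooth_jfun \<Omega> g"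
    by blast
  show "continuous_on (\<Omega> \<times> UNIV) (\<lambda>(x, u). h x u S)"
    using continuous_on_add[OF fg[THEN smooth_continuous, of S]] by (simp add: h case_prod_unfold)
  show "\<exists>h'. (\<exists>f g. h' = (\<lambda>x u S. f x u S + g x u S) \<and> smooth_jfun \<Omega> f \<and> smooth_jfun \<Omega> g) \<and>
      (\<forall>x\<in>\<Omega>. \<forall>u S. jhd w h x u S (h' x u S))"
    unfolding h
    by (rule exI[of _ "\<lambda>x u S. jpartial w f x u S + jpartial w g x u S"])
       (use fg in \<open>auto intro!: smooth_jpartial jhd_add smooth_jhd\<close>)
qed (use assms in auto)

lemma smooth_lin:
  fixes f :: "('n::finite, 'a, 'k::{real_normed_field,euclidean_space}) jfun"
  assumes "open \<Omega>" "smooth_jfun \<Omega> f"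
  shows "smooth_jfun \<Omega> (\<lambda>x u S. c S * f x u (r S))"
proof (rule smooth_jfun_coinduct[where P = "\<lambda>h. \<exists>f. h = (\<lambda>x u S. c S * f x u (r S)) \<and>
    smooth_jfun \<Omega> f", OF assms(1)])
  fix h :: "('n::finite, 'a, 'k::{real_normed_field,euclidean_space}) jfun"
  fix S w assume "\<exists>f. h = (\<lambda>x u S. c S * f x u (r S)) \<and> smooth_jfun \<Omega> f"
  then obtain f where h: "h = (\<lambda>x u S. c S * f x u (r S))" and f: "smooth_jfun \<Omega> f"
    by blast
  show "continuous_on (\<Omega> \<times> UNIV) (\<lambda>(x, u). h x u S)"
    using continuous_on_mult_left[OF smooth_continuous[OF f, of "r S"], of "c S"] by (simp add: h case_prod_unfold)
  show "\<exists>h'. (\<exists>f. h' = (\<lambda>x u S. c S * f x u (r S)) \<and> smooth_jfun \<Omega> f) \<and>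
      (\<forall>x\<in>\<Omega>. \<forall>u S. jhd w h x u S (h' x u S))"
    unfolding h
    by (rule exI[of _ "\<lambda>x u S. c S * jpartial w f x u (r S)"])
       (use f in \<open>auto intro!: smooth_jpartial jhd_lin smooth_jhd\<close>)
qed (use assms in auto)

lemma smooth_zero: "open \<Omega> \<Longrightarrow> smooth_jfun \<Omega> (\<lambda>x u S. 0)"
  by (rule smooth_jfun_coinduct[where P = "\<lambda>h. h = (\<lambda>x u S. 0)"])
     (auto simp: case_prod_unfold intro: jhd_zero)

lemma smooth_sum:
  fixes f :: "'j \<Rightarrow> ('n::finite, 'a, 'k::{real_normed_field,euclidean_space}) jfun"
  assumes "open \<Omega>" "\<And>j. j \<in> I \<Longrightarrow> smooth_jfun \<Omega> (f j)"
  shows "smooth_jfun \<Omega> (\<lambda>x u S. \<Sum>j\<in>I. f j x u S)"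
  using assms(2)
  by (induction I rule: infinite_finite_induct) (simp_all add: smooth_zero smooth_add assms(1))

text \<open>Multiples of the coordinate alone are not visibly closed under differentiation, since
  differentiating the coordinate leaves the other factor behind. Sums of such a multiple and a
  further smooth function are.\<close>

lemma smooth_jmulq:
  fixes f :: "('n::finite, 'a, 'k::{real_normed_field,euclidean_space}) jfun"
  assumes "open \<Omega>" "smooth_jfun \<Omega> f"
  shows "smooth_jfun \<Omega> (jmulq v f)"
proof (rule smooth_jfun_coinduct[where P = "\<lambda>h. \<exists>f g. h = (\<lambda>x u S. jmulq v f x u S + g x u S) \<and>
    smooth_jfun \<Omega> f \<and> smooth_jfun \<Omega> g", OF assms(1)])
  show "\<exists>fa g. jmulq v f = (\<lambda>x u S. jmulq v fa x u S + g x u S) \<and> smooth_jfun \<Omega> fa \<and> smooth_jfun \<Omega> g"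
    by (rule exI[of _ f], rule exI[of _ "\<lambda>x u S. 0"]) (use assms in \<open>auto intro: smooth_zero\<close>)
  fix h :: "('n::finite, 'a, 'k::{real_normed_field,euclidean_space}) jfun"
  fix S w assume "\<exists>f g. h = (\<lambda>x u S. jmulq v f x u S + g x u S) \<and> smooth_jfun \<Omega> f \<and> smooth_jfun \<Omega> g"
  then obtain f g where h: "h = (\<lambda>x u S. jmulq v f x u S + g x u S)"
    and fg: "smooth_jfun \<Omega> f" "smooth_jfun \<Omega> g"
    by blast
  have c: "continuous_on (\<Omega> \<times> UNIV) (\<lambda>p. snd p v :: 'k)"
    by (rule continuous_on_product_then_coordinatewise[OF continuous_on_snd[OF continuous_on_id]])
  show "continuous_on (\<Omega> \<times> UNIV) (\<lambda>(x, u). h x u S)"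
    using continuous_on_add[OF continuous_on_mult[OF c smooth_continuous[OF fg(1), of S, unfolded case_prod_unfold]]
        smooth_continuous[OF fg(2), of S, unfolded case_prod_unfold]]
    by (simp add: h case_prod_unfold jmulq_def)
  show "\<exists>h'. (\<exists>f g. h' = (\<lambda>x u S. jmulq v f x u S + g x u S) \<and> smooth_jfun \<Omega> f \<and> smooth_jfun \<Omega> g) \<and>
      (\<forall>x\<in>\<Omega>. \<forall>u S. jhd w h x u S (h' x u S))"
  proof (intro exI conjI)
    \<comment> \<open>The new remainder collects the derivative of the old one and the factor
      \<open>f\<close> that is left when the coordinate itself is differentiated.\<close>
    let ?g = "\<lambda>x u S. (if w = Inr v then f x u S else 0) + jpartial w g x u S"
    show "(\<lambda>x u S. jmulq v (jpartial w f) x u S + ?g x u S) = (\<lambda>x u S. jmulq v (jpartial w f) x u S + ?g x u S)"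
      by simp
    show "smooth_jfun \<Omega> (jpartial w f)" by (rule smooth_jpartial[OF fg(1)])
    show "smooth_jfun \<Omega> ?g"
      using fg by (cases "w = Inr v") (auto intro!: smooth_add smooth_jpartial assms(1))
    show "\<forall>x\<in>\<Omega>. \<forall>u S. jhd w h x u S (jmulq v (jpartial w f) x u S + ?g x u S)"
      unfolding h add.assoc[symmetric] jmulq_def[of v "jpartial w f"]
      by (intro ballI allI jhd_add[OF jhd_jmulq[OF smooth_jhd[OF fg(1)]] smooth_jhd[OF fg(2)]])
  qed
qed

lemma jpartial_add:
  fixes f :: "('n::finite, 'a, 'k::{real_normed_field,euclidean_space}) jfun"
  assumes "smooth_jfun \<Omega> f" "smooth_jfun \<Omega> g" "x \<in> \<Omega>"
  shows "jpartial w (\<lambda>x u S. f x u S + g x u S) x u S = jpartial w f x u S + jpartial w g x u S"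
  by (rule jhd_unique[OF jhd_add[OF smooth_jhd[OF assms(1,3)] smooth_jhd[OF assms(2,3)]]])

lemma jpartial_lin:
  fixes f :: "('n::finite, 'a, 'k::{real_normed_field,euclidean_space}) jfun"
  assumes "smooth_jfun \<Omega> f" "x \<in> \<Omega>"
  shows "jpartial w (\<lambda>x u S. c S * f x u (r S)) x u S = c S * jpartial w f x u (r S)"
  by (rule jhd_unique[OF jhd_lin[OF smooth_jhd[OF assms]]])

lemma jpartial_zero: "jpartial w (\<lambda>x u S. 0) x u S = 0"
  by (intro jhd_unique jhd_zero)

lemma jpartial_sum:
  fixes f :: "'j \<Rightarrow> ('n::finite, 'a, 'k::{real_normed_field,euclidean_space}) jfun"
  assumes "open \<Omega>" "\<And>j. j \<in> I \<Longrightarrow> smooth_jfun \<Omega> (f j)" "x \<in> \<Omega>"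
  shows "jpartial w (\<lambda>x u S. \<Sum>j\<in>I. f j x u S) x u S = (\<Sum>j\<in>I. jpartial w (f j) x u S)"
  using assms(2)
proof (induction I rule: infinite_finite_induct)
  case (insert j I)
  have "smooth_jfun \<Omega> (\<lambda>x u S. \<Sum>j\<in>I. f j x u S)"
    by (rule smooth_sum) (use insert assms in auto)
  then have "jpartial w (\<lambda>x u S. f j x u S + (\<Sum>j\<in>I. f j x u S)) x u S =
      jpartial w (f j) x u S + jpartial w (\<lambda>x u S. \<Sum>j\<in>I. f j x u S) x u S"
    by (intro jpartial_add[where \<Omega> = \<Omega>]) (use insert assms in auto)
  with insert show ?case by simp
qed (simp_all add: jpartial_zero)

lemma jpartial_jmulq:
  fixes f :: "('n::finite, 'a, 'k::{real_normed_field,euclidean_space}) jfun"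
  assumes "smooth_jfun \<Omega> f" "x \<in> \<Omega>"
  shows "jpartial w (jmulq v f) x u S = u v * jpartial w f x u S + (if w = Inr v then f x u S else 0)"
  by (rule jhd_unique[OF jhd_jmulq[OF smooth_jhd[OF assms]]])

text \<open>The flow along one coordinate, with a real parameter in fibre directions as well. A
  derivative over the ground field restricts to a real one along this flow, so statements about
  partial derivatives become statements about functions of real variables.\<close>

definition jmove :: "'n + ('n, 'a) jvar \<Rightarrow> real \<Rightarrow> (real^'n::finite) \<times> (('n, 'a) jvar \<Rightarrow> 'k::real_normed_field)
    \<Rightarrow> (real^'n) \<times> (('n, 'a) jvar \<Rightarrow> 'k)" where
  "jmove w t p = (case w of
     Inl i \<Rightarrow> (fst p + t *\<^sub>R axis i 1, snd p)
   | Inr v \<Rightarrow> (fst p, (snd p)(v := snd p v + of_real t)))"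

lemma jmove_add: "jmove w (s + t) p = jmove w s (jmove w t p)"
  by (cases w) (auto simp: jmove_def algebra_simps scaleR_add_left)

lemma jmove_zero [simp]: "jmove w 0 p = p"
  by (cases w) (auto simp: jmove_def)

lemma jmove_commute: "jmove w s (jmove w' t p) = jmove w' t (jmove w s p)"
  by (cases w; cases w') (auto simp: jmove_def algebra_simps fun_eq_iff)

lemma continuous_jmove: "continuous_on UNIV (\<lambda>(s, t). jmove w s (jmove w' t p))"
proof -
  define a :: "'a + ('a, 'b) jvar \<Rightarrow> real^'a" where "a w = (case w of Inl i \<Rightarrow> axis i 1 | Inr v \<Rightarrow> 0)" for w
  have "jmove w t p = (fst p + t *\<^sub>R a w, \<lambda>v. snd p v + of_real t * of_bool (w = Inr v))"
    for w t and p :: "(real^'a) \<times> (('a, 'b) jvar \<Rightarrow> 'c)"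
    by (cases w) (auto simp: jmove_def a_def)
  then show ?thesis
    unfolding case_prod_unfold
    by (auto intro!: continuous_on_Pair continuous_on_coordinatewise_then_product continuous_intros)
qed

text \<open>By additivity of the flow it is enough to differentiate at parameter 0. In a fibre
  direction the derivative over the ground field is composed with the line
  \<open>u v + of_real t\<close>, whose derivative in \<open>t\<close> is 1.\<close>

lemma jmove_has_derivative:
  fixes f :: "('n::finite, 'a, 'k::{real_normed_field,euclidean_space}) jfun"
  assumes "smooth_jfun \<Omega> f" "fst (jmove w s p) \<in> \<Omega>"
  shows "((\<lambda>s. (\<lambda>(x, u). f x u S) (jmove w s p)) has_vector_derivative
     (\<lambda>(x, u). jpartial w f x u S) (jmove w s p)) (at s)"
proof -
  obtain x u where xu: "jmove w s p = (x, u)" by force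
  have jhd: "jhd w f x u S (jpartial w f x u S)"
    by (rule smooth_jhd) (use assms xu in auto)
  have "((\<lambda>t. (\<lambda>(x, u). f x u S) (jmove w t (x, u))) has_vector_derivative jpartial w f x u S) (at 0)"
  proof (cases w)
    case (Inl i)
    with jhd show ?thesis by (simp add: jhd_def jmove_def)
  next
    case (Inr v)
    have "((\<lambda>z. f x (u(v := z)) S) has_field_derivative jpartial w f x u S) (at (u v + of_real 0))"
      using jhd Inr by (simp add: jhd_def)
    moreover have "((\<lambda>t. u v + of_real t) has_vector_derivative (1::'k)) (at 0)"
      by (auto intro!: derivative_eq_intros has_vector_derivative_of_real)
    ultimately have "((\<lambda>z. f x (u(v := z)) S) \<circ> (\<lambda>t. u v + of_real t) has_vector_derivative 1 * jpartial w f x u S) (at 0)"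
      by (intro field_vector_diff_chain_at)
    with Inr show ?thesis by (simp add: jmove_def o_def)
  qed
  then have 0: "((\<lambda>t. (\<lambda>(x, u). f x u S) (jmove w t (x, u))) has_vector_derivative jpartial w f x u S) (at (s - s))"
    by simp
  have "((\<lambda>t. t - s) has_vector_derivative 1) (at s)"
    by (auto intro!: derivative_eq_intros)
  from vector_diff_chain_at[OF this 0]
  have "((\<lambda>t. (\<lambda>(x, u). f x u S) (jmove w (t - s) (x, u))) has_vector_derivative jpartial w f x u S) (at s)"
    by (simp add: o_def)
  moreover have "jmove w (t - s) (x, u) = jmove w t p" for t
    unfolding xu[symmetric] jmove_add[symmetric] by simp
  ultimately show ?thesis by (simp add: xu)
qed

text \<open>Although a local function has infinitely many arguments, two derivatives involve only
  the two-parameter family of points reached by the flows of \<open>w\<close> and \<open>w'\<close>.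
  The pull-back to this family is a function on a real square, where mixed derivatives
  agree.\<close>

lemma jpartial_commute:
  fixes f :: "('n::finite, 'a, 'k::{real_normed_field,euclidean_space}) jfun"
  assumes op: "open \<Omega>" and f: "smooth_jfun \<Omega> f" and x: "x \<in> \<Omega>"
  shows "jpartial w (jpartial w' f) x u S = jpartial w' (jpartial w f) x u S"
proof -
  define \<phi> where "\<phi> g = (\<lambda>s t. (\<lambda>(x, u). g x u S) (jmove w s (jmove w' t (x, u))))"
    for g :: "('n, 'a, 'k) jfun"
  have "open ((\<lambda>(s, t). jmove w s (jmove w' t (x, u))) -` (\<Omega> \<times> UNIV))"
    by (rule open_vimage[OF _ continuous_jmove]) (use op in \<open>simp add: open_Times\<close>)
  moreover have "(0, 0) \<in> (\<lambda>(s, t). jmove w s (jmove w' t (x, u))) -` (\<Omega> \<times> UNIV)"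
    using x by simp
  ultimately obtain e where e: "0 < e"
    "ball (0, 0) e \<subseteq> (\<lambda>(s, t). jmove w s (jmove w' t (x, u))) -` (\<Omega> \<times> UNIV)"
    using open_contains_ball by blast
  \<comment> \<open>Halving \<open>e\<close> keeps the square inside the ball, because the norm of a
    pair is at most the sum of the norms.\<close>
  have in_\<Omega>: "fst (jmove w s (jmove w' t (x, u))) \<in> \<Omega>" if "\<bar>s\<bar> < e / 2" "\<bar>t\<bar> < e / 2" for s t
  proof -
    have "norm (s, t) < e" using norm_Pair_le[of s t] that by simp
    then have "(s, t) \<in> ball (0, 0) e" by (metis mem_ball dist_0_norm zero_prod_def)
    with e(2) show ?thesis by (auto simp: mem_Times_iff simp del: mem_ball)
  qed
  have cont: "isCont (\<lambda>(s, t). \<phi> g s t) (0, 0)" if "smooth_jfun \<Omega> g" for g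
  proof -
    have "continuous_on (ball (0, 0) e) ((\<lambda>(x, u). g x u S) \<circ> (\<lambda>(s, t). jmove w s (jmove w' t (x, u))))"
    proof (rule continuous_on_compose)
      show "continuous_on (ball (0, 0) e) (\<lambda>(s, t). jmove w s (jmove w' t (x, u)))"
        by (rule continuous_on_subset[OF continuous_jmove]) simp
      show "continuous_on ((\<lambda>(s, t). jmove w s (jmove w' t (x, u))) ` ball (0, 0) e) (\<lambda>(x, u). g x u S)"
        by (rule continuous_on_subset[OF smooth_continuous[OF that]]) (use e(2) in blast)
    qed
    moreover have "(\<lambda>(x, u). g x u S) \<circ> (\<lambda>(s, t). jmove w s (jmove w' t (x, u))) = (\<lambda>(s, t). \<phi> g s t)"
      by (auto simp: \<phi>_def fun_eq_iff)
    ultimately show ?thesis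
      using e(1) by (simp add: continuous_on_eq_continuous_at)
  qed
  have d1: "((\<lambda>s. \<phi> g s t) has_vector_derivative \<phi> (jpartial w g) s t) (at s)"
    if "smooth_jfun \<Omega> g" "\<bar>s\<bar> < e / 2" "\<bar>t\<bar> < e / 2" for g s t
    unfolding \<phi>_def by (rule jmove_has_derivative[OF that(1) in_\<Omega>[OF that(2,3)]])
  have d2: "((\<lambda>t. \<phi> g s t) has_vector_derivative \<phi> (jpartial w' g) s t) (at t)"
    if "smooth_jfun \<Omega> g" "\<bar>s\<bar> < e / 2" "\<bar>t\<bar> < e / 2" for g s t
    unfolding \<phi>_def jmove_commute[of w]
    by (rule jmove_has_derivative[OF that(1) in_\<Omega>[OF that(2,3), unfolded jmove_commute[of w]]])
  note sm = smooth_jpartial[OF f] smooth_jpartial[OF smooth_jpartial[OF f]]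
  have "\<phi> (jpartial w' (jpartial w f)) 0 0 = \<phi> (jpartial w (jpartial w' f)) 0 0"
    by (rule mixed_derivatives_eq[where f = "\<phi> f" and fa = "\<phi> (jpartial w f)" and fb = "\<phi> (jpartial w' f)" and e = "e / 2"])
       (use e(1) in \<open>auto intro!: d1 d2 cont sm f\<close>)
  then show ?thesis by (simp add: \<phi>_def)
qed

section \<open>Odd operations on local functions\<close>

definition jmulth ::
  "('n, 'a) jvar \<Rightarrow> ('n::finite, 'a::finite, 'k::{real_normed_field,euclidean_space}) jfun \<Rightarrow> ('n, 'a, 'k) jfun" where
  "jmulth v f x u = gext v (f x u)"

definition jeps ::
  "('n::finite, 'a::finite, 'k::{real_normed_field,euclidean_space}) jfun \<Rightarrow> ('n, 'a, 'k) jfun" where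
  "jeps f x u = geps (f x u)"

lemma jlin_forms:
  "jmulth v f = (\<lambda>x u S. (if v \<in> S then gnu v S else 0) * f x u (S - {v}))"
  "dthL v f = (\<lambda>x u S. (if v \<in> S then 0 else gnu v S) * f x u (insert v S))"
  "jeps f = (\<lambda>x u S. (-1) ^ card S * f x u S)"
  by (auto simp: jmulth_def dthL_def jeps_def gext_def gderivL_gnu geps_def fun_eq_iff)

lemma smooth_jmulth: "open \<Omega> \<Longrightarrow> smooth_jfun \<Omega> f \<Longrightarrow> smooth_jfun \<Omega> (jmulth v f)"
  unfolding jlin_forms by (rule smooth_lin)
lemma smooth_dthL: "open \<Omega> \<Longrightarrow> smooth_jfun \<Omega> f \<Longrightarrow> smooth_jfun \<Omega> (dthL v f)"
  unfolding jlin_forms by (rule smooth_lin)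
lemma smooth_jeps: "open \<Omega> \<Longrightarrow> smooth_jfun \<Omega> f \<Longrightarrow> smooth_jfun \<Omega> (jeps f)"
  unfolding jlin_forms by (rule smooth_lin[where r = "\<lambda>S. S" and c = "\<lambda>S. (-1) ^ card S"])
lemma smooth_scale:
  fixes f :: "('n::finite, 'a, 'k::{real_normed_field,euclidean_space}) jfun"
  shows "open \<Omega> \<Longrightarrow> smooth_jfun \<Omega> f \<Longrightarrow> smooth_jfun \<Omega> (\<lambda>x u S. c * f x u S)"
  by (rule smooth_lin[where r = "\<lambda>S. S" and c = "\<lambda>_. c"])

lemma jpartial_jmulth:
  "smooth_jfun \<Omega> f \<Longrightarrow> x \<in> \<Omega> \<Longrightarrow> jpartial w (jmulth v f) x u S = jmulth v (jpartial w f) x u S"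
  unfolding jlin_forms by (rule jpartial_lin)
lemma jpartial_dthL:
  "smooth_jfun \<Omega> f \<Longrightarrow> x \<in> \<Omega> \<Longrightarrow> jpartial w (dthL v f) x u S = dthL v (jpartial w f) x u S"
  unfolding jlin_forms by (rule jpartial_lin)
lemma jpartial_jeps:
  "smooth_jfun \<Omega> f \<Longrightarrow> x \<in> \<Omega> \<Longrightarrow> jpartial w (jeps f) x u S = jeps (jpartial w f) x u S"
  unfolding jlin_forms by (rule jpartial_lin[where r = "\<lambda>S. S" and c = "\<lambda>S. (-1) ^ card S"])
lemma jpartial_scale:
  fixes f :: "('n::finite, 'a, 'k::{real_normed_field,euclidean_space}) jfun"
  shows "smooth_jfun \<Omega> f \<Longrightarrow> x \<in> \<Omega> \<Longrightarrow> jpartial w (\<lambda>x u S. c * f x u S) x u S = c * jpartial w f x u S"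
  by (rule jpartial_lin[where r = "\<lambda>S. S" and c = "\<lambda>_. c"])

lemma eqon_jmulth: "eqon \<Omega> f g \<Longrightarrow> eqon \<Omega> (jmulth v f) (jmulth v g)"
  by (auto simp: eqon_def jmulth_def intro!: ext)
lemma eqon_dthL: "eqon \<Omega> f g \<Longrightarrow> eqon \<Omega> (dthL v f) (dthL v g)"
  by (auto simp: eqon_def dthL_def intro!: ext)
lemma eqon_jeps: "eqon \<Omega> f g \<Longrightarrow> eqon \<Omega> (jeps f) (jeps g)"
  by (auto simp: eqon_def jeps_def intro!: ext)

subsection \<open>Finite order\<close>

definition jvars :: "nat \<Rightarrow> ('n::finite, 'a::finite) jvar set" where
  "jvars m = {v. morder (snd v) \<le> m}"

lemma finite_morder: "finite {\<sigma> :: 'n::finite \<Rightarrow> nat. morder \<sigma> \<le> m}"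
proof (rule finite_subset)
  show "{\<sigma> :: 'n \<Rightarrow> nat. morder \<sigma> \<le> m} \<subseteq> PiE UNIV (\<lambda>_. {..m})"
  proof
    fix \<sigma> :: "'n \<Rightarrow> nat" assume "\<sigma> \<in> {\<sigma>. morder \<sigma> \<le> m}"
    moreover have "\<sigma> i \<le> morder \<sigma>" for i
      unfolding morder_def by (rule member_le_sum) auto
    ultimately show "\<sigma> \<in> PiE UNIV (\<lambda>_. {..m})" by (auto intro: order_trans)
  qed
  show "finite (PiE UNIV (\<lambda>_::'n. {..m}))" by (rule finite_PiE) auto
qed

lemma finite_jvars: "finite (jvars m :: ('n::finite, 'a::finite) jvar set)"
proof -
  have "jvars m = (UNIV :: 'a set) \<times> {\<sigma> :: 'n \<Rightarrow> nat. morder \<sigma> \<le> m}" by (auto simp: jvars_def)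
  then show ?thesis by (simp add: finite_morder)
qed

lemma morder_fun_upd_Suc: "morder (\<sigma>(i := Suc (\<sigma> i))) = Suc (morder \<sigma>)"
proof -
  have "(\<sigma>(i := Suc (\<sigma> i))) = (\<lambda>j. \<sigma> j + (if j = i then 1 else 0))" by auto
  then show ?thesis unfolding morder_def by (simp add: sum.distrib)
qed

lemma morder_jshift [simp]: "morder (snd (jshift i v)) = Suc (morder (snd v))"
  by (simp add: jshift_def morder_fun_upd_Suc)

lemma jshift_in_jvars [simp]: "jshift i v \<in> jvars (Suc m) \<longleftrightarrow> v \<in> jvars m"
  by (simp add: jvars_def)

lemma inj_jshift: "inj (jshift i :: ('n, 'a) jvar \<Rightarrow> ('n, 'a) jvar)"
proof (rule injI)
  fix v w :: "('n, 'a) jvar" assume eq: "jshift i v = jshift i w"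
  then have "fst v = fst w" "(snd v)(i := Suc (snd v i)) = (snd w)(i := Suc (snd w i))"
    by (auto simp: jshift_def)
  then have "snd v j = snd w j" for j
    by (cases "j = i") (auto simp: fun_eq_iff split: if_splits)
  with \<open>fst v = fst w\<close> show "v = w" by (auto simp: prod_eq_iff)
qed

lemma jshift_commute: "jshift i (jshift j v) = jshift j (jshift i v)"
  by (auto simp: jshift_def fun_upd_def fun_eq_iff)

lemma jorder_zero:
  fixes f :: "('n::finite, 'a::finite, 'k::{real_normed_field,euclidean_space}) jfun"
  assumes "jorder_le m \<Omega> f" "x \<in> \<Omega>" "\<not> S \<subseteq> jvars m"
  shows "f x u S = 0"
  using assms unfolding jorder_le_def jvars_def by blast

lemma jorder_eq:
  fixes f :: "('n::finite, 'a::finite, 'k::{real_normed_field,euclidean_space}) jfun"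
  assumes "jorder_le m \<Omega> f" "x \<in> \<Omega>" "\<And>v. v \<in> jvars m \<Longrightarrow> u v = u' v"
  shows "f x u = f x u'"
proof -
  have "\<forall>v. morder (snd v) \<le> m \<longrightarrow> u v = u' v" using assms(3) unfolding jvars_def by blast
  with assms(1,2) show ?thesis unfolding jorder_le_def by blast
qed

lemma jorder_leI:
  fixes f :: "('n::finite, 'a::finite, 'k::{real_normed_field,euclidean_space}) jfun"
  assumes "\<And>x u u'. x \<in> \<Omega> \<Longrightarrow> (\<And>v. v \<in> jvars m \<Longrightarrow> u v = u' v) \<Longrightarrow> f x u = f x u'"
    and "\<And>x u S. x \<in> \<Omega> \<Longrightarrow> \<not> S \<subseteq> jvars m \<Longrightarrow> f x u S = 0"
  shows "jorder_le m \<Omega> f"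
  unfolding jorder_le_def
proof (intro ballI conjI allI impI)
  fix x and u u' :: "('n, 'a) jvar \<Rightarrow> 'k"
  assume x: "x \<in> \<Omega>" and u: "\<forall>v. morder (snd v) \<le> m \<longrightarrow> u v = u' v"
  show "f x u = f x u'" by (rule assms(1)[OF x]) (use u in \<open>unfold jvars_def, blast\<close>)
next
  fix x u and S :: "('n, 'a) jvar set" assume "x \<in> \<Omega>" "f x u S \<noteq> 0"
  with assms(2) show "S \<subseteq> {v. morder (snd v) \<le> m}" unfolding jvars_def by blast
qed

lemma jorder_mono:
  fixes f :: "('n::finite, 'a::finite, 'k::{real_normed_field,euclidean_space}) jfun"
  assumes f: "jorder_le m \<Omega> f" and "m \<le> m'" shows "jorder_le m' \<Omega> f"
proof -
  have sub: "jvars m \<subseteq> (jvars m' :: ('n, 'a) jvar set)" using assms(2) by (auto simp: jvars_def)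
  show ?thesis
  proof (rule jorder_leI)
    fix x :: "real^'n" and u u' :: "('n, 'a) jvar \<Rightarrow> 'k"
    assume x: "x \<in> \<Omega>" and u: "\<And>v. v \<in> jvars m' \<Longrightarrow> u v = u' v"
    show "f x u = f x u'" by (rule jorder_eq[OF f x u]) (use sub in blast)
  next
    fix x :: "real^'n" and u :: "('n, 'a) jvar \<Rightarrow> 'k" and S :: "('n, 'a) jvar set"
    assume x: "x \<in> \<Omega>" and S: "\<not> S \<subseteq> jvars m'"
    show "f x u S = 0" by (rule jorder_zero[OF f x]) (use S sub in blast)
  qed
qed

lemma jorder_cong:
  assumes "eqon \<Omega> f g" "jorder_le m \<Omega> f" shows "jorder_le m \<Omega> g"
  using assms(2) assms(1)[unfolded eqon_def, rule_format] unfolding jorder_le_def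
  by simp

lemma jorder_gfin:
  fixes f :: "('n::finite, 'a::finite, 'k::{real_normed_field,euclidean_space}) jfun"
  assumes "jorder_le m \<Omega> f" "x \<in> \<Omega>" shows "gfin (f x u)"
  unfolding gfin_def using jorder_zero[OF assms] finite_subset[OF _ finite_jvars] by metis

lemma jorder_lin:
  fixes f :: "('n::finite, 'a::finite, 'k::{real_normed_field,euclidean_space}) jfun"
  assumes "jorder_le m \<Omega> f" "\<And>S. \<not> S \<subseteq> jvars m' \<Longrightarrow> c S = 0 \<or> \<not> r S \<subseteq> jvars m" "m \<le> m'"
  shows "jorder_le m' \<Omega> (\<lambda>x u S. c S * f x u (r S))"
proof (rule jorder_leI)
  fix x :: "real^'n" and u u' :: "('n, 'a) jvar \<Rightarrow> 'k" assume x: "x \<in> \<Omega>" and u: "\<And>v. v \<in> jvars m' \<Longrightarrow> u v = u' v"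
  have "f x u = f x u'"
    by (rule jorder_eq[OF assms(1) x u]) (use assms(3) in \<open>simp add: jvars_def\<close>)
  then show "(\<lambda>S. c S * f x u (r S)) = (\<lambda>S. c S * f x u' (r S))" by simp
qed (use assms(2) jorder_zero[OF assms(1)] in fastforce)

lemma jorder_dthL:
  fixes f :: "('n::finite, 'a::finite, 'k::{real_normed_field,euclidean_space}) jfun"
  shows "jorder_le m \<Omega> f \<Longrightarrow> jorder_le m \<Omega> (dthL v f)"
  unfolding jlin_forms by (rule jorder_lin) auto

lemma jorder_jeps:
  fixes f :: "('n::finite, 'a::finite, 'k::{real_normed_field,euclidean_space}) jfun"
  shows "jorder_le m \<Omega> f \<Longrightarrow> jorder_le m \<Omega> (jeps f)"
  unfolding jlin_forms by (rule jorder_lin[where r = "\<lambda>S. S" and c = "\<lambda>S. (-1) ^ card S"]) auto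

lemma jorder_scale:
  fixes f :: "('n::finite, 'a::finite, 'k::{real_normed_field,euclidean_space}) jfun"
  shows "jorder_le m \<Omega> f \<Longrightarrow> jorder_le m \<Omega> (\<lambda>x u S. c * f x u S)"
  by (rule jorder_lin[where r = "\<lambda>S. S" and c = "\<lambda>_. c"]) auto

lemma jorder_jmulth:
  fixes f :: "('n::finite, 'a::finite, 'k::{real_normed_field,euclidean_space}) jfun"
  shows "jorder_le m \<Omega> f \<Longrightarrow> v \<in> jvars m' \<Longrightarrow> m \<le> m' \<Longrightarrow> jorder_le m' \<Omega> (jmulth v f)"
  unfolding jlin_forms
proof (rule jorder_lin)
  fix S :: "('n, 'a) jvar set" assume "v \<in> jvars m'" "m \<le> m'" "\<not> S \<subseteq> jvars m'"
  then show "(if v \<in> S then gnu v S else 0 :: 'k) = 0 \<or> \<not> S - {v} \<subseteq> jvars m"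
    by (auto simp: jvars_def)
qed

lemma jorder_add:
  fixes f :: "('n::finite, 'a::finite, 'k::{real_normed_field,euclidean_space}) jfun"
  assumes "jorder_le m \<Omega> f" "jorder_le m \<Omega> g"
  shows "jorder_le m \<Omega> (\<lambda>x u S. f x u S + g x u S)"
proof (rule jorder_leI)
  fix x :: "real^'n" and u u' :: "('n, 'a) jvar \<Rightarrow> 'k" assume x: "x \<in> \<Omega>" and u: "\<And>v. v \<in> jvars m \<Longrightarrow> u v = u' v"
  show "(\<lambda>S. f x u S + g x u S) = (\<lambda>S. f x u' S + g x u' S)"
    by (simp add: jorder_eq[OF assms(1) x u] jorder_eq[OF assms(2) x u])
qed (use jorder_zero[OF assms(1)] jorder_zero[OF assms(2)] in fastforce)

lemma jorder_zero_fun: "jorder_le m \<Omega> (\<lambda>x u S. 0)"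
  by (simp add: jorder_le_def)

lemma jorder_sum:
  fixes f :: "'j \<Rightarrow> ('n::finite, 'a::finite, 'k::{real_normed_field,euclidean_space}) jfun"
  assumes "\<And>j. j \<in> I \<Longrightarrow> jorder_le m \<Omega> (f j)"
  shows "jorder_le m \<Omega> (\<lambda>x u S. \<Sum>j\<in>I. f j x u S)"
  using assms
  by (induction I rule: infinite_finite_induct) (simp_all add: jorder_zero_fun jorder_add)

lemma jorder_jmulq:
  fixes f :: "('n::finite, 'a::finite, 'k::{real_normed_field,euclidean_space}) jfun"
  assumes "jorder_le m \<Omega> f" "v \<in> jvars m'" "m \<le> m'"
  shows "jorder_le m' \<Omega> (jmulq v f)"
proof (rule jorder_leI)
  fix x :: "real^'n" and u u' :: "('n, 'a) jvar \<Rightarrow> 'k" assume x: "x \<in> \<Omega>" and u: "\<And>v. v \<in> jvars m' \<Longrightarrow> u v = u' v"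
  have "f x u = f x u'"
    by (rule jorder_eq[OF assms(1) x u]) (use assms(3) in \<open>simp add: jvars_def\<close>)
  with u[OF assms(2)] show "jmulq v f x u = jmulq v f x u'" by (simp add: jmulq_def[abs_def])
next
  fix x :: "real^'n" and u :: "('n, 'a) jvar \<Rightarrow> 'k" and S :: "('n, 'a) jvar set" assume "x \<in> \<Omega>" "\<not> S \<subseteq> jvars m'"
  moreover have "jvars m \<subseteq> (jvars m' :: ('n,'a) jvar set)" using assms(3) by (auto simp: jvars_def)
  ultimately have "f x u S = 0"
    using jorder_zero[OF assms(1), of x S u] by blast
  then show "jmulq v f x u S = 0" by (simp add: jmulq_def)
qed

lemma dq_zero:
  fixes f :: "('n::finite, 'a::finite, 'k::{real_normed_field,euclidean_space}) jfun"
  assumes "jorder_le m \<Omega> f" "v \<notin> jvars m" "x \<in> \<Omega>"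
  shows "dq v f x u S = 0"
proof -
  have "f x (u(v := z)) = f x u" for z
    by (rule jorder_eq[OF assms(1,3)]) (use assms(2) in auto)
  then show ?thesis by (simp add: dq_def)
qed

lemma dthL_zero:
  fixes f :: "('n::finite, 'a::finite, 'k::{real_normed_field,euclidean_space}) jfun"
  assumes "jorder_le m \<Omega> f" "v \<notin> jvars m" "x \<in> \<Omega>"
  shows "dthL v f x u S = 0"
  using jorder_zero[OF assms(1,3)] assms(2) by (simp add: jlin_forms)

text \<open>A base derivative at \<open>x\<close> compares values at nearby points, and openness of
  \<Omega> makes the order bound available there. A derivative in a fibre coordinate beyond the
  order is zero.\<close>

lemma jorder_jpartial:
  fixes f :: "('n::finite, 'a::finite, 'k::{real_normed_field,euclidean_space}) jfun"
  assumes op: "open \<Omega>" and f: "jorder_le m \<Omega> f"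
  shows "jorder_le m \<Omega> (jpartial w f)"
proof (cases w)
  case (Inl i)
  show ?thesis
  proof (rule jorder_leI)
    fix x :: "real^'n" and u u' :: "('n, 'a) jvar \<Rightarrow> 'k" assume x: "x \<in> \<Omega>" and u: "\<And>v. v \<in> jvars m \<Longrightarrow> u v = u' v"
    have "dx i f x u S = dx i f x u' S" for S
      unfolding dx_def pd_def
    proof (rule vector_derivative_cong_eq)
      show "\<forall>\<^sub>F t in nhds 0. t \<in> UNIV \<longrightarrow> f (x + t *\<^sub>R axis i 1) u S = f (x + t *\<^sub>R axis i 1) u' S"
        by (rule eventually_mono[OF eventually_axis[OF op x, of i]]) (simp add: jorder_eq[OF f _ u])
    qed auto
    then show "jpartial w f x u = jpartial w f x u'" using Inl by (auto simp: jpartial_def)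
  next
    fix x :: "real^'n" and u :: "('n, 'a) jvar \<Rightarrow> 'k" and S :: "('n, 'a) jvar set" assume x: "x \<in> \<Omega>" and S: "\<not> S \<subseteq> jvars m"
    have "dx i f x u S = dx i (\<lambda>x u S. 0) x u S"
      unfolding dx_def pd_def
    proof (rule vector_derivative_cong_eq)
      show "\<forall>\<^sub>F t in nhds 0. t \<in> UNIV \<longrightarrow> f (x + t *\<^sub>R axis i 1) u S = 0"
        by (rule eventually_mono[OF eventually_axis[OF op x, of i]]) (simp add: jorder_zero[OF f _ S])
    qed auto
    then show "jpartial w f x u S = 0" using Inl jpartial_zero[of w] by (auto simp: jpartial_def)
  qed
next
  case (Inr v)
  show ?thesis
  proof (rule jorder_leI)
    fix x :: "real^'n" and u u' :: "('n, 'a) jvar \<Rightarrow> 'k" assume x: "x \<in> \<Omega>" and u: "\<And>v. v \<in> jvars m \<Longrightarrow> u v = u' v"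
    show "jpartial w f x u = jpartial w f x u'"
    proof (cases "v \<in> jvars m")
      case True
      have "f x (u(v := z)) = f x (u'(v := z))" for z
        by (rule jorder_eq[OF f x]) (use u in auto)
      with Inr u[OF True] show ?thesis by (simp add: jpartial_def dq_def fun_eq_iff)
    next
      case False
      with Inr show ?thesis by (simp add: jpartial_def dq_zero[OF f False x] fun_eq_iff)
    qed
  next
    fix x :: "real^'n" and u :: "('n, 'a) jvar \<Rightarrow> 'k" and S :: "('n, 'a) jvar set" assume x: "x \<in> \<Omega>" and S: "\<not> S \<subseteq> jvars m"
    then show "jpartial w f x u S = 0" using Inr jorder_zero[OF f x S] by (simp add: jpartial_def dq_def)
  qed
qed

text \<open>Facts obtained from the locale \<open>folding_insort_key\<close> take the order as a
  parameter. This equation turns them into facts about the constant that occurs in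
  \<open>coord_list\<close> and \<open>geval\<close>.\<close>

lemma sorted_key_list_nat: "linorder.sorted_key_list_of_set (\<le>) f A = sorted_key_list_of_set (f :: 'a \<Rightarrow> nat) A"
  by (simp add: linorder.sorted_key_list_of_set_def[OF linorder_class.linorder_axioms] sorted_key_list_of_set_def
      linorder.insort_key_def[OF linorder_class.linorder_axioms] insort_key_def)

interpretation to_nat_key: folding_insort_key "(\<le>)" "(<)" UNIV "to_nat :: 'a::countable \<Rightarrow> nat"
  by unfold_locales simp

lemma coord_list: "set (coord_list :: 'n::finite list) = UNIV" "distinct (coord_list :: 'n list)"
proof -
  show "set coord_list = (UNIV :: 'n set)"
    unfolding coord_list_def by (rule to_nat_key.set_sorted_key_list_of_set[unfolded sorted_key_list_nat]) auto
  show "distinct (coord_list :: 'n list)"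
    using to_nat_key.distinct_sorted_key_list_of_set[unfolded sorted_key_list_nat, of "UNIV :: 'n set"]
    unfolding coord_list_def by (simp add: distinct_map)
qed

lemma jpartial_simps [simp]: "jpartial (Inl i) f = dx i f" "jpartial (Inr v) f = dq v f"
  by (simp_all add: jpartial_def)

lemma gext_add: "gext v (\<lambda>S. f S + g S) S = gext v f S + gext v g S"
  by (simp add: gext_def algebra_simps)
lemma gext_scale: "gext v (\<lambda>S. c * f S) S = c * gext v f S"
  by (simp add: gext_def algebra_simps)
lemma gext_sum: "gext v (\<lambda>S. \<Sum>j\<in>I. f j S) S = (\<Sum>j\<in>I. gext v (f j) S)"
  by (simp add: gext_def sum_distrib_left)
lemma gext_zero [simp]: "gext v (\<lambda>S. 0) S = 0"
  by (simp add: gext_def)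
lemma gderivL_add: "gderivL v (\<lambda>S. f S + g S) S = gderivL v f S + gderivL v g S"
  by (simp add: gderivL_def algebra_simps)
lemma gderivL_scale: "gderivL v (\<lambda>S. c * f S) S = c * gderivL v f S"
  by (simp add: gderivL_def algebra_simps)
lemma gderivL_sum: "gderivL v (\<lambda>S. \<Sum>j\<in>I. f j S) S = (\<Sum>j\<in>I. gderivL v (f j) S)"
  by (simp add: gderivL_def sum_distrib_left)

section \<open>Total derivatives and their commutators\<close>

definition jfuns :: "(real^'n) set \<Rightarrow> ('n::finite, 'a::finite, 'k::{real_normed_field,euclidean_space}) jfun set" where
  "jfuns \<Omega> = {f. smooth_jfun \<Omega> f \<and> (\<exists>m. jorder_le m \<Omega> f)}"

lemma jfunsI: "smooth_jfun \<Omega> f \<Longrightarrow> jorder_le m \<Omega> f \<Longrightarrow> f \<in> jfuns \<Omega>"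
  by (auto simp: jfuns_def)

lemma jfunsE:
  assumes "f \<in> jfuns \<Omega>" obtains m where "smooth_jfun \<Omega> f" "jorder_le m \<Omega> f"
  using assms by (auto simp: jfuns_def)

text \<open>The total derivative with its two infinite sums cut off at order \<open>M\<close>, and
  with \<open>gext\<close> as odd multiplication. It agrees with \<open>total_deriv\<close> whenever
  \<open>M\<close> bounds the order of \<open>f\<close>; the bound is kept free so that functions of
  different orders can share one range of summation.\<close>

definition td_form ::
  "nat \<Rightarrow> 'n \<Rightarrow> ('n::finite, 'a::finite, 'k::{real_normed_field,euclidean_space}) jfun \<Rightarrow> ('n, 'a, 'k) jfun" where
  "td_form M i f = (\<lambda>x u S. dx i f x u S + (\<Sum>v\<in>jvars M. jmulq (jshift i v) (dq v f) x u S)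
     + (\<Sum>v\<in>jvars M. jmulth (jshift i v) (dthL v f) x u S))"

text \<open>Lowers the multi-index in direction \<open>i\<close>. If its entry is already 0,
  truncated subtraction returns the coordinate unchanged, which is not the intended meaning; hence
  the case distinctions on \<open>snd v i = 0\<close> below.\<close>

definition junshift :: "'n \<Rightarrow> ('n, 'a) jvar \<Rightarrow> ('n, 'a) jvar" where
  "junshift i v = (fst v, (snd v)(i := snd v i - 1))"

lemma junshift_jshift [simp]: "junshift i (jshift i v) = v"
  by (simp add: junshift_def jshift_def)

lemma jshift_junshift: "snd v i \<noteq> 0 \<Longrightarrow> jshift i (junshift i v) = v"
  by (simp add: junshift_def jshift_def prod_eq_iff)

lemma snd_jshift [simp]: "snd (jshift i v) i = Suc (snd v i)"
  by (simp add: jshift_def)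

text \<open>The shifts of coordinates of order at most \<open>M\<close> are exactly the coordinates
  of order at most \<open>M + 1\<close> whose \<open>i\<close>-th entry is positive. This lines up
  the terms that arise when total derivatives are applied in different orders.\<close>

lemma sum_jshift:
  fixes h :: "('n::finite, 'a::finite) jvar \<Rightarrow> ('n, 'a) jvar \<Rightarrow> 'b::comm_monoid_add"
  shows "(\<Sum>v\<in>jvars (Suc M). if snd v i = 0 then 0 else h v (junshift i v)) = (\<Sum>v\<in>jvars M. h (jshift i v) v)"
proof -
  have "(\<Sum>v\<in>jvars M. h (jshift i v) v) = (\<Sum>v\<in>jshift i ` jvars M. h v (junshift i v))"
    by (subst sum.reindex) (auto intro: inj_on_subset[OF inj_jshift])
  also have "\<dots> = (\<Sum>v\<in>jshift i ` jvars M. if snd v i = 0 then 0 else h v (junshift i v))"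
    by (rule sum.cong) auto
  also have "\<dots> = (\<Sum>v\<in>jvars (Suc M). if snd v i = 0 then 0 else h v (junshift i v))"
  proof (rule sum.mono_neutral_left)
    show "\<forall>v\<in>jvars (Suc M) - jshift i ` jvars M. (if snd v i = 0 then 0 else h v (junshift i v)) = 0"
    proof
      fix v :: "('n, 'a) jvar" assume v: "v \<in> jvars (Suc M) - jshift i ` jvars M"
      have "snd v i = 0"
      proof (rule ccontr)
        assume "snd v i \<noteq> 0"
        then have "v = jshift i (junshift i v)" by (rule jshift_junshift[symmetric])
        with v show False by (metis DiffE imageI jshift_in_jvars)
      qed
      then show "(if snd v i = 0 then 0 else h v (junshift i v)) = 0" by simp
    qed
  qed (auto simp: finite_jvars)
  finally show ?thesis by simp
qed

text \<open>Differentiating the coefficient \<open>u (jshift i v)\<close> by the coordinate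
  \<open>w\<close> gives a Kronecker delta, so at most one summand survives. The support condition
  on \<open>h\<close> covers the case that this summand would lie outside the range.\<close>

lemma sum_jshift_delta:
  fixes h :: "('n::finite, 'a::finite) jvar \<Rightarrow> 'b::comm_monoid_add"
  assumes "\<And>v. v \<notin> jvars M \<Longrightarrow> h v = 0"
  shows "(\<Sum>v\<in>jvars M. if w = jshift i v then h v else 0) = (if snd w i = 0 then 0 else h (junshift i w))"
proof (cases "snd w i = 0")
  case True
  then have "w \<noteq> jshift i v" for v by (metis snd_jshift nat.distinct(1))
  with True show ?thesis by simp
next
  case False
  then have w: "w = jshift i (junshift i w)" by (rule jshift_junshift[symmetric])
  have "(w = jshift i v) = (junshift i w = v)" for v
    using w by (metis junshift_jshift)
  then show ?thesis using False assms by (auto simp: sum.delta finite_jvars)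
qed

lemma jmulq_apply: "jmulq v f x u S = u v * f x u S"
  by (simp add: jmulq_def)

context
  fixes \<Omega> :: "(real^'n::finite) set"
  assumes op: "open \<Omega>"
begin

lemma td_eq:
  fixes f :: "('n, 'a::finite, 'k::{real_normed_field,euclidean_space}) jfun"
  assumes f: "jorder_le M \<Omega> f"
  shows "eqon \<Omega> (total_deriv i f) (td_form M i f)"
  unfolding eqon_def
proof (intro ballI ext)
  fix x u S assume x: "x \<in> \<Omega>"
  have "Sum_any (\<lambda>v. u (jshift i v) * dq v f x u S) = (\<Sum>v\<in>jvars M. jmulq (jshift i v) (dq v f) x u S)"
    unfolding jmulq_def
    by (rule Sum_any.expand_superset) (use dq_zero[OF f _ x] in \<open>auto simp: finite_jvars\<close>)
  moreover have "gmul (gvar (jshift i v)) (dthL v f x u) S = jmulth (jshift i v) (dthL v f) x u S" for v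
    using gmul_gvar[OF jorder_gfin[OF jorder_dthL[OF f] x]] by (simp add: jmulth_def)
  moreover have "dthL v f x u = (\<lambda>S. 0)" if "v \<notin> jvars M" for v
    using dthL_zero[OF f that x] by (intro ext)
  then have "Sum_any (\<lambda>v. jmulth (jshift i v) (dthL v f) x u S) = (\<Sum>v\<in>jvars M. jmulth (jshift i v) (dthL v f) x u S)"
    by (intro Sum_any.expand_superset) (force simp: finite_jvars jmulth_def)+
  ultimately show "total_deriv i f x u S = td_form M i f x u S"
    by (simp add: total_deriv_def td_form_def)
qed

lemma smooth_td_form:
  assumes "smooth_jfun \<Omega> f" shows "smooth_jfun \<Omega> (td_form M i f)"
  unfolding td_form_def
  using smooth_jpartial[OF assms, of "Inl i"] smooth_jpartial[OF assms, of "Inr v" for v]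
  by (intro smooth_add smooth_sum smooth_jmulq smooth_jmulth smooth_dthL op assms) simp_all

lemma jorder_td_form:
  fixes f :: "('n, 'a::finite, 'k::{real_normed_field,euclidean_space}) jfun"
  assumes f: "jorder_le M \<Omega> f" shows "jorder_le (Suc M) \<Omega> (td_form M i f)"
proof -
  have "jorder_le (Suc M) \<Omega> (dx i f)" "jorder_le M \<Omega> (dq v f)" for v
    using jorder_jpartial[OF op f, of "Inl i"] jorder_jpartial[OF op f, of "Inr v"] by (auto intro: jorder_mono)
  then show ?thesis
    unfolding td_form_def
    by (intro jorder_add jorder_sum jorder_jmulq[where m = M] jorder_jmulth[where m = M] jorder_dthL f) auto
qed

lemma smooth_td: "smooth_jfun \<Omega> f \<Longrightarrow> jorder_le M \<Omega> f \<Longrightarrow> smooth_jfun \<Omega> (total_deriv i f)"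
  by (rule smooth_cong[OF op eqon_sym[OF td_eq] smooth_td_form])

lemma jorder_td: "jorder_le M \<Omega> f \<Longrightarrow> jorder_le (Suc M) \<Omega> (total_deriv i f)"
  by (rule jorder_cong[OF eqon_sym[OF td_eq] jorder_td_form])

lemma td_jfuns: "f \<in> jfuns \<Omega> \<Longrightarrow> total_deriv i f \<in> jfuns \<Omega>"
  by (elim jfunsE) (rule jfunsI[OF smooth_td jorder_td])

lemma td_cong:
  assumes "eqon \<Omega> f g" shows "eqon \<Omega> (total_deriv i f) (total_deriv i g)"
  unfolding eqon_def
proof (intro ballI ext)
  fix x u S assume x: "x \<in> \<Omega>"
  have "dx i f x u S = dx i g x u S" "dq v f x u S = dq v g x u S" "dthL v f x u = dthL v g x u" for v
    using jpartial_cong[OF op assms, of "Inl i"] jpartial_cong[OF op assms, of "Inr v"] eqon_dthL[OF assms, of v] x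
    by (simp_all add: eqon_def)
  then show "total_deriv i f x u S = total_deriv i g x u S" by (simp add: total_deriv_def)
qed

lemma jfuns_add:
  assumes "f \<in> jfuns \<Omega>" "g \<in> jfuns \<Omega>" shows "(\<lambda>x u S. f x u S + g x u S) \<in> jfuns \<Omega>"
proof -
  obtain m m' where *: "smooth_jfun \<Omega> f" "jorder_le m \<Omega> f" "smooth_jfun \<Omega> g" "jorder_le m' \<Omega> g"
    using assms(1,2) by (elim jfunsE) blast
  show ?thesis
    by (rule jfunsI[where m = "max m m'"]) (auto intro!: smooth_add jorder_add op * intro: jorder_mono *)
qed

lemma jfuns_scale: "f \<in> jfuns \<Omega> \<Longrightarrow> (\<lambda>x u S. c * f x u S) \<in> jfuns \<Omega>"
  by (elim jfunsE) (rule jfunsI[OF smooth_scale[OF op] jorder_scale])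

lemma jfuns_zero: "(\<lambda>x u S. 0) \<in> jfuns \<Omega>"
  by (rule jfunsI[OF smooth_zero[OF op] jorder_zero_fun])

lemma jfuns_sum: "(\<And>j. j \<in> I \<Longrightarrow> f j \<in> jfuns \<Omega>) \<Longrightarrow> (\<lambda>x u S. \<Sum>j\<in>I. f j x u S) \<in> jfuns \<Omega>"
  by (induction I rule: infinite_finite_induct) (simp_all add: jfuns_zero jfuns_add)

lemma jfuns_cong: "eqon \<Omega> f g \<Longrightarrow> f \<in> jfuns \<Omega> \<Longrightarrow> g \<in> jfuns \<Omega>"
  by (elim jfunsE) (rule jfunsI[OF smooth_cong[OF op] jorder_cong])

lemma jfuns_jpartial: "f \<in> jfuns \<Omega> \<Longrightarrow> jpartial w f \<in> jfuns \<Omega>"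
  by (elim jfunsE) (rule jfunsI[OF smooth_jpartial jorder_jpartial[OF op]])

lemma jfuns_dx: "f \<in> jfuns \<Omega> \<Longrightarrow> dx i f \<in> jfuns \<Omega>"
  using jfuns_jpartial[of f "Inl i"] by simp
lemma jfuns_dq: "f \<in> jfuns \<Omega> \<Longrightarrow> dq v f \<in> jfuns \<Omega>"
  using jfuns_jpartial[of f "Inr v"] by simp
lemma jfuns_dthL: "f \<in> jfuns \<Omega> \<Longrightarrow> dthL v f \<in> jfuns \<Omega>"
  by (elim jfunsE) (rule jfunsI[OF smooth_dthL[OF op] jorder_dthL])
lemma jfuns_jeps: "f \<in> jfuns \<Omega> \<Longrightarrow> jeps f \<in> jfuns \<Omega>"
  by (elim jfunsE) (rule jfunsI[OF smooth_jeps[OF op] jorder_jeps])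
lemma jfuns_jmulq: "f \<in> jfuns \<Omega> \<Longrightarrow> jmulq v f \<in> jfuns \<Omega>"
proof (elim jfunsE)
  fix m assume "smooth_jfun \<Omega> f" "jorder_le m \<Omega> f"
  then show "jmulq v f \<in> jfuns \<Omega>"
    by (intro jfunsI[where m = "max m (morder (snd v))"] smooth_jmulq jorder_jmulq[where m = m] op)
       (auto simp: jvars_def)
qed
lemma jfuns_jmulth: "f \<in> jfuns \<Omega> \<Longrightarrow> jmulth v f \<in> jfuns \<Omega>"
proof (elim jfunsE)
  fix m assume "smooth_jfun \<Omega> f" "jorder_le m \<Omega> f"
  then show "jmulth v f \<in> jfuns \<Omega>"
    by (intro jfunsI[where m = "max m (morder (snd v))"] smooth_jmulth jorder_jmulth[where m = m] op)
       (auto simp: jvars_def)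
qed

lemma jpartial_jfuns_add:
  "f \<in> jfuns \<Omega> \<Longrightarrow> g \<in> jfuns \<Omega> \<Longrightarrow> x \<in> \<Omega> \<Longrightarrow>
    jpartial w (\<lambda>x u S. f x u S + g x u S) x u S = jpartial w f x u S + jpartial w g x u S"
  by (elim jfunsE) (rule jpartial_add)

lemma jpartial_jfuns_scale:
  "f \<in> jfuns \<Omega> \<Longrightarrow> x \<in> \<Omega> \<Longrightarrow> jpartial w (\<lambda>x u S. c * f x u S) x u S = c * jpartial w f x u S"
  by (elim jfunsE) (rule jpartial_scale)

lemma td_add:
  assumes "f \<in> jfuns \<Omega>" "g \<in> jfuns \<Omega>" "x \<in> \<Omega>"
  shows "total_deriv i (\<lambda>x u S. f x u S + g x u S) x u S = total_deriv i f x u S + total_deriv i g x u S"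
proof -
  obtain m m' where *: "smooth_jfun \<Omega> f" "jorder_le m \<Omega> f" "smooth_jfun \<Omega> g" "jorder_le m' \<Omega> g"
    using assms(1,2) by (elim jfunsE) blast
  define M where "M = max m m'"
  have M: "jorder_le M \<Omega> f" "jorder_le M \<Omega> g" using * by (auto simp: M_def intro: jorder_mono)
  have dx: "dx i (\<lambda>x u S. f x u S + g x u S) x u S = dx i f x u S + dx i g x u S"
    using jpartial_add[OF *(1,3) assms(3), of "Inl i"] by simp
  have dq: "dq v (\<lambda>x u S. f x u S + g x u S) x u S = dq v f x u S + dq v g x u S" for v
    using jpartial_add[OF *(1,3) assms(3), of "Inr v"] by simp
  have "td_form M i (\<lambda>x u S. f x u S + g x u S) x u S = td_form M i f x u S + td_form M i g x u S"
    unfolding td_form_def jmulq_apply dx dq jmulth_def dthL_def gderivL_add[abs_def] gext_add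
    by (simp add: sum.distrib algebra_simps)
  then show ?thesis
    using td_eq[OF M(1), of i] td_eq[OF M(2), of i] td_eq[OF jorder_add[OF M], of i] assms(3)
    by (simp add: eqon_def)
qed

lemma td_scale:
  assumes "f \<in> jfuns \<Omega>" "x \<in> \<Omega>"
  shows "total_deriv i (\<lambda>x u S. c * f x u S) x u S = c * total_deriv i f x u S"
proof -
  obtain M where M: "smooth_jfun \<Omega> f" "jorder_le M \<Omega> f"
    using assms by (auto elim: jfunsE)
  have dx: "dx i (\<lambda>x u S. c * f x u S) x u S = c * dx i f x u S"
    using jpartial_scale[OF M(1) assms(2), of "Inl i"] by simp
  have dq: "dq v (\<lambda>x u S. c * f x u S) x u S = c * dq v f x u S" for v
    using jpartial_scale[OF M(1) assms(2), of "Inr v"] by simp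
  have "td_form M i (\<lambda>x u S. c * f x u S) x u S = c * td_form M i f x u S"
    unfolding td_form_def jmulq_apply dx dq jmulth_def dthL_def gderivL_scale[abs_def] gext_scale
    by (simp add: sum_distrib_left algebra_simps)
  then show ?thesis
    using td_eq[OF M(2), of i] td_eq[OF jorder_scale[OF M(2)], of i] assms(2)
    by (simp add: eqon_def)
qed

lemma td_zero: "x \<in> \<Omega> \<Longrightarrow> total_deriv i (\<lambda>x u S. 0) x u S = 0"
  using td_scale[OF jfuns_zero, of x i 0] by simp

lemma td_sum:
  assumes "\<And>j. j \<in> I \<Longrightarrow> f j \<in> jfuns \<Omega>" "x \<in> \<Omega>"
  shows "total_deriv i (\<lambda>x u S. \<Sum>j\<in>I. f j x u S) x u S = (\<Sum>j\<in>I. total_deriv i (f j) x u S)"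
  using assms
  by (induction I rule: infinite_finite_induct) (simp_all add: td_zero td_add jfuns_sum)

text \<open>Partial derivatives commute with one another and with the odd operations, so a
  commutator can only come from the coefficients \<open>u (jshift i v)\<close>. A base coordinate
  does not see them; a fibre coordinate picks out one.\<close>

lemma td_jpartial:
  assumes f: "f \<in> jfuns \<Omega>" and x: "x \<in> \<Omega>"
  shows "jpartial w (total_deriv i f) x u S = total_deriv i (jpartial w f) x u S
    + (case w of Inl _ \<Rightarrow> 0 | Inr v \<Rightarrow> if snd v i = 0 then 0 else dq (junshift i v) f x u S)"
proof -
  obtain M where sm: "smooth_jfun \<Omega> f" and M: "jorder_le M \<Omega> f"
    using f by (rule jfunsE)
  have smx: "smooth_jfun \<Omega> (dx i f)" and smq: "smooth_jfun \<Omega> (dq v f)" for v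
    using smooth_jpartial[OF sm, of "Inl i"] smooth_jpartial[OF sm, of "Inr v"] by simp_all
  note sms = smooth_jmulq[OF op smq] smooth_jmulth[OF op smooth_dthL[OF op sm]]
  have th: "jpartial w (jmulth a (dthL v f)) x u S = jmulth a (dthL v (jpartial w f)) x u S" for a v
  proof -
    have "jpartial w (dthL v f) x u = dthL v (jpartial w f) x u"
      by (intro ext) (rule jpartial_dthL[OF sm x])
    then show ?thesis
      by (simp add: jpartial_jmulth[OF smooth_dthL[OF op sm] x] jmulth_def)
  qed
  have "jpartial w (total_deriv i f) x u S = jpartial w (td_form M i f) x u S"
    using jpartial_cong[OF op td_eq[OF M]] x by (simp add: eqon_def)
  also have "\<dots> = jpartial w (dx i f) x u S + (\<Sum>v\<in>jvars M. jpartial w (jmulq (jshift i v) (dq v f)) x u S)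
     + (\<Sum>v\<in>jvars M. jpartial w (jmulth (jshift i v) (dthL v f)) x u S)"
    unfolding td_form_def
    by (simp add: jpartial_add[OF smooth_add[OF op smx smooth_sum[OF op sms(1)]] smooth_sum[OF op sms(2)] x]
        jpartial_add[OF smx smooth_sum[OF op sms(1)] x] jpartial_sum[OF op sms(1) x] jpartial_sum[OF op sms(2) x])
  also have "jpartial w (dx i f) x u S = dx i (jpartial w f) x u S"
    using jpartial_commute[OF op sm x, of w "Inl i"] by simp
  also have "(\<lambda>v. jpartial w (jmulq (jshift i v) (dq v f)) x u S) =
      (\<lambda>v. jmulq (jshift i v) (dq v (jpartial w f)) x u S + (if w = Inr (jshift i v) then dq v f x u S else 0))"
    using jpartial_commute[OF op sm x, of w "Inr v" for v]
    by (simp add: jpartial_jmulq[OF smq x] jmulq_apply)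
  also have "(\<Sum>v\<in>jvars M. jmulq (jshift i v) (dq v (jpartial w f)) x u S + (if w = Inr (jshift i v) then dq v f x u S else 0)) =
      (\<Sum>v\<in>jvars M. jmulq (jshift i v) (dq v (jpartial w f)) x u S) +
      (case w of Inl _ \<Rightarrow> 0 | Inr v \<Rightarrow> if snd v i = 0 then 0 else dq (junshift i v) f x u S)"
    using dq_zero[OF M _ x]
    by (cases w) (auto simp: sum.distrib sum_jshift_delta[where h = "\<lambda>v. dq v f x u S"])
  finally show ?thesis
    using td_eq[OF jorder_jpartial[OF op M], of i] x
    by (simp add: eqon_def td_form_def th algebra_simps)
qed

text \<open>Moving the odd derivative past the odd coefficient and past the inner odd derivative
  costs one sign each, and the two cancel. What remains is the Kronecker term of the anticommutation
  relation.\<close>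

lemma td_dthL:
  assumes f: "f \<in> jfuns \<Omega>" and x: "x \<in> \<Omega>"
  shows "dthL w (total_deriv i f) x u S = total_deriv i (dthL w f) x u S
    + (if snd w i = 0 then 0 else dthL (junshift i w) f x u S)"
proof -
  obtain M where sm: "smooth_jfun \<Omega> f" and M: "jorder_le M \<Omega> f"
    using f by (rule jfunsE)
  have dx: "dthL w (dx i f) x u S = dx i (dthL w f) x u S"
    using jpartial_dthL[OF sm x, of "Inl i"] by simp
  have q: "dthL w (jmulq a (dq v f)) x u S = jmulq a (dq v (dthL w f)) x u S" for a v
    using jpartial_dthL[OF sm x, of "Inr v"] by (simp add: dthL_def jmulq_def[abs_def] gderivL_scale)
  have anti: "gderivL w (gderivL v (f x u)) = (\<lambda>S. - 1 * gderivL v (gderivL w (f x u)) S)" for v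
    using gderivL_anticomm[of w v "f x u"] by (auto simp: fun_eq_iff)
  have th: "dthL w (jmulth (jshift i v) (dthL v f)) x u S =
      (if w = jshift i v then dthL v f x u S else 0) + jmulth (jshift i v) (dthL v (dthL w f)) x u S" for v
    unfolding dthL_def jmulth_def gderivL_gext anti gext_scale by simp
  have "dthL w (total_deriv i f) x u S = dthL w (td_form M i f) x u S"
    using eqon_dthL[OF td_eq[OF M]] x by (simp add: eqon_def)
  also have "\<dots> = dthL w (dx i f) x u S + (\<Sum>v\<in>jvars M. dthL w (jmulq (jshift i v) (dq v f)) x u S)
     + (\<Sum>v\<in>jvars M. dthL w (jmulth (jshift i v) (dthL v f)) x u S)"
    unfolding td_form_def dthL_def[of w] gderivL_add gderivL_sum ..
  also have "\<dots> = td_form M i (dthL w f) x u S + (if snd w i = 0 then 0 else dthL (junshift i w) f x u S)"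
    unfolding dx q th td_form_def
    using sum_jshift_delta[where h = "\<lambda>v. dthL v f x u S" and w = w and i = i and M = M] dthL_zero[OF M _ x]
    by (simp add: sum.distrib)
  finally show ?thesis
    using td_eq[OF jorder_dthL[OF M], of i] x
    by (simp add: eqon_def)
qed

text \<open>The product rule for a factor that is an even coordinate. Together with its odd
  counterpart it is all that is required to apply a second total derivative to the terms of a first
  one.\<close>

lemma td_jmulq:
  assumes f: "f \<in> jfuns \<Omega>" and x: "x \<in> \<Omega>"
  shows "total_deriv i (jmulq a f) x u S = u (jshift i a) * f x u S + u a * total_deriv i f x u S"
proof -
  obtain m where sm: "smooth_jfun \<Omega> f" and m: "jorder_le m \<Omega> f"
    using f by (rule jfunsE)
  \<comment> \<open>The bound has to reach the order of \<open>a\<close> as well, since the new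
    summand arises from the term at \<open>v = a\<close>.\<close>
  define M where "M = max m (morder (snd a))"
  have M: "jorder_le M \<Omega> f" using m by (auto simp: M_def intro: jorder_mono)
  have a: "a \<in> jvars M" by (simp add: jvars_def M_def)
  have dx: "dx i (jmulq a f) x u S = u a * dx i f x u S"
    using jpartial_jmulq[OF sm x, of "Inl i"] by simp
  have dq: "dq v (jmulq a f) x u S = u a * dq v f x u S + (if v = a then f x u S else 0)" for v
    using jpartial_jmulq[OF sm x, of "Inr v"] by simp
  have th: "jmulth b (dthL v (jmulq a f)) x u S = u a * jmulth b (dthL v f) x u S" for b v
    by (simp add: jmulth_def dthL_def jmulq_def[abs_def] gderivL_scale[abs_def] gext_scale)
  have "td_form M i (jmulq a f) x u S = u (jshift i a) * f x u S + u a * td_form M i f x u S"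
    unfolding td_form_def dx th jmulq_apply dq
    using a by (simp add: algebra_simps sum.distrib sum_distrib_left if_distrib[of "\<lambda>z. z * _"] if_distrib[of "\<lambda>z. _ * z"]
        sum.delta finite_jvars cong: if_cong)
  then show ?thesis
    using td_eq[OF jorder_jmulq[OF M a], of i] td_eq[OF M, of i] x by (simp add: eqon_def)
qed

text \<open>The odd factor is passed twice, once by an odd derivative and once by an odd
  coefficient, so no sign survives. The derivative that hits the factor itself produces the shifted
  coordinate.\<close>

lemma td_jmulth:
  assumes f: "f \<in> jfuns \<Omega>" and x: "x \<in> \<Omega>"
  shows "total_deriv i (jmulth a f) x u S = jmulth (jshift i a) f x u S + jmulth a (total_deriv i f) x u S"
proof -
  obtain m where sm: "smooth_jfun \<Omega> f" and m: "jorder_le m \<Omega> f"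
    using f by (rule jfunsE)
  define M where "M = max m (morder (snd a))"
  have M: "jorder_le M \<Omega> f" using m by (auto simp: M_def intro: jorder_mono)
  have a: "a \<in> jvars M" by (simp add: jvars_def M_def)
  have dx: "dx i (jmulth a f) x u S = jmulth a (dx i f) x u S"
    using jpartial_jmulth[OF sm x, of "Inl i"] by simp
  have dq: "jmulq b (dq v (jmulth a f)) x u S = jmulth a (jmulq b (dq v f)) x u S" for b v
    using jpartial_jmulth[OF sm x, of "Inr v"] by (simp add: jmulq_def[abs_def] jmulth_def gext_scale)
  have "gderivL v (gext a (f x u)) = (\<lambda>S. (if v = a then f x u S else 0) + - 1 * gext a (gderivL v (f x u)) S)" for v
    by (intro ext) (simp add: gderivL_gext)
  then have "gext b (gderivL v (gext a (f x u))) S =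
      (if v = a then gext b (f x u) S else 0) + - 1 * gext b (gext a (gderivL v (f x u))) S" for b v
    by (cases "v = a") (simp_all only: gext_add gext_scale gext_zero if_True if_False simp_thms)
  then have th: "jmulth b (dthL v (jmulth a f)) x u S =
      (if v = a then jmulth b f x u S else 0) + jmulth a (jmulth b (dthL v f)) x u S" for b v
    using gext_anticomm[of b a "gderivL v (f x u)" S]
    unfolding jmulth_def dthL_def by simp
  have "td_form M i (jmulth a f) x u S = jmulth (jshift i a) f x u S + jmulth a (td_form M i f) x u S"
  proof -
    have "jmulth a (td_form M i f) x u S = jmulth a (dx i f) x u S
      + (\<Sum>v\<in>jvars M. jmulth a (jmulq (jshift i v) (dq v f)) x u S)
      + (\<Sum>v\<in>jvars M. jmulth a (jmulth (jshift i v) (dthL v f)) x u S)"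
      unfolding td_form_def jmulth_def[of a] gext_add gext_sum ..
    then show ?thesis
      unfolding td_form_def dx th dq using a by (simp add: sum.distrib sum.delta finite_jvars)
  qed
  moreover have "jmulth a (total_deriv i f) x u S = jmulth a (td_form M i f) x u S"
    using eqon_jmulth[OF td_eq[OF M]] x by (simp add: eqon_def)
  ultimately show ?thesis
    using td_eq[OF jorder_jmulth[OF M a], of i] x by (simp add: eqon_def)
qed

text \<open>Applying \<open>D_i\<close> to the terms of \<open>D_j f\<close> yields doubly shifted
  coordinates from the coefficients. With the summation index replaced by its
  \<open>i\<close>-shift, these become the commutator terms that appear when \<open>D_j\<close> is
  expanded on \<open>D_i f\<close>.\<close>

lemma td_commute:
  assumes f: "f \<in> jfuns \<Omega>" and x: "x \<in> \<Omega>"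
  shows "total_deriv i (total_deriv j f) x u S = total_deriv j (total_deriv i f) x u S"
proof -
  obtain M where sm: "smooth_jfun \<Omega> f" and M: "jorder_le M \<Omega> f"
    using f by (rule jfunsE)
  note J = jfuns_dx[OF f] jfuns_jmulq[OF jfuns_dq[OF f]] jfuns_jmulth[OF jfuns_dthL[OF f]]
  \<comment> \<open>Since \<open>D_i f\<close> has order \<open>M + 1\<close>, both sides are
    expanded over the coordinates up to that order.\<close>
  have M': "jorder_le (Suc M) \<Omega> f" using M by (rule jorder_mono) simp
  let ?V = "jvars (Suc M)"
  have z: "dq v f x u = (\<lambda>S. 0)" "dthL v f x u = (\<lambda>S. 0)" if "v \<notin> jvars M" for v
    using dq_zero[OF M that x] dthL_zero[OF M that x] by (auto simp: fun_eq_iff)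
  have V: "finite ?V" "jvars M \<subseteq> ?V" by (auto simp: finite_jvars) (simp add: jvars_def)
  have "total_deriv i (total_deriv j f) x u S = total_deriv i (td_form (Suc M) j f) x u S"
    using td_cong[OF td_eq[OF M']] x by (simp add: eqon_def)
  also have "\<dots> = total_deriv i (dx j f) x u S
     + (\<Sum>v\<in>?V. total_deriv i (jmulq (jshift j v) (dq v f)) x u S)
     + (\<Sum>v\<in>?V. total_deriv i (jmulth (jshift j v) (dthL v f)) x u S)"
    unfolding td_form_def
    by (simp add: td_add[OF jfuns_add[OF J(1) jfuns_sum[OF J(2)]] jfuns_sum[OF J(3)] x]
        td_add[OF J(1) jfuns_sum[OF J(2)] x] td_sum[OF J(2) x] td_sum[OF J(3) x])
  also have "\<dots> = total_deriv i (dx j f) x u S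
     + (\<Sum>v\<in>?V. u (jshift j v) * total_deriv i (dq v f) x u S)
     + (\<Sum>v\<in>?V. jmulth (jshift j v) (total_deriv i (dthL v f)) x u S)
     + (\<Sum>v\<in>?V. u (jshift i (jshift j v)) * dq v f x u S)
     + (\<Sum>v\<in>?V. jmulth (jshift i (jshift j v)) (dthL v f) x u S)"
    by (simp add: td_jmulq[OF jfuns_dq[OF f] x] td_jmulth[OF jfuns_dthL[OF f] x] sum.distrib)
  also have "(\<Sum>v\<in>?V. u (jshift i (jshift j v)) * dq v f x u S) =
      (\<Sum>v\<in>jvars M. u (jshift i (jshift j v)) * dq v f x u S)"
    by (rule sum.mono_neutral_right) (use V z in auto)
  also have "\<dots> = (\<Sum>v\<in>?V. if snd v i = 0 then 0 else u (jshift j v) * dq (junshift i v) f x u S)"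
    by (subst sum_jshift[where h = "\<lambda>v v'. u (jshift j v) * dq v' f x u S"]) (simp add: jshift_commute)
  also have "(\<Sum>v\<in>?V. jmulth (jshift i (jshift j v)) (dthL v f) x u S) =
      (\<Sum>v\<in>jvars M. jmulth (jshift i (jshift j v)) (dthL v f) x u S)"
    by (rule sum.mono_neutral_right) (use V z in \<open>auto simp: jmulth_def\<close>)
  also have "\<dots> = (\<Sum>v\<in>?V. if snd v i = 0 then 0 else jmulth (jshift j v) (dthL (junshift i v) f) x u S)"
    by (subst sum_jshift[where h = "\<lambda>v v'. jmulth (jshift j v) (dthL v' f) x u S"]) (simp add: jshift_commute)
  finally have L: "total_deriv i (total_deriv j f) x u S = total_deriv i (dx j f) x u S
     + (\<Sum>v\<in>?V. u (jshift j v) * (total_deriv i (dq v f) x u S + (if snd v i = 0 then 0 else dq (junshift i v) f x u S)))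
     + (\<Sum>v\<in>?V. jmulth (jshift j v) (total_deriv i (dthL v f)) x u S +
         (if snd v i = 0 then 0 else jmulth (jshift j v) (dthL (junshift i v) f) x u S))"
    by (simp add: sum.distrib algebra_simps if_distrib[of "\<lambda>z. _ * z"] cong: if_cong)
  have dx: "dx j (total_deriv i f) x u S = total_deriv i (dx j f) x u S"
    using td_jpartial[OF f x, of "Inl j"] by simp
  have dq: "dq v (total_deriv i f) x u S = total_deriv i (dq v f) x u S
      + (if snd v i = 0 then 0 else dq (junshift i v) f x u S)" for v
    using td_jpartial[OF f x, of "Inr v"] by simp
  have th: "jmulth a (dthL v (total_deriv i f)) x u S = jmulth a (total_deriv i (dthL v f)) x u S +
         (if snd v i = 0 then 0 else jmulth a (dthL (junshift i v) f) x u S)" for a v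
  proof -
    have "dthL v (total_deriv i f) x u = (\<lambda>S. total_deriv i (dthL v f) x u S +
        (if snd v i = 0 then 0 else dthL (junshift i v) f x u S))"
      by (intro ext) (rule td_dthL[OF f x])
    then show ?thesis by (simp add: jmulth_def gext_add)
  qed
  have "total_deriv j (total_deriv i f) x u S = td_form (Suc M) j (total_deriv i f) x u S"
    using td_eq[OF jorder_td[OF M]] x by (simp add: eqon_def)
  also have "\<dots> = total_deriv i (total_deriv j f) x u S"
    unfolding L td_form_def jmulq_apply dx dq th ..
  finally show ?thesis by simp
qed

text \<open>In each odd term one multiplication raises the degree and one derivative lowers it, so a
  total derivative preserves parity.\<close>

lemma td_jeps:
  assumes f: "f \<in> jfuns \<Omega>" and x: "x \<in> \<Omega>"
  shows "total_deriv i (jeps f) x u S = jeps (total_deriv i f) x u S"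
proof -
  obtain M where sm: "smooth_jfun \<Omega> f" and M: "jorder_le M \<Omega> f"
    using f by (rule jfunsE)
  have dx: "dx i (jeps f) x u S = jeps (dx i f) x u S"
    using jpartial_jeps[OF sm x, of "Inl i"] by simp
  have dq: "jmulq b (dq v (jeps f)) x u S = jeps (jmulq b (dq v f)) x u S" for b v
    using jpartial_jeps[OF sm x, of "Inr v"] by (simp add: jmulq_def jeps_def geps_def mult_ac)
  have gf: "gfin (f x u)" "gfin (gderivL v (f x u))" for v
    using jorder_gfin[OF M x] jorder_gfin[OF jorder_dthL[OF M] x] by (auto simp: dthL_def)
  have "gext b (gderivL v (geps (f x u))) S = geps (gext b (gderivL v (f x u))) S" for b v
  proof -
    have "gderivL v (geps (f x u)) = (\<lambda>S. - 1 * geps (gderivL v (f x u)) S)"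
      using geps_gderivL[OF gf(1), of v] by simp
    moreover have "gext b (geps (gderivL v (f x u))) S = - geps (gext b (gderivL v (f x u))) S"
      using geps_gext[OF gf(2), of b v] by simp
    ultimately show ?thesis by (simp only: gext_scale) simp
  qed
  then have th: "jmulth b (dthL v (jeps f)) x u S = jeps (jmulth b (dthL v f)) x u S" for b v
    by (simp add: jmulth_def dthL_def jeps_def)
  have "td_form M i (jeps f) x u S = jeps (td_form M i f) x u S"
    unfolding td_form_def dx dq th by (simp add: jeps_def geps_def algebra_simps sum_distrib_left)
  moreover have "jeps (total_deriv i f) x u S = jeps (td_form M i f) x u S"
    using eqon_jeps[OF td_eq[OF M]] x by (simp add: eqon_def)
  ultimately show ?thesis
    using td_eq[OF jorder_jeps[OF M], of i] x by (simp add: eqon_def)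
qed

end

section \<open>Linear operators up to equality on a domain\<close>

lemma jeps_apply: "jeps f x u S = (-1) ^ card S * f x u S"
  by (simp add: jeps_def geps_def)

lemma eqonI: "(\<And>x u S. x \<in> \<Omega> \<Longrightarrow> f x u S = g x u S) \<Longrightarrow> eqon \<Omega> f g"
  by (auto simp: eqon_def fun_eq_iff)
lemma eqonD: "eqon \<Omega> f g \<Longrightarrow> x \<in> \<Omega> \<Longrightarrow> f x u S = g x u S"
  by (simp add: eqon_def)

text \<open>Linearity is asked only for smooth functions of finite order and only on \<Omega>, where
  the derivatives exist and the sums are finite. Compatibility with \<open>eqon\<close> is what
  allows such operators to be composed.\<close>

definition jlinear_op ::
  "(real^'n) set \<Rightarrow> (('n::finite, 'a::finite, 'k::{real_normed_field,euclidean_space}) jfun \<Rightarrow> ('n, 'a, 'k) jfun) \<Rightarrow> bool" where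
  "jlinear_op \<Omega> L \<longleftrightarrow> (\<forall>f\<in>jfuns \<Omega>. L f \<in> jfuns \<Omega>) \<and>
     (\<forall>f g. eqon \<Omega> f g \<longrightarrow> eqon \<Omega> (L f) (L g)) \<and>
     (\<forall>f\<in>jfuns \<Omega>. \<forall>g\<in>jfuns \<Omega>. eqon \<Omega> (L (\<lambda>x u S. f x u S + g x u S)) (\<lambda>x u S. L f x u S + L g x u S)) \<and>
     (\<forall>f\<in>jfuns \<Omega>. \<forall>c. eqon \<Omega> (L (\<lambda>x u S. c * f x u S)) (\<lambda>x u S. c * L f x u S))"

lemma jlinear_opD:
  assumes "jlinear_op \<Omega> L"
  shows "f \<in> jfuns \<Omega> \<Longrightarrow> L f \<in> jfuns \<Omega>"
    and "eqon \<Omega> f g \<Longrightarrow> eqon \<Omega> (L f) (L g)"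
    and "f \<in> jfuns \<Omega> \<Longrightarrow> g \<in> jfuns \<Omega> \<Longrightarrow> eqon \<Omega> (L (\<lambda>x u S. f x u S + g x u S)) (\<lambda>x u S. L f x u S + L g x u S)"
    and "f \<in> jfuns \<Omega> \<Longrightarrow> eqon \<Omega> (L (\<lambda>x u S. c * f x u S)) (\<lambda>x u S. c * L f x u S)"
  using assms unfolding jlinear_op_def by blast+

lemma jlinear_op_id: "jlinear_op \<Omega> (\<lambda>f. f)"
  by (simp add: jlinear_op_def)

lemma jlinear_op_comp:
  fixes L K :: "('n::finite, 'a::finite, 'k::{real_normed_field,euclidean_space}) jfun \<Rightarrow> ('n, 'a, 'k) jfun"
  assumes L: "jlinear_op \<Omega> L" and K: "jlinear_op \<Omega> K"
  shows "jlinear_op \<Omega> (\<lambda>f. L (K f))"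
  unfolding jlinear_op_def
proof (intro conjI ballI allI impI)
  fix f :: "('n, 'a, 'k) jfun" assume f: "f \<in> jfuns \<Omega>"
  show "L (K f) \<in> jfuns \<Omega>" by (intro jlinear_opD(1)[OF L] jlinear_opD(1)[OF K] f)
  fix c show "eqon \<Omega> (L (K (\<lambda>x u S. c * f x u S))) (\<lambda>x u S. c * L (K f) x u S)"
    by (rule eqon_trans[OF jlinear_opD(2)[OF L jlinear_opD(4)[OF K f]] jlinear_opD(4)[OF L jlinear_opD(1)[OF K f]]])
next
  fix f g :: "('n, 'a, 'k) jfun" assume fg: "f \<in> jfuns \<Omega>" "g \<in> jfuns \<Omega>"
  show "eqon \<Omega> (L (K (\<lambda>x u S. f x u S + g x u S))) (\<lambda>x u S. L (K f) x u S + L (K g) x u S)"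
    by (rule eqon_trans[OF jlinear_opD(2)[OF L jlinear_opD(3)[OF K fg]]
          jlinear_opD(3)[OF L jlinear_opD(1)[OF K fg(1)] jlinear_opD(1)[OF K fg(2)]]])
next
  fix f g :: "('n, 'a, 'k) jfun" assume "eqon \<Omega> f g"
  then show "eqon \<Omega> (L (K f)) (L (K g))" by (intro jlinear_opD(2)[OF L] jlinear_opD(2)[OF K])
qed

lemma jlinear_op_funpow: "jlinear_op \<Omega> L \<Longrightarrow> jlinear_op \<Omega> (L ^^ n)"
proof (induction n)
  case 0
  then show ?case by (simp add: jlinear_op_id id_def)
next
  case (Suc n)
  then show ?case using jlinear_op_comp[of \<Omega> L "L ^^ n"] by (simp add: o_def)
qed

context
  fixes \<Omega> :: "(real^'n::finite) set"
  assumes op: "open \<Omega>"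
begin

lemma jlinear_op_td: "jlinear_op \<Omega> (total_deriv i)"
  unfolding jlinear_op_def
  by (intro conjI ballI allI impI; (rule td_cong[OF op], assumption | intro td_jfuns[OF op] eqonI td_add[OF op] td_scale[OF op]))

lemma jlinear_op_foldr: "jlinear_op \<Omega> (foldr (\<lambda>i. total_deriv i ^^ \<sigma> i) is)"
proof (induction "is")
  case Nil
  then show ?case by (simp add: jlinear_op_id id_def)
next
  case (Cons i "is")
  then show ?case
    using jlinear_op_comp[OF jlinear_op_funpow[OF jlinear_op_td, of "\<sigma> i" i]]
    by (simp add: o_def)
qed

lemma jlinear_op_tdm: "jlinear_op \<Omega> (total_deriv_multi \<sigma>)"
  unfolding total_deriv_multi_def by (rule jlinear_op_foldr)

lemma funpow_commute_eqon:
  assumes L: "jlinear_op \<Omega> L" and C: "\<And>f. f \<in> jfuns \<Omega> \<Longrightarrow> K f \<in> jfuns \<Omega>"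
    and comm: "\<And>f. f \<in> jfuns \<Omega> \<Longrightarrow> eqon \<Omega> (L (K f)) (K (L f))"
    and f: "f \<in> jfuns \<Omega>"
  shows "eqon \<Omega> ((L ^^ n) (K f)) (K ((L ^^ n) f))"
proof (induction n)
  case (Suc n)
  have "eqon \<Omega> (L ((L ^^ n) (K f))) (L (K ((L ^^ n) f)))"
    by (rule jlinear_opD(2)[OF L Suc])
  also have "eqon \<Omega> \<dots> (K (L ((L ^^ n) f)))"
    by (rule comm[OF jlinear_opD(1)[OF jlinear_op_funpow[OF L] f]])
  finally show ?case by simp
qed simp

text \<open>Applied with \<open>K\<close> the parity involution and with \<open>K\<close> a further
  total derivative.\<close>

lemma foldr_commute_eqon:
  fixes K :: "('n, 'a::finite, 'k::{real_normed_field,euclidean_space}) jfun \<Rightarrow> ('n, 'a, 'k) jfun"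
  assumes C: "\<And>f. f \<in> jfuns \<Omega> \<Longrightarrow> K f \<in> jfuns \<Omega>"
    and comm: "\<And>i f. f \<in> jfuns \<Omega> \<Longrightarrow> eqon \<Omega> (total_deriv i (K f)) (K (total_deriv i f))"
    and f: "f \<in> jfuns \<Omega>"
  shows "eqon \<Omega> (foldr (\<lambda>i. total_deriv i ^^ \<sigma> i) is (K f)) (K (foldr (\<lambda>i. total_deriv i ^^ \<sigma> i) is f))"
proof (induction "is")
  case (Cons i "is")
  show ?case
    unfolding foldr.simps o_apply
    by (rule eqon_trans[OF jlinear_opD(2)[OF jlinear_op_funpow[OF jlinear_op_td] Cons]
          funpow_commute_eqon[where K = K, OF jlinear_op_td C comm jlinear_opD(1)[OF jlinear_op_foldr f]]])
qed simp

lemma tdm_jeps: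
  "f \<in> jfuns \<Omega> \<Longrightarrow> eqon \<Omega> (total_deriv_multi \<sigma> (jeps f)) (jeps (total_deriv_multi \<sigma> f))"
  unfolding total_deriv_multi_def
  by (rule foldr_commute_eqon[where K = jeps]) (auto intro: jfuns_jeps[OF op] eqonI td_jeps[OF op])

text \<open>The additional \<open>D_i\<close> stands in the slot of \<open>i\<close> and is carried
  outwards past the powers in front of it. The list is distinct, so the changed exponent occurs only
  once.\<close>

lemma foldr_td_Suc:
  fixes f :: "('n, 'a::finite, 'k::{real_normed_field,euclidean_space}) jfun"
  assumes f: "f \<in> jfuns \<Omega>" and "distinct is" "i \<in> set is"
  shows "eqon \<Omega> (foldr (\<lambda>k. total_deriv k ^^ ((\<sigma>(i := Suc (\<sigma> i))) k)) is f)
    (total_deriv i (foldr (\<lambda>k. total_deriv k ^^ \<sigma> k) is f))"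
  using assms(2,3)
proof (induction "is")
  case (Cons k "is")
  show ?case
  proof (cases "k = i")
    case True
    with Cons have "i \<notin> set is" by auto
    then have "foldr (\<lambda>k. total_deriv k ^^ ((\<sigma>(i := Suc (\<sigma> i))) k)) is f = foldr (\<lambda>k. total_deriv k ^^ \<sigma> k) is f"
      by (intro foldr_cong) auto
    with True show ?thesis by simp
  next
    case False
    then have IH: "eqon \<Omega> (foldr (\<lambda>k. total_deriv k ^^ ((\<sigma>(i := Suc (\<sigma> i))) k)) is f)
      (total_deriv i (foldr (\<lambda>k. total_deriv k ^^ \<sigma> k) is f))" using Cons by auto
    have comm: "eqon \<Omega> (total_deriv k (total_deriv i g)) (total_deriv i (total_deriv k g))" if "g \<in> jfuns \<Omega>"
      for g :: "('n, 'a, 'k) jfun"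
      by (rule eqonI, rule td_commute[OF op that])
    have "eqon \<Omega> ((total_deriv k ^^ \<sigma> k) (foldr (\<lambda>k. total_deriv k ^^ ((\<sigma>(i := Suc (\<sigma> i))) k)) is f))
        ((total_deriv k ^^ \<sigma> k) (total_deriv i (foldr (\<lambda>k. total_deriv k ^^ \<sigma> k) is f)))"
      by (rule jlinear_opD(2)[OF jlinear_op_funpow[OF jlinear_op_td] IH])
    also have "eqon \<Omega> \<dots> (total_deriv i ((total_deriv k ^^ \<sigma> k) (foldr (\<lambda>k. total_deriv k ^^ \<sigma> k) is f)))"
      by (rule funpow_commute_eqon[where K = "total_deriv i", OF jlinear_op_td td_jfuns[OF op] comm jlinear_opD(1)[OF jlinear_op_foldr f]])
    finally show ?thesis using False by simp
  qed
qed simp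

lemma tdm_td:
  assumes f: "f \<in> jfuns \<Omega>"
  shows "eqon \<Omega> (total_deriv_multi \<sigma> (total_deriv i f)) (total_deriv_multi (\<sigma>(i := Suc (\<sigma> i))) f)"
proof -
  have "eqon \<Omega> (total_deriv_multi \<sigma> (total_deriv i f)) (total_deriv i (total_deriv_multi \<sigma> f))"
    unfolding total_deriv_multi_def
    by (rule foldr_commute_eqon[where K = "total_deriv i", OF td_jfuns[OF op] _ f]) (assumption, rule eqonI, rule td_commute[OF op])
  also have "eqon \<Omega> \<dots> (total_deriv_multi (\<sigma>(i := Suc (\<sigma> i))) f)"
    unfolding total_deriv_multi_def
    by (rule eqon_sym[OF foldr_td_Suc[OF f]]) (auto simp: coord_list)
  finally show ?thesis .
qed

end

lemma jlinear_op_zero: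
  assumes L: "jlinear_op \<Omega> L" and op: "open \<Omega>" and f: "eqon \<Omega> f (\<lambda>x u S. 0)" and x: "x \<in> \<Omega>"
  shows "L f x u S = 0"
proof -
  have "L f x u S = L (\<lambda>x u S. 0) x u S"
    by (rule eqonD[OF jlinear_opD(2)[OF L f] x])
  also have "\<dots> = 0 * L (\<lambda>x u S. 0) x u S"
    using eqonD[OF jlinear_opD(4)[OF L jfuns_zero[OF op], of 0] x] by simp
  finally show ?thesis by simp
qed

section \<open>Variational derivatives annihilate total derivatives\<close>

text \<open>The Euler operator of an arbitrary family \<open>P\<close>. The even variational
  derivative and both odd ones are instances, which lets the cancellation argument be given once for
  even and odd variables.\<close>

definition euler_op ::
  "(('n \<Rightarrow> nat) \<Rightarrow> ('n::finite, 'a::finite, 'k::{real_normed_field,euclidean_space}) jfun \<Rightarrow> ('n, 'a, 'k) jfun)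
    \<Rightarrow> ('n, 'a, 'k) jfun \<Rightarrow> ('n, 'a, 'k) jfun" where
  "euler_op P f x u S = Sum_any (\<lambda>\<sigma>. (-1) ^ morder \<sigma> * total_deriv_multi \<sigma> (P \<sigma> f) x u S)"

lemma var_euler:
  "var_q \<alpha> = euler_op (\<lambda>\<sigma>. dq (\<alpha>, \<sigma>))" "var_thL \<alpha> = euler_op (\<lambda>\<sigma>. dthL (\<alpha>, \<sigma>))"
  "var_thR \<alpha> = euler_op (\<lambda>\<sigma>. dthR (\<alpha>, \<sigma>))"
  by (auto simp: var_q_def var_thL_def var_thR_def euler_op_def fun_eq_iff)

text \<open>What the cancellation uses of the even and the left odd partial derivatives: linearity,
  vanishing above the order of the function, and the commutator with a total derivative.\<close>

locale jet_derivations =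
  fixes \<Omega> :: "(real^'n::finite) set"
    and P :: "('n \<Rightarrow> nat) \<Rightarrow> ('n, 'a::finite, 'k::{real_normed_field,euclidean_space}) jfun \<Rightarrow> ('n, 'a, 'k) jfun"
  assumes op: "open \<Omega>"
    and P_linear: "jlinear_op \<Omega> (P \<sigma>)"
    and P_zero: "jorder_le m \<Omega> f \<Longrightarrow> m < morder \<sigma> \<Longrightarrow> x \<in> \<Omega> \<Longrightarrow> P \<sigma> f x u S = 0"
    and P_td: "f \<in> jfuns \<Omega> \<Longrightarrow> x \<in> \<Omega> \<Longrightarrow> P \<sigma> (total_deriv i f) x u S =
      total_deriv i (P \<sigma> f) x u S + (if \<sigma> i = 0 then 0 else P (\<sigma>(i := \<sigma> i - 1)) f x u S)"
begin

lemma euler_eq: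
  assumes f: "jorder_le m \<Omega> f" and x: "x \<in> \<Omega>" and "m \<le> M"
  shows "euler_op P f x u S = (\<Sum>\<sigma> | morder \<sigma> \<le> M. (-1) ^ morder \<sigma> * total_deriv_multi \<sigma> (P \<sigma> f) x u S)"
  unfolding euler_op_def
proof (rule Sum_any.expand_superset)
  show "finite {\<sigma> :: 'n \<Rightarrow> nat. morder \<sigma> \<le> M}" by (rule finite_morder)
  show "{\<sigma>. (-1) ^ morder \<sigma> * total_deriv_multi \<sigma> (P \<sigma> f) x u S \<noteq> 0} \<subseteq> {\<sigma>. morder \<sigma> \<le> M}"
  proof
    fix \<sigma> assume *: "\<sigma> \<in> {\<sigma>. (-1) ^ morder \<sigma> * total_deriv_multi \<sigma> (P \<sigma> f) x u S \<noteq> 0}"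
    show "\<sigma> \<in> {\<sigma>. morder \<sigma> \<le> M}"
    proof (rule ccontr)
      assume "\<sigma> \<notin> {\<sigma>. morder \<sigma> \<le> M}"
      then have "eqon \<Omega> (P \<sigma> f) (\<lambda>x u S. 0)"
        using assms(3) by (intro eqonI P_zero[OF f]) auto
      from jlinear_op_zero[OF jlinear_op_tdm[OF op] op this x] * show False by simp
    qed
  qed
qed

lemma jlinear_op_euler: "jlinear_op \<Omega> (euler_op P)"
  unfolding jlinear_op_def
proof (intro conjI ballI allI impI)
  fix f :: "('n, 'a, 'k) jfun" assume f: "f \<in> jfuns \<Omega>"
  then obtain m where m: "smooth_jfun \<Omega> f" "jorder_le m \<Omega> f" by (rule jfunsE)
  note L = jlinear_op_comp[OF jlinear_op_tdm[OF op] P_linear]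
  have "(\<lambda>x u S. \<Sum>\<sigma> | morder \<sigma> \<le> m. (-1) ^ morder \<sigma> * total_deriv_multi \<sigma> (P \<sigma> f) x u S) \<in> jfuns \<Omega>"
    by (intro jfuns_sum[OF op] jfuns_scale[OF op] jlinear_opD(1)[OF L f])
  then show "euler_op P f \<in> jfuns \<Omega>"
    by (rule jfuns_cong[OF op eqonI, rotated]) (simp add: euler_eq[OF m(2) _ order_refl])
  fix c
  show "eqon \<Omega> (euler_op P (\<lambda>x u S. c * f x u S)) (\<lambda>x u S. c * euler_op P f x u S)"
  proof (rule eqonI)
    fix x u S assume x: "x \<in> \<Omega>"
    show "euler_op P (\<lambda>x u S. c * f x u S) x u S = c * euler_op P f x u S"
      unfolding euler_eq[OF m(2) x order_refl] euler_eq[OF jorder_scale[OF m(2)] x order_refl]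
        eqonD[OF jlinear_opD(4)[OF L f] x]
      by (simp add: sum_distrib_left mult_ac)
  qed
next
  fix f g :: "('n, 'a, 'k) jfun" assume fg: "f \<in> jfuns \<Omega>" "g \<in> jfuns \<Omega>"
  then obtain m m' where m: "jorder_le m \<Omega> f" "jorder_le m' \<Omega> g" by (elim jfunsE) blast
  define M where "M = max m m'"
  have M: "jorder_le M \<Omega> f" "jorder_le M \<Omega> g" using m by (auto simp: M_def intro: jorder_mono)
  note L = jlinear_op_comp[OF jlinear_op_tdm[OF op] P_linear]
  show "eqon \<Omega> (euler_op P (\<lambda>x u S. f x u S + g x u S)) (\<lambda>x u S. euler_op P f x u S + euler_op P g x u S)"
  proof (rule eqonI)
    fix x u S assume x: "x \<in> \<Omega>"
    show "euler_op P (\<lambda>x u S. f x u S + g x u S) x u S = euler_op P f x u S + euler_op P g x u S"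
      unfolding euler_eq[OF M(1) x order_refl] euler_eq[OF M(2) x order_refl] euler_eq[OF jorder_add[OF M] x order_refl]
        eqonD[OF jlinear_opD(3)[OF L fg] x]
      by (simp add: sum.distrib algebra_simps)
  qed
next
  fix f g :: "('n, 'a, 'k) jfun" assume "eqon \<Omega> f g"
  then have "eqon \<Omega> (total_deriv_multi \<sigma> (P \<sigma> f)) (total_deriv_multi \<sigma> (P \<sigma> g))" for \<sigma>
    by (intro jlinear_opD(2)[OF jlinear_op_tdm[OF op]] jlinear_opD(2)[OF P_linear])
  then show "eqon \<Omega> (euler_op P f) (euler_op P g)"
    by (intro eqonI) (simp add: euler_op_def eqon_def)
qed

text \<open>The commutator splits each summand into a part in which the multi-index of the outer
  operator is raised by \<open>i\<close> and a part in which that of \<open>P\<close> is lowered.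
  Raising the index throughout the second part matches it with the first, with the opposite sign
  because \<open>morder\<close> grows by one.\<close>

lemma euler_td:
  assumes f: "f \<in> jfuns \<Omega>" and x: "x \<in> \<Omega>"
  shows "euler_op P (total_deriv i f) x u S = 0"
proof -
  obtain m where m: "smooth_jfun \<Omega> f" "jorder_le m \<Omega> f" using f by (rule jfunsE)
  let ?A = "\<lambda>M. {\<sigma> :: 'n \<Rightarrow> nat. morder \<sigma> \<le> M}"
  let ?t = "\<lambda>\<sigma> g. total_deriv_multi \<sigma> g x u S"
  have Pf: "P \<sigma> f \<in> jfuns \<Omega>" for \<sigma> by (rule jlinear_opD(1)[OF P_linear f])
  have split: "?t \<sigma> (P \<sigma> (total_deriv i f)) =
      ?t (\<sigma>(i := Suc (\<sigma> i))) (P \<sigma> f) + (if \<sigma> i = 0 then 0 else ?t \<sigma> (P (\<sigma>(i := \<sigma> i - 1)) f))" for \<sigma>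
  proof -
    \<comment> \<open>The second part is written as a local function of its own, with the case
      distinction inside, so that linearity of \<open>total_deriv_multi \<sigma>\<close> applies to
      the sum.\<close>
    define r where "r = (\<lambda>x u S. if \<sigma> i = 0 then 0 else P (\<sigma>(i := \<sigma> i - 1)) f x u S)"
    have r: "r \<in> jfuns \<Omega>" using Pf jfuns_zero[OF op] by (cases "\<sigma> i = 0") (simp_all add: r_def)
    have "eqon \<Omega> (P \<sigma> (total_deriv i f)) (\<lambda>x u S. total_deriv i (P \<sigma> f) x u S + r x u S)"
      unfolding r_def by (rule eqonI, rule P_td[OF f])
    then have "?t \<sigma> (P \<sigma> (total_deriv i f)) = ?t \<sigma> (\<lambda>x u S. total_deriv i (P \<sigma> f) x u S + r x u S)"
      by (rule eqonD[OF jlinear_opD(2)[OF jlinear_op_tdm[OF op]] x])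
    also have "\<dots> = ?t \<sigma> (total_deriv i (P \<sigma> f)) + ?t \<sigma> r"
      by (rule eqonD[OF jlinear_opD(3)[OF jlinear_op_tdm[OF op] td_jfuns[OF op Pf] r] x])
    also have "?t \<sigma> (total_deriv i (P \<sigma> f)) = ?t (\<sigma>(i := Suc (\<sigma> i))) (P \<sigma> f)"
      by (rule eqonD[OF tdm_td[OF op Pf] x])
    also have "?t \<sigma> r = (if \<sigma> i = 0 then 0 else ?t \<sigma> (P (\<sigma>(i := \<sigma> i - 1)) f))"
    proof (cases "\<sigma> i = 0")
      case True
      then have "eqon \<Omega> r (\<lambda>x u S. 0)" by (simp add: r_def)
      from jlinear_op_zero[OF jlinear_op_tdm[OF op] op this x] True show ?thesis by simp
    qed (simp add: r_def)
    finally show ?thesis .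
  qed
  have "euler_op P (total_deriv i f) x u S =
      (\<Sum>\<sigma>\<in>?A (Suc m). (-1) ^ morder \<sigma> * ?t (\<sigma>(i := Suc (\<sigma> i))) (P \<sigma> f)) +
      (\<Sum>\<sigma>\<in>?A (Suc m). if \<sigma> i = 0 then 0 else (-1) ^ morder \<sigma> * ?t \<sigma> (P (\<sigma>(i := \<sigma> i - 1)) f))"
    unfolding euler_eq[OF jorder_td[OF op m(2)] x order_refl] split
    by (simp add: algebra_simps sum.distrib if_distrib[of "\<lambda>z. _ * z"] cong: if_cong)
  also have "(\<Sum>\<sigma>\<in>?A (Suc m). if \<sigma> i = 0 then 0 else (-1) ^ morder \<sigma> * ?t \<sigma> (P (\<sigma>(i := \<sigma> i - 1)) f)) =
      (\<Sum>\<sigma>\<in>{\<sigma>\<in>?A (Suc m). \<sigma> i \<noteq> 0}. (-1) ^ morder \<sigma> * ?t \<sigma> (P (\<sigma>(i := \<sigma> i - 1)) f))"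
    by (rule sum.mono_neutral_cong_right) (auto simp: finite_morder)
  also have "\<dots> = (\<Sum>\<sigma>\<in>?A m. (-1) ^ Suc (morder \<sigma>) * ?t (\<sigma>(i := Suc (\<sigma> i))) (P \<sigma> f))"
  proof (rule sum.reindex_bij_witness[where i = "\<lambda>\<sigma>. \<sigma>(i := Suc (\<sigma> i))" and j = "\<lambda>\<sigma>. \<sigma>(i := \<sigma> i - 1)"])
    fix \<sigma> assume \<sigma>: "\<sigma> \<in> {\<sigma>\<in>?A (Suc m). \<sigma> i \<noteq> 0}"
    let ?\<tau> = "\<sigma>(i := \<sigma> i - 1)"
    show *: "?\<tau>(i := Suc (?\<tau> i)) = \<sigma>" using \<sigma> by auto
    then have ord: "morder \<sigma> = Suc (morder ?\<tau>)" using morder_fun_upd_Suc[of ?\<tau> i] by simp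
    then show "?\<tau> \<in> ?A m" using \<sigma> by simp
    show "(-1) ^ Suc (morder ?\<tau>) * ?t (?\<tau>(i := Suc (?\<tau> i))) (P ?\<tau> f) =
        (-1) ^ morder \<sigma> * ?t \<sigma> (P (\<sigma>(i := \<sigma> i - 1)) f)"
      unfolding * ord[symmetric] ..
  qed (auto simp: morder_fun_upd_Suc)
  \<comment> \<open>The range reaches order \<open>m + 1\<close> because a total derivative raises
    the order by one. In this part the top layer is zero, since \<open>P \<sigma> f\<close> vanishes
    above order \<open>m\<close>; the ranges of both parts then agree.\<close>
  also have "(\<Sum>\<sigma>\<in>?A (Suc m). (-1) ^ morder \<sigma> * ?t (\<sigma>(i := Suc (\<sigma> i))) (P \<sigma> f)) =
      (\<Sum>\<sigma>\<in>?A m. (-1) ^ morder \<sigma> * ?t (\<sigma>(i := Suc (\<sigma> i))) (P \<sigma> f))"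
  proof (rule sum.mono_neutral_right)
    show "\<forall>\<sigma>\<in>?A (Suc m) - ?A m. (-1) ^ morder \<sigma> * ?t (\<sigma>(i := Suc (\<sigma> i))) (P \<sigma> f) = 0"
    proof
      fix \<sigma> assume "\<sigma> \<in> ?A (Suc m) - ?A m"
      then have "eqon \<Omega> (P \<sigma> f) (\<lambda>x u S. 0)" by (intro eqonI P_zero[OF m(2)]) auto
      from jlinear_op_zero[OF jlinear_op_tdm[OF op] op this x]
      show "(-1) ^ morder \<sigma> * ?t (\<sigma>(i := Suc (\<sigma> i))) (P \<sigma> f) = 0" by simp
    qed
  qed (auto simp: finite_morder)
  finally show ?thesis by (simp add: sum_negf fun_upd_def)
qed

lemma euler_divergence:
  assumes "\<And>k. \<eta> k \<in> jfuns \<Omega>" and "eqon \<Omega> f (\<lambda>x u S. \<Sum>k\<in>UNIV. total_deriv k (\<eta> k) x u S)" and x: "x \<in> \<Omega>"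
  shows "euler_op P f x u S = 0"
proof -
  have sum: "euler_op P (\<lambda>x u S. \<Sum>k\<in>I. total_deriv k (\<eta> k) x u S) x u S = 0" if "finite I" for I
    using that
  proof (induction I)
    case empty
    show ?case using jlinear_op_zero[OF jlinear_op_euler op eqon_refl x] by simp
  next
    case (insert k I)
    have J: "total_deriv k (\<eta> k) \<in> jfuns \<Omega>" "(\<lambda>x u S. \<Sum>k\<in>I. total_deriv k (\<eta> k) x u S) \<in> jfuns \<Omega>"
      by (intro td_jfuns[OF op] jfuns_sum[OF op] assms(1))+
    have "euler_op P (\<lambda>x u S. total_deriv k (\<eta> k) x u S + (\<Sum>k\<in>I. total_deriv k (\<eta> k) x u S)) x u S = 0"
      using eqonD[OF jlinear_opD(3)[OF jlinear_op_euler J] x] euler_td[OF assms(1) x] insert.IH by simp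
    with insert show ?case by simp
  qed
  show ?thesis
    using eqonD[OF jlinear_opD(2)[OF jlinear_op_euler assms(2)] x] sum[of UNIV] by simp
qed

end

section \<open>The even and the odd variational derivatives\<close>

lemma jlinear_op_dq: "open \<Omega> \<Longrightarrow> jlinear_op \<Omega> (dq v)"
  unfolding jlinear_op_def jpartial_simps(2)[symmetric]
  by (intro conjI ballI allI impI; (rule jpartial_cong, assumption, assumption | intro jfuns_jpartial eqonI jpartial_jfuns_add jpartial_jfuns_scale))

lemma jlinear_op_dthL: "open \<Omega> \<Longrightarrow> jlinear_op \<Omega> (dthL v)"
  unfolding jlinear_op_def
  by (intro conjI ballI allI impI jfuns_dthL eqon_dthL)
     (auto simp: dthL_def eqon_def gderivL_add gderivL_scale fun_eq_iff)

lemma jet_derivations_dq: "open \<Omega> \<Longrightarrow> jet_derivations \<Omega> (\<lambda>\<sigma>. dq (\<alpha>, \<sigma>))"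
proof (unfold_locales)
  fix f :: "('a, 'b, 'c) jfun" and x u S \<sigma> i
  assume "open \<Omega>" "f \<in> jfuns \<Omega>" "x \<in> \<Omega>"
  then show "dq (\<alpha>, \<sigma>) (total_deriv i f) x u S =
      total_deriv i (dq (\<alpha>, \<sigma>) f) x u S + (if \<sigma> i = 0 then 0 else dq (\<alpha>, \<sigma>(i := \<sigma> i - 1)) f x u S)"
    using td_jpartial[of \<Omega> f x "Inr (\<alpha>, \<sigma>)" i u S] by (simp add: junshift_def)
qed (auto intro: jlinear_op_dq dq_zero simp: jvars_def)

lemma jet_derivations_dthL: "open \<Omega> \<Longrightarrow> jet_derivations \<Omega> (\<lambda>\<sigma>. dthL (\<alpha>, \<sigma>))"
proof (unfold_locales)
  fix f :: "('a, 'b, 'c) jfun" and x u S \<sigma> i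
  assume "open \<Omega>" "f \<in> jfuns \<Omega>" "x \<in> \<Omega>"
  then show "dthL (\<alpha>, \<sigma>) (total_deriv i f) x u S =
      total_deriv i (dthL (\<alpha>, \<sigma>) f) x u S + (if \<sigma> i = 0 then 0 else dthL (\<alpha>, \<sigma>(i := \<sigma> i - 1)) f x u S)"
    using td_dthL[of \<Omega> f x "(\<alpha>, \<sigma>)" i u S] by (simp add: junshift_def)
qed (auto intro: jlinear_op_dthL dthL_zero simp: jvars_def)

context
  fixes \<Omega> :: "(real^'n::finite) set"
  assumes op: "open \<Omega>"
begin

lemma jlinear_op_var_q: "jlinear_op \<Omega> (var_q \<alpha>)"
  unfolding var_euler by (rule jet_derivations.jlinear_op_euler[OF jet_derivations_dq[OF op]])

lemma jlinear_op_var_thL: "jlinear_op \<Omega> (var_thL \<alpha>)"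
  unfolding var_euler by (rule jet_derivations.jlinear_op_euler[OF jet_derivations_dthL[OF op]])

lemmas var_q_divergence = jet_derivations.euler_divergence[OF jet_derivations_dq[OF op], folded var_euler]
lemmas var_thL_divergence = jet_derivations.euler_divergence[OF jet_derivations_dthL[OF op], folded var_euler]

lemma var_q_jeps:
  assumes f: "f \<in> jfuns \<Omega>"
  shows "eqon \<Omega> (var_q \<alpha> (jeps f)) (jeps (var_q \<alpha> f))"
proof (rule eqonI)
  fix x u S assume x: "x \<in> \<Omega>"
  obtain m where m: "smooth_jfun \<Omega> f" "jorder_le m \<Omega> f" using f by (rule jfunsE)
  have t: "total_deriv_multi \<sigma> (dq v (jeps f)) x u S = jeps (total_deriv_multi \<sigma> (dq v f)) x u S" for v \<sigma>
  proof -
    have "eqon \<Omega> (dq v (jeps f)) (jeps (dq v f))"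
      using jpartial_jeps[OF m(1), of _ "Inr v"] by (intro eqonI) simp
    from eqonD[OF jlinear_opD(2)[OF jlinear_op_tdm[OF op] this] x]
      eqonD[OF tdm_jeps[OF op jfuns_dq[OF op f]] x] show ?thesis by simp
  qed
  show "var_q \<alpha> (jeps f) x u S = jeps (var_q \<alpha> f) x u S"
    unfolding jeps_apply var_euler
      jet_derivations.euler_eq[OF jet_derivations_dq[OF op] m(2) x order_refl]
      jet_derivations.euler_eq[OF jet_derivations_dq[OF op] jorder_jeps[OF m(2)] x order_refl] t
    by (simp add: sum_distrib_left mult_ac)
qed

lemma var_thL_jeps:
  assumes f: "f \<in> jfuns \<Omega>"
  shows "eqon \<Omega> (var_thL \<alpha> (jeps f)) (\<lambda>x u S. - jeps (var_thL \<alpha> f) x u S)"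
proof (rule eqonI)
  fix x u S assume x: "x \<in> \<Omega>"
  obtain m where m: "smooth_jfun \<Omega> f" "jorder_le m \<Omega> f" using f by (rule jfunsE)
  have t: "total_deriv_multi \<sigma> (dthL v (jeps f)) x u S = - jeps (total_deriv_multi \<sigma> (dthL v f)) x u S" for v \<sigma>
  proof -
    have "eqon \<Omega> (dthL v (jeps f)) (\<lambda>x u S. (-1) * jeps (dthL v f) x u S)"
      using geps_gderivL[OF jorder_gfin[OF m(2)], of _ v] by (intro eqonI) (simp add: dthL_def jeps_def)
    then have "total_deriv_multi \<sigma> (dthL v (jeps f)) x u S =
        total_deriv_multi \<sigma> (\<lambda>x u S. (-1) * jeps (dthL v f) x u S) x u S"
      by (rule eqonD[OF jlinear_opD(2)[OF jlinear_op_tdm[OF op]] x])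
    also have "\<dots> = (-1) * total_deriv_multi \<sigma> (jeps (dthL v f)) x u S"
      by (rule eqonD[OF jlinear_opD(4)[OF jlinear_op_tdm[OF op] jfuns_jeps[OF op jfuns_dthL[OF op f]]] x])
    also have "total_deriv_multi \<sigma> (jeps (dthL v f)) x u S = jeps (total_deriv_multi \<sigma> (dthL v f)) x u S"
      by (rule eqonD[OF tdm_jeps[OF op jfuns_dthL[OF op f]] x])
    finally show ?thesis by simp
  qed
  show "var_thL \<alpha> (jeps f) x u S = - jeps (var_thL \<alpha> f) x u S"
    unfolding jeps_apply var_euler
      jet_derivations.euler_eq[OF jet_derivations_dthL[OF op] m(2) x order_refl]
      jet_derivations.euler_eq[OF jet_derivations_dthL[OF op] jorder_jeps[OF m(2)] x order_refl] t
    by (simp add: sum_distrib_left sum_negf mult_ac)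
qed

text \<open>Left and right partial derivatives differ by the parity involution, which commutes with
  total derivatives. What is known of left variational derivatives, in particular that they depend
  only on the class, thus carries over to right ones.\<close>

lemma var_thR_eq:
  assumes f: "f \<in> jfuns \<Omega>"
  shows "eqon \<Omega> (var_thR \<alpha> f) (jeps (var_thL \<alpha> f))"
proof (rule eqonI)
  fix x u S assume x: "x \<in> \<Omega>"
  obtain m where m: "smooth_jfun \<Omega> f" "jorder_le m \<Omega> f" using f by (rule jfunsE)
  have t: "total_deriv_multi \<sigma> (dthR v f) x u S = (-1) ^ card S * total_deriv_multi \<sigma> (dthL v f) x u S" for v \<sigma>
  proof -
    have "eqon \<Omega> (dthR v f) (jeps (dthL v f))"
      using gderivR_geps[OF jorder_gfin[OF m(2)], of _ v] by (intro eqonI) (simp add: dthL_def dthR_def jeps_def)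
    from eqonD[OF jlinear_opD(2)[OF jlinear_op_tdm[OF op] this] x]
      eqonD[OF tdm_jeps[OF op jfuns_dthL[OF op f]] x] show ?thesis by (simp add: jeps_def geps_def)
  qed
  have "euler_op (\<lambda>\<sigma>. dthR (\<alpha>, \<sigma>)) f x u S =
      Sum_any (\<lambda>\<sigma>. (-1) ^ card S * ((-1) ^ morder \<sigma> * total_deriv_multi \<sigma> (dthL (\<alpha>, \<sigma>) f) x u S))"
    unfolding euler_op_def t by (simp add: mult_ac)
  also have "\<dots> = (\<Sum>\<sigma> | morder \<sigma> \<le> m. (-1) ^ card S * ((-1) ^ morder \<sigma> * total_deriv_multi \<sigma> (dthL (\<alpha>, \<sigma>) f) x u S))"
  proof (rule Sum_any.expand_superset[OF finite_morder], rule subsetI, rule ccontr)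
    fix \<sigma> :: "'n \<Rightarrow> nat"
    assume *: "\<sigma> \<in> {\<sigma>. (-1) ^ card S * ((-1) ^ morder \<sigma> * total_deriv_multi \<sigma> (dthL (\<alpha>, \<sigma>) f) x u S) \<noteq> 0}"
      and "\<sigma> \<notin> {\<sigma>. morder \<sigma> \<le> m}"
    then have "eqon \<Omega> (dthL (\<alpha>, \<sigma>) f) (\<lambda>x u S. 0)"
      by (intro eqonI dthL_zero[OF m(2)]) (auto simp: jvars_def)
    from jlinear_op_zero[OF jlinear_op_tdm[OF op] op this x] * show False by simp
  qed
  finally show "var_thR \<alpha> f x u S = jeps (var_thL \<alpha> f) x u S"
    unfolding jeps_def geps_def var_euler
      jet_derivations.euler_eq[OF jet_derivations_dthL[OF op] m(2) x order_refl]
    by (simp add: sum_distrib_left)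
qed

end

section \<open>Pull-backs along sections\<close>

lemma geval_add:
  assumes "finite {S. f S \<noteq> 0}" "finite {S. g S \<noteq> 0}"
  shows "geval (\<lambda>S. f S + g S) y T = geval f y T + geval g y T"
  unfolding geval_def distrib_right
  by (rule Sum_any.distrib; rule finite_subset[OF _ assms(1)] finite_subset[OF _ assms(2)]; auto)

lemma geval_scale:
  assumes "finite {S. f S \<noteq> (0::'k::idom)}"
  shows "geval (\<lambda>S. c * f S) y T = c * geval f y T"
  unfolding geval_def mult.assoc
  by (rule Sum_any_right_distrib[symmetric]; rule finite_subset[OF _ assms(1)]; auto)

text \<open>A monomial of degree \<open>k\<close> becomes a product of \<open>k\<close> odd
  elements, whose nonzero coefficients sit at sets with cardinality of the same parity as
  \<open>k\<close>. The involution therefore passes through the substitution.\<close>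

lemma geval_geps:
  fixes y :: "'v::countable \<Rightarrow> ('w::countable, 'k::idom) grass"
  assumes "gfin f" "finite {S. f S \<noteq> 0}" and y: "\<And>v. gpar 1 (y v)"
  shows "geval (geps f) y T = (-1) ^ card T * geval f y T"
proof -
  have "geps f S * gprod (map y (sorted_key_list_of_set to_nat S)) T =
      (-1) ^ card T * (f S * gprod (map y (sorted_key_list_of_set to_nat S)) T)" for S
  proof (cases "f S = 0 \<or> gprod (map y (sorted_key_list_of_set to_nat S)) T = 0")
    case False
    then have "finite S" using assms(1) by (auto simp: gfin_def)
    then have len: "length (sorted_key_list_of_set to_nat S) = card S"
      by (intro to_nat_key.length_sorted_key_list_of_set[unfolded sorted_key_list_nat]) auto
    have "gpar (length (map y (sorted_key_list_of_set to_nat S))) (gprod (map y (sorted_key_list_of_set to_nat S)))"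
      by (rule gpar_gprod) (use y in auto)
    with False have "even (card T + card S)" by (auto simp: gpar_def len)
    then have "(-1) ^ card S = ((-1) ^ card T :: 'k)"
      by (metis even_add neg_one_even_power neg_one_odd_power)
    then show ?thesis by (simp add: geps_def)
  qed (auto simp: geps_def)
  then have "geval (geps f) y T =
      Sum_any (\<lambda>S. (-1) ^ card T * (f S * gprod (map y (sorted_key_list_of_set to_nat S)) T))"
    by (simp only: geval_def)
  also have "\<dots> = (-1) ^ card T * geval f y T"
    unfolding geval_def
    by (intro Sum_any_right_distrib[symmetric] finite_subset[OF _ assms(2)]) auto
  finally show ?thesis .
qed

lemma pd_zero:
  fixes h :: "real^'n::finite \<Rightarrow> 'b::real_normed_vector"
  assumes "open U" "\<And>y. y \<in> U \<Longrightarrow> h y = 0" "x \<in> U"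
  shows "pd i h x = 0"
proof -
  have "((\<lambda>t. h (x + t *\<^sub>R axis i 1)) has_vector_derivative 0) (at 0)
      \<longleftrightarrow> ((\<lambda>t::real. 0::'b) has_vector_derivative 0) (at 0)"
    by (rule has_vector_derivative_cong_ev)
       (use assms in \<open>auto intro!: eventually_mono[OF eventually_axis[OF assms(1,3), of i]]\<close>)
  then show ?thesis unfolding pd_def by (simp add: vector_derivative_at)
qed

text \<open>Ensures that derivatives of the odd components of a section are odd again: a coefficient
  that vanishes throughout an open set has vanishing derivatives there.\<close>

lemma pd_multi_zero:
  fixes h :: "real^'n::finite \<Rightarrow> 'b::real_normed_vector"
  assumes U: "open U" and "\<And>y. y \<in> U \<Longrightarrow> h y = 0" "x \<in> U"
  shows "pd_multi \<sigma> h x = 0"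
proof -
  have pow: "(pd i ^^ n) g x = 0" if "\<And>y. y \<in> U \<Longrightarrow> g y = 0" "x \<in> U" for i n g x
    using that by (induction n arbitrary: x) (auto intro: pd_zero[OF U])
  have "foldr (\<lambda>i. pd i ^^ \<sigma> i) is h x = 0" if "x \<in> U" for "is" x
    using that
  proof (induction "is" arbitrary: x)
    case (Cons i "is")
    then show ?case by (auto intro!: pow)
  qed (use assms in auto)
  with assms(3) show ?thesis by (simp add: pd_multi_def)
qed

lemma jorder_finite_support:
  fixes f :: "('n::finite, 'a::finite, 'k::{real_normed_field,euclidean_space}) jfun"
  assumes "jorder_le m \<Omega> f" "x \<in> \<Omega>" shows "finite {S. f x u S \<noteq> 0}"
  by (rule finite_subset[of _ "Pow (jvars m)"]) (use jorder_zero[OF assms] finite_jvars in auto)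

lemma pullback_add:
  assumes "f \<in> jfuns \<Omega>" "g \<in> jfuns \<Omega>" "x \<in> \<Omega>"
  shows "jet_pullback (\<lambda>x u S. f x u S + g x u S) s i x T = jet_pullback f s i x T + jet_pullback g s i x T"
proof -
  obtain m m' where "jorder_le m \<Omega> f" "jorder_le m' \<Omega> g"
    using assms(1,2) by (elim jfunsE) blast
  then show ?thesis
    unfolding jet_pullback_def by (intro geval_add jorder_finite_support[OF _ assms(3)])
qed

lemma pullback_scale:
  assumes "f \<in> jfuns \<Omega>" "x \<in> \<Omega>"
  shows "jet_pullback (\<lambda>x u S. c * f x u S) s i x T = c * jet_pullback f s i x T"
proof -
  obtain m where "jorder_le m \<Omega> f" using assms(1) by (elim jfunsE)
  then show ?thesis
    unfolding jet_pullback_def by (intro geval_scale jorder_finite_support[OF _ assms(2)])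
qed

lemma pullback_cong: "eqon \<Omega> f g \<Longrightarrow> x \<in> \<Omega> \<Longrightarrow> jet_pullback f s i x = jet_pullback g s i x"
  by (simp add: jet_pullback_def eqon_def)

section \<open>Classes of densities\<close>

definition deqv where
  "deqv B f g \<longleftrightarrow> (\<forall>i\<in>charts B. eqon (cimg B i) (f i) (g i))"

definition dadd where "dadd f g = (\<lambda>i x u S. f i x u S + g i x u S)"
definition dscale where "dscale c f = (\<lambda>i x u S. c * f i x u S)"
definition deps where "deps f = (\<lambda>i. jeps (f i))"

lemma ddiff: "(\<lambda>i x u S. g i x u S - f i x u S) = dadd g (dscale (-1) (f :: ('i, 'n::finite, 'a, 'k::{real_normed_field,euclidean_space}) dens))"
  by (simp add: dadd_def dscale_def)

lemma deqvI: "(\<And>i x u S. i \<in> charts B \<Longrightarrow> x \<in> cimg B i \<Longrightarrow> f i x u S = g i x u S) \<Longrightarrow> deqv B f g"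
  by (auto simp: deqv_def intro: eqonI)

lemma deqvD: "deqv B f g \<Longrightarrow> i \<in> charts B \<Longrightarrow> x \<in> cimg B i \<Longrightarrow> f i x u S = g i x u S"
  by (auto simp: deqv_def intro: eqonD)

section \<open>Densities, currents and exact densities under linear operations\<close>

locale bv_geometry =
  fixes B :: "('i, 'm::{t2_space,second_countable_topology}, 'n::finite, 'a::finite,
                'k::{real_normed_field,euclidean_space}) bv_bundle"
  assumes oriented: "oriented_vector_bundle B"
begin

lemma open_cdom: "i \<in> charts B \<Longrightarrow> open (cdom B i)"
  and open_cimg: "i \<in> charts B \<Longrightarrow> open (cimg B i)"
  and chart_homeo: "i \<in> charts B \<Longrightarrow> homeomorphism (cdom B i) (cimg B i) (coord B i) (cinv B i)"
  and cdom_cover: "(\<Union>i\<in>charts B. cdom B i) = UNIV"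
  using oriented by (auto simp: oriented_vector_bundle_def)

lemma coord_in_cimg: "p \<in> cdom B i \<Longrightarrow> coord B i p \<in> cimg B i"
  by (simp add: cimg_def)

lemma open_coord_image:
  assumes "i \<in> charts B" "open W" shows "open (coord B i ` (W \<inter> cdom B i))"
proof -
  have "openin (top_of_set (cdom B i)) (W \<inter> cdom B i)"
    using assms(2) by (metis Int_commute openin_open_Int)
  then have "openin (top_of_set (cimg B i)) (coord B i ` (W \<inter> cdom B i))"
    using homeomorphism_imp_open_map[OF chart_homeo[OF assms(1)]] by blast
  then show ?thesis using open_cimg[OF assms(1)] by (simp add: openin_open_eq)
qed

text \<open>A component of the section can have a nonzero derivative at the point only if it is
  nonzero somewhere on the open image of \<open>W\<close>, and there the section is odd. So odd
  elements are substituted for the odd coordinates, and parity of the local function becomes parity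
  in the auxiliary generators.\<close>

lemma pullback_jeps:
  assumes f: "f \<in> jfuns (cimg B i)" and s: "local_section B W s" "open W"
    and i: "i \<in> charts B" and p: "p \<in> W" "p \<in> cdom B i"
  shows "jet_pullback (jeps f) s i (coord B i p) T = (-1) ^ card T * jet_pullback f s i (coord B i p) T"
proof -
  let ?x = "coord B i p" and ?U = "coord B i ` (W \<inter> cdom B i)"
  obtain m where m: "jorder_le m (cimg B i) f" using f by (elim jfunsE)
  have x: "?x \<in> cimg B i" "?x \<in> ?U" using p coord_in_cimg by auto
  have "gpar 1 (\<lambda>T. pd_multi \<sigma> (\<lambda>y. snd s i y \<alpha> T) ?x)" for \<alpha> \<sigma>
    unfolding gpar_def
  proof (intro allI impI)
    fix T assume nz: "pd_multi \<sigma> (\<lambda>y. snd s i y \<alpha> T) ?x \<noteq> 0"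
    have "\<exists>y\<in>?U. snd s i y \<alpha> T \<noteq> 0"
      using pd_multi_zero[OF open_coord_image[OF i s(2)] _ x(2), of "\<lambda>y. snd s i y \<alpha> T" \<sigma>] nz by blast
    then show "finite T \<and> even (card T + 1)"
      using s(1) i unfolding local_section_def by fastforce
  qed
  then show ?thesis
    unfolding jet_pullback_def jeps_def
    by (intro geval_geps jorder_gfin[OF m x(1)] jorder_finite_support[OF m x(1)]) (auto split: prod.split)
qed

lemma dens_jfuns: "f \<in> densities B \<Longrightarrow> i \<in> charts B \<Longrightarrow> f i \<in> jfuns (cimg B i)"
  by (auto simp: densities_def jfuns_def)

lemma densitiesI:
  assumes "\<exists>m. \<forall>i\<in>charts B. jorder_le m (cimg B i) (f i)"
    and "\<And>i. i \<in> charts B \<Longrightarrow> f i \<in> jfuns (cimg B i)"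
    and "\<And>W s i j p T. open W \<Longrightarrow> local_section B W s \<Longrightarrow> i \<in> charts B \<Longrightarrow> j \<in> charts B \<Longrightarrow>
      p \<in> W \<Longrightarrow> p \<in> cdom B i \<Longrightarrow> p \<in> cdom B j \<Longrightarrow>
      jet_pullback (f i) s i (coord B i p) T =
          of_real (det (jacobian B i j p)) * jet_pullback (f j) s j (coord B j p) T"
  shows "f \<in> densities B"
  using assms unfolding densities_def jfuns_def by blast

lemma densitiesD:
  assumes "f \<in> densities B" "open W" "local_section B W s" "i \<in> charts B" "j \<in> charts B"
    "p \<in> W" "p \<in> cdom B i" "p \<in> cdom B j"
  shows "jet_pullback (f i) s i (coord B i p) T =
          of_real (det (jacobian B i j p)) * jet_pullback (f j) s j (coord B j p) T"
  using assms unfolding densities_def by blast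

lemma dens_order: "f \<in> densities B \<Longrightarrow> \<exists>m. \<forall>i\<in>charts B. jorder_le m (cimg B i) (f i)"
  by (auto simp: densities_def)

lemma dens_add:
  assumes f: "f \<in> densities B" and g: "g \<in> densities B" shows "dadd f g \<in> densities B"
proof (rule densitiesI)
  obtain m m' where "\<forall>i\<in>charts B. jorder_le m (cimg B i) (f i)" "\<forall>i\<in>charts B. jorder_le m' (cimg B i) (g i)"
    using dens_order[OF f] dens_order[OF g] by blast
  then show "\<exists>m. \<forall>i\<in>charts B. jorder_le m (cimg B i) (dadd f g i)"
    unfolding dadd_def by (intro exI[of _ "max m m'"] ballI jorder_add) (auto intro: jorder_mono)
  show "dadd f g i \<in> jfuns (cimg B i)" if "i \<in> charts B" for i
    unfolding dadd_def by (intro jfuns_add open_cimg dens_jfuns f g that)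
  fix W s i j p T
  assume a: "open W" "local_section B W s" "i \<in> charts B" "j \<in> charts B" "p \<in> W" "p \<in> cdom B i" "p \<in> cdom B j"
  show "jet_pullback (dadd f g i) s i (coord B i p) T =
          of_real (det (jacobian B i j p)) * jet_pullback (dadd f g j) s j (coord B j p) T"
    unfolding dadd_def
      pullback_add[OF dens_jfuns[OF f a(3)] dens_jfuns[OF g a(3)] coord_in_cimg[OF a(6)]]
      pullback_add[OF dens_jfuns[OF f a(4)] dens_jfuns[OF g a(4)] coord_in_cimg[OF a(7)]]
      densitiesD[OF f a] densitiesD[OF g a] by (simp add: algebra_simps)
qed

lemma dens_scale:
  assumes f: "f \<in> densities B" shows "dscale c f \<in> densities B"
proof (rule densitiesI)
  show "\<exists>m. \<forall>i\<in>charts B. jorder_le m (cimg B i) (dscale c f i)"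
    using dens_order[OF f] unfolding dscale_def by (metis jorder_scale)
  show "dscale c f i \<in> jfuns (cimg B i)" if "i \<in> charts B" for i
    unfolding dscale_def by (intro jfuns_scale open_cimg dens_jfuns f that)
  fix W s i j p T
  assume a: "open W" "local_section B W s" "i \<in> charts B" "j \<in> charts B" "p \<in> W" "p \<in> cdom B i" "p \<in> cdom B j"
  show "jet_pullback (dscale c f i) s i (coord B i p) T =
          of_real (det (jacobian B i j p)) * jet_pullback (dscale c f j) s j (coord B j p) T"
    unfolding dscale_def
      pullback_scale[OF dens_jfuns[OF f a(3)] coord_in_cimg[OF a(6)]]
      pullback_scale[OF dens_jfuns[OF f a(4)] coord_in_cimg[OF a(7)]]
      densitiesD[OF f a] by (simp add: algebra_simps)
qed

text \<open>The transformation law of densities is tested on pull-backs along sections. There the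
  involution is the factor \<open>(-1) ^ card T\<close>, the same in both charts.\<close>

lemma dens_eps:
  assumes f: "f \<in> densities B" shows "deps f \<in> densities B"
proof (rule densitiesI)
  show "\<exists>m. \<forall>i\<in>charts B. jorder_le m (cimg B i) (deps f i)"
    using dens_order[OF f] unfolding deps_def by (metis jorder_jeps)
  show "deps f i \<in> jfuns (cimg B i)" if "i \<in> charts B" for i
    unfolding deps_def by (intro jfuns_jeps open_cimg dens_jfuns f that)
  fix W s i j p T
  assume a: "open W" "local_section B W s" "i \<in> charts B" "j \<in> charts B" "p \<in> W" "p \<in> cdom B i" "p \<in> cdom B j"
  show "jet_pullback (deps f i) s i (coord B i p) T =
          of_real (det (jacobian B i j p)) * jet_pullback (deps f j) s j (coord B j p) T"
    unfolding deps_def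
      pullback_jeps[OF dens_jfuns[OF f a(3)] a(2,1,3,5,6)]
      pullback_jeps[OF dens_jfuns[OF f a(4)] a(2,1,4,5,7)]
      densitiesD[OF f a] by (simp add: algebra_simps)
qed

lemma dens_cong:
  assumes f: "f \<in> densities B" and eq: "deqv B f g" shows "g \<in> densities B"
proof (rule densitiesI)
  have eq: "eqon (cimg B i) (f i) (g i)" if "i \<in> charts B" for i
    using eq that by (simp add: deqv_def)
  show "\<exists>m. \<forall>i\<in>charts B. jorder_le m (cimg B i) (g i)"
    using dens_order[OF f] jorder_cong[OF eq] by blast
  show "g i \<in> jfuns (cimg B i)" if "i \<in> charts B" for i
    using jfuns_cong[OF open_cimg eq dens_jfuns[OF f]] that by blast
  fix W s i j p T
  assume a: "open W" "local_section B W s" "i \<in> charts B" "j \<in> charts B" "p \<in> W" "p \<in> cdom B i" "p \<in> cdom B j"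
  show "jet_pullback (g i) s i (coord B i p) T =
          of_real (det (jacobian B i j p)) * jet_pullback (g j) s j (coord B j p) T"
    unfolding pullback_cong[OF eq[OF a(3)] coord_in_cimg[OF a(6)], symmetric]
      pullback_cong[OF eq[OF a(4)] coord_in_cimg[OF a(7)], symmetric] by (rule densitiesD[OF f a])
qed

lemma currents_jfuns: "\<eta> \<in> currents B \<Longrightarrow> i \<in> charts B \<Longrightarrow> \<eta> k i \<in> jfuns (cimg B i)"
  by (auto simp: currents_def jfuns_def)

lemma currentsI:
  assumes "\<exists>m. \<forall>i\<in>charts B. \<forall>k. jorder_le m (cimg B i) (\<eta> k i)"
    and "\<And>i k. i \<in> charts B \<Longrightarrow> \<eta> k i \<in> jfuns (cimg B i)"
    and "\<And>W s i j p T l. open W \<Longrightarrow> local_section B W s \<Longrightarrow> i \<in> charts B \<Longrightarrow> j \<in> charts B \<Longrightarrow>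
      p \<in> W \<Longrightarrow> p \<in> cdom B i \<Longrightarrow> p \<in> cdom B j \<Longrightarrow>
      (\<Sum>k\<in>UNIV. of_real (jacobian B i j p $ l $ k) * jet_pullback (\<eta> k i) s i (coord B i p) T) =
          of_real (det (jacobian B i j p)) * jet_pullback (\<eta> l j) s j (coord B j p) T"
  shows "\<eta> \<in> currents B"
  using assms unfolding currents_def jfuns_def by blast

lemma currentsD:
  assumes "\<eta> \<in> currents B" "open W" "local_section B W s" "i \<in> charts B" "j \<in> charts B"
    "p \<in> W" "p \<in> cdom B i" "p \<in> cdom B j"
  shows "(\<Sum>k\<in>UNIV. of_real (jacobian B i j p $ l $ k) * jet_pullback (\<eta> k i) s i (coord B i p) T) =
          of_real (det (jacobian B i j p)) * jet_pullback (\<eta> l j) s j (coord B j p) T"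
  using assms unfolding currents_def by blast

lemma currents_order: "\<eta> \<in> currents B \<Longrightarrow> \<exists>m. \<forall>i\<in>charts B. \<forall>k. jorder_le m (cimg B i) (\<eta> k i)"
  by (auto simp: currents_def)

lemma currents_add:
  assumes f: "\<eta> \<in> currents B" and g: "\<zeta> \<in> currents B" shows "(\<lambda>k. dadd (\<eta> k) (\<zeta> k)) \<in> currents B"
proof (rule currentsI)
  obtain m m' where "\<forall>i\<in>charts B. \<forall>k. jorder_le m (cimg B i) (\<eta> k i)" "\<forall>i\<in>charts B. \<forall>k. jorder_le m' (cimg B i) (\<zeta> k i)"
    using currents_order[OF f] currents_order[OF g] by blast
  then show "\<exists>m. \<forall>i\<in>charts B. \<forall>k. jorder_le m (cimg B i) (dadd (\<eta> k) (\<zeta> k) i)"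
    unfolding dadd_def by (intro exI[of _ "max m m'"] ballI allI jorder_add)
      (meson jorder_mono max.cobounded1 max.cobounded2)+
  show "dadd (\<eta> k) (\<zeta> k) i \<in> jfuns (cimg B i)" if "i \<in> charts B" for i k
    unfolding dadd_def by (intro jfuns_add open_cimg currents_jfuns f g that)
  fix W s i j p T l
  assume a: "open W" "local_section B W s" "i \<in> charts B" "j \<in> charts B" "p \<in> W" "p \<in> cdom B i" "p \<in> cdom B j"
  show "(\<Sum>k\<in>UNIV. of_real (jacobian B i j p $ l $ k) * jet_pullback (dadd (\<eta> k) (\<zeta> k) i) s i (coord B i p) T) =
          of_real (det (jacobian B i j p)) * jet_pullback (dadd (\<eta> l) (\<zeta> l) j) s j (coord B j p) T"
    unfolding dadd_def
      pullback_add[OF currents_jfuns[OF f a(3)] currents_jfuns[OF g a(3)] coord_in_cimg[OF a(6)]]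
      pullback_add[OF currents_jfuns[OF f a(4)] currents_jfuns[OF g a(4)] coord_in_cimg[OF a(7)]]
      distrib_left sum.distrib currentsD[OF f a] currentsD[OF g a] ..
qed

lemma currents_scale:
  assumes f: "\<eta> \<in> currents B" shows "(\<lambda>k. dscale c (\<eta> k)) \<in> currents B"
proof (rule currentsI)
  show "\<exists>m. \<forall>i\<in>charts B. \<forall>k. jorder_le m (cimg B i) (dscale c (\<eta> k) i)"
    using currents_order[OF f] unfolding dscale_def by (metis jorder_scale)
  show "dscale c (\<eta> k) i \<in> jfuns (cimg B i)" if "i \<in> charts B" for i k
    unfolding dscale_def by (intro jfuns_scale open_cimg currents_jfuns f that)
  fix W s i j p T l
  assume a: "open W" "local_section B W s" "i \<in> charts B" "j \<in> charts B" "p \<in> W" "p \<in> cdom B i" "p \<in> cdom B j"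
  show "(\<Sum>k\<in>UNIV. of_real (jacobian B i j p $ l $ k) * jet_pullback (dscale c (\<eta> k) i) s i (coord B i p) T) =
          of_real (det (jacobian B i j p)) * jet_pullback (dscale c (\<eta> l) j) s j (coord B j p) T"
    unfolding dscale_def
      pullback_scale[OF currents_jfuns[OF f a(3)] coord_in_cimg[OF a(6)]]
      pullback_scale[OF currents_jfuns[OF f a(4)] coord_in_cimg[OF a(7)]]
      mult.left_commute[of _ c] sum_distrib_left[symmetric] currentsD[OF f a] ..
qed

lemma currents_eps:
  assumes f: "\<eta> \<in> currents B" shows "(\<lambda>k. deps (\<eta> k)) \<in> currents B"
proof (rule currentsI)
  show "\<exists>m. \<forall>i\<in>charts B. \<forall>k. jorder_le m (cimg B i) (deps (\<eta> k) i)"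
    using currents_order[OF f] unfolding deps_def by (metis jorder_jeps)
  show "deps (\<eta> k) i \<in> jfuns (cimg B i)" if "i \<in> charts B" for i k
    unfolding deps_def by (intro jfuns_jeps open_cimg currents_jfuns f that)
  fix W s i j p T l
  assume a: "open W" "local_section B W s" "i \<in> charts B" "j \<in> charts B" "p \<in> W" "p \<in> cdom B i" "p \<in> cdom B j"
  show "(\<Sum>k\<in>UNIV. of_real (jacobian B i j p $ l $ k) * jet_pullback (deps (\<eta> k) i) s i (coord B i p) T) =
          of_real (det (jacobian B i j p)) * jet_pullback (deps (\<eta> l) j) s j (coord B j p) T"
    unfolding deps_def
      pullback_jeps[OF currents_jfuns[OF f a(3)] a(2,1,3,5,6)]
      pullback_jeps[OF currents_jfuns[OF f a(4)] a(2,1,4,5,7)]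
      mult.left_commute[of _ "(-1) ^ _"] sum_distrib_left[symmetric] currentsD[OF f a] ..
qed

lemma exactE:
  assumes "f \<in> exact_densities B"
  obtains \<eta> where "f \<in> densities B" "\<eta> \<in> currents B"
    "\<And>i. i \<in> charts B \<Longrightarrow> eqon (cimg B i) (f i) (\<lambda>x u S. \<Sum>k\<in>UNIV. total_deriv k (\<eta> k i) x u S)"
  using assms unfolding exact_densities_def eqon_def by (auto simp: fun_eq_iff)

lemma exactI:
  assumes "f \<in> densities B" "\<eta> \<in> currents B"
    "\<And>i x u S. i \<in> charts B \<Longrightarrow> x \<in> cimg B i \<Longrightarrow> f i x u S = (\<Sum>k\<in>UNIV. total_deriv k (\<eta> k i) x u S)"
  shows "f \<in> exact_densities B"
  using assms unfolding exact_densities_def by blast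

lemma exact_add:
  assumes f: "f \<in> exact_densities B" and g: "g \<in> exact_densities B" shows "dadd f g \<in> exact_densities B"
proof -
  obtain \<eta> where \<eta>: "f \<in> densities B" "\<eta> \<in> currents B"
    "\<And>i. i \<in> charts B \<Longrightarrow> eqon (cimg B i) (f i) (\<lambda>x u S. \<Sum>k\<in>UNIV. total_deriv k (\<eta> k i) x u S)"
    using f by (rule exactE) blast
  obtain \<zeta> where \<zeta>: "g \<in> densities B" "\<zeta> \<in> currents B"
    "\<And>i. i \<in> charts B \<Longrightarrow> eqon (cimg B i) (g i) (\<lambda>x u S. \<Sum>k\<in>UNIV. total_deriv k (\<zeta> k i) x u S)"
    using g by (rule exactE) blast
  show ?thesis
  proof (rule exactI[OF dens_add[OF \<eta>(1) \<zeta>(1)] currents_add[OF \<eta>(2) \<zeta>(2)]])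
    fix i x u S assume i: "i \<in> charts B" "x \<in> cimg B i"
    show "dadd f g i x u S = (\<Sum>k\<in>UNIV. total_deriv k (dadd (\<eta> k) (\<zeta> k) i) x u S)"
      unfolding dadd_def td_add[OF open_cimg[OF i(1)] currents_jfuns[OF \<eta>(2) i(1)] currents_jfuns[OF \<zeta>(2) i(1)] i(2)]
        sum.distrib eqonD[OF \<eta>(3)[OF i(1)] i(2)] eqonD[OF \<zeta>(3)[OF i(1)] i(2)] ..
  qed
qed

lemma exact_scale:
  assumes f: "f \<in> exact_densities B" shows "dscale c f \<in> exact_densities B"
proof -
  obtain \<eta> where \<eta>: "f \<in> densities B" "\<eta> \<in> currents B"
    "\<And>i. i \<in> charts B \<Longrightarrow> eqon (cimg B i) (f i) (\<lambda>x u S. \<Sum>k\<in>UNIV. total_deriv k (\<eta> k i) x u S)"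
    using f by (rule exactE) blast
  show ?thesis
  proof (rule exactI[OF dens_scale[OF \<eta>(1)] currents_scale[OF \<eta>(2)]])
    fix i x u S assume i: "i \<in> charts B" "x \<in> cimg B i"
    show "dscale c f i x u S = (\<Sum>k\<in>UNIV. total_deriv k (dscale c (\<eta> k) i) x u S)"
      unfolding dscale_def td_scale[OF open_cimg[OF i(1)] currents_jfuns[OF \<eta>(2) i(1)] i(2)]
        sum_distrib_left[symmetric] eqonD[OF \<eta>(3)[OF i(1)] i(2)] ..
  qed
qed

text \<open>Total derivatives are even, so the involution of a primitive is a primitive of the
  involution.\<close>

lemma exact_eps:
  assumes f: "f \<in> exact_densities B" shows "deps f \<in> exact_densities B"
proof -
  obtain \<eta> where \<eta>: "f \<in> densities B" "\<eta> \<in> currents B"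
    "\<And>i. i \<in> charts B \<Longrightarrow> eqon (cimg B i) (f i) (\<lambda>x u S. \<Sum>k\<in>UNIV. total_deriv k (\<eta> k i) x u S)"
    using f by (rule exactE) blast
  show ?thesis
  proof (rule exactI[OF dens_eps[OF \<eta>(1)] currents_eps[OF \<eta>(2)]])
    fix i x u S assume i: "i \<in> charts B" "x \<in> cimg B i"
    show "deps f i x u S = (\<Sum>k\<in>UNIV. total_deriv k (deps (\<eta> k) i) x u S)"
      unfolding deps_def td_jeps[OF open_cimg[OF i(1)] currents_jfuns[OF \<eta>(2) i(1)] i(2)]
        jeps_apply sum_distrib_left[symmetric] eqonD[OF \<eta>(3)[OF i(1)] i(2)] ..
  qed
qed

lemma exact_cong:
  assumes "f \<in> exact_densities B" "deqv B f g" shows "g \<in> exact_densities B"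
proof -
  obtain \<eta> where \<eta>: "f \<in> densities B" "\<eta> \<in> currents B"
    "\<And>i. i \<in> charts B \<Longrightarrow> eqon (cimg B i) (f i) (\<lambda>x u S. \<Sum>k\<in>UNIV. total_deriv k (\<eta> k i) x u S)"
    using assms(1) by (rule exactE) blast
  show ?thesis
    by (rule exactI[OF dens_cong[OF \<eta>(1) assms(2)] \<eta>(2)])
       (use eqonD[OF \<eta>(3)] deqvD[OF assms(2)] in force)
qed

lemma exact_zero: assumes "f \<in> densities B" "deqv B f (\<lambda>i x u S. 0)" shows "f \<in> exact_densities B"
proof -
  have "(\<lambda>k i x u S. 0) \<in> currents B"
    by (rule currentsI) (auto simp: jorder_zero_fun intro: jfuns_zero open_cimg simp: jet_pullback_def geval_def)
  then show ?thesis
    by (rule exactI[OF assms(1)]) (use assms(2) in \<open>auto simp: deqvD td_zero[OF open_cimg]\<close>)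
qed

section \<open>Integral functionals as classes of densities\<close>

lemma hclass_self:
  assumes f: "f \<in> densities B" shows "f \<in> hclass B f"
proof -
  have "dadd f (dscale (-1) f) \<in> exact_densities B"
    by (rule exact_zero[OF dens_add[OF f dens_scale[OF f]]]) (auto simp: dadd_def dscale_def intro: deqvI)
  with f show ?thesis by (simp add: hclass_def ddiff)
qed

lemma hclass_eq_iff:
  assumes f: "f \<in> densities B" and g: "g \<in> densities B"
  shows "hclass B f = hclass B g \<longleftrightarrow> dadd g (dscale (-1) f) \<in> exact_densities B"
proof
  assume "hclass B f = hclass B g"
  moreover have "g \<in> hclass B g" by (rule hclass_self[OF g])
  ultimately show "dadd g (dscale (-1) f) \<in> exact_densities B"
    by (auto simp: hclass_def ddiff)
next
  assume e: "dadd g (dscale (-1) f) \<in> exact_densities B"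
  have e': "dadd f (dscale (-1) g) \<in> exact_densities B"
    by (rule exact_cong[OF exact_scale[OF e, of "-1"]]) (auto simp: dadd_def dscale_def intro: deqvI)
  have "dadd h (dscale (-1) g) \<in> exact_densities B" if "dadd h (dscale (-1) f) \<in> exact_densities B" for h
    by (rule exact_cong[OF exact_add[OF that e']]) (auto simp: dadd_def dscale_def intro: deqvI)
  moreover have "dadd h (dscale (-1) f) \<in> exact_densities B" if "dadd h (dscale (-1) g) \<in> exact_densities B" for h
    by (rule exact_cong[OF exact_add[OF that e]]) (auto simp: dadd_def dscale_def intro: deqvI)
  ultimately show "hclass B f = hclass B g"
    unfolding hclass_def ddiff by blast
qed

lemma in_hclassD:
  assumes "f \<in> densities B" "g \<in> hclass B f"
  shows "g \<in> densities B" "hclass B g = hclass B f" "dadd g (dscale (-1) f) \<in> exact_densities B"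
  using assms hclass_eq_iff[of f g] by (auto simp: hclass_def ddiff)

lemma hclass_deqv:
  assumes "f \<in> densities B" "deqv B f g" shows "hclass B f = hclass B g"
  unfolding hclass_eq_iff[OF assms(1) dens_cong[OF assms]]
  by (intro exact_zero dens_add dens_scale dens_cong[OF assms] assms(1))
     (use deqvD[OF assms(2)] in \<open>auto simp: dadd_def dscale_def intro!: deqvI\<close>)

lemma integral_functionalsE:
  assumes "F \<in> integral_functionals B" obtains f where "f \<in> densities B" "F = hclass B f"
  using assms by (auto simp: integral_functionals_def)

lemma hclass_in: "f \<in> densities B \<Longrightarrow> hclass B f \<in> integral_functionals B"
  by (simp add: integral_functionals_def)

text \<open>Operations on classes are unions over representatives. Once all of them give the same
  result, the union collapses to it, the class being nonempty.\<close>

lemma UN_hclass: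
  assumes "f \<in> densities B" "\<And>g. g \<in> hclass B f \<Longrightarrow> \<Phi> g = \<Phi> f"
  shows "(\<Union>g\<in>hclass B f. \<Phi> g) = \<Phi> f"
proof -
  have "(\<Union>g\<in>hclass B f. \<Phi> g) = (\<Union>g\<in>hclass B f. \<Phi> f)"
    by (rule SUP_cong[OF refl assms(2)])
  with hclass_self[OF assms(1)] show ?thesis by auto
qed

lemma hadd_hclass:
  assumes f: "f \<in> densities B" and g: "g \<in> densities B"
  shows "hadd B (hclass B f) (hclass B g) = hclass B (dadd f g)"
proof -
  have *: "hclass B (dadd f' g') = hclass B (dadd f g)" if "f' \<in> hclass B f" "g' \<in> hclass B g" for f' g'
  proof -
    note f' = in_hclassD[OF f that(1)] and g' = in_hclassD[OF g that(2)]
    have "hclass B (dadd f g) = hclass B (dadd f' g')"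
      unfolding hclass_eq_iff[OF dens_add[OF f g] dens_add[OF f'(1) g'(1)]]
      by (rule exact_cong[OF exact_add[OF f'(3) g'(3)]])
         (auto simp: dadd_def dscale_def intro: deqvI)
    then show ?thesis ..
  qed
  have "(\<Union>f'\<in>hclass B f. \<Union>g'\<in>hclass B g. hclass B (dadd f' g')) =
      (\<Union>f'\<in>hclass B f. \<Union>g'\<in>hclass B g. hclass B (dadd f g))"
    by (intro SUP_cong refl *)
  with hclass_self[OF f] hclass_self[OF g] show ?thesis
    unfolding hadd_def dadd_def[symmetric] by auto
qed

lemma hscale_hclass:
  assumes f: "f \<in> densities B"
  shows "hscale B c (hclass B f) = hclass B (dscale c f)"
  unfolding hscale_def dscale_def[symmetric]
proof (rule UN_hclass[OF f])
  fix g assume g: "g \<in> hclass B f"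
  note g = in_hclassD[OF f g]
  have "hclass B (dscale c f) = hclass B (dscale c g)"
    unfolding hclass_eq_iff[OF dens_scale[OF f] dens_scale[OF g(1)]]
    by (rule exact_cong[OF exact_scale[OF g(3), of c]])
       (auto simp: dadd_def dscale_def algebra_simps intro: deqvI)
  then show "hclass B (dscale c g) = hclass B (dscale c f)" ..
qed

text \<open>The parity involution on integral functionals; it descends to classes because exact
  densities are stable under \<open>deps\<close>.\<close>

definition hsig where "hsig F = (\<Union>f\<in>F. hclass B (deps f))"

lemma hsig_hclass:
  assumes f: "f \<in> densities B"
  shows "hsig (hclass B f) = hclass B (deps f)"
  unfolding hsig_def
proof (rule UN_hclass[OF f])
  fix g assume g: "g \<in> hclass B f"
  note g = in_hclassD[OF f g]
  have "hclass B (deps f) = hclass B (deps g)"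
    unfolding hclass_eq_iff[OF dens_eps[OF f] dens_eps[OF g(1)]]
    by (rule exact_cong[OF exact_eps[OF g(3)]])
       (auto simp: dadd_def dscale_def deps_def jeps_apply algebra_simps intro: deqvI)
  then show "hclass B (deps g) = hclass B (deps f)" ..
qed

section \<open>Variational derivatives depend only on the class\<close>

lemma var_exact:
  assumes d: "d \<in> exact_densities B" and i: "i \<in> charts B" and x: "x \<in> cimg B i"
  shows "var_q \<alpha> (d i) x u S = 0" "var_thL \<alpha> (d i) x u S = 0"
proof -
  obtain \<eta> where \<eta>: "d \<in> densities B" "\<eta> \<in> currents B"
    "\<And>i. i \<in> charts B \<Longrightarrow> eqon (cimg B i) (d i) (\<lambda>x u S. \<Sum>k\<in>UNIV. total_deriv k (\<eta> k i) x u S)"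
    using d by (rule exactE) blast
  show "var_q \<alpha> (d i) x u S = 0"
    by (rule var_q_divergence[OF open_cimg[OF i] currents_jfuns[OF \<eta>(2) i] \<eta>(3)[OF i] x])
  show "var_thL \<alpha> (d i) x u S = 0"
    by (rule var_thL_divergence[OF open_cimg[OF i] currents_jfuns[OF \<eta>(2) i] \<eta>(3)[OF i] x])
qed

text \<open>Two representatives differ by an exact density, and linearity removes its
  contribution.\<close>

lemma jlinear_op_equiv:
  assumes L: "jlinear_op (cimg B i) L" and z: "\<And>d x u S. d \<in> exact_densities B \<Longrightarrow> x \<in> cimg B i \<Longrightarrow> L (d i) x u S = 0"
    and f: "f \<in> densities B" and g: "g \<in> hclass B f" and i: "i \<in> charts B"
  shows "eqon (cimg B i) (L (g i)) (L (f i))"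
proof (rule eqonI)
  fix x u S assume x: "x \<in> cimg B i"
  note g = in_hclassD[OF f g]
  have "eqon (cimg B i) (g i) (\<lambda>x u S. f i x u S + dadd g (dscale (-1) f) i x u S)"
    by (rule eqonI) (simp add: dadd_def dscale_def)
  then have "L (g i) x u S = L (\<lambda>x u S. f i x u S + dadd g (dscale (-1) f) i x u S) x u S"
    by (rule eqonD[OF jlinear_opD(2)[OF L] x])
  also have "\<dots> = L (f i) x u S + L (dadd g (dscale (-1) f) i) x u S"
    by (rule eqonD[OF jlinear_opD(3)[OF L dens_jfuns[OF f i] dens_jfuns[OF _ i]] x])
       (intro dens_add dens_scale f g)
  also have "L (dadd g (dscale (-1) f) i) x u S = 0" by (rule z[OF g(3) x])
  finally show "L (g i) x u S = L (f i) x u S" by simp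
qed

lemma var_equiv:
  assumes f: "f \<in> densities B" and g: "g \<in> hclass B f" and i: "i \<in> charts B"
  shows "eqon (cimg B i) (var_q \<alpha> (g i)) (var_q \<alpha> (f i))"
    and "eqon (cimg B i) (var_thL \<alpha> (g i)) (var_thL \<alpha> (f i))"
    and "eqon (cimg B i) (var_thR \<alpha> (g i)) (var_thR \<alpha> (f i))"
proof -
  show "eqon (cimg B i) (var_q \<alpha> (g i)) (var_q \<alpha> (f i))"
    by (rule jlinear_op_equiv[where L = "var_q \<alpha>", OF jlinear_op_var_q[OF open_cimg[OF i]] _ f g i])
      (rule var_exact(1)[OF _ i])
  show thL: "eqon (cimg B i) (var_thL \<alpha> (g i)) (var_thL \<alpha> (f i))"
    by (rule jlinear_op_equiv[where L = "var_thL \<alpha>", OF jlinear_op_var_thL[OF open_cimg[OF i]] _ f g i])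
      (rule var_exact(2)[OF _ i])
  have "eqon (cimg B i) (var_thR \<alpha> (g i)) (jeps (var_thL \<alpha> (g i)))"
    by (rule var_thR_eq[OF open_cimg[OF i] dens_jfuns[OF in_hclassD(1)[OF f g] i]])
  also have "eqon (cimg B i) \<dots> (jeps (var_thL \<alpha> (f i)))" by (rule eqon_jeps[OF thL])
  also have "eqon (cimg B i) \<dots> (var_thR \<alpha> (f i))"
    by (rule eqon_sym[OF var_thR_eq[OF open_cimg[OF i] dens_jfuns[OF f i]]])
  finally show "eqon (cimg B i) (var_thR \<alpha> (g i)) (var_thR \<alpha> (f i))" .
qed

lemma jlinear_op_lap: "i \<in> charts B \<Longrightarrow> jlinear_op (cimg B i) (\<lambda>f. var_q \<alpha> (var_thL \<alpha> f))"
  by (rule jlinear_op_comp[OF jlinear_op_var_q[OF open_cimg] jlinear_op_var_thL[OF open_cimg]])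

end

context bv_geometry begin

section \<open>Linearity and parity of the Laplacian and of the bracket\<close>

lemma laplacian_add:
  assumes f: "f \<in> densities B" and g: "g \<in> densities B"
  shows "deqv B (laplacian_dens (dadd f g)) (dadd (laplacian_dens f) (laplacian_dens g))"
proof (rule deqvI)
  fix i x u S assume i: "i \<in> charts B" and x: "x \<in> cimg B i"
  have "var_q \<alpha> (var_thL \<alpha> (\<lambda>x u S. f i x u S + g i x u S)) x u S =
      var_q \<alpha> (var_thL \<alpha> (f i)) x u S + var_q \<alpha> (var_thL \<alpha> (g i)) x u S" for \<alpha>
    by (rule eqonD[OF jlinear_opD(3)[OF jlinear_op_lap[OF i] dens_jfuns[OF f i] dens_jfuns[OF g i]] x])
  then show "laplacian_dens (dadd f g) i x u S = dadd (laplacian_dens f) (laplacian_dens g) i x u S"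
    unfolding laplacian_dens_def dadd_def sum.distrib[symmetric]
    by (rule sum.cong[OF refl])
qed

lemma laplacian_scale:
  assumes f: "f \<in> densities B"
  shows "deqv B (laplacian_dens (dscale c f)) (dscale c (laplacian_dens f))"
proof (rule deqvI)
  fix i x u S assume i: "i \<in> charts B" and x: "x \<in> cimg B i"
  show "laplacian_dens (dscale c f) i x u S = dscale c (laplacian_dens f) i x u S"
    unfolding laplacian_dens_def dscale_def sum_distrib_left
    by (rule sum.cong[OF refl]) (rule eqonD[OF jlinear_opD(4)[OF jlinear_op_lap[OF i] dens_jfuns[OF f i]] x])
qed

text \<open>The inner variational derivative is already the same function for equivalent densities,
  so the Laplacians coincide in every chart and not merely up to exact terms.\<close>

lemma laplacian_equiv:
  assumes f: "f \<in> densities B" and g: "g \<in> hclass B f"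
  shows "deqv B (laplacian_dens g) (laplacian_dens f)"
  by (rule deqvI, unfold laplacian_dens_def)
     (intro sum.cong refl eqonD[OF jlinear_opD(2)[OF jlinear_op_var_q[OF open_cimg] var_equiv(2)[OF f g]]])

lemma bracket_equiv:
  assumes "f \<in> densities B" "f' \<in> hclass B f" "g \<in> densities B" "g' \<in> hclass B g"
  shows "deqv B (bracket_dens f' g') (bracket_dens f g)"
proof (rule deqvI)
  fix i x u S assume i: "i \<in> charts B" and x: "x \<in> cimg B i"
  note vf = var_equiv[OF assms(1,2) i, unfolded eqon_def, rule_format, OF x]
  note vg = var_equiv[OF assms(3,4) i, unfolded eqon_def, rule_format, OF x]
  show "bracket_dens f' g' i x u S = bracket_dens f g i x u S"
    unfolding bracket_dens_def vf vg ..
qed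

text \<open>Parity as an eigenvalue equation of the involution. In this form it can be carried
  through linear operators; \<open>dpar_iff\<close> recovers the description by nonzero
  coefficients.\<close>

definition dpar :: "nat \<Rightarrow> ('i, 'n, 'a, 'k) dens \<Rightarrow> bool" where
  "dpar p f \<longleftrightarrow> deqv B (deps f) (dscale ((-1) ^ p) f)"

lemma dpar_iff: "dpar p f \<longleftrightarrow> (\<forall>i\<in>charts B. \<forall>x\<in>cimg B i. \<forall>u S. f i x u S \<noteq> 0 \<longrightarrow> even (card S + p))"
proof -
  have pow: "(-1) ^ n = ((-1) ^ p :: 'k) \<longleftrightarrow> even (n + p)" for n
    by (cases "even n"; cases "even p") auto
  have "(-1) ^ card S * z = (-1) ^ p * z \<longleftrightarrow> (z \<noteq> 0 \<longrightarrow> even (card S + p))"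
    for z :: 'k and S :: "('n, 'a) jvar set"
    by (cases "z = 0") (simp_all only: mult_cancel_right pow simp_thms mult_zero_right)
  then show ?thesis
    unfolding dpar_def deqv_def eqon_def deps_def dscale_def fun_eq_iff jeps_apply by (simp only:)
qed

lemma hparity_iff: "hparity B p F \<longleftrightarrow> (\<exists>f\<in>densities B. F = hclass B f \<and> dpar p f)"
proof
  assume *: "hparity B p F"
  then obtain f0 where f0: "f0 \<in> densities B" "F = hclass B f0"
    unfolding hparity_def by (auto elim: integral_functionalsE)
  from * obtain f where f: "f \<in> F" "dpar p f" unfolding hparity_def dpar_iff by blast
  then show "\<exists>f\<in>densities B. F = hclass B f \<and> dpar p f"
    using in_hclassD[OF f0(1)] f0(2) by metis
next
  assume "\<exists>f\<in>densities B. F = hclass B f \<and> dpar p f"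
  then show "hparity B p F"
    unfolding hparity_def dpar_iff using hclass_in hclass_self by blast
qed

text \<open>An even and an odd variational derivative are composed. The former commutes with the
  involution, the latter anticommutes with it and so shifts the parity by one.\<close>

lemma laplacian_par:
  assumes f: "f \<in> densities B" and p: "dpar p f"
  shows "dpar (p + 1) (laplacian_dens f)"
  unfolding dpar_def
proof (rule deqvI)
  fix i x u S assume i: "i \<in> charts B" and x: "x \<in> cimg B i"
  let ?\<Omega> = "cimg B i"
  note op = open_cimg[OF i] and J = dens_jfuns[OF f i]
  have "jeps (var_q \<alpha> (var_thL \<alpha> (f i))) x u S = (-1) ^ (p + 1) * var_q \<alpha> (var_thL \<alpha> (f i)) x u S" for \<alpha>
  proof -
    note T = jlinear_opD[OF jlinear_op_var_thL[OF op, of \<alpha>]] and Q = jlinear_opD[OF jlinear_op_var_q[OF op, of \<alpha>]]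
    have "eqon ?\<Omega> (jeps (f i)) (\<lambda>x u S. (-1) ^ p * f i x u S)"
      using p i by (auto simp: dpar_def deqv_def deps_def dscale_def)
    then have "eqon ?\<Omega> (var_thL \<alpha> (jeps (f i))) (var_thL \<alpha> (\<lambda>x u S. (-1) ^ p * f i x u S))"
      by (rule T(2))
    from eqon_trans[OF this T(4)[OF J]] have
      1: "eqon ?\<Omega> (var_thL \<alpha> (jeps (f i))) (\<lambda>x u S. (-1) ^ p * var_thL \<alpha> (f i) x u S)" .
    have "eqon ?\<Omega> (jeps (var_thL \<alpha> (f i))) (\<lambda>x u S. (-1) ^ (p + 1) * var_thL \<alpha> (f i) x u S)"
    proof (rule eqonI)
      fix x u S assume x: "x \<in> ?\<Omega>"
      show "jeps (var_thL \<alpha> (f i)) x u S = (-1) ^ (p + 1) * var_thL \<alpha> (f i) x u S"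
        using eqonD[OF 1 x, of u S] eqonD[OF var_thL_jeps[OF op J] x, of \<alpha> u S]
        by (simp add: equation_minus_iff[of "jeps _ _ _ _"])
    qed
    from eqonD[OF eqon_trans[OF eqon_sym[OF var_q_jeps[OF op T(1)[OF J]]] eqon_trans[OF Q(2)[OF this] Q(4)[OF T(1)[OF J]]]] x]
    show ?thesis .
  qed
  then show "deps (laplacian_dens f) i x u S = dscale ((-1) ^ (p + 1)) (laplacian_dens f) i x u S"
    unfolding deps_def dscale_def laplacian_dens_def jeps_apply sum_distrib_left by (simp only:)
qed

lemma var_par:
  assumes f: "f \<in> densities B" and p: "dpar p f" and i: "i \<in> charts B" and x: "x \<in> cimg B i"
  shows "geps (var_q \<alpha> (f i) x u) = (\<lambda>S. (-1) ^ p * var_q \<alpha> (f i) x u S)"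
    and "geps (var_thL \<alpha> (f i) x u) = (\<lambda>S. (-1) ^ (p + 1) * var_thL \<alpha> (f i) x u S)"
    and "geps (var_thR \<alpha> (f i) x u) = (\<lambda>S. (-1) ^ (p + 1) * var_thR \<alpha> (f i) x u S)"
proof -
  let ?\<Omega> = "cimg B i"
  note op = open_cimg[OF i] and J = dens_jfuns[OF f i]
  note T = jlinear_opD[OF jlinear_op_var_thL[OF op, of \<alpha>]] and Q = jlinear_opD[OF jlinear_op_var_q[OF op, of \<alpha>]]
  have e: "eqon ?\<Omega> (jeps (f i)) (\<lambda>x u S. (-1) ^ p * f i x u S)"
    using p i by (auto simp: dpar_def deqv_def deps_def dscale_def)
  show "geps (var_q \<alpha> (f i) x u) = (\<lambda>S. (-1) ^ p * var_q \<alpha> (f i) x u S)"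
    using eqonD[OF eqon_trans[OF eqon_trans[OF eqon_sym[OF var_q_jeps[OF op J, of \<alpha>]] Q(2)[OF e]] Q(4)[OF J]] x]
    by (auto simp: jeps_def)
  have "eqon ?\<Omega> (\<lambda>x u S. - jeps (var_thL \<alpha> (f i)) x u S) (\<lambda>x u S. (-1) ^ p * var_thL \<alpha> (f i) x u S)"
    by (rule eqon_trans[OF eqon_trans[OF eqon_sym[OF var_thL_jeps[OF op J]] T(2)[OF e]] T(4)[OF J]])
  then have "- jeps (var_thL \<alpha> (f i)) x u S = (-1) ^ p * var_thL \<alpha> (f i) x u S" for S
    by (rule eqonD[OF _ x])
  then have thL: "jeps (var_thL \<alpha> (f i)) x u S = (-1) ^ (p + 1) * var_thL \<alpha> (f i) x u S" for S
    by (simp add: equation_minus_iff[of "jeps _ _ _ _"])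
  then show "geps (var_thL \<alpha> (f i) x u) = (\<lambda>S. (-1) ^ (p + 1) * var_thL \<alpha> (f i) x u S)"
    by (auto simp: jeps_def)
  have R: "var_thR \<alpha> (f i) x u = jeps (var_thL \<alpha> (f i)) x u"
    using var_thR_eq[OF op J] x by (simp add: eqon_def)
  show "geps (var_thR \<alpha> (f i) x u) = (\<lambda>S. (-1) ^ (p + 1) * var_thR \<alpha> (f i) x u S)"
  proof
    fix S
    have "geps (jeps (var_thL \<alpha> (f i)) x u) S = var_thL \<alpha> (f i) x u S"
      by (simp add: geps_def jeps_apply)
    then show "geps (var_thR \<alpha> (f i) x u) S = (-1) ^ (p + 1) * var_thR \<alpha> (f i) x u S"
      unfolding R thL by simp
  qed
qed

text \<open>The involution is multiplicative, and every product in the bracket contains exactly one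
  variation with respect to an odd variable.\<close>

lemma bracket_par:
  assumes f: "f \<in> densities B" "dpar p f" and g: "g \<in> densities B" "dpar q g"
  shows "dpar (p + q + 1) (bracket_dens f g)"
  unfolding dpar_def
proof (rule deqvI)
  fix i x u S assume i: "i \<in> charts B" and x: "x \<in> cimg B i"
  note vf = var_par[OF f i x] and vg = var_par[OF g i x]
  have "(-1) ^ card S * gmul (var_q \<alpha> (f i) x u) (var_thL \<alpha> (g i) x u) S
      = (-1) ^ (p + q + 1) * gmul (var_q \<alpha> (f i) x u) (var_thL \<alpha> (g i) x u) S"
    "(-1) ^ card S * gmul (var_thR \<alpha> (f i) x u) (var_q \<alpha> (g i) x u) S
      = (-1) ^ (p + q + 1) * gmul (var_thR \<alpha> (f i) x u) (var_q \<alpha> (g i) x u) S" for \<alpha>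
    using geps_gmul[of "var_q \<alpha> (f i) x u" "var_thL \<alpha> (g i) x u", unfolded vf vg gmul_scale_left gmul_scale_right]
      geps_gmul[of "var_thR \<alpha> (f i) x u" "var_q \<alpha> (g i) x u", unfolded vf vg gmul_scale_left gmul_scale_right]
    by (auto simp: geps_def fun_eq_iff power_add mult_ac)
  then show "deps (bracket_dens f g) i x u S = dscale ((-1) ^ (p + q + 1)) (bracket_dens f g) i x u S"
    unfolding deps_def dscale_def bracket_dens_def jeps_apply sum_distrib_left right_diff_distrib
    by (simp only:)
qed

lemma hparity_hsig:
  assumes "hparity B p F" shows "hsig F = hscale B ((-1) ^ p) F"
proof -
  obtain f where f: "f \<in> densities B" "F = hclass B f" "dpar p f" using assms hparity_iff by blast
  then show ?thesis
    using hclass_deqv[OF dens_eps[OF f(1)]] by (simp add: hsig_hclass hscale_hclass dpar_def)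
qed

text \<open>Half the sum and half the difference of \<open>f\<close> and \<open>deps f\<close> are
  eigenvectors of the involution for the eigenvalues 1 and -1, and they add up to
  \<open>f\<close>.\<close>

lemma hparity_decomp:
  assumes "F \<in> integral_functionals B"
  shows "\<exists>F0 F1. hparity B 0 F0 \<and> hparity B 1 F1 \<and> F = hadd B F0 F1"
proof -
  obtain f where f: "f \<in> densities B" "F = hclass B f" using assms by (rule integral_functionalsE)
  let ?g = "\<lambda>c. dscale (1/2) (dadd f (dscale c (deps f)))"
  have g: "?g c \<in> densities B" for c by (intro dens_scale dens_add dens_eps f)
  have "dpar 0 (?g 1)" "dpar 1 (?g (-1))"
    unfolding dpar_def by (auto simp: deps_def dscale_def dadd_def jeps_apply algebra_simps intro!: deqvI)
  then have "hparity B 0 (hclass B (?g 1))" "hparity B 1 (hclass B (?g (-1)))"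
    using g hparity_iff by blast+
  moreover have "F = hadd B (hclass B (?g 1)) (hclass B (?g (-1)))"
    unfolding hadd_hclass[OF g g] f(2)
    by (rule hclass_deqv[OF f(1)]) (auto simp: dscale_def dadd_def field_simps intro!: deqvI)
  ultimately show ?thesis by blast
qed

lemma hsig_in: "F \<in> integral_functionals B \<Longrightarrow> hsig F \<in> integral_functionals B"
  by (elim integral_functionalsE) (simp add: hsig_hclass hclass_in dens_eps)

lemma hadd_in: "F \<in> integral_functionals B \<Longrightarrow> G \<in> integral_functionals B \<Longrightarrow> hadd B F G \<in> integral_functionals B"
  by (elim integral_functionalsE) (simp add: hadd_hclass hclass_in dens_add)

lemma hscale_in: "F \<in> integral_functionals B \<Longrightarrow> hscale B c F \<in> integral_functionals B"
  by (elim integral_functionalsE) (simp add: hscale_hclass hclass_in dens_scale)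

lemma hsig_hadd:
  assumes "F \<in> integral_functionals B" "G \<in> integral_functionals B"
  shows "hsig (hadd B F G) = hadd B (hsig F) (hsig G)"
proof -
  obtain f g where f: "f \<in> densities B" "F = hclass B f" and g: "g \<in> densities B" "G = hclass B g"
    using assms by (meson integral_functionalsE)
  show ?thesis
    unfolding f(2) g(2) hadd_hclass[OF f(1) g(1)] hsig_hclass[OF f(1)] hsig_hclass[OF g(1)]
      hsig_hclass[OF dens_add[OF f(1) g(1)]] hadd_hclass[OF dens_eps[OF f(1)] dens_eps[OF g(1)]]
    by (rule hclass_deqv[OF dens_eps[OF dens_add[OF f(1) g(1)]]])
       (auto simp: deps_def dadd_def jeps_apply algebra_simps intro!: deqvI)
qed

lemma hsig_hscale:
  assumes "F \<in> integral_functionals B"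
  shows "hsig (hscale B c F) = hscale B c (hsig F)"
proof -
  obtain f where f: "f \<in> densities B" "F = hclass B f"
    using assms by (rule integral_functionalsE)
  show ?thesis
    unfolding f(2) hscale_hclass[OF f(1)] hsig_hclass[OF f(1)]
      hsig_hclass[OF dens_scale[OF f(1)]] hscale_hclass[OF dens_eps[OF f(1)]]
    by (rule hclass_deqv[OF dens_eps[OF dens_scale[OF f(1)]]])
       (auto simp: deps_def dscale_def jeps_apply algebra_simps intro!: deqvI)
qed

end

text \<open>The coordinate formulas for the Laplacian and the bracket do not obey the transformation
  law of densities automatically, so this is assumed. Independence of the representatives is then
  proved.\<close>

locale bv_operations = bv_geometry B
  for B :: "('i, 'm::{t2_space,second_countable_topology}, 'n::finite, 'a::finite,
                'k::{real_normed_field,euclidean_space}) bv_bundle" +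
  assumes laplacian_well_defined: "\<And>h. h \<in> densities B \<Longrightarrow> laplacian_dens h \<in> densities B"
    and bracket_well_defined:
      "\<And>f g. f \<in> densities B \<Longrightarrow> g \<in> densities B \<Longrightarrow> bracket_dens f g \<in> densities B"
begin

lemma hlaplacian_hclass:
  assumes f: "f \<in> densities B"
  shows "hlaplacian B (hclass B f) = hclass B (laplacian_dens f)"
  unfolding hlaplacian_def
proof (rule UN_hclass[OF f])
  fix g assume g: "g \<in> hclass B f"
  show "hclass B (laplacian_dens g) = hclass B (laplacian_dens f)"
    by (rule hclass_deqv[OF laplacian_well_defined laplacian_equiv[OF f g]]) (rule in_hclassD(1)[OF f g])
qed

lemma hbracket_hclass:
  assumes f: "f \<in> densities B" and g: "g \<in> densities B"
  shows "hbracket B (hclass B f) (hclass B g) = hclass B (bracket_dens f g)"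
proof -
  have *: "hclass B (bracket_dens f' g') = hclass B (bracket_dens f g)"
    if "f' \<in> hclass B f" "g' \<in> hclass B g" for f' g'
    by (rule hclass_deqv[OF bracket_well_defined[OF in_hclassD(1)[OF f that(1)] in_hclassD(1)[OF g that(2)]]
          bracket_equiv[OF f that(1) g that(2)]])
  have "(\<Union>f'\<in>hclass B f. \<Union>g'\<in>hclass B g. hclass B (bracket_dens f' g')) =
      (\<Union>f'\<in>hclass B f. \<Union>g'\<in>hclass B g. hclass B (bracket_dens f g))"
    by (intro SUP_cong refl *)
  with hclass_self[OF f] hclass_self[OF g] show ?thesis
    unfolding hbracket_def by auto
qed

lemma hlaplacian_in: "F \<in> integral_functionals B \<Longrightarrow> hlaplacian B F \<in> integral_functionals B"
  by (elim integral_functionalsE) (simp add: hlaplacian_hclass hclass_in laplacian_well_defined)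

lemma hlaplacian_hadd:
  assumes "F \<in> integral_functionals B" "G \<in> integral_functionals B"
  shows "hlaplacian B (hadd B F G) = hadd B (hlaplacian B F) (hlaplacian B G)"
proof -
  obtain f g where f: "f \<in> densities B" "F = hclass B f" and g: "g \<in> densities B" "G = hclass B g"
    using assms by (meson integral_functionalsE)
  show ?thesis
    unfolding f(2) g(2) hadd_hclass[OF f(1) g(1)] hlaplacian_hclass[OF f(1)] hlaplacian_hclass[OF g(1)]
      hlaplacian_hclass[OF dens_add[OF f(1) g(1)]]
      hadd_hclass[OF laplacian_well_defined[OF f(1)] laplacian_well_defined[OF g(1)]]
    by (rule hclass_deqv[OF laplacian_well_defined[OF dens_add[OF f(1) g(1)]] laplacian_add[OF f(1) g(1)]])
qed

lemma hlaplacian_hscale: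
  assumes "F \<in> integral_functionals B"
  shows "hlaplacian B (hscale B c F) = hscale B c (hlaplacian B F)"
proof -
  obtain f where f: "f \<in> densities B" "F = hclass B f"
    using assms by (rule integral_functionalsE)
  show ?thesis
    unfolding f(2) hscale_hclass[OF f(1)] hlaplacian_hclass[OF f(1)]
      hlaplacian_hclass[OF dens_scale[OF f(1)]] hscale_hclass[OF laplacian_well_defined[OF f(1)]]
    by (rule hclass_deqv[OF laplacian_well_defined[OF dens_scale[OF f(1)]] laplacian_scale[OF f(1)]])
qed

lemma hparity_hlaplacian: "hparity B p F \<Longrightarrow> hparity B (p + 1) (hlaplacian B F)"
  unfolding hparity_iff using laplacian_par laplacian_well_defined hlaplacian_hclass by blast

lemma hparity_hbracket: "hparity B p F \<Longrightarrow> hparity B q G \<Longrightarrow> hparity B (p + q + 1) (hbracket B F G)"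
  unfolding hparity_iff using bracket_par bracket_well_defined hbracket_hclass by blast

end

section \<open>The tensor algebra\<close>

lemma lookup_tscale [simp]: "Poly_Mapping.lookup (tscale c x) w = c * Poly_Mapping.lookup x w"
  by (auto simp: tscale_def Poly_Mapping.map.rep_eq when_def)

interpretation tens: vector_space "tscale :: 'k::field \<Rightarrow> ('w \<Rightarrow>\<^sub>0 'k) \<Rightarrow> ('w \<Rightarrow>\<^sub>0 'k)"
  by unfold_locales (rule poly_mapping_eqI, simp add: lookup_add algebra_simps)+

interpretation tens_pair: vector_space_pair
  "tscale :: 'k::field \<Rightarrow> ('w \<Rightarrow>\<^sub>0 'k) \<Rightarrow> ('w \<Rightarrow>\<^sub>0 'k)" "tscale :: 'k::field \<Rightarrow> ('z \<Rightarrow>\<^sub>0 'k) \<Rightarrow> ('z \<Rightarrow>\<^sub>0 'k)"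
  by unfold_locales

abbreviation wd :: "'w \<Rightarrow> ('w \<Rightarrow>\<^sub>0 'k::field)" where "wd w \<equiv> Poly_Mapping.single w 1"

lemma single_eq_tscale: "Poly_Mapping.single w c = tscale c (wd w)"
  by (auto simp: poly_mapping_eq_iff fun_eq_iff lookup_single when_def)

lemma keys_tscale: "Poly_Mapping.keys (tscale c x) \<subseteq> Poly_Mapping.keys (x :: 'w \<Rightarrow>\<^sub>0 'k::field)"
  by (auto simp: in_keys_iff)

lemma tens_expand: "x = (\<Sum>w\<in>Poly_Mapping.keys x. tscale (Poly_Mapping.lookup x w) (wd w :: 'w \<Rightarrow>\<^sub>0 'k::field))"
proof (rule poly_mapping_eqI)
  fix v
  have "(\<Sum>w\<in>Poly_Mapping.keys x. Poly_Mapping.lookup x w * Poly_Mapping.lookup (wd w :: 'w \<Rightarrow>\<^sub>0 'k) v) =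
    (\<Sum>w\<in>Poly_Mapping.keys x. if w = v then Poly_Mapping.lookup x w else 0)"
    by (rule sum.cong) (auto simp: lookup_single when_def)
  also have "\<dots> = Poly_Mapping.lookup x v"
    by (auto simp: in_keys_iff)
  finally show "Poly_Mapping.lookup x v =
      Poly_Mapping.lookup (\<Sum>w\<in>Poly_Mapping.keys x. tscale (Poly_Mapping.lookup x w) (wd w)) v"
    by (simp add: lookup_sum)
qed

text \<open>Reduces linear statements to words. The set \<open>K\<close> restricts the words to
  those that can occur, for example nonempty or homogeneous ones.\<close>

lemma tens_induct:
  fixes x :: "'w \<Rightarrow>\<^sub>0 'k::field"
  assumes "Poly_Mapping.keys x \<subseteq> K" "P 0" "\<And>x y. P x \<Longrightarrow> P y \<Longrightarrow> P (x + y)"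
    "\<And>c x. P x \<Longrightarrow> P (tscale c x)" "\<And>w. w \<in> K \<Longrightarrow> P (wd w)"
  shows "P x"
proof -
  have "P (\<Sum>w\<in>W. tscale (Poly_Mapping.lookup x w) (wd w))" if "finite W" "W \<subseteq> K" for W
    using that by (induction W) (auto intro: assms)
  from this[OF _ assms(1)] show ?thesis by (subst tens_expand) simp
qed

section \<open>Linear and bilinear extension from words\<close>

definition lext :: "('w \<Rightarrow> ('z \<Rightarrow>\<^sub>0 'k)) \<Rightarrow> ('w \<Rightarrow>\<^sub>0 'k::field) \<Rightarrow> ('z \<Rightarrow>\<^sub>0 'k)" where
  "lext \<phi> x = (\<Sum>w\<in>Poly_Mapping.keys x. tscale (Poly_Mapping.lookup x w) (\<phi> w))"

lemma lext_superset:
  assumes "finite W" "Poly_Mapping.keys x \<subseteq> W"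
  shows "lext \<phi> x = (\<Sum>w\<in>W. tscale (Poly_Mapping.lookup x w) (\<phi> w))"
  unfolding lext_def by (rule sum.mono_neutral_left) (use assms in \<open>auto simp: in_keys_iff\<close>)

lemma lext_add: "lext \<phi> (x + y) = lext \<phi> x + lext \<phi> y"
proof -
  let ?W = "Poly_Mapping.keys x \<union> Poly_Mapping.keys y"
  have W: "finite ?W" "Poly_Mapping.keys (x + y) \<subseteq> ?W" using keys_add[of x y] by auto
  show ?thesis
    unfolding lext_superset[OF W] lext_superset[OF W(1) Un_upper1] lext_superset[OF W(1) Un_upper2]
    by (simp add: lookup_add tens.scale_left_distrib sum.distrib)
qed

lemma lext_scale: "lext \<phi> (tscale c x) = tscale c (lext \<phi> x)"
  unfolding lext_superset[OF finite_keys keys_tscale[of c x]] lext_def[of _ x]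
  by (simp add: tens.scale_sum_right)

lemma lext_zero [simp]: "lext \<phi> 0 = 0" by (simp add: lext_def)

lemma lext_minus: "lext \<phi> (- x) = - lext \<phi> x"
  using lext_scale[of \<phi> "-1" x] by simp

lemma lext_diff: "lext \<phi> (x - y) = lext \<phi> x - lext \<phi> y"
  using lext_add[of \<phi> x "- y"] by (simp add: lext_minus)

lemma lext_wd [simp]: "lext \<phi> (wd w) = \<phi> w"
  by (simp add: lext_def)

lemma lext_fun_add: "lext (\<lambda>w. \<phi> w + \<psi> w) x = lext \<phi> x + lext \<psi> x"
  by (simp add: lext_def tens.scale_right_distrib sum.distrib)

lemma lext_fun_scale: "lext (\<lambda>w. tscale c (\<phi> w)) x = tscale c (lext \<phi> x)"
  by (simp add: lext_def tens.scale_sum_right mult.commute)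

definition bext :: "('w \<Rightarrow> 'w \<Rightarrow> ('z \<Rightarrow>\<^sub>0 'k)) \<Rightarrow> ('w \<Rightarrow>\<^sub>0 'k::field) \<Rightarrow> ('w \<Rightarrow>\<^sub>0 'k) \<Rightarrow> ('z \<Rightarrow>\<^sub>0 'k)" where
  "bext \<phi> x y = lext (\<lambda>v. lext (\<phi> v) y) x"

lemma bext_add_left: "bext \<phi> (x + x') y = bext \<phi> x y + bext \<phi> x' y"
  by (simp add: bext_def lext_add)
lemma bext_add_right: "bext \<phi> x (y + y') = bext \<phi> x y + bext \<phi> x y'"
  by (simp add: bext_def lext_add lext_fun_add)
lemma bext_scale_left: "bext \<phi> (tscale c x) y = tscale c (bext \<phi> x y)"
  by (simp add: bext_def lext_scale)
lemma bext_scale_right: "bext \<phi> x (tscale c y) = tscale c (bext \<phi> x y)"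
  by (simp add: bext_def lext_scale lext_fun_scale)
lemma bext_zero [simp]: "bext \<phi> 0 y = 0" "bext \<phi> x 0 = 0"
  using bext_scale_right[of \<phi> x 0 0] by (simp_all add: bext_def)
lemma bext_minus_left: "bext \<phi> (- x) y = - bext \<phi> x y"
  by (simp add: bext_def lext_minus)
lemma bext_minus_right: "bext \<phi> x (- y) = - bext \<phi> x y"
  using bext_scale_right[of \<phi> x "-1" y] by simp
lemma bext_diff_left: "bext \<phi> (x - x') y = bext \<phi> x y - bext \<phi> x' y"
  by (simp add: bext_def lext_diff)
lemma bext_diff_right: "bext \<phi> x (y - y') = bext \<phi> x y - bext \<phi> x y'"
  using bext_add_right[of \<phi> x y "- y'"] by (simp add: bext_minus_right)
lemma bext_wd [simp]: "bext \<phi> (wd v) (wd w) = \<phi> v w"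
  by (simp add: bext_def)

text \<open>The defining double sum runs over the supports of both factors, which change under
  addition. As a bilinear extension the product inherits the rules of linearity from
  \<open>bext\<close>.\<close>

lemma tmul_bext: "tmul x y = bext (\<lambda>v w. wd (v @ w)) x (y :: 'h list \<Rightarrow>\<^sub>0 'k::field)"
proof -
  have "Poly_Mapping.single (v @ w) (a * b) = tscale a (tscale b (wd (v @ w)))" for v w :: "'h list" and a b :: 'k
    by (simp add: single_eq_tscale[of _ "a * b"])
  then show ?thesis
    by (simp add: tmul_def bext_def lext_def tens.scale_sum_right)
qed

lemmas tmul_add_left = bext_add_left[where \<phi> = "\<lambda>v w. wd (v @ w)", folded tmul_bext]
lemmas tmul_add_right = bext_add_right[where \<phi> = "\<lambda>v w. wd (v @ w)", folded tmul_bext]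
lemmas tmul_scale_left = bext_scale_left[where \<phi> = "\<lambda>v w. wd (v @ w)", folded tmul_bext]
lemmas tmul_scale_right = bext_scale_right[where \<phi> = "\<lambda>v w. wd (v @ w)", folded tmul_bext]
lemmas tmul_minus_left = bext_minus_left[where \<phi> = "\<lambda>v w. wd (v @ w)", folded tmul_bext]
lemmas tmul_minus_right = bext_minus_right[where \<phi> = "\<lambda>v w. wd (v @ w)", folded tmul_bext]
lemmas tmul_diff_left = bext_diff_left[where \<phi> = "\<lambda>v w. wd (v @ w)", folded tmul_bext]
lemmas tmul_diff_right = bext_diff_right[where \<phi> = "\<lambda>v w. wd (v @ w)", folded tmul_bext]
lemmas tmul_zero [simp] = bext_zero[where \<phi> = "\<lambda>v w. wd (v @ w)", folded tmul_bext]
lemmas tmul_wd = bext_wd[where \<phi> = "\<lambda>v w. wd (v @ w)", folded tmul_bext]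
lemmas tmul_linear = tmul_add_left tmul_add_right tmul_scale_left tmul_scale_right
  tmul_minus_left tmul_minus_right tmul_diff_left tmul_diff_right

lemma tmul_assoc: "tmul (tmul x y) z = tmul x (tmul y (z :: 'h list \<Rightarrow>\<^sub>0 'k::field))"
proof -
  have 1: "tmul (tmul (wd u) (wd v)) z = tmul (wd u) (tmul (wd v) z)" for u v
    by (rule tens_induct[where P = "\<lambda>z. tmul (tmul (wd u) (wd v)) z = tmul (wd u) (tmul (wd v) z)" and K = UNIV])
       (simp_all only: tmul_linear tmul_wd tmul_zero append_assoc subset_UNIV)
  have 2: "tmul (tmul (wd u) y) z = tmul (wd u) (tmul y z)" for u
    by (rule tens_induct[where P = "\<lambda>y. tmul (tmul (wd u) y) z = tmul (wd u) (tmul y z)" and K = UNIV])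
       (simp_all only: tmul_linear 1 tmul_zero subset_UNIV)
  show ?thesis
    by (rule tens_induct[where P = "\<lambda>x. tmul (tmul x y) z = tmul x (tmul y z)" and K = UNIV])
       (simp_all only: tmul_linear 2 tmul_zero subset_UNIV)
qed

lemma tmul_one [simp]: "tmul x (wd []) = x" "tmul (wd []) x = (x :: 'h list \<Rightarrow>\<^sub>0 'k::field)"
proof -
  show "tmul x (wd []) = x"
    by (rule tens_induct[where P = "\<lambda>x. tmul x (wd []) = x" and K = UNIV])
       (simp_all only: tmul_linear tmul_wd tmul_zero append_Nil2 subset_UNIV)
  show "tmul (wd []) x = x"
    by (rule tens_induct[where P = "\<lambda>x. tmul (wd []) x = x" and K = UNIV])
       (simp_all only: tmul_linear tmul_wd tmul_zero append_Nil subset_UNIV)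
qed

lemma keys_tmul: "Poly_Mapping.keys (tmul x y) \<subseteq> {v @ w | v w. v \<in> Poly_Mapping.keys x \<and> w \<in> Poly_Mapping.keys y}"
proof
  fix u assume "u \<in> Poly_Mapping.keys (tmul x y)"
  then have "(\<Sum>v\<in>Poly_Mapping.keys x. \<Sum>w\<in>Poly_Mapping.keys y.
     Poly_Mapping.lookup (Poly_Mapping.single (v @ w) (Poly_Mapping.lookup x v * Poly_Mapping.lookup y w)) u) \<noteq> 0"
    by (simp add: tmul_def in_keys_iff lookup_sum)
  then obtain v w where "v \<in> Poly_Mapping.keys x" "w \<in> Poly_Mapping.keys y"
    "Poly_Mapping.lookup (Poly_Mapping.single (v @ w) (Poly_Mapping.lookup x v * Poly_Mapping.lookup y w)) u \<noteq> 0"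
    by (metis (no_types, lifting) sum.not_neutral_contains_not_neutral)
  then show "u \<in> {v @ w | v w. v \<in> Poly_Mapping.keys x \<and> w \<in> Poly_Mapping.keys y}"
    by (auto simp: lookup_single when_def split: if_splits)
qed

text \<open>A basis of \<open>R\<close> is extended to a basis of the whole space. The map that
  kills the former and fixes the remaining basis vectors is a projection with kernel
  \<open>R\<close>.\<close>

lemma exists_linear_with_kernel:
  fixes R :: "('w \<Rightarrow>\<^sub>0 'k::field) set"
  assumes R: "tens.subspace R"
  shows "\<exists>nf :: ('w \<Rightarrow>\<^sub>0 'k) \<Rightarrow> ('w \<Rightarrow>\<^sub>0 'k). (\<forall>x y. nf (x + y) = nf x + nf y) \<and>
    (\<forall>c x. nf (tscale c x) = tscale c (nf x)) \<and> (\<forall>x. nf x = 0 \<longleftrightarrow> x \<in> R)"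
proof -
  obtain C where C: "C \<subseteq> R" "tens.independent C" "R \<subseteq> tens.span C"
    using tens.maximal_independent_subset[of R] by metis
  have RC: "R = tens.span C"
    using C(3) tens.span_minimal[OF C(1) R] by (rule equalityI)
  define E where "E = tens.extend_basis C"
  have E: "C \<subseteq> E" "tens.independent E" "tens.span E = UNIV"
    unfolding E_def
    by (rule tens.extend_basis_superset[OF C(2)], rule tens.independent_extend_basis[OF C(2)],
        rule tens.span_extend_basis[OF C(2)])
  define g where "g = tens_pair.construct E (\<lambda>x. if x \<in> C then 0 else x)"
  have g1: "Vector_Spaces.linear tscale tscale g"
    unfolding g_def by (rule tens_pair.linear_construct[OF E(2)])
  have g2: "g x = (if x \<in> C then 0 else x)" if "x \<in> E" for x
    unfolding g_def by (rule tens_pair.construct_basis[OF E(2) that])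
  interpret g: Vector_Spaces.linear tscale tscale g by (rule g1)
  \<comment> \<open>The zero map and the identity serve for comparison: a linear map that agrees
    with one of them on a set agrees with it on the span.\<close>
  have zl: "Vector_Spaces.linear tscale tscale (\<lambda>x :: 'w \<Rightarrow>\<^sub>0 'k. 0 :: 'w \<Rightarrow>\<^sub>0 'k)"
    by unfold_locales simp_all
  have idl: "Vector_Spaces.linear tscale tscale (\<lambda>x :: 'w \<Rightarrow>\<^sub>0 'k. x)"
    by unfold_locales simp_all
  have gC: "g x = 0" if "x \<in> tens.span C" for x
    by (rule tens_pair.linear_eq_on[OF g1 zl that]) (use g2 E(1) in auto)
  have gD: "g x = x" if "x \<in> tens.span (E - C)" for x
    by (rule tens_pair.linear_eq_on[OF g1 idl that]) (use g2 in auto)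
  have "x \<in> R" if "g x = 0" for x
  proof -
    have "x \<in> tens.span (C \<union> (E - C))" using E by (simp add: Un_absorb1)
    then obtain a b where ab: "a \<in> tens.span C" "b \<in> tens.span (E - C)" "x = a + b"
      unfolding tens.span_Un by auto
    have "g x = b" using ab gC gD by (simp add: g.add)
    with that ab show ?thesis by (simp add: RC)
  qed
  then show ?thesis
    using gC by (intro exI[of _ g]) (auto simp: g.add g.scale RC)
qed

lemma minus_one_power_if: "(-1) ^ n = (if even n then 1 else - 1 :: 'k::ring_1)"
  by simp

context bv_geometry
begin

abbreviation IF where "IF \<equiv> integral_functionals B"

section \<open>The two-sided ideal of relations\<close>

definition rel_add where
  "rel_add v w F G = (wd (v @ [hadd B F G] @ w) - wd (v @ [F] @ w) - wd (v @ [G] @ w) :: ('i, 'n, 'a, 'k) tens)"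
definition rel_scale where
  "rel_scale v w c F = (wd (v @ [hscale B c F] @ w) - Poly_Mapping.single (v @ [F] @ w) c :: ('i, 'n, 'a, 'k) tens)"
definition rel_comm where
  "rel_comm v w F G p q = (wd (v @ [F, G] @ w) - Poly_Mapping.single (v @ [G, F] @ w) ((-1) ^ (p * q)) :: ('i, 'n, 'a, 'k) tens)"

lemma relation_cases:
  assumes "g \<in> tensor_relations B"
  obtains (add) v w F G where "set v \<subseteq> IF" "set w \<subseteq> IF" "F \<in> IF" "G \<in> IF" "g = rel_add v w F G"
  | (scale) v w c F where "set v \<subseteq> IF" "set w \<subseteq> IF" "F \<in> IF" "g = rel_scale v w c F"
  | (comm) v w F G p q where "set v \<subseteq> IF" "set w \<subseteq> IF" "hparity B p F" "hparity B q G" "g = rel_comm v w F G p q"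
proof -
  consider (1) "g \<in> {wd (v @ [hadd B F G] @ w) - wd (v @ [F] @ w) - wd (v @ [G] @ w) | v w F G.
        set v \<union> set w \<union> {F, G} \<subseteq> IF}"
    | (2) "g \<in> {wd (v @ [hscale B c F] @ w) - Poly_Mapping.single (v @ [F] @ w) c | v w c F.
        set v \<union> set w \<union> {F} \<subseteq> IF}"
    | (3) "g \<in> {wd (v @ [F, G] @ w) - Poly_Mapping.single (v @ [G, F] @ w) ((-1) ^ (p * q))
        | v w F G p q. set v \<union> set w \<subseteq> IF \<and> hparity B p F \<and> hparity B q G}"
    using assms unfolding tensor_relations_def by blast
  then show ?thesis
  proof cases
    case 1 then show ?thesis using add unfolding rel_add_def by blast
  next
    case 2 then show ?thesis using scale unfolding rel_scale_def by blast
  next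
    case 3 then show ?thesis using comm unfolding rel_comm_def by blast
  qed
qed

definition R :: "('i, 'n, 'a, 'k) tens set" where "R = tens.span (tensor_relations B)"

lemma rel_add_R:
  assumes "set v \<subseteq> IF" "set w \<subseteq> IF" "F \<in> IF" "G \<in> IF" shows "rel_add v w F G \<in> R"
proof -
  have "set v \<union> set w \<union> {F, G} \<subseteq> IF" using assms by blast
  then have "rel_add v w F G \<in> tensor_relations B"
    unfolding tensor_relations_def rel_add_def by blast
  then show ?thesis unfolding R_def by (rule tens.span_base)
qed

lemma rel_scale_R:
  assumes "set v \<subseteq> IF" "set w \<subseteq> IF" "F \<in> IF" shows "rel_scale v w c F \<in> R"
proof -
  have "set v \<union> set w \<union> {F} \<subseteq> IF" using assms by blast
  then have "rel_scale v w c F \<in> tensor_relations B"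
    unfolding tensor_relations_def rel_scale_def by blast
  then show ?thesis unfolding R_def by (rule tens.span_base)
qed

lemma rel_comm_R:
  assumes "set v \<subseteq> IF" "set w \<subseteq> IF" "hparity B p F" "hparity B q G" shows "rel_comm v w F G p q \<in> R"
proof -
  have "set v \<union> set w \<subseteq> IF" using assms by blast
  with assms(3,4) have "rel_comm v w F G p q \<in> tensor_relations B"
    unfolding tensor_relations_def rel_comm_def by blast
  then show ?thesis unfolding R_def by (rule tens.span_base)
qed

lemma hparity_in: "hparity B p F \<Longrightarrow> F \<in> IF"
  by (simp add: hparity_def)

text \<open>Combinations of all words in integral functionals, the empty word included. The empty
  word represents no local functional, but it is the unit for \<open>tmul\<close> and the base of
  inductions on words.\<close>

definition U :: "('i, 'n, 'a, 'k) tens set" where "U = {x. Poly_Mapping.keys x \<subseteq> {w. set w \<subseteq> IF}}"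

lemma tensors_alt: "tensors B = {x. Poly_Mapping.keys x \<subseteq> {w. w \<noteq> [] \<and> set w \<subseteq> IF}}"
  by (auto simp: tensors_def)

lemma tensors_U: "x \<in> tensors B \<Longrightarrow> x \<in> U"
  by (auto simp: tensors_def U_def)

lemma keys_subspace: "tens.subspace {x :: 'w \<Rightarrow>\<^sub>0 'k. Poly_Mapping.keys x \<subseteq> K}"
proof (rule tens.subspaceI)
  fix x y :: "'w \<Rightarrow>\<^sub>0 'k" and c
  show "0 \<in> {x :: 'w \<Rightarrow>\<^sub>0 'k. Poly_Mapping.keys x \<subseteq> K}" by simp
  assume x: "x \<in> {x. Poly_Mapping.keys x \<subseteq> K}"
  show "tscale c x \<in> {x. Poly_Mapping.keys x \<subseteq> K}" using x keys_tscale[of c x] by blast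
  assume "y \<in> {x. Poly_Mapping.keys x \<subseteq> K}"
  with x show "x + y \<in> {x. Poly_Mapping.keys x \<subseteq> K}" using keys_add[of x y] by blast
qed

lemma tensors_subspace: "tens.subspace (tensors B)" unfolding tensors_alt by (rule keys_subspace)
lemma U_subspace: "tens.subspace U" unfolding U_def by (rule keys_subspace)
lemma R_subspace: "tens.subspace R" unfolding R_def by (rule tens.subspace_span)

lemmas tensors_closed = tens.subspace_add[OF tensors_subspace] tens.subspace_diff[OF tensors_subspace]
  tens.subspace_scale[OF tensors_subspace] tens.subspace_0[OF tensors_subspace] tens.subspace_neg[OF tensors_subspace]
lemmas U_closed = tens.subspace_add[OF U_subspace] tens.subspace_diff[OF U_subspace]
  tens.subspace_scale[OF U_subspace] tens.subspace_0[OF U_subspace] tens.subspace_neg[OF U_subspace]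
lemmas R_closed = tens.subspace_add[OF R_subspace] tens.subspace_diff[OF R_subspace]
  tens.subspace_scale[OF R_subspace] tens.subspace_0[OF R_subspace] tens.subspace_neg[OF R_subspace]

lemma wd_tensors: "w \<noteq> [] \<Longrightarrow> set w \<subseteq> IF \<Longrightarrow> wd w \<in> tensors B"
  by (simp add: tensors_def)
lemma single_tensors: "w \<noteq> [] \<Longrightarrow> set w \<subseteq> IF \<Longrightarrow> Poly_Mapping.single w c \<in> tensors B"
  by (simp add: tensors_def)
lemma wd_U: "set w \<subseteq> IF \<Longrightarrow> wd w \<in> U"
  by (simp add: U_def)

lemma U_induct:
  assumes "x \<in> U" "P 0" "\<And>x y. P x \<Longrightarrow> P y \<Longrightarrow> P (x + y)"
    "\<And>c x. P x \<Longrightarrow> P (tscale c x)" "\<And>w. set w \<subseteq> IF \<Longrightarrow> P (wd w)"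
  shows "P x"
  by (rule tens_induct[where P = P and K = "{w. set w \<subseteq> IF}"]) (use assms in \<open>auto simp: U_def\<close>)

lemma tensors_induct:
  assumes "x \<in> tensors B" "P 0" "\<And>x y. P x \<Longrightarrow> P y \<Longrightarrow> P (x + y)"
    "\<And>c x. P x \<Longrightarrow> P (tscale c x)" "\<And>w. w \<noteq> [] \<Longrightarrow> set w \<subseteq> IF \<Longrightarrow> P (wd w)"
  shows "P x"
  by (rule tens_induct[where P = P and K = "{w. w \<noteq> [] \<and> set w \<subseteq> IF}"]) (use assms in \<open>auto simp: tensors_alt\<close>)

lemma R_induct:
  assumes "r \<in> R" "tens.subspace {x. P x}" "\<And>g. g \<in> tensor_relations B \<Longrightarrow> P g"
  shows "P r"
  using tens.span_induct[of r "tensor_relations B" P] assms by (auto simp: R_def)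

lemma R_tensors: "r \<in> R \<Longrightarrow> r \<in> tensors B"
proof (rule R_induct[where P = "\<lambda>r. r \<in> tensors B"])
  fix g assume "g \<in> tensor_relations B"
  then show "g \<in> tensors B"
  proof (cases rule: relation_cases)
    case add then show ?thesis
      unfolding add(5) rel_add_def by (intro tensors_closed wd_tensors) (auto simp: hadd_in)
  next
    case scale then show ?thesis
      unfolding scale(4) rel_scale_def by (intro tensors_closed wd_tensors single_tensors) (auto simp: hscale_in)
  next
    case comm then show ?thesis
      unfolding comm(5) rel_comm_def by (intro tensors_closed wd_tensors single_tensors) (auto simp: hparity_in)
  qed
qed (simp_all only: Collect_mem_eq tensors_subspace)

lemma tmul_single: "tmul (Poly_Mapping.single v a) (Poly_Mapping.single w b) = Poly_Mapping.single (v @ w) (a * b :: 'k)"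
  by (simp add: single_eq_tscale[of _ a] single_eq_tscale[of _ b] single_eq_tscale[of _ "a * b"] tmul_linear tmul_wd mult.commute)

lemma subspace_tmul_left: "tens.subspace S \<Longrightarrow> tens.subspace {x :: ('i, 'n, 'a, 'k) tens. tmul y x \<in> S}"
  by (auto simp: tens.subspace_def tmul_linear)
lemma subspace_tmul_right: "tens.subspace S \<Longrightarrow> tens.subspace {x :: ('i, 'n, 'a, 'k) tens. tmul x y \<in> S}"
  by (auto simp: tens.subspace_def tmul_linear)

text \<open>Relations come with arbitrary words \<open>v\<close> and \<open>w\<close> around them,
  so attaching a further word only lengthens this context. Hence their span absorbs products from
  both sides.\<close>

lemma rel_append:
  assumes "g \<in> tensor_relations B" "set u \<subseteq> IF"
  shows "tmul (wd u) g \<in> R" "tmul g (wd u) \<in> R"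
proof -
  from assms(1) have "tmul (wd u) g \<in> R \<and> tmul g (wd u) \<in> R"
  proof (cases rule: relation_cases)
    case (add v w F G)
    have "tmul (wd u) g = rel_add (u @ v) w F G" "tmul g (wd u) = rel_add v (w @ u) F G"
      by (simp_all add: add rel_add_def tmul_linear tmul_wd)
    with add assms(2) show ?thesis by (auto intro!: rel_add_R)
  next
    case (scale v w c F)
    have "tmul (wd u) g = rel_scale (u @ v) w c F" "tmul g (wd u) = rel_scale v (w @ u) c F"
      by (simp_all add: scale rel_scale_def tmul_linear tmul_single)
    with scale assms(2) show ?thesis by (auto intro!: rel_scale_R)
  next
    case (comm v w F G p q)
    have "tmul (wd u) g = rel_comm (u @ v) w F G p q" "tmul g (wd u) = rel_comm v (w @ u) F G p q"
      by (simp_all add: comm rel_comm_def tmul_linear tmul_single)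
    with comm assms(2) show ?thesis by (auto intro!: rel_comm_R)
  qed
  then show "tmul (wd u) g \<in> R" "tmul g (wd u) \<in> R" by auto
qed

lemma tmul_R_left:
  assumes "r \<in> R" "x \<in> U" shows "tmul x r \<in> R"
  using assms(2)
proof (rule U_induct)
  fix u assume u: "set u \<subseteq> IF"
  show "tmul (wd u) r \<in> R"
    using assms(1)
    by (rule R_induct[where P = "\<lambda>r. tmul (wd u) r \<in> R"]) (use u in \<open>auto intro: subspace_tmul_left[OF R_subspace] rel_append\<close>)
qed (auto simp: tmul_linear intro: R_closed)

lemma tmul_R_right:
  assumes "r \<in> R" "x \<in> U" shows "tmul r x \<in> R"
  using assms(2)
proof (rule U_induct)
  fix u assume u: "set u \<subseteq> IF"
  show "tmul r (wd u) \<in> R"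
    using assms(1)
    by (rule R_induct[where P = "\<lambda>r. tmul r (wd u) \<in> R"]) (use u in \<open>auto intro: subspace_tmul_right[OF R_subspace] rel_append\<close>)
qed (auto simp: tmul_linear intro: R_closed)

lemma tmul_U: "x \<in> U \<Longrightarrow> y \<in> U \<Longrightarrow> tmul x y \<in> U"
  using keys_tmul[of x y] unfolding U_def by fastforce

lemma tmul_tensors:
  "x \<in> tensors B \<Longrightarrow> y \<in> U \<Longrightarrow> tmul x y \<in> tensors B" "x \<in> U \<Longrightarrow> y \<in> tensors B \<Longrightarrow> tmul x y \<in> tensors B"
  using keys_tmul[of x y] unfolding U_def tensors_alt by fastforce+

text \<open>A linear map whose kernel is the span of the relations turns congruences into equations.\<close>

definition nf :: "('i, 'n, 'a, 'k) tens \<Rightarrow> ('i, 'n, 'a, 'k) tens" where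
  "nf = (SOME nf. (\<forall>x y. nf (x + y) = nf x + nf y) \<and> (\<forall>c x. nf (tscale c x) = tscale c (nf x)) \<and>
     (\<forall>x. nf x = 0 \<longleftrightarrow> x \<in> R))"

lemma nf: "nf (x + y) = nf x + nf y" "nf (tscale c x) = tscale c (nf x)" "nf x = 0 \<longleftrightarrow> x \<in> R"
proof -
  have "(\<forall>x y. nf (x + y) = nf x + nf y) \<and> (\<forall>c x. nf (tscale c x) = tscale c (nf x)) \<and> (\<forall>x. nf x = 0 \<longleftrightarrow> x \<in> R)"
    unfolding nf_def by (rule someI_ex[OF exists_linear_with_kernel[OF R_subspace]])
  then show "nf (x + y) = nf x + nf y" "nf (tscale c x) = tscale c (nf x)" "nf x = 0 \<longleftrightarrow> x \<in> R" by blast+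
qed

lemma nf_zero [simp]: "nf 0 = 0"
  using nf(2)[of 0 0] by simp
lemma nf_minus: "nf (- x) = - nf x"
  using nf(2)[of "-1" x] by simp
lemma nf_diff: "nf (x - y) = nf x - nf y"
  using nf(1)[of x "- y"] by (simp add: nf_minus)
lemmas nf_linear = nf(1,2) nf_minus nf_diff

lemma nf_eq_iff: "nf x = nf y \<longleftrightarrow> x - y \<in> R"
  using nf(3)[of "x - y"] by (simp add: nf_diff)

lemma nf_tmul_cong_left:
  assumes "nf x = nf x'" "y \<in> U" shows "nf (tmul x y) = nf (tmul x' y)"
  using tmul_R_right[OF assms(1)[unfolded nf_eq_iff] assms(2)] by (simp add: nf_eq_iff tmul_linear)

lemma nf_tmul_cong_right:
  assumes "nf y = nf y'" "x \<in> U" shows "nf (tmul x y) = nf (tmul x y')"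
  using tmul_R_left[OF assms(1)[unfolded nf_eq_iff] assms(2)] by (simp add: nf_eq_iff tmul_linear)

lemma nf_hadd: "F \<in> IF \<Longrightarrow> G \<in> IF \<Longrightarrow> nf (wd [hadd B F G]) = nf (wd [F]) + nf (wd [G])"
  using rel_add_R[of "[]" "[]" F G] nf_eq_iff[of "wd [hadd B F G]" "wd [F] + wd [G]"]
  by (simp add: rel_add_def nf_linear diff_diff_eq)

lemma nf_hscale: "F \<in> IF \<Longrightarrow> nf (wd [hscale B c F]) = tscale c (nf (wd [F]))"
  using rel_scale_R[of "[]" "[]" F c] nf_eq_iff[of "wd [hscale B c F]" "tscale c (wd [F])"]
  by (simp add: rel_scale_def nf_linear single_eq_tscale[of _ c])

lemma nf_comm:
  assumes "hparity B p F" "hparity B q G"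
  shows "nf (wd [F, G]) = tscale ((-1) ^ (p * q)) (nf (wd [G, F]))"
  using rel_comm_R[of "[]" "[]" p F q G] assms nf_eq_iff[of "wd [F, G]" "tscale ((-1) ^ (p * q)) (wd [G, F])"]
  by (simp add: rel_comm_def nf_linear single_eq_tscale[of _ "(-1) ^ _"])

lemma lclass_eq_iff:
  assumes "x \<in> tensors B" "y \<in> tensors B"
  shows "lclass B x = lclass B y \<longleftrightarrow> nf x = nf y"
proof
  assume "lclass B x = lclass B y"
  moreover have "x \<in> lclass B x" using assms R_closed(4) by (simp add: lclass_def R_def)
  ultimately show "nf x = nf y" by (simp add: lclass_def nf_eq_iff R_def)
next
  have *: "lclass B x = {z \<in> tensors B. nf z = nf x}" for x
    by (simp add: lclass_def nf_eq_iff R_def)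
  assume "nf x = nf y" then show "lclass B x = lclass B y" by (simp add: *)
qed

lemma in_lclass: "z \<in> lclass B x \<longleftrightarrow> z \<in> tensors B \<and> nf z = nf x"
  by (simp add: lclass_def nf_eq_iff R_def)

lemma local_functionalsE:
  assumes "F \<in> local_functionals B" obtains x where "x \<in> tensors B" "F = lclass B x"
  using assms by (auto simp: local_functionals_def)

lemma lclass_in: "x \<in> tensors B \<Longrightarrow> lclass B x \<in> local_functionals B"
  by (simp add: local_functionals_def)

lemma ladd_lclass:
  assumes "x \<in> tensors B" "y \<in> tensors B"
  shows "ladd B (lclass B x) (lclass B y) = lclass B (x + y)"
proof -
  have "lclass B (x' + y') = lclass B (x + y)" if "x' \<in> lclass B x" "y' \<in> lclass B y" for x' y'
    using that assms lclass_eq_iff[of "x' + y'" "x + y"] by (simp add: in_lclass tensors_closed nf_linear)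
  then have "ladd B (lclass B x) (lclass B y) = (\<Union>x'\<in>lclass B x. \<Union>y'\<in>lclass B y. lclass B (x + y))"
    unfolding ladd_def by (intro SUP_cong refl)
  moreover have "x \<in> lclass B x" "y \<in> lclass B y" using assms by (simp_all add: in_lclass)
  ultimately show ?thesis by auto
qed

lemma lscale_lclass:
  assumes "x \<in> tensors B"
  shows "lscale B c (lclass B x) = lclass B (tscale c x)"
proof -
  have "lclass B (tscale c x') = lclass B (tscale c x)" if "x' \<in> lclass B x" for x'
    using that assms lclass_eq_iff[of "tscale c x'" "tscale c x"] by (simp add: in_lclass tensors_closed nf_linear)
  then have "lscale B c (lclass B x) = (\<Union>x'\<in>lclass B x. lclass B (tscale c x))"
    unfolding lscale_def by (intro SUP_cong refl)
  moreover have "x \<in> lclass B x" using assms by (simp_all add: in_lclass)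
  ultimately show ?thesis by auto
qed

lemma lmul_lclass:
  assumes "x \<in> tensors B" "y \<in> tensors B"
  shows "lmul B (lclass B x) (lclass B y) = lclass B (tmul x y)"
proof -
  have "lclass B (tmul x' y') = lclass B (tmul x y)" if "x' \<in> lclass B x" "y' \<in> lclass B y" for x' y'
  proof -
    have t: "x' \<in> tensors B" "y' \<in> tensors B" "nf x' = nf x" "nf y' = nf y" using that by (auto simp: in_lclass)
    have "nf (tmul x' y') = nf (tmul x y)"
      using nf_tmul_cong_left[OF t(3) tensors_U[OF t(2)]] nf_tmul_cong_right[OF t(4) tensors_U[OF assms(1)]] by simp
    then show ?thesis
      using t assms by (subst lclass_eq_iff) (auto intro: tmul_tensors tensors_U)
  qed
  then have "lmul B (lclass B x) (lclass B y) = (\<Union>x'\<in>lclass B x. \<Union>y'\<in>lclass B y. lclass B (tmul x y))"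
    unfolding lmul_def by (intro SUP_cong refl)
  moreover have "x \<in> lclass B x" "y \<in> lclass B y" using assms by (simp_all add: in_lclass)
  ultimately show ?thesis by auto
qed

subsection \<open>Homogeneous words\<close>

text \<open>A relation rather than a function, because parities exist only through representatives
  and the zero class has every parity. The list \<open>ps\<close> records parities of the letters,
  whose sum counts modulo 2.\<close>

definition hw :: "nat \<Rightarrow> ('i, 'n, 'a, 'k) ifun list \<Rightarrow> bool" where
  "hw p w \<longleftrightarrow> (\<exists>ps. list_all2 (hparity B) ps w \<and> even (sum_list ps + p))"

lemma hw_Nil [simp]: "hw p [] \<longleftrightarrow> even p"
  by (simp add: hw_def)

lemma hw_Cons: "hw p (F # w) \<longleftrightarrow> (\<exists>q r. hparity B q F \<and> hw r w \<and> even (q + r + p))"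
proof
  assume "hw p (F # w)"
  then obtain q ps where "hparity B q F" "list_all2 (hparity B) ps w" "even (q + sum_list ps + p)"
    unfolding hw_def by (auto simp: list_all2_Cons2)
  then show "\<exists>q r. hparity B q F \<and> hw r w \<and> even (q + r + p)"
    unfolding hw_def by (intro exI[of _ q] exI[of _ "sum_list ps"]) auto
next
  assume "\<exists>q r. hparity B q F \<and> hw r w \<and> even (q + r + p)"
  then obtain q r ps where *: "hparity B q F" "list_all2 (hparity B) ps w" "even (sum_list ps + r)" "even (q + r + p)"
    unfolding hw_def by blast
  then have "even (sum_list (q # ps) + p)" by auto
  with * show "hw p (F # w)" unfolding hw_def by (intro exI[of _ "q # ps"]) auto
qed

lemma hw_cong: "hw p w \<Longrightarrow> even (p + q) \<Longrightarrow> hw q w"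
  unfolding hw_def by (elim ex_forward) auto

lemma hw_single: "hparity B p F \<Longrightarrow> hw p [F]"
  unfolding hw_Cons by (intro exI[of _ p] exI[of _ 0]) auto

lemma hw_append: "hw p v \<Longrightarrow> hw q w \<Longrightarrow> hw (p + q) (v @ w)"
proof (induction v arbitrary: p)
  case Nil
  then show ?case by (auto elim: hw_cong)
next
  case (Cons F v)
  then obtain a r where *: "hparity B a F" "hw r v" "even (a + r + p)" by (auto simp: hw_Cons)
  show ?case
    unfolding append_Cons hw_Cons
    by (intro exI[of _ a] exI[of _ "r + q"]) (use * Cons in auto)
qed

lemma hw_in: "hw p w \<Longrightarrow> set w \<subseteq> IF"
  by (induction w arbitrary: p) (auto simp: hw_Cons hparity_in)

lemma hw_lparity:
  assumes "hw p w" "w \<noteq> []" shows "lparity B p (lclass B (wd w))"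
proof -
  have w: "wd w \<in> tensors B" using assms by (intro wd_tensors hw_in)
  show ?thesis
    unfolding lparity_def
  proof (intro conjI lclass_in w bexI[of _ "wd w"] ballI)
    fix v assume "v \<in> Poly_Mapping.keys (wd w :: ('i, 'n, 'a, 'k) tens)"
    then have "v = w" by simp
    with assms(1) show "\<exists>ps. list_all2 (hparity B) ps v \<and> even (sum_list ps + p)"
      unfolding hw_def by blast
  qed (use w in \<open>simp add: in_lclass\<close>)
qed

text \<open>Each letter is the sum of an even and an odd functional; multiplying out gives
  homogeneous words.\<close>

lemma decomp_word:
  "set w \<subseteq> IF \<Longrightarrow> \<exists>x\<in>U. nf (wd w) = nf x \<and> (\<forall>u\<in>Poly_Mapping.keys x. \<exists>p. hw p u)"
proof (induction w)
  case Nil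
  then show ?case by (intro bexI[of _ "wd []"]) (auto simp: U_def intro: exI[of _ 0])
next
  case (Cons F w)
  then obtain x where x: "x \<in> U" "nf (wd w) = nf x" "\<forall>u\<in>Poly_Mapping.keys x. \<exists>p. hw p u" by auto
  obtain F0 F1 where F: "hparity B 0 F0" "hparity B 1 F1" "F = hadd B F0 F1"
    using hparity_decomp[of F] Cons by auto
  have F01: "F0 \<in> IF" "F1 \<in> IF" using F hparity_in by auto
  let ?x = "tmul (wd [F0] + wd [F1]) x"
  have w: "wd w \<in> U" using Cons by (auto intro: wd_U)
  have "nf (wd (F # w)) = nf (tmul (wd [F]) (wd w))" by (simp add: tmul_wd)
  also have "\<dots> = nf (tmul (wd [F0] + wd [F1]) (wd w))"
    using F by (intro nf_tmul_cong_left w) (simp add: nf_hadd F01 nf_linear)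
  also have "\<dots> = nf ?x"
    by (intro nf_tmul_cong_right x(2) U_closed wd_U) (use F01 in auto)
  finally have "nf (wd (F # w)) = nf ?x" .
  moreover have "?x \<in> U" by (intro tmul_U U_closed wd_U x(1)) (use F01 in auto)
  moreover have "\<exists>p. hw p u" if u: "u \<in> Poly_Mapping.keys ?x" for u
  proof -
    have "u \<in> {v @ w | v w. v \<in> Poly_Mapping.keys (wd [F0] + wd [F1] :: ('i, 'n, 'a, 'k) tens) \<and> w \<in> Poly_Mapping.keys x}"
      using u keys_tmul[of "wd [F0] + wd [F1]" x] by blast
    then obtain v u' where v: "v \<in> Poly_Mapping.keys (wd [F0] + wd [F1] :: ('i, 'n, 'a, 'k) tens)"
      and u': "u' \<in> Poly_Mapping.keys x" "u = v @ u'" by blast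
    have "v = [F0] \<or> v = [F1]"
      using v keys_add[of "wd [F0]" "wd [F1] :: ('i, 'n, 'a, 'k) tens"] by auto
    then have "\<exists>p. hw p v" using F hw_single by blast
    with u' x(3) show ?thesis using hw_append by blast
  qed
  ultimately show ?case by blast
qed

text \<open>Sign rules are available for homogeneous words, whereas an arbitrary word is merely
  congruent to a combination of such. The induction therefore asks that \<open>P\<close> be
  invariant under congruence as well.\<close>

lemma hom_induct:
  assumes x: "x \<in> U" and P: "P 0" "\<And>x y. P x \<Longrightarrow> P y \<Longrightarrow> P (x + y)" "\<And>c x. P x \<Longrightarrow> P (tscale c x)"
    and cong: "\<And>x y. x \<in> U \<Longrightarrow> y \<in> U \<Longrightarrow> nf x = nf y \<Longrightarrow> P x \<Longrightarrow> P y"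
    and hom: "\<And>p w. hw p w \<Longrightarrow> P (wd w)"
  shows "P x"
  using x
proof (rule U_induct)
  fix w assume w: "set w \<subseteq> IF"
  then obtain y where y: "y \<in> U" "nf (wd w) = nf y" "\<forall>u\<in>Poly_Mapping.keys y. \<exists>p. hw p u"
    using decomp_word by blast
  have "P y"
    by (rule tens_induct[where P = P and K = "{u. \<exists>p. hw p u}"]) (use y(3) P hom in auto)
  with y(1,2) w show "P (wd w)" by (metis cong wd_U)
qed (use P in auto)

text \<open>Homogeneity up to congruence. Representatives of brackets are obtained by choice and
  their words may be inhomogeneous, so that only the class can be said to have a parity.\<close>

definition hpar :: "nat \<Rightarrow> ('i, 'n, 'a, 'k) tens \<Rightarrow> bool" where
  "hpar p x \<longleftrightarrow> x \<in> U \<and> (\<exists>y\<in>U. nf x = nf y \<and> (\<forall>w\<in>Poly_Mapping.keys y. hw p w))"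

lemma hparE:
  assumes "hpar p x"
  obtains y where "x \<in> U" "y \<in> U" "nf x = nf y" "\<And>w. w \<in> Poly_Mapping.keys y \<Longrightarrow> hw p w"
  using assms unfolding hpar_def by (elim conjE bexE) blast

lemma hparI:
  assumes "x \<in> U" "y \<in> U" "nf x = nf y" "\<And>w. w \<in> Poly_Mapping.keys y \<Longrightarrow> hw p w"
  shows "hpar p x"
  unfolding hpar_def by (intro conjI bexI[of _ y] ballI assms)

lemma hpar_wd: "hw p w \<Longrightarrow> hpar p (wd w)"
  by (rule hparI[of _ "wd w"]) (auto intro!: wd_U dest: hw_in)

lemma hpar_cong:
  assumes "hpar p x" "y \<in> U" "nf x = nf y" "even (p + q)" shows "hpar q y"
proof -
  from assms(1) obtain z where z: "x \<in> U" "z \<in> U" "nf x = nf z" "\<And>w. w \<in> Poly_Mapping.keys z \<Longrightarrow> hw p w"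
    by (rule hparE) blast
  show ?thesis
    by (rule hparI[OF assms(2) z(2)]) (use assms(3) z(3) hw_cong[OF z(4) assms(4)] in auto)
qed

lemma hpar_add:
  assumes "hpar p x" "hpar p y" shows "hpar p (x + y)"
proof -
  from assms(1) obtain x' where x: "x \<in> U" "x' \<in> U" "nf x = nf x'" "\<And>w. w \<in> Poly_Mapping.keys x' \<Longrightarrow> hw p w"
    by (rule hparE) blast
  from assms(2) obtain y' where y: "y \<in> U" "y' \<in> U" "nf y = nf y'" "\<And>w. w \<in> Poly_Mapping.keys y' \<Longrightarrow> hw p w"
    by (rule hparE) blast
  have "hw p w" if "w \<in> Poly_Mapping.keys (x' + y')" for w using that keys_add[of x' y'] x(4) y(4) by blast
  with x y show ?thesis
    by (intro hparI[of _ "x' + y'"]) (simp_all add: nf_linear U_closed)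
qed

lemma hpar_scale:
  assumes "hpar p x" shows "hpar p (tscale c x)"
proof -
  from assms obtain x' where x: "x \<in> U" "x' \<in> U" "nf x = nf x'" "\<And>w. w \<in> Poly_Mapping.keys x' \<Longrightarrow> hw p w"
    by (rule hparE) blast
  have "hw p w" if "w \<in> Poly_Mapping.keys (tscale c x')" for w using that keys_tscale[of c x'] x(4) by blast
  with x show ?thesis
    by (intro hparI[of _ "tscale c x'"]) (simp_all add: nf_linear U_closed)
qed

lemma hpar_tmul:
  assumes "hpar p x" "hpar q y" shows "hpar (p + q) (tmul x y)"
proof -
  from assms(1) obtain x' where x: "x \<in> U" "x' \<in> U" "nf x = nf x'" "\<And>w. w \<in> Poly_Mapping.keys x' \<Longrightarrow> hw p w"
    by (rule hparE) blast
  from assms(2) obtain y' where y: "y \<in> U" "y' \<in> U" "nf y = nf y'" "\<And>w. w \<in> Poly_Mapping.keys y' \<Longrightarrow> hw q w"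
    by (rule hparE) blast
  have "hw (p + q) w" if "w \<in> Poly_Mapping.keys (tmul x' y')" for w
    using that keys_tmul[of x' y'] hw_append[OF x(4) y(4)] by blast
  moreover have "nf (tmul x y) = nf (tmul x' y')"
    using nf_tmul_cong_left[OF x(3) y(1)] nf_tmul_cong_right[OF y(3) x(2)] by simp
  ultimately show ?thesis
    using tmul_U[OF x(1) y(1)] tmul_U[OF x(2) y(2)] by (intro hparI[of _ "tmul x' y'"])
qed

text \<open>The letter passes the letters of \<open>w\<close> one at a time. The exponents add up to
  \<open>p * q\<close> modulo 2 because the parities of the letters add up to
  \<open>q\<close>.\<close>

lemma letter_commute:
  assumes F: "hparity B p F" and w: "hw q w"
  shows "nf (wd (F # w)) = tscale ((-1) ^ (p * q)) (nf (wd (w @ [F])))"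
  using w
proof (induction w arbitrary: q)
  case Nil
  then show ?case by auto
next
  case (Cons G w)
  then obtain a r where G: "hparity B a G" and w: "hw r w" and ev: "even (a + r + q)" by (auto simp: hw_Cons)
  have in_IF: "F \<in> IF" "G \<in> IF" "set w \<subseteq> IF" using F G w hparity_in hw_in by auto
  have "nf (wd (F # G # w)) = nf (tmul (wd [F, G]) (wd w))" by (simp add: tmul_wd)
  also have "\<dots> = nf (tmul (tscale ((-1) ^ (p * a)) (wd [G, F])) (wd w))"
    by (rule nf_tmul_cong_left) (use nf_comm[OF F G] in_IF in \<open>auto simp: nf_linear intro: wd_U\<close>)
  also have "\<dots> = tscale ((-1) ^ (p * a)) (nf (tmul (wd [G]) (wd (F # w))))"
    by (simp add: tmul_linear tmul_wd nf_linear)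
  also have "nf (tmul (wd [G]) (wd (F # w))) = nf (tmul (wd [G]) (tscale ((-1) ^ (p * r)) (wd (w @ [F]))))"
    by (rule nf_tmul_cong_right) (use Cons.IH[OF w] in_IF in \<open>auto simp: nf_linear intro: wd_U\<close>)
  finally have "nf (wd (F # G # w)) = tscale ((-1) ^ (p * a) * (-1) ^ (p * r)) (nf (wd (G # w @ [F])))"
    by (simp add: tmul_linear tmul_wd nf_linear)
  moreover have "(-1) ^ (p * a) * (-1) ^ (p * r) = ((-1) ^ (p * q) :: 'k)"
    using ev by (auto simp: minus_one_power_if)
  ultimately show ?case by simp
qed

lemma word_commute:
  assumes v: "hw p v" and w: "hw q w"
  shows "nf (wd (v @ w)) = tscale ((-1) ^ (p * q)) (nf (wd (w @ v)))"
  using v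
proof (induction v arbitrary: p)
  case Nil
  then show ?case by auto
next
  case (Cons F v)
  then obtain a r where F: "hparity B a F" and v: "hw r v" and ev: "even (a + r + p)" by (auto simp: hw_Cons)
  have in_IF: "F \<in> IF" "set v \<subseteq> IF" "set w \<subseteq> IF" using F v w hparity_in hw_in by auto
  have "nf (wd (F # v @ w)) = nf (tmul (wd [F]) (wd (v @ w)))" by (simp add: tmul_wd)
  also have "\<dots> = nf (tmul (wd [F]) (tscale ((-1) ^ (r * q)) (wd (w @ v))))"
    by (rule nf_tmul_cong_right) (use Cons.IH[OF v] in_IF in \<open>auto simp: nf_linear intro: wd_U\<close>)
  also have "\<dots> = tscale ((-1) ^ (r * q)) (nf (tmul (wd (F # w)) (wd v)))"
    by (simp add: tmul_linear tmul_wd nf_linear)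
  also have "nf (tmul (wd (F # w)) (wd v)) = nf (tmul (tscale ((-1) ^ (a * q)) (wd (w @ [F]))) (wd v))"
    by (rule nf_tmul_cong_left) (use letter_commute[OF F w] in_IF in \<open>auto simp: nf_linear intro: wd_U\<close>)
  finally have "nf (wd (F # v @ w)) = tscale ((-1) ^ (r * q) * (-1) ^ (a * q)) (nf (wd (w @ F # v)))"
    by (simp add: tmul_linear tmul_wd nf_linear)
  moreover have "(-1) ^ (r * q) * (-1) ^ (a * q) = ((-1) ^ (p * q) :: 'k)"
    using ev by (auto simp: minus_one_power_if)
  ultimately show ?case by simp
qed

text \<open>Both factors are replaced by congruent combinations of homogeneous words, to which the
  rule for words extends by bilinearity.\<close>

lemma hpar_commute:
  assumes "hpar p x" "hpar q y"
  shows "nf (tmul x y) = tscale ((-1) ^ (p * q)) (nf (tmul y x))"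
proof -
  from assms(1) obtain x' where x: "x \<in> U" "x' \<in> U" "nf x = nf x'" "\<And>w. w \<in> Poly_Mapping.keys x' \<Longrightarrow> hw p w"
    by (rule hparE) blast
  from assms(2) obtain y' where y: "y \<in> U" "y' \<in> U" "nf y = nf y'" "\<And>w. w \<in> Poly_Mapping.keys y' \<Longrightarrow> hw q w"
    by (rule hparE) blast
  have kx: "Poly_Mapping.keys x' \<subseteq> {w. hw p w}" and ky: "Poly_Mapping.keys y' \<subseteq> {w. hw q w}"
    using x(4) y(4) by blast+
  have word: "nf (tmul (wd v) y') = tscale ((-1) ^ (p * q)) (nf (tmul y' (wd v)))" if v: "hw p v" for v
  proof (rule tens_induct[where P = "\<lambda>y'. nf (tmul (wd v) y') = tscale ((-1) ^ (p * q)) (nf (tmul y' (wd v)))", OF ky])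
    fix w assume "w \<in> {w. hw q w}"
    then show "nf (tmul (wd v) (wd w)) = tscale ((-1) ^ (p * q)) (nf (tmul (wd w) (wd v)))"
      unfolding tmul_wd using word_commute[OF v] by blast
  qed (simp_all add: tmul_linear nf_linear tens.scale_right_distrib mult.commute)
  have "nf (tmul x' y') = tscale ((-1) ^ (p * q)) (nf (tmul y' x'))"
  proof (rule tens_induct[where P = "\<lambda>x'. nf (tmul x' y') = tscale ((-1) ^ (p * q)) (nf (tmul y' x'))", OF kx])
    fix v assume "v \<in> {w. hw p w}"
    then show "nf (tmul (wd v) y') = tscale ((-1) ^ (p * q)) (nf (tmul y' (wd v)))"
      using word by blast
  qed (simp_all add: tmul_linear nf_linear tens.scale_right_distrib mult.commute)
  moreover have "nf (tmul x y) = nf (tmul x' y')"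
    using nf_tmul_cong_left[OF x(3) y(1)] nf_tmul_cong_right[OF y(3) x(2)] by simp
  moreover have "nf (tmul y x) = nf (tmul y' x')"
    using nf_tmul_cong_left[OF y(3) x(1)] nf_tmul_cong_right[OF x(3) y(2)] by simp
  ultimately show ?thesis by simp
qed

end

section \<open>The extended operators\<close>

locale bv_bracket = bv_operations B
  for B :: "('i, 'm::{t2_space,second_countable_topology}, 'n::finite, 'a::finite,
                'k::{real_normed_field,euclidean_space}) bv_bundle" +
  fixes br :: "('i, 'n, 'a, 'k) lfun \<Rightarrow> ('i, 'n, 'a, 'k) lfun \<Rightarrow> ('i, 'n, 'a, 'k) lfun"
  assumes bracket: "schouten_bracket B br"
begin

lemma br_llinear:
  assumes "F \<in> local_functionals B" shows "llinear B (br F)" "llinear B (\<lambda>G. br G F)"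
  using bracket assms unfolding schouten_bracket_def by blast+

lemma br_in: "F \<in> local_functionals B \<Longrightarrow> G \<in> local_functionals B \<Longrightarrow> br F G \<in> local_functionals B"
  using br_llinear(1)[of F] unfolding llinear_def by blast

lemma br_add_right: "F \<in> local_functionals B \<Longrightarrow> G \<in> local_functionals B \<Longrightarrow> H \<in> local_functionals B \<Longrightarrow>
    br F (ladd B G H) = ladd B (br F G) (br F H)"
  using br_llinear(1)[of F] unfolding llinear_def by blast

lemma br_scale_right:
  "F \<in> local_functionals B \<Longrightarrow> G \<in> local_functionals B \<Longrightarrow> br F (lscale B c G) = lscale B c (br F G)"
  using br_llinear(1)[of F] unfolding llinear_def by blast

lemma br_add_left: "F \<in> local_functionals B \<Longrightarrow> G \<in> local_functionals B \<Longrightarrow> H \<in> local_functionals B \<Longrightarrow>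
    br (ladd B G H) F = ladd B (br G F) (br H F)"
  using br_llinear(2)[of F] unfolding llinear_def by blast

lemma br_scale_left:
  "F \<in> local_functionals B \<Longrightarrow> G \<in> local_functionals B \<Longrightarrow> br (lscale B c G) F = lscale B c (br G F)"
  using br_llinear(2)[of F] unfolding llinear_def by blast

lemma br_incl: "F \<in> IF \<Longrightarrow> G \<in> IF \<Longrightarrow> br (lincl B F) (lincl B G) = lincl B (hbracket B F G)"
  using bracket unfolding schouten_bracket_def by blast

lemma br_skew: "lparity B p F \<Longrightarrow> lparity B q G \<Longrightarrow> br F G = lscale B (- ((-1) ^ ((p + 1) * (q + 1)))) (br G F)"
  using bracket unfolding schouten_bracket_def by blast

lemma br_leibniz: "lparity B p F \<Longrightarrow> lparity B q G \<Longrightarrow> lparity B r H \<Longrightarrow>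
    br F (lmul B G H) = ladd B (lmul B (br F G) H) (lscale B ((-1) ^ ((p + 1) * q)) (lmul B G (br F H)))"
  using bracket unfolding schouten_bracket_def by blast

text \<open>The bracket on representatives, extended by zero to the unit of the tensor algebra.\<close>

definition bw :: "('i, 'n, 'a, 'k) ifun list \<Rightarrow> ('i, 'n, 'a, 'k) ifun list \<Rightarrow> ('i, 'n, 'a, 'k) tens" where
  "bw v w = (if v = [] \<or> w = [] then 0
     else SOME z. z \<in> tensors B \<and> lclass B z = br (lclass B (wd v)) (lclass B (wd w)))"

definition bt :: "('i, 'n, 'a, 'k) tens \<Rightarrow> ('i, 'n, 'a, 'k) tens \<Rightarrow> ('i, 'n, 'a, 'k) tens" where
  "bt = bext bw"

section \<open>The bracket on representatives: bilinearity, Leibniz rules and parity\<close>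

lemma bt_linear:
  "bt (x + x') y = bt x y + bt x' y" "bt x (y + y') = bt x y + bt x y'"
  "bt (tscale c x) y = tscale c (bt x y)" "bt x (tscale c y) = tscale c (bt x y)"
  "bt (- x) y = - bt x y" "bt x (- y) = - bt x y"
  "bt (x - x') y = bt x y - bt x' y" "bt x (y - y') = bt x y - bt x y'"
  unfolding bt_def
  by (rule bext_add_left bext_add_right bext_scale_left bext_scale_right
      bext_minus_left bext_minus_right bext_diff_left bext_diff_right)+

lemma bt_zero [simp]: "bt 0 y = 0" "bt x 0 = 0"
  by (simp_all add: bt_def)

lemma bt_one [simp]: "bt x (wd []) = 0" "bt (wd []) x = 0"
proof -
  show "bt x (wd []) = 0"
    by (rule tens_induct[where P = "\<lambda>x. bt x (wd []) = 0" and K = UNIV])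
       (simp_all add: bt_linear, simp add: bt_def bw_def)
  show "bt (wd []) x = 0"
    by (rule tens_induct[where P = "\<lambda>x. bt (wd []) x = 0" and K = UNIV])
       (simp_all add: bt_linear, simp add: bt_def bw_def)
qed

lemma bw_class:
  assumes "v \<noteq> []" "set v \<subseteq> IF" "w \<noteq> []" "set w \<subseteq> IF"
  shows "bt (wd v) (wd w) \<in> tensors B" "lclass B (bt (wd v) (wd w)) = br (lclass B (wd v)) (lclass B (wd w))"
proof -
  have "br (lclass B (wd v)) (lclass B (wd w)) \<in> local_functionals B"
    by (intro br_in lclass_in wd_tensors assms)
  then obtain z where "z \<in> tensors B \<and> lclass B z = br (lclass B (wd v)) (lclass B (wd w))"
    by (auto elim: local_functionalsE)
  from someI[of "\<lambda>z. z \<in> tensors B \<and> lclass B z = br (lclass B (wd v)) (lclass B (wd w))", OF this]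
  show "bt (wd v) (wd w) \<in> tensors B" "lclass B (bt (wd v) (wd w)) = br (lclass B (wd v)) (lclass B (wd w))"
    using assms(1,3) by (auto simp: bt_def bw_def)
qed

lemma lclass_zero: "lclass B 0 = lscale B 0 (lclass B 0)"
  using lscale_lclass[OF tensors_closed(4), of 0] by simp

lemma br_zero:
  assumes "F \<in> local_functionals B"
  shows "br F (lclass B 0) = lclass B 0" "br (lclass B 0) F = lclass B 0"
proof -
  have 0: "lclass B 0 \<in> local_functionals B" by (rule lclass_in[OF tensors_closed(4)])
  have z: "lscale B 0 G = lclass B 0" if "G \<in> local_functionals B" for G
    using that by (elim local_functionalsE) (simp add: lscale_lclass)
  show "br F (lclass B 0) = lclass B 0"
    using br_scale_right[OF assms 0, of 0] z[OF br_in[OF assms 0]] lclass_zero by simp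
  show "br (lclass B 0) F = lclass B 0"
    using br_scale_left[OF assms 0, of 0] z[OF br_in[OF 0 assms]] lclass_zero by simp
qed

text \<open>On words the representative was chosen to have the right class, and bilinearity of both
  sides extends this to combinations. The membership statements are carried along because the
  operations on classes are computed only for members of \<open>tensors B\<close>.\<close>

lemma bt_class:
  assumes x: "x \<in> tensors B" and y: "y \<in> tensors B"
  shows "bt x y \<in> tensors B \<and> lclass B (bt x y) = br (lclass B x) (lclass B y)"
proof -
  have word: "y \<in> tensors B \<and> bt (wd v) y \<in> tensors B \<and> lclass B (bt (wd v) y) = br (lclass B (wd v)) (lclass B y)"
    if v: "v \<noteq> []" "set v \<subseteq> IF" for v
  proof (rule tensors_induct[OF y])
    have wv: "lclass B (wd v) \<in> local_functionals B" by (intro lclass_in wd_tensors v)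
    show "0 \<in> tensors B \<and> bt (wd v) 0 \<in> tensors B \<and> lclass B (bt (wd v) 0) = br (lclass B (wd v)) (lclass B 0)"
      using br_zero[OF wv] by (simp add: tensors_closed)
    show "x + y \<in> tensors B \<and> bt (wd v) (x + y) \<in> tensors B \<and>
        lclass B (bt (wd v) (x + y)) = br (lclass B (wd v)) (lclass B (x + y))"
      if "x \<in> tensors B \<and> bt (wd v) x \<in> tensors B \<and> lclass B (bt (wd v) x) = br (lclass B (wd v)) (lclass B x)"
        "y \<in> tensors B \<and> bt (wd v) y \<in> tensors B \<and> lclass B (bt (wd v) y) = br (lclass B (wd v)) (lclass B y)" for x y
    proof -
      have "lclass B (bt (wd v) x + bt (wd v) y) = br (lclass B (wd v)) (lclass B (x + y))"
        using that ladd_lclass[of "bt (wd v) x" "bt (wd v) y"] ladd_lclass[of x y] br_add_right[OF wv lclass_in lclass_in, of x y] by simp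
      with that show ?thesis by (simp add: bt_linear tensors_closed)
    qed
    show "tscale c x \<in> tensors B \<and> bt (wd v) (tscale c x) \<in> tensors B \<and>
        lclass B (bt (wd v) (tscale c x)) = br (lclass B (wd v)) (lclass B (tscale c x))"
      if "x \<in> tensors B \<and> bt (wd v) x \<in> tensors B \<and> lclass B (bt (wd v) x) = br (lclass B (wd v)) (lclass B x)" for c x
    proof -
      have "lclass B (tscale c (bt (wd v) x)) = br (lclass B (wd v)) (lclass B (tscale c x))"
        using that lscale_lclass[of "bt (wd v) x" c] lscale_lclass[of x c] br_scale_right[OF wv lclass_in, of x c] by simp
      with that show ?thesis by (simp add: bt_linear tensors_closed)
    qed
  qed (use bw_class[OF v] wd_tensors in auto)
  have wy: "lclass B y \<in> local_functionals B" by (intro lclass_in y)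
  have "x \<in> tensors B \<and> bt x y \<in> tensors B \<and> lclass B (bt x y) = br (lclass B x) (lclass B y)"
  proof (rule tensors_induct[OF x])
    show "0 \<in> tensors B \<and> bt 0 y \<in> tensors B \<and> lclass B (bt 0 y) = br (lclass B 0) (lclass B y)"
      using br_zero[OF wy] by (simp add: tensors_closed)
    show "x + x' \<in> tensors B \<and> bt (x + x') y \<in> tensors B \<and> lclass B (bt (x + x') y) = br (lclass B (x + x')) (lclass B y)"
      if "x \<in> tensors B \<and> bt x y \<in> tensors B \<and> lclass B (bt x y) = br (lclass B x) (lclass B y)"
        "x' \<in> tensors B \<and> bt x' y \<in> tensors B \<and> lclass B (bt x' y) = br (lclass B x') (lclass B y)" for x x'
    proof -
      have "lclass B (bt x y + bt x' y) = br (lclass B (x + x')) (lclass B y)"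
        using that ladd_lclass[of "bt x y" "bt x' y"] ladd_lclass[of x x'] br_add_left[OF wy lclass_in lclass_in, of x x'] by simp
      with that show ?thesis by (simp add: bt_linear tensors_closed)
    qed
    show "tscale c x \<in> tensors B \<and> bt (tscale c x) y \<in> tensors B \<and>
        lclass B (bt (tscale c x) y) = br (lclass B (tscale c x)) (lclass B y)"
      if "x \<in> tensors B \<and> bt x y \<in> tensors B \<and> lclass B (bt x y) = br (lclass B x) (lclass B y)" for c x
    proof -
      have "lclass B (tscale c (bt x y)) = br (lclass B (tscale c x)) (lclass B y)"
        using that lscale_lclass[of "bt x y" c] lscale_lclass[of x c] br_scale_left[OF wy lclass_in, of x c] by simp
      with that show ?thesis by (simp add: bt_linear tensors_closed)
    qed
  qed (use word wd_tensors in auto)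
  then show ?thesis by blast
qed

lemma bt_tensors:
  assumes "x \<in> U" "y \<in> U" shows "bt x y \<in> tensors B"
proof -
  have word: "bt (wd v) (wd w) \<in> tensors B" if "set v \<subseteq> IF" "set w \<subseteq> IF" for v w
    using bw_class(1)[OF _ that(1) _ that(2)] by (cases "v = []"; cases "w = []") (auto simp: tensors_closed)
  have "bt (wd v) y \<in> tensors B" if "set v \<subseteq> IF" for v
    by (rule U_induct[where P = "\<lambda>y. bt (wd v) y \<in> tensors B", OF assms(2)])
       (simp_all add: bt_linear tensors_closed word that)
  then show ?thesis
    by (intro U_induct[where P = "\<lambda>x. bt x y \<in> tensors B", OF assms(1)])
       (simp_all add: bt_linear tensors_closed)
qed

text \<open>A combination of relations represents the zero functional, whose bracket with anything
  is zero by linearity. With the empty word the bracket is zero by definition.\<close>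

lemma bt_R:
  assumes r: "r \<in> R" and y: "y \<in> U"
  shows "bt r y \<in> R" "bt y r \<in> R"
proof -
  have R0: "z \<in> R" if "z \<in> tensors B" "lclass B z = lclass B 0" for z
    using that lclass_eq_iff[of z 0] nf(3)[of z] by (simp add: tensors_closed)
  have rt: "r \<in> tensors B" by (rule R_tensors[OF r])
  have r0: "lclass B r = lclass B 0"
    using r rt by (simp add: lclass_eq_iff tensors_closed nf(3))
  have word: "bt r (wd w) \<in> R \<and> bt (wd w) r \<in> R" if w: "set w \<subseteq> IF" for w
  proof (cases "w = []")
    case False
    have ww: "wd w \<in> tensors B" by (rule wd_tensors[OF False w])
    show ?thesis
      using bt_class[OF rt ww] bt_class[OF ww rt] br_zero[OF lclass_in[OF ww]] by (simp add: r0 R0)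
  qed (simp add: R_closed)
  show "bt r y \<in> R"
    by (rule U_induct[where P = "\<lambda>y. bt r y \<in> R", OF y]) (simp_all add: bt_linear R_closed word)
  show "bt y r \<in> R"
    by (rule U_induct[where P = "\<lambda>y. bt y r \<in> R", OF y]) (simp_all add: bt_linear R_closed word)
qed

lemma nf_bt_cong_left: "nf x = nf x' \<Longrightarrow> y \<in> U \<Longrightarrow> nf (bt x y) = nf (bt x' y)"
  using bt_R(1)[of "x - x'" y] by (simp add: nf_eq_iff bt_linear)

lemma nf_bt_cong_right: "nf y = nf y' \<Longrightarrow> x \<in> U \<Longrightarrow> nf (bt x y) = nf (bt x y')"
  using bt_R(2)[of "y - y'" x] by (simp add: nf_eq_iff bt_linear)

lemma bt_U: "x \<in> U \<Longrightarrow> y \<in> U \<Longrightarrow> bt x y \<in> U"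
  by (rule tensors_U[OF bt_tensors])

lemma bt_incl:
  assumes "F \<in> IF" "G \<in> IF" shows "nf (bt (wd [F]) (wd [G])) = nf (wd [hbracket B F G])"
proof -
  have t: "wd [F] \<in> tensors B" "wd [G] \<in> tensors B" using assms by (auto intro: wd_tensors)
  have h: "wd [hbracket B F G] \<in> tensors B"
    using hbracket_hclass assms by (auto elim!: integral_functionalsE intro!: wd_tensors hclass_in bracket_well_defined)
  show ?thesis
    using bt_class[OF t] br_incl[OF assms] lclass_eq_iff[OF _ h] unfolding lincl_def by auto
qed

lemma bt_skew:
  assumes v: "hw p v" and w: "hw q w"
  shows "nf (bt (wd v) (wd w)) = tscale (- ((-1) ^ ((p + 1) * (q + 1)))) (nf (bt (wd w) (wd v)))"
proof (cases "v = [] \<or> w = []")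
  case False
  have t: "wd v \<in> tensors B" "wd w \<in> tensors B" using False v w hw_in by (auto intro!: wd_tensors)
  note vw = bt_class[OF t] and wv = bt_class[OF t(2,1)]
  have "lclass B (bt (wd v) (wd w)) = lclass B (tscale (- ((-1) ^ ((p + 1) * (q + 1)))) (bt (wd w) (wd v)))"
    using br_skew[OF hw_lparity[OF v] hw_lparity[OF w]] False vw lscale_lclass[OF conjunct1[OF wv], unfolded conjunct2[OF wv]]
    by simp
  then show ?thesis using vw wv by (subst (asm) lclass_eq_iff) (auto simp: nf_linear tensors_closed)
qed auto

lemma bt_leibniz_word:
  assumes u: "hw p u" and v: "hw q v" and w: "hw r w"
  shows "nf (bt (wd u) (wd (v @ w))) =
    nf (tmul (bt (wd u) (wd v)) (wd w)) + tscale ((-1) ^ ((p + 1) * q)) (nf (tmul (wd v) (bt (wd u) (wd w))))"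
proof -
  consider "u = []" | "v = []" | "w = []" | "u \<noteq> []" "v \<noteq> []" "w \<noteq> []" by blast
  then show ?thesis
  proof cases
    \<comment> \<open>With an empty middle word the parity \<open>q\<close> is even; the sign is
      then 1 and both sides are the bracket of \<open>u\<close> with \<open>w\<close>.\<close>
    case 2
    with v show ?thesis by simp
  next
    case 4
    have t: "wd u \<in> tensors B" "wd v \<in> tensors B" "wd w \<in> tensors B" using 4 u v w hw_in by (auto intro!: wd_tensors)
    have vw: "tmul (wd v) (wd w) \<in> tensors B" by (intro tmul_tensors(1) t tensors_U)
    note uv = bt_class[OF t(1,2)] and uw = bt_class[OF t(1,3)]
    note m = tmul_tensors(1)[OF conjunct1[OF uv] tensors_U[OF t(3)]]
      tmul_tensors(2)[OF tensors_U[OF t(2)] conjunct1[OF uw]]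
    have "lclass B (bt (wd u) (tmul (wd v) (wd w))) = br (lclass B (wd u)) (lmul B (lclass B (wd v)) (lclass B (wd w)))"
      using bt_class[OF t(1) vw] lmul_lclass[OF t(2,3)] by simp
    also have "\<dots> = ladd B (lmul B (br (lclass B (wd u)) (lclass B (wd v))) (lclass B (wd w)))
        (lscale B ((-1) ^ ((p + 1) * q)) (lmul B (lclass B (wd v)) (br (lclass B (wd u)) (lclass B (wd w)))))"
      by (rule br_leibniz[OF hw_lparity[OF u] hw_lparity[OF v] hw_lparity[OF w]]) (use 4 in auto)
    also have "\<dots> = lclass B (tmul (bt (wd u) (wd v)) (wd w) + tscale ((-1) ^ ((p + 1) * q)) (tmul (wd v) (bt (wd u) (wd w))))"
      unfolding conjunct2[OF uv, symmetric] conjunct2[OF uw, symmetric]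
        lmul_lclass[OF conjunct1[OF uv] t(3)] lmul_lclass[OF t(2) conjunct1[OF uw]]
        lscale_lclass[OF m(2)] ladd_lclass[OF m(1) tensors_closed(3)[OF m(2)]] ..
    finally show ?thesis
      using bt_class[OF t(1) vw] m by (subst (asm) lclass_eq_iff) (auto simp: nf_linear tensors_closed tmul_wd)
  qed auto
qed

lemma bt_leibniz:
  assumes u: "hw p u" and v: "hw q v" and y: "y \<in> U"
  shows "nf (bt (wd u) (tmul (wd v) y)) =
    nf (tmul (bt (wd u) (wd v)) y) + tscale ((-1) ^ ((p + 1) * q)) (nf (tmul (wd v) (bt (wd u) y)))"
proof -
  have uU: "wd u \<in> U" "wd v \<in> U" using u v by (auto intro!: wd_U dest: hw_in)
  show ?thesis
    using y
  proof (rule hom_induct)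
    fix x y assume U: "x \<in> U" "y \<in> U" and eq: "nf x = nf y"
      and x: "nf (bt (wd u) (tmul (wd v) x)) =
        nf (tmul (bt (wd u) (wd v)) x) + tscale ((-1) ^ ((p + 1) * q)) (nf (tmul (wd v) (bt (wd u) x)))"
    have "nf (bt (wd u) (tmul (wd v) x)) = nf (bt (wd u) (tmul (wd v) y))"
      by (intro nf_bt_cong_right nf_tmul_cong_right eq uU)
    moreover have "nf (tmul (bt (wd u) (wd v)) x) = nf (tmul (bt (wd u) (wd v)) y)"
      by (intro nf_tmul_cong_right eq bt_U uU)
    moreover have "nf (tmul (wd v) (bt (wd u) x)) = nf (tmul (wd v) (bt (wd u) y))"
      by (intro nf_bt_cong_right nf_tmul_cong_right eq uU)
    ultimately show "nf (bt (wd u) (tmul (wd v) y)) =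
        nf (tmul (bt (wd u) (wd v)) y) + tscale ((-1) ^ ((p + 1) * q)) (nf (tmul (wd v) (bt (wd u) y)))"
      using x by simp
  next
    fix r w assume "hw r w"
    from bt_leibniz_word[OF u v this]
    show "nf (bt (wd u) (tmul (wd v) (wd w))) =
      nf (tmul (bt (wd u) (wd v)) (wd w)) + tscale ((-1) ^ ((p + 1) * q)) (nf (tmul (wd v) (bt (wd u) (wd w))))"
      by (simp add: tmul_wd)
  qed (simp_all add: tmul_linear bt_linear nf_linear tens.scale_right_distrib mult.commute)
qed

text \<open>For two letters the parity of the bracket comes from the densities; the Leibniz rule in
  the second argument propagates it to words.\<close>

lemma bt_letter_hpar:
  assumes F: "hparity B p F" and w: "hw q w"
  shows "hpar (p + q + 1) (bt (wd [F]) (wd w))"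
  using w
proof (induction w arbitrary: q)
  case Nil
  then show ?case by (auto intro: hparI[of _ 0] simp: U_closed)
next
  case (Cons G w)
  then obtain a r where G: "hparity B a G" and w: "hw r w" and ev: "even (a + r + q)" by (auto simp: hw_Cons)
  have in_IF: "F \<in> IF" "G \<in> IF" "set w \<subseteq> IF" using F G w hparity_in hw_in by auto
  have wU: "wd [F] \<in> U" "wd [G] \<in> U" "wd w \<in> U" "wd (G # w) \<in> U" using in_IF by (auto intro!: wd_U)
  have "hpar (p + a + 1) (bt (wd [F]) (wd [G]))"
    by (rule hpar_cong[OF hpar_wd[OF hw_single[OF hparity_hbracket[OF F G]]] bt_U[OF wU(1,2)] bt_incl[OF in_IF(1,2), symmetric]]) simp
  then have "hpar (p + a + 1 + r) (tmul (bt (wd [F]) (wd [G])) (wd w))"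
    by (rule hpar_tmul[OF _ hpar_wd[OF w]])
  moreover have "hpar (a + (p + r + 1)) (tscale ((-1) ^ ((p + 1) * a)) (tmul (wd [G]) (bt (wd [F]) (wd w))))"
    by (intro hpar_scale hpar_tmul hpar_wd hw_single G Cons.IH[OF w])
  then have "hpar (p + a + 1 + r) (tscale ((-1) ^ ((p + 1) * a)) (tmul (wd [G]) (bt (wd [F]) (wd w))))"
    by (simp add: ac_simps)
  ultimately have "hpar (p + a + 1 + r) (tmul (bt (wd [F]) (wd [G])) (wd w) +
      tscale ((-1) ^ ((p + 1) * a)) (tmul (wd [G]) (bt (wd [F]) (wd w))))"
    by (rule hpar_add)
  then show ?case
  proof (rule hpar_cong)
    show "nf (tmul (bt (wd [F]) (wd [G])) (wd w) + tscale ((-1) ^ ((p + 1) * a)) (tmul (wd [G]) (bt (wd [F]) (wd w)))) =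
        nf (bt (wd [F]) (wd (G # w)))"
      using bt_leibniz_word[OF hw_single[OF F] hw_single[OF G] w] by (simp add: nf_linear)
    show "even (p + a + 1 + r + (p + q + 1))" using ev by auto
  qed (intro bt_U wU)
qed

text \<open>The Leibniz rule acts on the second argument, so the word to be taken apart is moved
  there by skew-symmetry and moved back at the end.\<close>

lemma bt_hpar:
  assumes v: "hw p v" and w: "hw q w"
  shows "hpar (p + q + 1) (bt (wd v) (wd w))"
  using v
proof (induction v arbitrary: p)
  case Nil
  then show ?case by (auto intro: hparI[of _ 0] simp: U_closed)
next
  case (Cons F v)
  then obtain a r where F: "hparity B a F" and v: "hw r v" and ev: "even (a + r + p)" by (auto simp: hw_Cons)
  have in_IF: "F \<in> IF" "set v \<subseteq> IF" "set w \<subseteq> IF" using F v w hparity_in hw_in by auto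
  have wU: "wd [F] \<in> U" "wd v \<in> U" "wd w \<in> U" "wd (F # v) \<in> U" using in_IF by (auto intro!: wd_U)
  have swap: "hpar (s + q + 1) (bt (wd w) (wd u))" if "hpar (s + q + 1) (bt (wd u) (wd w))" "hw s u" for s u
  proof -
    have u: "wd u \<in> U" using that(2) by (auto intro!: wd_U dest: hw_in)
    show ?thesis
      by (rule hpar_cong[OF hpar_scale[OF that(1)] bt_U[OF wU(3) u]])
         (use bt_skew[OF w that(2)] in \<open>auto simp: nf_linear\<close>)
  qed
  have 1: "hpar (a + q + 1) (bt (wd w) (wd [F]))"
    by (rule swap[OF bt_letter_hpar[OF F w] hw_single[OF F]])
  have 2: "hpar (r + q + 1) (bt (wd w) (wd v))"
    by (rule swap[OF Cons.IH[OF v] v])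
  have "hpar (a + q + 1 + r) (tmul (bt (wd w) (wd [F])) (wd v))"
    by (intro hpar_tmul 1 hpar_wd v)
  moreover have "hpar (a + (r + q + 1)) (tscale ((-1) ^ ((q + 1) * a)) (tmul (wd [F]) (bt (wd w) (wd v))))"
    by (intro hpar_scale hpar_tmul hpar_wd hw_single F 2)
  then have "hpar (a + q + 1 + r) (tscale ((-1) ^ ((q + 1) * a)) (tmul (wd [F]) (bt (wd w) (wd v))))"
    by (simp add: ac_simps)
  ultimately have "hpar (a + q + 1 + r) (tmul (bt (wd w) (wd [F])) (wd v) +
      tscale ((-1) ^ ((q + 1) * a)) (tmul (wd [F]) (bt (wd w) (wd v))))"
    by (rule hpar_add)
  then have "hpar (a + r + q + 1) (bt (wd w) (wd (F # v)))"
  proof (rule hpar_cong)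
    show "nf (tmul (bt (wd w) (wd [F])) (wd v) + tscale ((-1) ^ ((q + 1) * a)) (tmul (wd [F]) (bt (wd w) (wd v)))) =
        nf (bt (wd w) (wd (F # v)))"
      using bt_leibniz_word[OF w hw_single[OF F] v] by (simp add: nf_linear)
  qed (auto intro!: bt_U wU)
  from hpar_scale[OF this, of "- ((-1) ^ ((p + 1) * (q + 1)))"] show ?case
    by (rule hpar_cong) (use bt_U[OF wU(4,3)] bt_skew[OF Cons.prems w] ev in \<open>auto simp: nf_linear\<close>)
qed

text \<open>Skew-symmetry moves \<open>v @ v'\<close> to the second argument, the Leibniz rule
  splits it there, and skew-symmetry undoes the exchange in each term. In one term the bracket then
  stands to the left of \<open>v'\<close>; commuting it across uses its parity
  \<open>p + q + 1\<close>.\<close>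

lemma bt_leibniz_left:
  assumes v: "hw p v" and v': "hw p' v'" and y: "y \<in> U"
  shows "nf (bt (wd (v @ v')) y) =
    nf (tmul (wd v) (bt (wd v') y)) + tscale ((-1) ^ (p * p')) (nf (tmul (wd v') (bt (wd v) y)))"
proof -
  have vU: "wd v \<in> U" "wd v' \<in> U" "wd (v @ v') \<in> U" using hw_in[OF v] hw_in[OF v'] by (auto intro!: wd_U)
  show ?thesis
    using y
  proof (rule hom_induct)
    fix x y assume U: "x \<in> U" "y \<in> U" and eq: "nf x = nf y"
      and x: "nf (bt (wd (v @ v')) x) =
        nf (tmul (wd v) (bt (wd v') x)) + tscale ((-1) ^ (p * p')) (nf (tmul (wd v') (bt (wd v) x)))"
    have "nf (bt (wd (v @ v')) x) = nf (bt (wd (v @ v')) y)"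
      "nf (tmul (wd v) (bt (wd v') x)) = nf (tmul (wd v) (bt (wd v') y))"
      "nf (tmul (wd v') (bt (wd v) x)) = nf (tmul (wd v') (bt (wd v) y))"
      by (intro nf_bt_cong_right nf_tmul_cong_right eq vU)+
    with x show "nf (bt (wd (v @ v')) y) =
        nf (tmul (wd v) (bt (wd v') y)) + tscale ((-1) ^ (p * p')) (nf (tmul (wd v') (bt (wd v) y)))"
      by simp
  next
    fix q w assume w: "hw q w"
    have wU: "wd w \<in> U" using w by (auto intro!: wd_U dest: hw_in)
    have 1: "nf (tmul (bt (wd w) (wd v)) (wd v')) =
        tscale (- ((-1) ^ ((q + 1) * (p + 1))) * (-1) ^ ((p + q + 1) * p')) (nf (tmul (wd v') (bt (wd v) (wd w))))"
    proof -
      have "nf (tmul (bt (wd w) (wd v)) (wd v')) = nf (tmul (tscale (- ((-1) ^ ((q + 1) * (p + 1)))) (bt (wd v) (wd w))) (wd v'))"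
        by (rule nf_tmul_cong_left[OF _ vU(2)]) (simp only: bt_skew[OF w v] nf_linear)
      also have "\<dots> = tscale (- ((-1) ^ ((q + 1) * (p + 1)))) (nf (tmul (bt (wd v) (wd w)) (wd v')))"
        by (simp only: tmul_linear nf_linear)
      also have "nf (tmul (bt (wd v) (wd w)) (wd v')) = tscale ((-1) ^ ((p + q + 1) * p')) (nf (tmul (wd v') (bt (wd v) (wd w))))"
        by (rule hpar_commute[OF bt_hpar[OF v w] hpar_wd[OF v']])
      finally show ?thesis by (simp only: tens.scale_scale)
    qed
    have 2: "nf (tmul (wd v) (bt (wd w) (wd v'))) =
        tscale (- ((-1) ^ ((q + 1) * (p' + 1)))) (nf (tmul (wd v) (bt (wd v') (wd w))))"
    proof -
      have "nf (tmul (wd v) (bt (wd w) (wd v'))) = nf (tmul (wd v) (tscale (- ((-1) ^ ((q + 1) * (p' + 1)))) (bt (wd v') (wd w))))"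
        by (rule nf_tmul_cong_right[OF _ vU(1)]) (simp only: bt_skew[OF w v'] nf_linear)
      then show ?thesis by (simp only: tmul_linear nf_linear)
    qed
    have "nf (bt (wd (v @ v')) (wd w)) = tscale (- ((-1) ^ ((p + p' + 1) * (q + 1)))) (nf (bt (wd w) (wd (v @ v'))))"
      by (rule bt_skew[OF hw_append[OF v v'] w])
    also have "\<dots> = tscale (- ((-1) ^ ((p + p' + 1) * (q + 1))) * (- ((-1) ^ ((q + 1) * (p + 1))) * (-1) ^ ((p + q + 1) * p')))
          (nf (tmul (wd v') (bt (wd v) (wd w)))) +
        tscale (- ((-1) ^ ((p + p' + 1) * (q + 1))) * ((-1) ^ ((q + 1) * p) * - ((-1) ^ ((q + 1) * (p' + 1)))))
          (nf (tmul (wd v) (bt (wd v') (wd w))))"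
      unfolding bt_leibniz_word[OF w v v'] 1 2 tens.scale_right_distrib tens.scale_scale ..
    \<comment> \<open>The signs depend only on the parities of \<open>p\<close>, \<open>p'\<close>
      and \<open>q\<close>, and \<open>q\<close> cancels from both coefficients.\<close>
    also have "- ((-1) ^ ((p + p' + 1) * (q + 1))) * (- ((-1) ^ ((q + 1) * (p + 1))) * (-1) ^ ((p + q + 1) * p')) = ((-1) ^ (p * p') :: 'k)"
      by (cases "even p"; cases "even p'"; cases "even q") (simp_all add: minus_one_power_if)
    also have "- ((-1) ^ ((p + p' + 1) * (q + 1))) * ((-1) ^ ((q + 1) * p) * - ((-1) ^ ((q + 1) * (p' + 1)))) = (1 :: 'k)"
      by (cases "even p"; cases "even p'"; cases "even q") (simp_all add: minus_one_power_if)
    finally show "nf (bt (wd (v @ v')) (wd w)) =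
        nf (tmul (wd v) (bt (wd v') (wd w))) + tscale ((-1) ^ (p * p')) (nf (tmul (wd v') (bt (wd v) (wd w))))"
      by (simp add: add.commute)
  qed (simp_all add: tmul_linear bt_linear nf_linear tens.scale_right_distrib mult.commute)
qed

subsection \<open>The Laplacian\<close>

text \<open>On a one-letter word the last two summands vanish, since the bracket with the unit and
  the Laplacian of the unit are zero. This is what makes the recursion extend the operator on
  integral functionals.\<close>

primrec dw :: "('i, 'n, 'a, 'k) ifun list \<Rightarrow> ('i, 'n, 'a, 'k) tens" where
  "dw [] = 0"
| "dw (F # w) = tmul (wd [hlaplacian B F]) (wd w) + bt (wd [hsig F]) (wd w) + tmul (wd [hsig F]) (dw w)"

definition dl :: "('i, 'n, 'a, 'k) tens \<Rightarrow> ('i, 'n, 'a, 'k) tens" where "dl = lext dw"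

lemma dl_linear: "dl (x + y) = dl x + dl y" "dl (tscale c x) = tscale c (dl x)" "dl (- x) = - dl x" "dl (x - y) = dl x - dl y"
  by (simp_all add: dl_def lext_add lext_scale lext_minus lext_diff)

lemma dl_zero [simp]: "dl 0 = 0" by (simp add: dl_def)
lemma dl_wd [simp]: "dl (wd w) = dw w" by (simp add: dl_def)

lemma dl_letter:
  "dl (tmul (wd [F]) x) = tmul (wd [hlaplacian B F]) x + bt (wd [hsig F]) x + tmul (wd [hsig F]) (dl x)"
  by (rule tens_induct[where P = "\<lambda>x. dl (tmul (wd [F]) x) =
      tmul (wd [hlaplacian B F]) x + bt (wd [hsig F]) x + tmul (wd [hsig F]) (dl x)" and K = UNIV])
     (simp_all add: tmul_linear bt_linear dl_linear tens.scale_right_distrib tmul_wd)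

lemma dw_tensors: "set w \<subseteq> IF \<Longrightarrow> dw w \<in> tensors B"
proof (induction w)
  case (Cons F w)
  then have *: "F \<in> IF" "set w \<subseteq> IF" by auto
  have "wd [hlaplacian B F] \<in> tensors B" "wd [hsig F] \<in> tensors B"
    using * hlaplacian_in hsig_in by (auto intro!: wd_tensors)
  with Cons * show ?case
    by (simp del: tmul_one) (intro tensors_closed tmul_tensors(1) bt_tensors tensors_U wd_U; auto intro: tensors_U)
qed (simp add: tensors_closed)

lemma dl_tensors: "x \<in> U \<Longrightarrow> dl x \<in> tensors B"
  by (rule U_induct[where P = "\<lambda>x. dl x \<in> tensors B"]) (simp_all add: dl_linear tensors_closed dw_tensors)

text \<open>Every term of the recursion contains \<open>r\<close> or \<open>dl r\<close> as a factor
  or an argument of the bracket, and \<open>R\<close> is stable under both operations.\<close>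

lemma dl_letter_R:
  assumes F: "F \<in> IF" and r: "r \<in> R" and d: "dl r \<in> R"
  shows "dl (tmul (wd [F]) r) \<in> R"
  unfolding dl_letter
  by (intro R_closed(1) tmul_R_left bt_R(2) r d wd_U) (use F hlaplacian_in hsig_in in auto)

lemma nf_hsig: "hparity B p F \<Longrightarrow> nf (wd [hsig F]) = tscale ((-1) ^ p) (nf (wd [F]))"
  by (simp add: hparity_hsig nf_hscale hparity_in)

text \<open>On a homogeneous letter the involution is, up to congruence, the scalar
  \<open>(-1) ^ p\<close>. The recursion then takes the shape of the product formula with a letter
  as first factor.\<close>

lemma dl_letter_hom:
  assumes F: "hparity B p F" and x: "x \<in> U"
  shows "nf (dl (tmul (wd [F]) x)) = nf (tmul (wd [hlaplacian B F]) x) + tscale ((-1) ^ p) (nf (bt (wd [F]) x))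
    + tscale ((-1) ^ p) (nf (tmul (wd [F]) (dl x)))"
proof -
  have s: "nf (wd [hsig F]) = nf (tscale ((-1) ^ p) (wd [F]))" using nf_hsig[OF F] by (simp add: nf_linear)
  have "nf (bt (wd [hsig F]) x) = tscale ((-1) ^ p) (nf (bt (wd [F]) x))"
    using nf_bt_cong_left[OF s x] by (simp add: bt_linear nf_linear)
  moreover have "nf (tmul (wd [hsig F]) (dl x)) = tscale ((-1) ^ p) (nf (tmul (wd [F]) (dl x)))"
    using nf_tmul_cong_left[OF s tensors_U[OF dl_tensors[OF x]]] by (simp add: tmul_linear nf_linear)
  ultimately show ?thesis unfolding dl_letter by (simp add: nf_linear)
qed

text \<open>Expanding two letters gives six terms. Under the swap, the two terms with the Laplacian
  of a letter are exchanged, with a sign computed from the shifted parity, and so are the two terms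
  in which \<open>x\<close> is bracketed with a letter. The bracket of \<open>F\<close> and
  \<open>G\<close> is matched by skew-symmetry, the term with \<open>dl x\<close> by commuting the
  letters.\<close>

lemma dl_comm:
  assumes F: "hparity B p F" and G: "hparity B q G" and x: "x \<in> U"
  shows "nf (dl (tmul (wd [F, G]) x)) = tscale ((-1) ^ (p * q)) (nf (dl (tmul (wd [G, F]) x)))"
proof -
  note hF = hw_single[OF F] and hG = hw_single[OF G]
  note hDF = hw_single[OF hparity_hlaplacian[OF F]] and hDG = hw_single[OF hparity_hlaplacian[OF G]]
  have in_IF: "F \<in> IF" "G \<in> IF" "hlaplacian B F \<in> IF" "hlaplacian B G \<in> IF"
    using F G hparity_in hlaplacian_in by auto
  have U: "wd [F] \<in> U" "wd [G] \<in> U" "wd [hlaplacian B F] \<in> U" "wd [hlaplacian B G] \<in> U" "dl x \<in> U" "bt (wd [F]) x \<in> U" "bt (wd [G]) x \<in> U"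
    "tmul (wd [F]) x \<in> U" "tmul (wd [G]) x \<in> U"
    using in_IF x by (auto intro!: wd_U tensors_U[OF dl_tensors] bt_U tmul_U)
  have expand: "nf (dl (tmul (wd [F, G]) x)) =
      nf (tmul (wd [hlaplacian B F]) (tmul (wd [G]) x))
      + tscale ((-1) ^ p) (nf (tmul (bt (wd [F]) (wd [G])) x))
      + tscale ((-1) ^ p * (-1) ^ ((p + 1) * q)) (nf (tmul (wd [G]) (bt (wd [F]) x)))
      + tscale ((-1) ^ p) (nf (tmul (wd [F]) (tmul (wd [hlaplacian B G]) x)))
      + tscale ((-1) ^ p * (-1) ^ q) (nf (tmul (wd [F]) (bt (wd [G]) x)))
      + tscale ((-1) ^ p * (-1) ^ q) (nf (tmul (wd [F]) (tmul (wd [G]) (dl x))))"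
    if F: "hparity B p F" and G: "hparity B q G" for p q F G
  proof -
    have U: "wd [F] \<in> U" "tmul (wd [G]) x \<in> U" using F G x hparity_in by (auto intro!: wd_U tmul_U)
    have "nf (dl (tmul (wd [F, G]) x)) = nf (dl (tmul (wd [F]) (tmul (wd [G]) x)))"
      by (simp add: tmul_wd flip: tmul_assoc)
    also have "\<dots> = nf (tmul (wd [hlaplacian B F]) (tmul (wd [G]) x)) + tscale ((-1) ^ p) (nf (bt (wd [F]) (tmul (wd [G]) x)))
      + tscale ((-1) ^ p) (nf (tmul (wd [F]) (dl (tmul (wd [G]) x))))"
      by (rule dl_letter_hom[OF F U(2)])
    also have "nf (bt (wd [F]) (tmul (wd [G]) x)) =
        nf (tmul (bt (wd [F]) (wd [G])) x) + tscale ((-1) ^ ((p + 1) * q)) (nf (tmul (wd [G]) (bt (wd [F]) x)))"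
      by (rule bt_leibniz[OF hw_single[OF F] hw_single[OF G] x])
    also have "nf (tmul (wd [F]) (dl (tmul (wd [G]) x))) =
      nf (tmul (wd [F]) (tmul (wd [hlaplacian B G]) x + tscale ((-1) ^ q) (bt (wd [G]) x) + tscale ((-1) ^ q) (tmul (wd [G]) (dl x))))"
      by (rule nf_tmul_cong_right[OF _ U(1)]) (simp add: dl_letter_hom[OF G x] nf_linear)
    finally show ?thesis
      by (simp only: tmul_linear nf_linear tens.scale_right_distrib tens.scale_scale add.assoc)
  qed
  have comm: "nf (tmul (wd [H]) (tmul (wd [K]) z)) = tscale ((-1) ^ (a * b)) (nf (tmul (wd [K]) (tmul (wd [H]) z)))"
    if "hparity B a H" "hparity B b K" "z \<in> U" for a b H K z
  proof -
    have "nf (tmul (wd [H, K]) z) = nf (tmul (tscale ((-1) ^ (a * b)) (wd [K, H])) z)"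
      using nf_comm[OF that(1,2)] by (intro nf_tmul_cong_left that(3)) (simp add: nf_linear)
    then show ?thesis by (simp add: tmul_linear nf_linear tmul_wd flip: tmul_assoc)
  qed
  have sk: "nf (tmul (bt (wd [F]) (wd [G])) x) = tscale (- ((-1) ^ ((p + 1) * (q + 1)))) (nf (tmul (bt (wd [G]) (wd [F])) x))"
  proof -
    have "nf (tmul (bt (wd [F]) (wd [G])) x) = nf (tmul (tscale (- ((-1) ^ ((p + 1) * (q + 1)))) (bt (wd [G]) (wd [F]))) x)"
      by (rule nf_tmul_cong_left[OF _ x]) (simp only: bt_skew[OF hF hG] nf_linear)
    then show ?thesis by (simp only: tmul_linear nf_linear)
  qed
  show ?thesis
    \<comment> \<open>Both expansions are brought to the same six terms; what is left to compare are
      coefficients that depend on the parities of \<open>p\<close> and \<open>q\<close>.\<close>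
    unfolding expand[OF F G] expand[OF G F] sk
      comm[OF hparity_hlaplacian[OF F] G x] comm[OF F hparity_hlaplacian[OF G] x] comm[OF F G U(5)]
    by (cases "even p"; cases "even q") (simp_all add: minus_one_power_if)
qed

text \<open>Letters in front of a relation are removed by \<open>dl_letter_R\<close>, which uses
  that the relation and its image both lie in \<open>R\<close>; hence the conjunction in each
  induction. With no letter left in front, sums and multiples are respected because
  \<open>hlaplacian B\<close> and \<open>hsig\<close> are linear, and the exchange of letters is
  \<open>dl_comm\<close>.\<close>

lemma dl_R: assumes "r \<in> R" shows "dl r \<in> R"
  using assms
proof (rule R_induct)
  show "tens.subspace {r. dl r \<in> R}"
    by (auto intro!: tens.subspaceI simp: dl_linear R_closed)
  fix g assume "g \<in> tensor_relations B"
  then show "dl g \<in> R"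
  proof (cases rule: relation_cases)
    case (add v w F G)
    then have "rel_add v w F G \<in> R \<and> dl (rel_add v w F G) \<in> R"
    proof (induction v arbitrary: g)
      case Nil
      let ?d = "\<lambda>\<phi>. wd [\<phi> (hadd B F G)] - wd [\<phi> F] - wd [\<phi> G]"
      have d: "?d (hlaplacian B) \<in> R" "?d hsig \<in> R"
        using rel_add_R[of "[]" "[]" "hlaplacian B F" "hlaplacian B G"] rel_add_R[of "[]" "[]" "hsig F" "hsig G"] Nil
        by (simp_all add: rel_add_def hlaplacian_hadd hsig_hadd hlaplacian_in hsig_in)
      have U: "wd w \<in> U" "dw w \<in> U" using Nil by (auto intro: wd_U tensors_U dw_tensors)
      have "dl (rel_add [] w F G) = tmul (?d (hlaplacian B)) (wd w) + bt (?d hsig) (wd w) + tmul (?d hsig) (dw w)"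
        by (simp add: rel_add_def dl_linear tmul_linear bt_linear algebra_simps)
      moreover have "\<dots> \<in> R" by (intro R_closed(1) tmul_R_right bt_R(1) d U)
      ultimately show ?case using rel_add_R[of "[]" w F G] Nil by simp
    next
      case (Cons H v)
      then have "rel_add v w F G \<in> R \<and> dl (rel_add v w F G) \<in> R" by simp
      moreover have "rel_add (H # v) w F G = tmul (wd [H]) (rel_add v w F G)"
        by (simp add: rel_add_def tmul_linear tmul_wd)
      moreover have "rel_add (H # v) w F G \<in> R" using Cons.prems by (intro rel_add_R) auto
      ultimately show ?case using dl_letter_R[of H] Cons.prems by auto
    qed
    with add show ?thesis by simp
  next
    case (scale v w c F)
    then have "rel_scale v w c F \<in> R \<and> dl (rel_scale v w c F) \<in> R"
    proof (induction v arbitrary: g)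
      case Nil
      let ?d = "\<lambda>\<phi>. wd [\<phi> (hscale B c F)] - tscale c (wd [\<phi> F])"
      have d: "?d (hlaplacian B) \<in> R" "?d hsig \<in> R"
        using rel_scale_R[of "[]" "[]" "hlaplacian B F" c] rel_scale_R[of "[]" "[]" "hsig F" c] Nil
        by (simp_all add: rel_scale_def hlaplacian_hscale hsig_hscale hlaplacian_in hsig_in single_eq_tscale[of _ c])
      have U: "wd w \<in> U" "dw w \<in> U" using Nil by (auto intro: wd_U tensors_U dw_tensors)
      have "dl (rel_scale [] w c F) = tmul (?d (hlaplacian B)) (wd w) + bt (?d hsig) (wd w) + tmul (?d hsig) (dw w)"
        by (simp add: rel_scale_def single_eq_tscale[of _ c] dl_linear tmul_linear bt_linear tens.scale_right_distrib algebra_simps)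
      moreover have "\<dots> \<in> R" by (intro R_closed(1) tmul_R_right bt_R(1) d U)
      ultimately show ?case using rel_scale_R[of "[]" w F c] Nil by simp
    next
      case (Cons H v)
      then have "rel_scale v w c F \<in> R \<and> dl (rel_scale v w c F) \<in> R" by simp
      moreover have "rel_scale (H # v) w c F = tmul (wd [H]) (rel_scale v w c F)"
        by (simp add: rel_scale_def tmul_linear tmul_wd tmul_single)
      moreover have "rel_scale (H # v) w c F \<in> R" using Cons.prems by (intro rel_scale_R) auto
      ultimately show ?case using dl_letter_R[of H] Cons.prems by auto
    qed
    with scale show ?thesis by simp
  next
    case (comm v w F G p q)
    then have "rel_comm v w F G p q \<in> R \<and> dl (rel_comm v w F G p q) \<in> R"
    proof (induction v arbitrary: g)
      case Nil
      have "rel_comm [] w F G p q = tmul (wd [F, G]) (wd w) - tscale ((-1) ^ (p * q)) (tmul (wd [G, F]) (wd w))"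
        by (simp add: rel_comm_def single_eq_tscale[of _ "(-1) ^ _"] tmul_wd)
      then have "nf (dl (rel_comm [] w F G p q)) = 0"
        using dl_comm[OF Nil(3,4) wd_U[OF Nil(2)]] by (simp only: dl_linear nf_linear diff_self)
      then show ?case using rel_comm_R[OF Nil(1-4)] by (simp add: nf(3))
    next
      case (Cons H v)
      then have "rel_comm v w F G p q \<in> R \<and> dl (rel_comm v w F G p q) \<in> R" by simp
      moreover have "rel_comm (H # v) w F G p q = tmul (wd [H]) (rel_comm v w F G p q)"
        by (simp add: rel_comm_def tmul_linear tmul_wd tmul_single)
      moreover have "rel_comm (H # v) w F G p q \<in> R" using Cons.prems by (intro rel_comm_R) auto
      ultimately show ?case using dl_letter_R[of H] Cons.prems by auto
    qed
    with comm show ?thesis by simp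
  qed
qed

lemma nf_dl_cong: "nf x = nf y \<Longrightarrow> nf (dl x) = nf (dl y)"
  using dl_R[of "x - y"] by (simp add: nf_eq_iff dl_linear)

lemma dl_product_word:
  assumes v: "hw p v" and y: "y \<in> U"
  shows "nf (dl (tmul (wd v) y)) = nf (tmul (dw v) y) + tscale ((-1) ^ p) (nf (bt (wd v) y))
    + tscale ((-1) ^ p) (nf (tmul (wd v) (dl y)))"
  using v
proof (induction v arbitrary: p)
  case Nil
  then show ?case by simp
next
  case (Cons F v)
  then obtain a r where F: "hparity B a F" and v: "hw r v" and ev: "even (a + r + p)" by (auto simp: hw_Cons)
  have in_IF: "F \<in> IF" "set v \<subseteq> IF" using F v hparity_in hw_in by auto
  have U: "wd [F] \<in> U" "wd v \<in> U" "tmul (wd v) y \<in> U" using in_IF y by (auto intro!: wd_U tmul_U)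
  have "nf (dl (tmul (wd (F # v)) y)) = nf (dl (tmul (wd [F]) (tmul (wd v) y)))"
    by (simp add: tmul_wd flip: tmul_assoc)
  also have "\<dots> = nf (tmul (wd [hlaplacian B F]) (tmul (wd v) y)) + tscale ((-1) ^ a) (nf (bt (wd [F]) (tmul (wd v) y)))
      + tscale ((-1) ^ a) (nf (tmul (wd [F]) (dl (tmul (wd v) y))))"
    by (rule dl_letter_hom[OF F U(3)])
  also have "nf (bt (wd [F]) (tmul (wd v) y)) =
      nf (tmul (bt (wd [F]) (wd v)) y) + tscale ((-1) ^ ((a + 1) * r)) (nf (tmul (wd v) (bt (wd [F]) y)))"
    by (rule bt_leibniz[OF hw_single[OF F] v y])
  also have "nf (tmul (wd [F]) (dl (tmul (wd v) y))) =
      nf (tmul (wd [F]) (tmul (dw v) y + tscale ((-1) ^ r) (bt (wd v) y) + tscale ((-1) ^ r) (tmul (wd v) (dl y))))"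
    by (rule nf_tmul_cong_right[OF _ U(1)]) (simp add: Cons.IH[OF v] nf_linear)
  finally have L: "nf (dl (tmul (wd (F # v)) y)) =
      nf (tmul (wd [hlaplacian B F]) (tmul (wd v) y)) + tscale ((-1) ^ a) (nf (tmul (bt (wd [F]) (wd v)) y))
      + tscale ((-1) ^ a * (-1) ^ ((a + 1) * r)) (nf (tmul (wd v) (bt (wd [F]) y)))
      + tscale ((-1) ^ a) (nf (tmul (wd [F]) (tmul (dw v) y)))
      + tscale ((-1) ^ a * (-1) ^ r) (nf (tmul (wd [F]) (bt (wd v) y)))
      + tscale ((-1) ^ a * (-1) ^ r) (nf (tmul (wd [F]) (tmul (wd v) (dl y))))"
    by (simp only: tmul_linear nf_linear tens.scale_right_distrib tens.scale_scale add.assoc)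
  \<comment> \<open>The three terms of the expansion in which no bracket or Laplacian involves
    \<open>y\<close> form the Laplacian of \<open>F # v\<close> times \<open>y\<close>.\<close>
  have D: "nf (tmul (dw (F # v)) y) = nf (tmul (wd [hlaplacian B F]) (tmul (wd v) y))
      + tscale ((-1) ^ a) (nf (tmul (bt (wd [F]) (wd v)) y)) + tscale ((-1) ^ a) (nf (tmul (wd [F]) (tmul (dw v) y)))"
  proof -
    have "nf (dw (F # v)) = nf (tmul (wd [hlaplacian B F]) (wd v) + tscale ((-1) ^ a) (bt (wd [F]) (wd v))
        + tscale ((-1) ^ a) (tmul (wd [F]) (dw v)))"
      using dl_letter_hom[OF F U(2)] by (simp add: tmul_wd nf_linear del: dw.simps)
    from nf_tmul_cong_left[OF this y] show ?thesis
      by (simp only: tmul_linear nf_linear tmul_assoc)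
  qed
  \<comment> \<open>The two terms in which \<open>y\<close> is bracketed with \<open>v\<close> or
    with \<open>F\<close> together form the bracket of \<open>F # v\<close> with
    \<open>y\<close>.\<close>
  have Bk: "nf (bt (wd (F # v)) y) = nf (tmul (wd [F]) (bt (wd v) y)) + tscale ((-1) ^ (a * r)) (nf (tmul (wd v) (bt (wd [F]) y)))"
    using bt_leibniz_left[OF hw_single[OF F] v y] by simp
  have M: "tmul (wd (F # v)) (dl y) = tmul (wd [F]) (tmul (wd v) (dl y))"
    by (simp add: tmul_wd flip: tmul_assoc)
  have s: "even p \<longleftrightarrow> even (a + r)" using ev by auto
  show ?case
    unfolding L D Bk M
    by (cases "even a"; cases "even r") (simp_all add: minus_one_power_if s)
qed

lemma dl_product:
  assumes x: "Poly_Mapping.keys x \<subseteq> {w. hw p w}" and y: "y \<in> U"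
  shows "nf (dl (tmul x y)) = nf (tmul (dl x) y) + tscale ((-1) ^ p) (nf (bt x y))
    + tscale ((-1) ^ p) (nf (tmul x (dl y)))"
proof (rule tens_induct[OF x])
  fix w assume "w \<in> {w. hw p w}"
  then show "nf (dl (tmul (wd w) y)) = nf (tmul (dl (wd w)) y) + tscale ((-1) ^ p) (nf (bt (wd w) y))
    + tscale ((-1) ^ p) (nf (tmul (wd w) (dl y)))"
    using dl_product_word[OF _ y] by simp
qed (simp_all add: dl_linear tmul_linear bt_linear nf_linear tens.scale_right_distrib mult.commute)

section \<open>Descent of the Laplacian to local functionals\<close>

definition laplacian :: "('i, 'n, 'a, 'k) lfun \<Rightarrow> ('i, 'n, 'a, 'k) lfun" where
  "laplacian F = (\<Union>x\<in>F. lclass B (dl x))"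

lemma laplacian_lclass:
  assumes "x \<in> tensors B" shows "laplacian (lclass B x) = lclass B (dl x)"
proof -
  have "lclass B (dl x') = lclass B (dl x)" if "x' \<in> lclass B x" for x'
    using that assms nf_dl_cong[of x' x]
    by (subst lclass_eq_iff) (auto simp: in_lclass intro: dl_tensors tensors_U)
  then have "laplacian (lclass B x) = (\<Union>x'\<in>lclass B x. lclass B (dl x))"
    unfolding laplacian_def by (intro SUP_cong refl)
  moreover have "x \<in> lclass B x" using assms by (simp_all add: in_lclass)
  ultimately show ?thesis by auto
qed

lemma llinear_laplacian: "llinear B laplacian"
  unfolding llinear_def
proof (intro conjI ballI allI)
  fix F assume "F \<in> local_functionals B"
  then obtain x where x: "x \<in> tensors B" "F = lclass B x" by (rule local_functionalsE)
  have d: "dl x \<in> tensors B" by (intro dl_tensors tensors_U x)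
  show "laplacian F \<in> local_functionals B" using x d by (simp add: laplacian_lclass lclass_in)
  show "laplacian (lscale B c F) = lscale B c (laplacian F)" for c
    using x d by (simp add: laplacian_lclass lscale_lclass tensors_closed dl_linear)
  fix G assume "G \<in> local_functionals B"
  then obtain y where y: "y \<in> tensors B" "G = lclass B y" by (rule local_functionalsE)
  have e: "dl y \<in> tensors B" by (intro dl_tensors tensors_U y)
  show "laplacian (ladd B F G) = ladd B (laplacian F) (laplacian G)"
    using x y d e by (simp add: laplacian_lclass ladd_lclass tensors_closed dl_linear)
qed

lemma laplacian_incl: "F \<in> IF \<Longrightarrow> laplacian (lincl B F) = lincl B (hlaplacian B F)"
  unfolding lincl_def by (subst laplacian_lclass) (auto intro: wd_tensors)

lemma laplacian_product:
  assumes F: "lparity B p F" and G: "G \<in> local_functionals B"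
  shows "laplacian (lmul B F G) = ladd B (lmul B (laplacian F) G)
    (ladd B (lscale B ((-1) ^ p) (br F G)) (lscale B ((-1) ^ p) (lmul B F (laplacian G))))"
proof -
  obtain x0 where x0: "x0 \<in> tensors B" "F = lclass B x0"
    using F unfolding lparity_def by (auto elim: local_functionalsE)
  \<comment> \<open>Among the representatives of \<open>F\<close>, the one that witnesses the parity
    is used: all its words are homogeneous, as the product formula on representatives
    requires.\<close>
  obtain x where x: "x \<in> F" "\<forall>w\<in>Poly_Mapping.keys x. hw p w"
    using F unfolding lparity_def hw_def by blast
  have xt: "x \<in> tensors B" "F = lclass B x"
    using x(1) x0 lclass_eq_iff[of x x0] by (auto simp: in_lclass)
  obtain y where y: "y \<in> tensors B" "G = lclass B y" using G by (rule local_functionalsE)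
  have U: "x \<in> U" "y \<in> U" using xt y by (auto intro: tensors_U)
  have t: "dl x \<in> tensors B" "dl y \<in> tensors B" "tmul x y \<in> tensors B" "tmul (dl x) y \<in> tensors B"
      "tmul x (dl y) \<in> tensors B" "bt x y \<in> tensors B" "dl (tmul x y) \<in> tensors B"
    using U xt y by (auto intro!: dl_tensors tmul_tensors(1) tmul_U bt_tensors intro: tensors_U dl_tensors)
  have "lclass B (dl (tmul x y)) = lclass B (tmul (dl x) y + (tscale ((-1) ^ p) (bt x y) + tscale ((-1) ^ p) (tmul x (dl y))))"
    using t x(2) dl_product[of x p y] U by (subst lclass_eq_iff) (auto simp: tensors_closed nf_linear add.assoc)
  moreover have "br F G = lclass B (bt x y)" using bt_class[OF xt(1) y(1)] xt y by simp
  ultimately show ?thesis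
    using t xt y
    by (simp add: laplacian_lclass lmul_lclass lscale_lclass ladd_lclass tensors_closed)
qed

end

section \<open>Values on sections\<close>

lemma gfin_geval: "gfin (geval g (y :: 'v::countable \<Rightarrow> ('w::countable, 'k::comm_ring_1) grass))"
  unfolding gfin_def
proof (intro allI impI, rule ccontr)
  fix T assume nz: "geval g y T \<noteq> 0" and T: "infinite T"
  have "gprod ys T = 0" for ys :: "('w, 'k) grass list"
    using gfin_gprod[of ys] T unfolding gfin_def by blast
  then show False using nz by (simp add: geval_def)
qed

lemma gfin_pullback: "gfin (jet_pullback f s i x)"
  unfolding jet_pullback_def by (rule gfin_geval)

context bv_geometry
begin

text \<open>The pieces are fixed by a choice, so their existence has to be shown. By second
  countability countably many chart domains cover the manifold, and removing from each the preceding
  ones makes the pieces disjoint.\<close>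

lemma borel_pieces:
  shows "fst (borel_pieces B r) \<in> charts B" "snd (borel_pieces B r) \<subseteq> cdom B (fst (borel_pieces B r))"
proof -
  obtain \<F> where \<F>: "\<F> \<subseteq> cdom B ` charts B" "countable \<F>" "\<Union>\<F> = UNIV"
    using Lindelof[of "cdom B ` charts B"] open_cdom cdom_cover by (metis imageE)
  have "\<F> \<noteq> {}" using \<F>(3) by auto
  define A where "A n = from_nat_into \<F> n" for n
  have A: "A n \<in> \<F>" "range A = \<F>" for n
    using from_nat_into[OF \<open>\<F> \<noteq> {}\<close>] range_from_nat_into[OF \<open>\<F> \<noteq> {}\<close> \<F>(2)] by (auto simp: A_def)
  have "\<forall>n. \<exists>i\<in>charts B. A n = cdom B i" using A(1) \<F>(1) by blast
  then obtain c where c: "\<And>n. c n \<in> charts B" "\<And>n. A n = cdom B (c n)" by metis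
  define P where "P n = (c n, disjointed A n)" for n
  have "range A \<subseteq> sets borel" using c open_cdom by auto
  then have meas: "disjointed A n \<in> sets borel" for n
    using sets.range_disjointed_sets[of A borel] by blast
  let ?Q = "\<lambda>P :: nat \<Rightarrow> 'i \<times> 'm set.
     (\<forall>r. fst (P r) \<in> charts B \<and> snd (P r) \<in> sets borel \<and> snd (P r) \<subseteq> cdom B (fst (P r))) \<and>
     disjoint_family (\<lambda>r. snd (P r)) \<and> (\<Union>r. snd (P r)) = UNIV"
  have "?Q P"
    using c meas disjointed_subset[of A] disjoint_family_disjointed[of A] UN_disjointed_eq[of A] A(2) \<F>(3)
    by (auto simp: P_def)
  then have "?Q (borel_pieces B)"
    unfolding borel_pieces_def by (rule someI[of ?Q])
  then show "fst (borel_pieces B r) \<in> charts B" "snd (borel_pieces B r) \<subseteq> cdom B (fst (borel_pieces B r))"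
    by simp_all
qed

lemma piece_imgE:
  assumes "x \<in> piece_img B r"
  obtains p where "p \<in> cdom B (fst (borel_pieces B r))" "x = coord B (fst (borel_pieces B r)) p"
  using assms borel_pieces(2)[of r] unfolding piece_img_def by blast

section \<open>Linearity of the integral of top-degree forms\<close>

lemma form_integral_cong:
  assumes "\<And>r x. x \<in> piece_img B r \<Longrightarrow> \<omega> (fst (borel_pieces B r)) x = \<omega>' (fst (borel_pieces B r)) x"
  shows "form_integral B \<omega> = form_integral B \<omega>'"
proof -
  have "(LINT x:piece_img B r|lborel. \<omega> (fst (borel_pieces B r)) x) =
      (LINT x:piece_img B r|lborel. \<omega>' (fst (borel_pieces B r)) x)" for r
    unfolding set_lebesgue_integral_def
    by (rule Bochner_Integration.integral_cong) (use assms in \<open>auto simp: indicator_def\<close>)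
  then show ?thesis by (simp add: form_integral_def)
qed

text \<open>The series is dominated by that of the integrals of norms, whose convergence is part of
  \<open>form_integrable\<close>.\<close>

lemma form_integrable_summable:
  fixes \<omega> :: "'i \<Rightarrow> real^'n \<Rightarrow> 'k"
  assumes "form_integrable B \<omega>"
  shows "summable (\<lambda>r. LINT x:piece_img B r|lborel. \<omega> (fst (borel_pieces B r)) x)"
proof (rule summable_comparison_test[OF exI[of _ 0]])
  show "summable (\<lambda>r. LINT x:piece_img B r|lborel. norm (\<omega> (fst (borel_pieces B r)) x))"
    using assms by (simp add: form_integrable_def)
  have "norm (LINT x:piece_img B r|lborel. \<omega> (fst (borel_pieces B r)) x)
      \<le> (LINT x:piece_img B r|lborel. norm (\<omega> (fst (borel_pieces B r)) x))" for r
    unfolding set_lebesgue_integral_def by (rule order_trans[OF integral_norm_bound]) simp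
  then show "\<forall>r\<ge>0. norm (LINT x:piece_img B r|lborel. \<omega> (fst (borel_pieces B r)) x)
      \<le> (LINT x:piece_img B r|lborel. norm (\<omega> (fst (borel_pieces B r)) x))" by blast
qed

lemma form_integral_add:
  fixes \<omega> \<omega>' :: "'i \<Rightarrow> real^'n \<Rightarrow> 'k"
  assumes "form_integrable B \<omega>" "form_integrable B \<omega>'"
  shows "form_integral B (\<lambda>i x. \<omega> i x + \<omega>' i x) = form_integral B \<omega> + form_integral B \<omega>'"
proof -
  have "(LINT x:piece_img B r|lborel. \<omega> (fst (borel_pieces B r)) x + \<omega>' (fst (borel_pieces B r)) x) =
      (LINT x:piece_img B r|lborel. \<omega> (fst (borel_pieces B r)) x) +
      (LINT x:piece_img B r|lborel. \<omega>' (fst (borel_pieces B r)) x)" for r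
    by (rule set_integral_add(2)) (use assms in \<open>auto simp: form_integrable_def\<close>)
  then show ?thesis
    unfolding form_integral_def
    by (simp add: suminf_add[OF form_integrable_summable[OF assms(1)] form_integrable_summable[OF assms(2)]])
qed

lemma form_integral_scale:
  fixes \<omega> :: "'i \<Rightarrow> real^'n \<Rightarrow> 'k"
  assumes "form_integrable B \<omega>"
  shows "form_integral B (\<lambda>i x. c * \<omega> i x) = c * form_integral B \<omega>"
proof -
  have "(LINT x:piece_img B r|lborel. c * \<omega> (fst (borel_pieces B r)) x) =
      c * (LINT x:piece_img B r|lborel. \<omega> (fst (borel_pieces B r)) x)" for r
    by (rule set_integral_mult_right)
  then show ?thesis
    unfolding form_integral_def
    by (simp add: suminf_mult[OF form_integrable_summable[OF assms]])
qed

lemma form_integral_zero: "form_integral B (\<lambda>i x. 0 :: 'k) = 0"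
  by (simp add: form_integral_def set_lebesgue_integral_def)

end

locale bv_section_value = bv_geometry B
  for B :: "('i, 'm::{t2_space,second_countable_topology}, 'n::finite, 'a::finite,
                'k::{real_normed_field,euclidean_space}) bv_bundle" +
  fixes s :: "('i, 'n, 'a, 'k) bv_section"
  assumes s: "s \<in> bv_sections B"
begin

lemma s_local: "local_section B UNIV s"
  using s unfolding bv_sections_def by blast

lemma s_integrable: "f \<in> densities B \<Longrightarrow> form_integrable B (\<lambda>i x. jet_pullback (f i) s i x T)"
  using s unfolding bv_sections_def by blast

lemma s_exact: "f \<in> exact_densities B \<Longrightarrow> dens_integral B f s T = 0"
  using s unfolding bv_sections_def by blast

section \<open>Values of integral functionals on a section\<close>

lemma dens_integral_add:
  assumes f: "f \<in> densities B" and g: "g \<in> densities B"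
  shows "dens_integral B (dadd f g) s T = dens_integral B f s T + dens_integral B g s T"
proof -
  have "dens_integral B (dadd f g) s T = form_integral B (\<lambda>i x. jet_pullback (f i) s i x T + jet_pullback (g i) s i x T)"
    unfolding dens_integral_def
  proof (rule form_integral_cong)
    fix r x assume "x \<in> piece_img B r"
    then obtain p where p: "p \<in> cdom B (fst (borel_pieces B r))" "x = coord B (fst (borel_pieces B r)) p"
      by (rule piece_imgE)
    show "jet_pullback (dadd f g (fst (borel_pieces B r))) s (fst (borel_pieces B r)) x T =
        jet_pullback (f (fst (borel_pieces B r))) s (fst (borel_pieces B r)) x T +
        jet_pullback (g (fst (borel_pieces B r))) s (fst (borel_pieces B r)) x T"
      unfolding dadd_def p(2)
      by (rule pullback_add[OF dens_jfuns[OF f borel_pieces(1)] dens_jfuns[OF g borel_pieces(1)] coord_in_cimg[OF p(1)]])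
  qed
  then show ?thesis
    using form_integral_add[OF s_integrable[OF f] s_integrable[OF g], of T T] by (simp add: dens_integral_def)
qed

lemma dens_integral_scale:
  assumes f: "f \<in> densities B"
  shows "dens_integral B (dscale c f) s T = c * dens_integral B f s T"
proof -
  have "dens_integral B (dscale c f) s T = form_integral B (\<lambda>i x. c * jet_pullback (f i) s i x T)"
    unfolding dens_integral_def
  proof (rule form_integral_cong)
    fix r x assume "x \<in> piece_img B r"
    then obtain p where p: "p \<in> cdom B (fst (borel_pieces B r))" "x = coord B (fst (borel_pieces B r)) p"
      by (rule piece_imgE)
    show "jet_pullback (dscale c f (fst (borel_pieces B r))) s (fst (borel_pieces B r)) x T =
        c * jet_pullback (f (fst (borel_pieces B r))) s (fst (borel_pieces B r)) x T"
      unfolding dscale_def p(2)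
      by (rule pullback_scale[OF dens_jfuns[OF f borel_pieces(1)] coord_in_cimg[OF p(1)]])
  qed
  then show ?thesis
    using form_integral_scale[OF s_integrable[OF f], of c T] by (simp add: dens_integral_def)
qed

lemma dens_integral_eps:
  assumes f: "f \<in> densities B"
  shows "dens_integral B (deps f) s T = (-1) ^ card T * dens_integral B f s T"
proof -
  have "dens_integral B (deps f) s T = form_integral B (\<lambda>i x. (-1) ^ card T * jet_pullback (f i) s i x T)"
    unfolding dens_integral_def
  proof (rule form_integral_cong)
    fix r x assume "x \<in> piece_img B r"
    then obtain p where p: "p \<in> cdom B (fst (borel_pieces B r))" "x = coord B (fst (borel_pieces B r)) p"
      by (rule piece_imgE)
    show "jet_pullback (deps f (fst (borel_pieces B r))) s (fst (borel_pieces B r)) x T =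
        (-1) ^ card T * jet_pullback (f (fst (borel_pieces B r))) s (fst (borel_pieces B r)) x T"
      unfolding deps_def p(2)
      by (rule pullback_jeps[OF dens_jfuns[OF f borel_pieces(1)] s_local open_UNIV borel_pieces(1) UNIV_I p(1)])
  qed
  then show ?thesis
    using form_integral_scale[OF s_integrable[OF f], of "(-1) ^ card T" T] by (simp add: dens_integral_def)
qed

text \<open>Equivalent densities differ by an exact one, whose integral vanishes on every section in
  \<open>bv_sections B\<close>. The choice of a representative in \<open>hvalue\<close> is therefore
  harmless.\<close>

lemma dens_integral_hclass:
  assumes f: "f \<in> densities B" and g: "g \<in> hclass B f"
  shows "dens_integral B g s = dens_integral B f s"
proof
  fix T
  note g = in_hclassD[OF f g]
  have "dens_integral B g s T + - 1 * dens_integral B f s T = 0"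
    using dens_integral_add[OF g(1) dens_scale[OF f], of "-1" T] s_exact[OF g(3)]
    by (simp add: dens_integral_scale[OF f])
  then show "dens_integral B g s T = dens_integral B f s T" by simp
qed

abbreviation hv where "hv F \<equiv> hvalue B F s"

lemma hv_hclass: "f \<in> densities B \<Longrightarrow> hv (hclass B f) = dens_integral B f s"
  unfolding hvalue_def
  by (rule dens_integral_hclass, assumption, rule someI[of "\<lambda>g. g \<in> hclass B f"], rule hclass_self)

lemma gfin_hv:
  assumes "F \<in> IF" shows "gfin (hv F)"
proof -
  obtain f where f: "f \<in> densities B" "F = hclass B f" using assms by (rule integral_functionalsE)
  have "dens_integral B f s T = 0" if T: "infinite T" for T
  proof -
    have "jet_pullback (f i) s i x T = 0" for i x
      using gfin_pullback[of "f i" s i x] T unfolding gfin_def by blast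
    then show ?thesis by (simp add: dens_integral_def form_integral_zero)
  qed
  then show ?thesis
    unfolding f(2) hv_hclass[OF f(1)] gfin_def by blast
qed

text \<open>The involution multiplies the value at \<open>T\<close> by \<open>(-1) ^ card T\<close>,
  but on a homogeneous functional it is the scalar \<open>(-1) ^ p\<close>; where the value is
  nonzero the signs agree. Values thus commute with exactly the signs prescribed by the
  relations.\<close>

lemma gpar_hv:
  assumes "hparity B p F" shows "gpar p (hv F)"
proof -
  obtain f where f: "f \<in> densities B" "F = hclass B f" "dpar p f" using assms hparity_iff by blast
  have "hv (hclass B (deps f)) = hv (hclass B (dscale ((-1) ^ p) f))"
    using hclass_deqv[OF dens_eps[OF f(1)]] f(3) by (simp add: dpar_def)
  then have eq: "dens_integral B (deps f) s = dens_integral B (dscale ((-1) ^ p) f) s"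
    using f(1) by (simp only: hv_hclass dens_eps dens_scale)
  have "even (card T + p)" if nz: "hv F T \<noteq> 0" for T
  proof -
    have "(-1) ^ card T * dens_integral B f s T = (-1) ^ p * dens_integral B f s T"
      using fun_cong[OF eq, of T] unfolding dens_integral_eps[OF f(1)] dens_integral_scale[OF f(1)] .
    then have "(-1) ^ card T = ((-1) ^ p :: 'k)"
      using nz unfolding f(2) hv_hclass[OF f(1)] mult_cancel_right by blast
    then show ?thesis
      by (cases "even (card T)"; cases "even p") auto
  qed
  then show ?thesis
    using gfin_hv[OF hparity_in[OF assms]] by (auto simp: gpar_def gfin_def)
qed

lemma hv_hadd: "F \<in> IF \<Longrightarrow> G \<in> IF \<Longrightarrow> hv (hadd B F G) = (\<lambda>T. hv F T + hv G T)"
  by (elim integral_functionalsE) (auto simp: hadd_hclass hv_hclass dens_add dens_integral_add)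

lemma hv_hscale: "F \<in> IF \<Longrightarrow> hv (hscale B c F) = (\<lambda>T. c * hv F T)"
  by (elim integral_functionalsE) (auto simp: hscale_hclass hv_hclass dens_scale dens_integral_scale)

text \<open>Evaluation of representatives: the homomorphism from the tensor algebra to the auxiliary
  Grassmann algebra that sends a letter to its value. \<open>lvalue\<close> is this map at a chosen
  representative.\<close>

definition ev :: "('i, 'n, 'a, 'k) tens \<Rightarrow> (nat, 'k) grass" where
  "ev x = (\<lambda>T. \<Sum>w\<in>Poly_Mapping.keys x. Poly_Mapping.lookup x w * gprod (map hv w) T)"

lemma ev_superset:
  assumes "finite W" "Poly_Mapping.keys x \<subseteq> W"
  shows "ev x T = (\<Sum>w\<in>W. Poly_Mapping.lookup x w * gprod (map hv w) T)"
  unfolding ev_def by (rule sum.mono_neutral_left) (use assms in \<open>auto simp: in_keys_iff\<close>)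

lemma ev_add: "ev (x + y) = (\<lambda>T. ev x T + ev y T)"
proof
  fix T
  let ?W = "Poly_Mapping.keys x \<union> Poly_Mapping.keys y"
  have W: "finite ?W" "Poly_Mapping.keys (x + y) \<subseteq> ?W" using keys_add[of x y] by auto
  show "ev (x + y) T = ev x T + ev y T"
    unfolding ev_superset[OF W] ev_superset[OF W(1) Un_upper1] ev_superset[OF W(1) Un_upper2]
    by (simp add: lookup_add algebra_simps sum.distrib)
qed

lemma ev_scale: "ev (tscale c x) = (\<lambda>T. c * ev x T)"
proof
  fix T show "ev (tscale c x) T = c * ev x T"
    unfolding ev_superset[OF finite_keys keys_tscale[of c x]] ev_def[of x]
    by (simp add: sum_distrib_left mult.assoc)
qed

lemma ev_zero [simp]: "ev 0 = (\<lambda>T. 0)" by (simp add: ev_def)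
lemma ev_wd [simp]: "ev (wd w) = gprod (map hv w)" by (simp add: ev_def)
lemma ev_diff: "ev (x - y) = (\<lambda>T. ev x T - ev y T)"
  using ev_add[of x "- y"] ev_scale[of "-1" y] by simp

lemma ev_tmul: "ev (tmul x y) = gmul (ev x) (ev y)"
proof -
  have word: "ev (tmul (wd v) y) = gmul (ev (wd v)) (ev y)" for v
    by (rule tens_induct[where P = "\<lambda>y. ev (tmul (wd v) y) = gmul (ev (wd v)) (ev y)" and K = UNIV])
       (simp_all add: tmul_linear ev_add ev_scale gmul_add_right gmul_scale_right tmul_wd gprod_append)
  show ?thesis
    by (rule tens_induct[where P = "\<lambda>x. ev (tmul x y) = gmul (ev x) (ev y)" and K = UNIV])
       (simp_all add: tmul_linear ev_add ev_scale gmul_add_left gmul_scale_left word)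
qed

text \<open>The relations hold among the values: sums and multiples because integration is linear,
  the exchange of letters because values have the parity of their functionals.\<close>

lemma ev_R:
  assumes "r \<in> R" shows "ev r = (\<lambda>T. 0)"
  using assms
proof (rule R_induct)
  show "tens.subspace {r. ev r = (\<lambda>T. 0)}"
    by (rule tens.subspaceI) (auto simp: ev_add ev_scale)
  fix g assume "g \<in> tensor_relations B"
  then show "ev g = (\<lambda>T. 0)"
  proof (cases rule: relation_cases)
    case (add v w F G)
    then show ?thesis
      by (simp add: rel_add_def ev_diff gprod_append hv_hadd gmul_add_left gmul_add_right)
  next
    case (scale v w c F)
    then show ?thesis
      by (simp add: rel_scale_def single_eq_tscale[of _ c] ev_diff ev_scale gprod_append hv_hscale gmul_scale_left gmul_scale_right)
  next
    case (comm v w F G p q)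
    have "gmul (hv F) (gmul (hv G) z) = (\<lambda>T. (-1) ^ (p * q) * gmul (hv G) (gmul (hv F) z) T)" for z
      using gmul_commute[OF gpar_hv[OF comm(3)] gpar_hv[OF comm(4)]]
      by (simp add: gmul_scale_left flip: gmul_assoc)
    with comm show ?thesis
      by (simp add: rel_comm_def single_eq_tscale[of _ "(-1) ^ _"] ev_diff ev_scale gprod_append gmul_scale_right)
  qed
qed

lemma ev_cong: "nf x = nf y \<Longrightarrow> ev x = ev y"
  using ev_R[of "x - y"] by (simp add: nf_eq_iff ev_diff fun_eq_iff)

lemma lvalue_lclass:
  assumes "x \<in> tensors B" shows "lvalue B (lclass B x) s = ev x"
proof -
  have "(SOME z. z \<in> lclass B x) \<in> lclass B x"
    by (rule someI[of "\<lambda>z. z \<in> lclass B x" x]) (use assms in \<open>simp add: in_lclass\<close>)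
  then have "ev (SOME z. z \<in> lclass B x) = ev x" by (intro ev_cong) (simp add: in_lclass)
  then show ?thesis unfolding lvalue_def Let_def ev_def .
qed

lemma lvalue_lscale:
  assumes "F \<in> local_functionals B"
  shows "lscale B c F \<in> local_functionals B" "lvalue B (lscale B c F) s T = c * lvalue B F s T"
proof -
  obtain x where x: "x \<in> tensors B" "F = lclass B x" using assms by (rule local_functionalsE)
  note t = tensors_closed(3)[OF x(1), of c]
  show "lscale B c F \<in> local_functionals B" "lvalue B (lscale B c F) s T = c * lvalue B F s T"
    unfolding x(2) lscale_lclass[OF x(1)] lvalue_lclass[OF x(1)] lvalue_lclass[OF t]
    by (simp_all add: lclass_in t ev_scale)
qed

lemma lvalue_ladd_lmul:
  assumes "F \<in> local_functionals B" "G \<in> local_functionals B"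
  shows "ladd B F G \<in> local_functionals B" "lmul B F G \<in> local_functionals B"
    and "lvalue B (ladd B F G) s T = lvalue B F s T + lvalue B G s T"
    and "lvalue B (lmul B F G) s = gmul (lvalue B F s) (lvalue B G s)"
proof -
  obtain x where x: "x \<in> tensors B" "F = lclass B x" using assms(1) by (rule local_functionalsE)
  obtain y where y: "y \<in> tensors B" "G = lclass B y" using assms(2) by (rule local_functionalsE)
  note t = tensors_closed(1)[OF x(1) y(1)] tmul_tensors(1)[OF x(1) tensors_U[OF y(1)]]
  show "ladd B F G \<in> local_functionals B" "lmul B F G \<in> local_functionals B"
    "lvalue B (ladd B F G) s T = lvalue B F s T + lvalue B G s T"
    "lvalue B (lmul B F G) s = gmul (lvalue B F s) (lvalue B G s)"
    unfolding x(2) y(2) ladd_lclass[OF x(1) y(1)] lmul_lclass[OF x(1) y(1)]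
      lvalue_lclass[OF x(1)] lvalue_lclass[OF y(1)] t[THEN lvalue_lclass]
    by (simp_all add: lclass_in t ev_add ev_tmul)
qed

end

theorem theorem2:
  fixes B :: "('i, 'm::{t2_space,second_countable_topology}, 'n::finite, 'a::finite,
                'k::{real_normed_field,euclidean_space}) bv_bundle"
    and br :: "('i, 'n, 'a, 'k) lfun \<Rightarrow> ('i, 'n, 'a, 'k) lfun \<Rightarrow> ('i, 'n, 'a, 'k) lfun"
  assumes oriented: "oriented_vector_bundle B"
    and laplacian_well_defined: "\<And>h. h \<in> densities B \<Longrightarrow> laplacian_dens h \<in> densities B"
    and bracket_well_defined:
      "\<And>f g. f \<in> densities B \<Longrightarrow> g \<in> densities B \<Longrightarrow> bracket_dens f g \<in> densities B"
    and bracket: "schouten_bracket B br"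
  shows "\<exists>\<Delta>. llinear B \<Delta> \<and>
           (\<forall>F\<in>integral_functionals B. \<Delta> (lincl B F) = lincl B (hlaplacian B F)) \<and>
           (\<forall>p F G. lparity B p F \<and> G \<in> local_functionals B \<longrightarrow>
              \<Delta> (lmul B F G) =
                ladd B (lmul B (\<Delta> F) G)
                  (ladd B (lscale B ((-1) ^ p) (br F G))
                          (lscale B ((-1) ^ p) (lmul B F (\<Delta> G)))) \<and>
              (\<forall>s\<in>bv_sections B. \<forall>T.
                 lvalue B (\<Delta> (lmul B F G)) s T =
                   gmul (lvalue B (\<Delta> F) s) (lvalue B G s) T
                   + (-1) ^ p * lvalue B (br F G) s T
                   + (-1) ^ p * gmul (lvalue B F s) (lvalue B (\<Delta> G) s) T))"
proof -
  have "bv_geometry B" by (rule bv_geometry.intro[OF oriented])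
  then have "bv_operations B"
    by (rule bv_operations.intro[OF _ bv_operations_axioms.intro[OF laplacian_well_defined bracket_well_defined]])
  then have "bv_bracket B br"
    by (rule bv_bracket.intro[OF _ bv_bracket_axioms.intro[OF bracket]])
  then interpret bv_bracket B br .
  have "lvalue B (laplacian (lmul B F G)) s T =
      gmul (lvalue B (laplacian F) s) (lvalue B G s) T + (-1) ^ p * lvalue B (br F G) s T
      + (-1) ^ p * gmul (lvalue B F s) (lvalue B (laplacian G) s) T"
    if F: "lparity B p F" and G: "G \<in> local_functionals B" and s: "s \<in> bv_sections B" for p F G s T
  proof -
    interpret bv_section_value B s by unfold_locales (rule s)
    have F': "F \<in> local_functionals B" using F by (simp add: lparity_def)
    have D: "laplacian F \<in> local_functionals B" "laplacian G \<in> local_functionals B"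
      using llinear_laplacian F' G by (auto simp: llinear_def)
    note in_lf = F' G D br_in[OF F' G]
    show ?thesis
      \<comment> \<open>The product formula already holds between classes. Evaluation at
        \<open>s\<close> turns \<open>lmul\<close> into \<open>gmul\<close> and respects sums and
        multiples.\<close>
      unfolding laplacian_product[OF F G]
      by (simp add: lvalue_lscale lvalue_ladd_lmul in_lf)
  qed
  then show ?thesis
    using llinear_laplacian laplacian_incl laplacian_product by (intro exI[of _ laplacian]) blast
qed

end
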